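(* Let $A = (a_{ij})$ be a random $n\times n$ matrix with $a_{ij} = 0$ for $i \ge j$ and with the entries $a_{ij}$, $1 \le i < j \le n$, independent standard normal $N(0,1)$ random variables (a Sherrington–Kirkpatrick instance). Then for all sufficiently large $n$, \[ \Pr_A\big[T_A \ge 2^{0.451 n}\big] \le 0.01. \]
   Context: For $x \in \{\pm1\}^n$ let $H(x) = \sum_{1\le i<j\le n} a_{ij}x_ix_j = x^T A x$ and $E_{\min}(H) = \min_{x\in\{\pm1\}^n} H(x)$. For $x \in \{\pm1\}^\ell$, $0 \le \ell \le n$, \[ \mathrm{Bound}_A(x) := \sum_{1\le i<j\le \ell} a_{ij}x_ix_j \;-\; \sum_{j=\ell+1}^n \Big|\sum_{i=1}^\ell a_{ij}x_i\Big| \;+\; \min_{z\in\{\pm1\}^{n-\ell}} \sum_{\ell+1\le i<j\le n} a_{ij}z_iz_j, \] where empty sums are $0$. The branch-and-bound tree is the complete binary tree whose nodes at depth $\ell$ are the strings $x \in \{\pm1\}^\ell$ ($0\le \ell\le n$), with node cost $\mathrm{Bound}_A(x)$. $T_A$ denotes the number of nodes of this tree truncated at the optimal cost, i.e. $T_A$ is (at most) the number of strings $x \in \bigcup_{\ell=0}^n \{\pm1\}^\ell$ with $\mathrm{Bound}_A(x) \le E_{\min}(H)$. *)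

theory Defs
  imports "HOL-Probability.Probability"
begin

text \<open>Indices are 0-based: variables 0..n-1; the upper-triangular couplings
  a_ij (i < j < n) are the values A (i,j) of a function A :: nat \<times> nat \<Rightarrow> real.\<close>

definition SK_pairs :: "nat \<Rightarrow> (nat \<times> nat) set" where
  "SK_pairs n = {(i,j). i < j \<and> j < n}"

definition spins :: "nat \<Rightarrow> real list set" where
  "spins l = {x. length x = l \<and> set x \<subseteq> {-1, 1}}"

definition SK_H :: "(nat \<times> nat \<Rightarrow> real) \<Rightarrow> nat \<Rightarrow> real list \<Rightarrow> real" where
  "SK_H A n x = (\<Sum>j<n. \<Sum>i<j. A (i,j) * x ! i * x ! j)"

definition SK_Emin :: "(nat \<times> nat \<Rightarrow> real) \<Rightarrow> nat \<Rightarrow> real" where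
  "SK_Emin A n = Min (SK_H A n ` spins n)"

text \<open>Bound_A(x) for x in {+1,-1}^l, l = length x \<le> n.  The last term is the
  minimum over z in {+1,-1}^(n-l) of sum_{l \<le> i < j < n} a_ij z_i z_j, where z is
  indexed from position l (z ! (i - l) plays the role of z_i).\<close>
definition SK_Bound :: "(nat \<times> nat \<Rightarrow> real) \<Rightarrow> nat \<Rightarrow> real list \<Rightarrow> real" where
  "SK_Bound A n x =
     (let l = length x in
       (\<Sum>j<l. \<Sum>i<j. A (i,j) * x ! i * x ! j)
       - (\<Sum>j\<in>{l..<n}. \<bar>\<Sum>i<l. A (i,j) * x ! i\<bar>)
       + Min ((\<lambda>z. \<Sum>j\<in>{l..<n}. \<Sum>i\<in>{l..<j}. A (i,j) * z ! (i - l) * z ! (j - l))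
               ` spins (n - l)))"

text \<open>T_A: number of nodes x of the branch-and-bound tree (strings of length
  0..n) with Bound_A(x) \<le> E_min(H).\<close>
definition SK_T :: "(nat \<times> nat \<Rightarrow> real) \<Rightarrow> nat \<Rightarrow> nat" where
  "SK_T A n = card {x. length x \<le> n \<and> set x \<subseteq> {-1, 1} \<and> SK_Bound A n x \<le> SK_Emin A n}"

definition std_normal :: "real measure" where
  "std_normal = density lborel (\<lambda>x. ennreal (std_normal_density x))"

definition SK_measure :: "nat \<Rightarrow> (nat \<times> nat \<Rightarrow> real) measure" where
  "SK_measure n = PiM (SK_pairs n) (\<lambda>_. std_normal)"

end

theory Submission
  imports Defs "HOL-Real_Asymp.Real_Asymp"
begin

text \<open>
  Write \<open>E k\<close> for the maximum of the energy on \<open>k\<close> sites. A node at depth \<open>l\<close> survives only if the energy inside its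
  prefix together with the absolute fields it exerts on the other sites exceeds \<open>E n\<close> minus the maximum over the
  last \<open>n - l\<close> sites. By superadditivity (a consequence of the Sudakov--Fernique comparison) the mean of
  \<open>E k / (k * sqrt k)\<close> has a limit \<open>P\<close> and never exceeds it, and by a variance bound \<open>E\<close> concentrates, so this gap is
  at least about \<open>n * sqrt n * P * (1 - (1 - l / n) powr (3 / 2))\<close>. An exponential moment bound with parameter
  \<open>22 / 25 / sqrt n\<close> shows that the expected number of prefixes overcoming the gap is below \<open>2 powr (0.4505 * n)\<close>
  at every depth, provided \<open>P \<ge> 0.658\<close>; depths below \<open>0.4505 * n\<close> are counted trivially.

  The lower bound on \<open>P\<close> comes from a greedy algorithm in 100 rounds. The local fields of the sites not yet fixed perform
  independent Gaussian walks, one step per round. In each round \<open>n / 100\<close> sites, preferably those with large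
  fields, are aligned with their fields. The density of the walkers that remain is kept of the
  form \<open>A * exp (- \<alpha> * x\<^sup>2) * max 0 (1 - \<theta> * x\<^sup>2)\<close>, and the sum of all fields grows by the expected increase
  of \<open>\<bar>x\<bar>\<close> along their walks.
\<close>

text \<open>The node condition compares the maximum over all sites with the maximum over the last
  ones, so unrelated numerical bounds for the two would lose their difference at every depth.
  Superadditivity makes the limit also a supremum, which bounds the tail term by the very same
  constant \<open>P\<close>. The resulting gap increases with \<open>P\<close>, and only a lower
  estimate of \<open>P\<close> remains to be supplied.

  That estimate has to be fairly good. At depth \<open>n\<close> the exponent per site is ln 2 - c *
  P + c^2 / 4, at best ln 2 - P^2, and it must stay below 0.4505 * ln 2, which requires P to be
  about 0.617 or more. Fixing the sites in a prescribed order along their fields gives only 2/3 *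
  sqrt (2 / pi), about 0.532. The rounds do better because sites with large fields are used early
  while the others go on accumulating.

  The random state of the algorithm is not tracked: survivors are drawn with probabilities fixed in
  advance, and what remains is a finite list of parameters checked in integer arithmetic.\<close>

section \<open>Products of standard normal laws and their linear images\<close>

definition gauss :: "'i set \<Rightarrow> ('i \<Rightarrow> real) measure" where
  "gauss I = PiM I (\<lambda>_. std_normal)"

text \<open>An image of the standard law and not a density: the degenerate case
  \<open>\<sigma> = 0\<close> is included, and integrals reduce to \<open>std_normal\<close> by
  substitution.\<close>

definition scaled_normal :: "real \<Rightarrow> real measure" where
  "scaled_normal \<sigma> = distr std_normal borel (\<lambda>x. \<sigma> * x)"

lemma sets_std_normal[simp, measurable_cong]: "sets std_normal = sets borel"
  by (simp add: std_normal_def)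

lemma space_std_normal[simp]: "space std_normal = UNIV"
  by (simp add: std_normal_def)

interpretation std_normal: prob_space std_normal
  unfolding std_normal_def by (rule prob_space_normal_density) simp

interpretation gauss: product_sigma_finite "\<lambda>_. std_normal"
  by unfold_locales

lemma prob_space_gauss: "prob_space (gauss I)"
  unfolding gauss_def by (intro prob_space_PiM) unfold_locales

lemma sets_gauss[measurable_cong]: "sets (gauss I) = sets (PiM I (\<lambda>_. borel))"
  unfolding gauss_def by (intro sets_PiM_cong) auto

lemma space_gauss: "space (gauss I) = (\<Pi>\<^sub>E i\<in>I. UNIV)"
  unfolding gauss_def by (simp add: space_PiM)

lemma sets_scaled_normal[simp, measurable_cong]: "sets (scaled_normal s) = sets borel"
  by (simp add: scaled_normal_def)

lemma space_scaled_normal[simp]: "space (scaled_normal s) = UNIV"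
  by (simp add: scaled_normal_def)

lemma prob_space_scaled_normal: "prob_space (scaled_normal s)"
  unfolding scaled_normal_def by (intro std_normal.prob_space_distr) simp

lemma integral_std_normal:
  fixes f :: "real \<Rightarrow> real"
  assumes [measurable]: "f \<in> borel_measurable borel"
  shows "(\<integral>x. f x \<partial>std_normal) = (\<integral>x. std_normal_density x * f x \<partial>lborel)"
  unfolding std_normal_def by (subst integral_density) auto

lemma integrable_std_normal:
  fixes f :: "real \<Rightarrow> real"
  assumes [measurable]: "f \<in> borel_measurable borel"
  shows "integrable std_normal f \<longleftrightarrow> integrable lborel (\<lambda>x. std_normal_density x * f x)"
  unfolding std_normal_def by (subst integrable_density) auto

lemma std_normal_moments:
  "integrable std_normal (\<lambda>x. x ^ k)"
  "integrable std_normal (\<lambda>x. \<bar>x\<bar> ^ k)"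
  "(\<integral>x. x \<partial>std_normal) = 0"
  "(\<integral>x. x ^ 2 \<partial>std_normal) = 1"
  "(\<integral>x. x ^ 4 \<partial>std_normal) = 3"
  "(\<integral>x. x ^ 6 \<partial>std_normal) = 15"
  "(\<integral>x. \<bar>x\<bar> \<partial>std_normal) = sqrt (2 / pi)"
proof -
  show "integrable std_normal (\<lambda>x. x ^ k)"
    using integrable_normal_moment[of 1 0 k] by (simp add: integrable_std_normal)
  show "integrable std_normal (\<lambda>x. \<bar>x\<bar> ^ k)"
    using integrable_std_normal_moment_abs[of k] by (simp add: integrable_std_normal)
  show "(\<integral>x. x \<partial>std_normal) = 0"
    using integral_std_normal_moment_odd[of 0] by (simp add: integral_std_normal)
  show "(\<integral>x. x ^ 2 \<partial>std_normal) = 1"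
    using integral_std_normal_moment_even[of 1] by (simp add: integral_std_normal)
  show "(\<integral>x. x ^ 4 \<partial>std_normal) = 3"
    using integral_std_normal_moment_even[of 2] by (simp add: integral_std_normal fact_numeral)
  show "(\<integral>x. x ^ 6 \<partial>std_normal) = 15"
    using integral_std_normal_moment_even[of 3] by (simp add: integral_std_normal fact_numeral)
  show "(\<integral>x. \<bar>x\<bar> \<partial>std_normal) = sqrt (2 / pi)"
    using integral_std_normal_moment_abs_odd[of 0] by (simp add: integral_std_normal)
qed

lemma gauss_component:
  assumes "i \<in> I" shows "distr (gauss I) std_normal (\<lambda>\<omega>. \<omega> i) = std_normal"
  unfolding gauss_def using distr_PiM_component[of I "\<lambda>_. std_normal" i] assms
  by (simp add: std_normal.prob_space_axioms)

lemma gauss_component_integrable: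
  fixes f :: "real \<Rightarrow> real"
  assumes "i \<in> I" "integrable std_normal f"
  shows "integrable (gauss I) (\<lambda>\<omega>. f (\<omega> i))"
proof -
  have [measurable]: "(\<lambda>\<omega>. \<omega> i) \<in> measurable (gauss I) std_normal"
    unfolding gauss_def using assms by simp
  show ?thesis
    using assms by (intro integrable_distr[of "\<lambda>\<omega>. \<omega> i" "gauss I" std_normal]) (auto simp: gauss_component)
qed

lemma gauss_component_integral:
  fixes f :: "real \<Rightarrow> real"
  assumes "i \<in> I" and [measurable]: "f \<in> borel_measurable borel"
  shows "(\<integral>\<omega>. f (\<omega> i) \<partial>gauss I) = (\<integral>x. f x \<partial>std_normal)"
proof -
  have [measurable]: "(\<lambda>\<omega>. \<omega> i) \<in> measurable (gauss I) std_normal"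
    unfolding gauss_def using assms by simp
  have "(\<integral>x. f x \<partial>distr (gauss I) std_normal (\<lambda>\<omega>. \<omega> i)) = (\<integral>\<omega>. f (\<omega> i) \<partial>gauss I)"
    by (rule integral_distr) auto
  then show ?thesis using gauss_component[OF assms(1)] by simp
qed

lemma gauss_indep:
  assumes "J \<noteq> {}"
  shows "prob_space.indep_vars (gauss J) (\<lambda>_. borel) (\<lambda>j \<omega>. \<omega> j) J"
proof -
  interpret prob_space "gauss J" by (rule prob_space_gauss)
  have d: "distr (gauss J) borel (\<lambda>\<omega>. \<omega> j) = std_normal" if "j \<in> J" for j
    using gauss_component[OF that] by (metis distr_cong sets_std_normal)
  have "distr (gauss J) (PiM J (\<lambda>_. borel)) (\<lambda>\<omega>. \<lambda>j\<in>J. \<omega> j) = distr (gauss J) (gauss J) (\<lambda>\<omega>. \<omega>)"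
    by (rule distr_cong) (auto simp: sets_gauss space_gauss PiE_restrict)
  also have "\<dots> = gauss J" by (simp add: distr_id)
  also have "\<dots> = PiM J (\<lambda>j. distr (gauss J) borel (\<lambda>\<omega>. \<omega> j))"
    unfolding gauss_def by (intro PiM_cong) (auto simp: d[unfolded gauss_def])
  finally show ?thesis using assms
    by (subst indep_vars_iff_distr_eq_PiM') (auto simp: gauss_def)
qed

lemma distributed_std_normal_scale:
  fixes c :: real
  assumes "c \<noteq> 0"
  shows "distributed std_normal lborel (\<lambda>x. c * x) (normal_density 0 \<bar>c\<bar>)"
proof -
  have "distributed std_normal lborel (\<lambda>x. x) (normal_density 0 1)"
    unfolding distributed_def std_normal_def by (simp add: distr_id2)
  from std_normal.normal_density_affine[OF this _ assms, of 0] show ?thesis by simp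
qed

lemma scaled_normal_density:
  assumes "c \<noteq> 0" shows "scaled_normal c = density lborel (normal_density 0 \<bar>c\<bar>)"
proof -
  have "scaled_normal c = distr std_normal lborel (\<lambda>x. c * x)"
    unfolding scaled_normal_def by (rule distr_cong) auto
  then show ?thesis
  using distributed_distr_eq_density[OF distributed_std_normal_scale[OF assms]]
  by simp
qed

lemma scaled_normal_abs: "scaled_normal \<bar>c\<bar> = scaled_normal c"
  by (cases "c = 0") (simp_all add: scaled_normal_density)

lemma gauss_linear_form:
  fixes c :: "'j \<Rightarrow> real"
  assumes "finite S" "S \<noteq> {}" "S \<subseteq> J" "\<And>j. j \<in> S \<Longrightarrow> c j \<noteq> 0"
  shows "distr (gauss J) borel (\<lambda>\<omega>. \<Sum>j\<in>S. c j * \<omega> j) = scaled_normal (sqrt (\<Sum>j\<in>S. (c j)\<^sup>2))"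
proof -
  interpret prob_space "gauss J" by (rule prob_space_gauss)
  have J: "J \<noteq> {}" using assms by auto
  have "indep_vars (\<lambda>_. borel) (\<lambda>j \<omega>. \<omega> j) S"
    by (rule indep_vars_subset[OF gauss_indep[OF J]]) fact
  from indep_vars_compose2[OF this, of "\<lambda>j x. c j * x" "\<lambda>_. borel"]
  have ind: "indep_vars (\<lambda>_. borel) (\<lambda>j \<omega>. c j * \<omega> j) S" by simp
  have dj: "distributed (gauss J) lborel (\<lambda>\<omega>. c j * \<omega> j) (normal_density 0 \<bar>c j\<bar>)" if "j \<in> S" for j
  proof -
    have j: "j \<in> J" using that assms by auto
    have [measurable]: "(\<lambda>\<omega>. \<omega> j) \<in> measurable (gauss J) std_normal"
      unfolding gauss_def using j by simp
    have "distr (gauss J) lborel (\<lambda>\<omega>. c j * \<omega> j)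
        = distr (distr (gauss J) std_normal (\<lambda>\<omega>. \<omega> j)) lborel (\<lambda>x. c j * x)"
      by (subst distr_distr) (auto simp: comp_def)
    also have "\<dots> = density lborel (normal_density 0 \<bar>c j\<bar>)"
      unfolding gauss_component[OF j]
      using distributed_distr_eq_density[OF distributed_std_normal_scale[OF assms(4)[OF that]]] .
    finally have "distr (gauss J) lborel (\<lambda>\<omega>. c j * \<omega> j) = density lborel (normal_density 0 \<bar>c j\<bar>)" .
    moreover have "(\<lambda>\<omega>. c j * \<omega> j) \<in> borel_measurable (gauss J)"
      using j by (simp add: gauss_def)
    ultimately show ?thesis unfolding distributed_def by simp
  qed
  have s: "sqrt (\<Sum>j\<in>S. (c j)\<^sup>2) > 0"
    using assms by (intro real_sqrt_gt_zero sum_pos) auto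
  have "distributed (gauss J) lborel (\<lambda>\<omega>. \<Sum>j\<in>S. c j * \<omega> j)
      (normal_density (\<Sum>j\<in>S. 0) (sqrt (\<Sum>j\<in>S. \<bar>c j\<bar>\<^sup>2)))"
    using assms by (intro sum_indep_normal ind dj) auto
  then have d: "distributed (gauss J) lborel (\<lambda>\<omega>. \<Sum>j\<in>S. c j * \<omega> j)
      (normal_density 0 (sqrt (\<Sum>j\<in>S. (c j)\<^sup>2)))" by simp
  have "distr (gauss J) borel (\<lambda>\<omega>. \<Sum>j\<in>S. c j * \<omega> j) = distr (gauss J) lborel (\<lambda>\<omega>. \<Sum>j\<in>S. c j * \<omega> j)"
    by (rule distr_cong) auto
  then show ?thesis
    using distributed_distr_eq_density[OF d] scaled_normal_density[of "sqrt (\<Sum>j\<in>S. (c j)\<^sup>2)"] s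
    by simp
qed

text \<open>Functions of disjoint blocks of coordinates are independent, so only the variance of
  each form matters. The changes of Gaussian variables below are mostly of this type: increments of
  local fields, layers of a coordinate, fields exerted by a prefix, the reflection of all
  couplings.\<close>

lemma gauss_linear_forms:
  fixes c :: "'i \<Rightarrow> 'j \<Rightarrow> real"
  assumes I: "finite I" "I \<noteq> {}" and S: "\<And>i. i \<in> I \<Longrightarrow> finite (S i) \<and> S i \<noteq> {} \<and> S i \<subseteq> J"
    and c: "\<And>i j. i \<in> I \<Longrightarrow> j \<in> S i \<Longrightarrow> c i j \<noteq> 0"
    and disj: "disjoint_family_on S I"
  shows "distr (gauss J) (PiM I (\<lambda>_. borel)) (\<lambda>\<omega>. \<lambda>i\<in>I. \<Sum>j\<in>S i. c i j * \<omega> j)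
    = PiM I (\<lambda>i. scaled_normal (sqrt (\<Sum>j\<in>S i. (c i j)\<^sup>2)))"
proof -
  interpret prob_space "gauss J" by (rule prob_space_gauss)
  have J: "J \<noteq> {}" using I S by fastforce
  have r: "indep_vars (\<lambda>i. PiM (S i) (\<lambda>_. borel)) (\<lambda>i \<omega>. restrict (\<lambda>j. \<omega> j) (S i)) I"
    by (rule indep_vars_restrict[OF gauss_indep[OF J]]) (use S disj in auto)
  have "indep_vars (\<lambda>_. borel) (\<lambda>i \<omega>. \<Sum>j\<in>S i. c i j * (restrict (\<lambda>j. \<omega> j) (S i)) j) I"
    by (rule indep_vars_compose2[OF r, of "\<lambda>i x. \<Sum>j\<in>S i. c i j * x j"]) auto
  then have ind: "indep_vars (\<lambda>_. borel) (\<lambda>i \<omega>. \<Sum>j\<in>S i. c i j * \<omega> j) I"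
    by simp
  have rv: "random_variable borel (\<lambda>\<omega>. \<Sum>j\<in>S i. c i j * \<omega> j)" if "i \<in> I" for i
    using ind that unfolding indep_vars_def by blast
  have "distr (gauss J) (PiM I (\<lambda>_. borel)) (\<lambda>\<omega>. \<lambda>i\<in>I. \<Sum>j\<in>S i. c i j * \<omega> j)
    = PiM I (\<lambda>i. distr (gauss J) borel (\<lambda>\<omega>. \<Sum>j\<in>S i. c i j * \<omega> j))"
    using ind rv I by (subst (asm) indep_vars_iff_distr_eq_PiM') auto
  also have "\<dots> = PiM I (\<lambda>i. scaled_normal (sqrt (\<Sum>j\<in>S i. (c i j)\<^sup>2)))"
    by (intro PiM_cong refl gauss_linear_form) (use S c in auto)
  finally show ?thesis .
qed

lemma scaled_normal_1: "scaled_normal 1 = std_normal"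
  by (simp add: scaled_normal_density std_normal_def)

lemma PiM_component_integral:
  fixes f :: "_ \<Rightarrow> real"
  assumes M: "\<And>i. i \<in> I \<Longrightarrow> prob_space (M i)" and i: "i \<in> I"
    and [measurable]: "f \<in> borel_measurable (M i)"
  shows "(\<integral>\<omega>. f (\<omega> i) \<partial>PiM I M) = (\<integral>x. f x \<partial>M i)"
    and "integrable (PiM I M) (\<lambda>\<omega>. f (\<omega> i)) \<longleftrightarrow> integrable (M i) f"
proof -
  have [measurable]: "(\<lambda>\<omega>. \<omega> i) \<in> measurable (PiM I M) (M i)" using i by simp
  have d: "distr (PiM I M) (M i) (\<lambda>\<omega>. \<omega> i) = M i" by (rule distr_PiM_component[OF M i])
  have "(\<integral>x. f x \<partial>distr (PiM I M) (M i) (\<lambda>\<omega>. \<omega> i)) = (\<integral>\<omega>. f (\<omega> i) \<partial>PiM I M)"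
    by (rule integral_distr) auto
  then show "(\<integral>\<omega>. f (\<omega> i) \<partial>PiM I M) = (\<integral>x. f x \<partial>M i)" by (simp add: d)
  have "integrable (distr (PiM I M) (M i) (\<lambda>\<omega>. \<omega> i)) f \<longleftrightarrow> integrable (PiM I M) (\<lambda>\<omega>. f (\<omega> i))"
    by (rule integrable_distr_eq) auto
  then show "integrable (PiM I M) (\<lambda>\<omega>. f (\<omega> i)) \<longleftrightarrow> integrable (M i) f" by (simp add: d)
qed

text \<open>Maxima over configurations are Lipschitz in the Gaussian variables and hence grow at
  most linearly; this criterion provides their integrability.\<close>

lemma PiM_integrable_linear_growth:
  fixes f :: "('i \<Rightarrow> real) \<Rightarrow> real"
  assumes "finite I" and Q: "prob_space Q" "integrable Q (\<lambda>x. x)" "sets Q = sets borel"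
    and f: "f \<in> borel_measurable (PiM I (\<lambda>_. Q))"
    and b: "\<And>\<omega>. \<omega> \<in> space (PiM I (\<lambda>_. Q)) \<Longrightarrow> \<bar>f \<omega>\<bar> \<le> C + (\<Sum>i\<in>I. c * \<bar>\<omega> i\<bar>)"
  shows "integrable (PiM I (\<lambda>_. Q)) f"
proof (rule Bochner_Integration.integrable_bound[OF _ f])
  interpret prob_space "PiM I (\<lambda>_. Q)" by (intro prob_space_PiM Q)
  have "integrable (PiM I (\<lambda>_. Q)) (\<lambda>\<omega>. \<bar>\<omega> i\<bar>)" if "i \<in> I" for i
  proof -
    have int: "integrable Q (\<lambda>x. \<bar>x\<bar>)" using Q(2) by simp
    then have m: "(\<lambda>x::real. \<bar>x\<bar>) \<in> borel_measurable Q" by (rule borel_measurable_integrable)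
    then show ?thesis
      using PiM_component_integral(2)[of I "\<lambda>_. Q" i "\<lambda>x. \<bar>x\<bar>"] that Q(1) m int by simp
  qed
  then show "integrable (PiM I (\<lambda>_. Q)) (\<lambda>\<omega>. C + (\<Sum>i\<in>I. c * \<bar>\<omega> i\<bar>))"
    by (intro Bochner_Integration.integrable_add Bochner_Integration.integrable_sum integrable_mult_right integrable_const)
  show "AE \<omega> in PiM I (\<lambda>_. Q). norm (f \<omega>) \<le> norm (C + (\<Sum>i\<in>I. c * \<bar>\<omega> i\<bar>))"
  proof (rule AE_I2)
    fix \<omega> assume "\<omega> \<in> space (PiM I (\<lambda>_. Q))"
    from b[OF this] show "norm (f \<omega>) \<le> norm (C + (\<Sum>i\<in>I. c * \<bar>\<omega> i\<bar>))"
      unfolding real_norm_def by linarith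
  qed
qed

lemma std_normal_integrable: "integrable std_normal (\<lambda>x. x)"
  using std_normal_moments(1)[of 1] by simp

lemma scaled_normal_integrable: "integrable (scaled_normal s) (\<lambda>x. x)"
proof -
  have "integrable std_normal (\<lambda>x. s * x)"
    by (intro integrable_mult_right std_normal_integrable)
  then show ?thesis
    unfolding scaled_normal_def by (intro integrable_distr_eq[THEN iffD2]) simp_all
qed

lemma gauss_integrable_linear_growth:
  fixes f :: "('i \<Rightarrow> real) \<Rightarrow> real"
  assumes "finite I" "f \<in> borel_measurable (gauss I)"
    and "\<And>\<omega>. \<bar>f \<omega>\<bar> \<le> C + (\<Sum>i\<in>I. c * \<bar>\<omega> i\<bar>)"
  shows "integrable (gauss I) f"
  using assms unfolding gauss_def
  by (intro PiM_integrable_linear_growth[where Q=std_normal]) (auto simp: std_normal.prob_space_axioms std_normal_integrable)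

section \<open>Maximal energy with an external field\<close>

text \<open>A configuration is encoded by the set of its sites with spin \<open>+1\<close>.\<close>

definition spin :: "nat set \<Rightarrow> nat \<Rightarrow> real" where
  "spin X i = (if i \<in> X then 1 else -1)"

definition pairs :: "nat set \<Rightarrow> (nat \<times> nat) set" where
  "pairs V = {(i,j). i \<in> V \<and> j \<in> V \<and> i < j}"

text \<open>The external field \<open>h\<close> carries the influence of sites that have already
  been fixed. It keeps the family closed under fixing sites, which the greedy induction requires;
  \<open>\<tau>\<close> scales the couplings only.\<close>

definition energy :: "real \<Rightarrow> nat set \<Rightarrow> (nat \<times> nat \<Rightarrow> real) \<Rightarrow> (nat \<Rightarrow> real) \<Rightarrow> nat set \<Rightarrow> real" where
  "energy \<tau> V a h X = (\<Sum>i\<in>V. h i * spin X i) + \<tau> * (\<Sum>e\<in>pairs V. a e * (spin X (fst e) * spin X (snd e)))"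

definition max_energy :: "real \<Rightarrow> nat set \<Rightarrow> (nat \<times> nat \<Rightarrow> real) \<Rightarrow> (nat \<Rightarrow> real) \<Rightarrow> real" where
  "max_energy \<tau> V a h = Max (energy \<tau> V a h ` Pow V)"

definition mean_max :: "real \<Rightarrow> nat set \<Rightarrow> (nat \<Rightarrow> real) \<Rightarrow> real" where
  "mean_max \<tau> V h = (\<integral>a. max_energy \<tau> V a h \<partial>gauss (pairs V))"

lemma spin_square[simp]: "spin X i * spin X i = 1" "(spin X i)\<^sup>2 = 1" "\<bar>spin X i\<bar> = 1" "spin X i \<noteq> 0"
  by (auto simp: spin_def)

lemma finite_pairs[simp]: "finite V \<Longrightarrow> finite (pairs V)"
  by (rule finite_subset[of _ "V \<times> V"]) (auto simp: pairs_def)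

lemma pairs_mono: "W \<subseteq> V \<Longrightarrow> pairs W \<subseteq> pairs V"
  by (auto simp: pairs_def)

lemma max_energy_ge: "finite V \<Longrightarrow> X \<subseteq> V \<Longrightarrow> energy \<tau> V a h X \<le> max_energy \<tau> V a h"
  unfolding max_energy_def by (intro Max_ge) auto

lemma max_energy_attained:
  assumes "finite V" obtains X where "X \<subseteq> V" "max_energy \<tau> V a h = energy \<tau> V a h X"
proof -
  have "max_energy \<tau> V a h \<in> energy \<tau> V a h ` Pow V"
    unfolding max_energy_def using assms by (intro Max_in) auto
  then show ?thesis using that by auto
qed

lemma max_energy_cong:
  assumes "\<And>i. i \<in> V \<Longrightarrow> h i = h' i" "\<And>e. e \<in> pairs V \<Longrightarrow> a e = a' e"
  shows "max_energy \<tau> V a h = max_energy \<tau> V a' h'"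
proof -
  have "energy \<tau> V a h = energy \<tau> V a' h'"
    unfolding energy_def using assms by (intro ext arg_cong2[where f="(+)"] arg_cong2[where f="(*)"] sum.cong refl) auto
  then show ?thesis by (simp add: max_energy_def)
qed

lemma mean_max_cong: "(\<And>i. i \<in> V \<Longrightarrow> h i = h' i) \<Longrightarrow> mean_max \<tau> V h = mean_max \<tau> V h'"
  unfolding mean_max_def by (intro Bochner_Integration.integral_cong refl max_energy_cong) auto

lemma energy_lipschitz:
  assumes "finite V"
  shows "\<bar>energy \<tau> V a h X - energy \<tau> V a' h' X\<bar> \<le> (\<Sum>i\<in>V. \<bar>h i - h' i\<bar>) + \<bar>\<tau>\<bar> * (\<Sum>e\<in>pairs V. \<bar>a e - a' e\<bar>)"
proof -
  have "energy \<tau> V a h X - energy \<tau> V a' h' X =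
     (\<Sum>i\<in>V. (h i - h' i) * spin X i) + \<tau> * (\<Sum>e\<in>pairs V. (a e - a' e) * (spin X (fst e) * spin X (snd e)))"
    by (simp add: energy_def algebra_simps sum_subtractf)
  also have "\<bar>\<dots>\<bar> \<le> \<bar>\<Sum>i\<in>V. (h i - h' i) * spin X i\<bar> + \<bar>\<tau>\<bar> * \<bar>\<Sum>e\<in>pairs V. (a e - a' e) * (spin X (fst e) * spin X (snd e))\<bar>"
    by (rule order_trans[OF abs_triangle_ineq]) (simp add: abs_mult)
  also have "\<dots> \<le> (\<Sum>i\<in>V. \<bar>(h i - h' i) * spin X i\<bar>) + \<bar>\<tau>\<bar> * (\<Sum>e\<in>pairs V. \<bar>(a e - a' e) * (spin X (fst e) * spin X (snd e))\<bar>)"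
    by (intro add_mono mult_left_mono sum_abs) auto
  finally show ?thesis by (simp add: abs_mult)
qed

lemma max_energy_lipschitz:
  assumes "finite V"
  shows "\<bar>max_energy \<tau> V a h - max_energy \<tau> V a' h'\<bar> \<le> (\<Sum>i\<in>V. \<bar>h i - h' i\<bar>) + \<bar>\<tau>\<bar> * (\<Sum>e\<in>pairs V. \<bar>a e - a' e\<bar>)"
    (is "_ \<le> ?B")
proof -
  obtain X where X: "X \<subseteq> V" "max_energy \<tau> V a h = energy \<tau> V a h X" by (rule max_energy_attained[OF assms])
  obtain Y where Y: "Y \<subseteq> V" "max_energy \<tau> V a' h' = energy \<tau> V a' h' Y" by (rule max_energy_attained[OF assms])
  have "energy \<tau> V a' h' X \<le> max_energy \<tau> V a' h'" "energy \<tau> V a h Y \<le> max_energy \<tau> V a h" by (rule max_energy_ge[OF assms X(1)], rule max_energy_ge[OF assms Y(1)])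
  moreover have "\<bar>energy \<tau> V a h X - energy \<tau> V a' h' X\<bar> \<le> ?B" "\<bar>energy \<tau> V a h Y - energy \<tau> V a' h' Y\<bar> \<le> ?B"
    using energy_lipschitz[OF assms] by blast+
  ultimately show ?thesis using X(2) Y(2) by linarith
qed

lemma max_energy_zero: "finite V \<Longrightarrow> max_energy \<tau> V (\<lambda>_. 0) (\<lambda>_. 0) = 0"
proof -
  assume V: "finite V"
  obtain X where "max_energy \<tau> V (\<lambda>_. 0) (\<lambda>_. 0) = energy \<tau> V (\<lambda>_. 0) (\<lambda>_. 0) X" by (rule max_energy_attained[OF V])
  then show ?thesis by (simp add: energy_def)
qed

lemma max_energy_bound:
  assumes "finite V"
  shows "\<bar>max_energy \<tau> V a h\<bar> \<le> (\<Sum>i\<in>V. \<bar>h i\<bar>) + \<bar>\<tau>\<bar> * (\<Sum>e\<in>pairs V. \<bar>a e\<bar>)"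
  using max_energy_lipschitz[OF assms, of \<tau> a h "\<lambda>_. 0" "\<lambda>_. 0"] max_energy_zero[OF assms] by simp

lemma max_energy_measurable:
  assumes "finite V"
    and A: "\<And>e. e \<in> pairs V \<Longrightarrow> (\<lambda>\<omega>. A \<omega> e) \<in> borel_measurable M"
    and H: "\<And>i. i \<in> V \<Longrightarrow> (\<lambda>\<omega>. H \<omega> i) \<in> borel_measurable M"
  shows "(\<lambda>\<omega>. max_energy \<tau> V (A \<omega>) (H \<omega>)) \<in> borel_measurable M"
  unfolding max_energy_def
proof (rule borel_measurable_Max)
  show "finite (Pow V)" using assms by simp
  fix X
  show "(\<lambda>\<omega>. energy \<tau> V (A \<omega>) (H \<omega>) X) \<in> borel_measurable M"
    unfolding energy_def using A H
    by (intro borel_measurable_add borel_measurable_times borel_measurable_sum borel_measurable_const) auto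
qed

lemma gauss_comp_measurable: "e \<in> I \<Longrightarrow> (\<lambda>\<omega>. \<omega> e) \<in> borel_measurable (gauss I)"
  by (simp add: gauss_def)

lemma max_energy_integrable:
  assumes "finite V" shows "integrable (gauss (pairs V)) (\<lambda>a. max_energy \<tau> V a h)"
  using assms
proof (intro gauss_integrable_linear_growth)
  show "\<bar>max_energy \<tau> V \<omega> h\<bar> \<le> (\<Sum>i\<in>V. \<bar>h i\<bar>) + (\<Sum>i\<in>pairs V. \<bar>\<tau>\<bar> * \<bar>\<omega> i\<bar>)" for \<omega>
    using max_energy_bound[OF assms, of \<tau> \<omega> h] by (simp add: sum_distrib_left)
  show "(\<lambda>a. max_energy \<tau> V a h) \<in> borel_measurable (gauss (pairs V))"
    by (intro max_energy_measurable assms gauss_comp_measurable borel_measurable_const)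
qed simp

lemma mean_max_lipschitz:
  assumes "finite V"
  shows "\<bar>mean_max \<tau> V h - mean_max \<tau> V h'\<bar> \<le> (\<Sum>i\<in>V. \<bar>h i - h' i\<bar>)"
proof -
  interpret prob_space "gauss (pairs V)" by (rule prob_space_gauss)
  have eq: "mean_max \<tau> V h - mean_max \<tau> V h' = (\<integral>a. max_energy \<tau> V a h - max_energy \<tau> V a h' \<partial>gauss (pairs V))"
    unfolding mean_max_def using assms by (simp add: max_energy_integrable)
  have A: "\<bar>\<integral>a. max_energy \<tau> V a h - max_energy \<tau> V a h' \<partial>gauss (pairs V)\<bar> \<le> (\<integral>a. \<bar>max_energy \<tau> V a h - max_energy \<tau> V a h'\<bar> \<partial>gauss (pairs V))"
    by (rule integral_abs_bound)
  have "(\<integral>a. \<bar>max_energy \<tau> V a h - max_energy \<tau> V a h'\<bar> \<partial>gauss (pairs V)) \<le> (\<integral>a. (\<Sum>i\<in>V. \<bar>h i - h' i\<bar>) \<partial>gauss (pairs V))"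
    using assms max_energy_lipschitz[OF assms, of \<tau> _ h _ h']
    by (intro integral_mono) (auto simp: max_energy_integrable intro: order_trans[OF max_energy_lipschitz[OF assms]])
  also have "\<dots> = (\<Sum>i\<in>V. \<bar>h i - h' i\<bar>)" by (simp add: prob_space)
  finally show ?thesis using A eq by linarith
qed

lemma mean_max_measurable:
  assumes V: "finite V" and H: "\<And>i. i \<in> V \<Longrightarrow> (\<lambda>\<omega>. H \<omega> i) \<in> borel_measurable M"
  shows "(\<lambda>\<omega>. mean_max \<tau> V (H \<omega>)) \<in> borel_measurable M"
proof -
  interpret prob_space "gauss (pairs V)" by (rule prob_space_gauss)
  have "(\<lambda>(\<omega>, a). max_energy \<tau> V a (H \<omega>)) \<in> borel_measurable (M \<Otimes>\<^sub>M gauss (pairs V))"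
    unfolding split_beta
  proof (rule max_energy_measurable[OF V])
    show "(\<lambda>x. snd x e) \<in> borel_measurable (M \<Otimes>\<^sub>M gauss (pairs V))" if "e \<in> pairs V" for e
      by (rule measurable_compose[OF measurable_snd gauss_comp_measurable[OF that]])
    show "(\<lambda>x. H (fst x) i) \<in> borel_measurable (M \<Otimes>\<^sub>M gauss (pairs V))" if "i \<in> V" for i
      by (rule measurable_compose[OF measurable_fst H[OF that]])
  qed
  then show ?thesis unfolding mean_max_def by (rule borel_measurable_lebesgue_integral)
qed

section \<open>Fixing a batch of sites along their fields\<close>

text \<open>Pairs are ordered, so a cross pair is recovered from its two ends through
  \<open>min\<close> and \<open>max\<close>.\<close>

lemma mixed_sum:
  fixes f :: "nat \<times> nat \<Rightarrow> real"
  assumes "finite V" "D \<subseteq> V"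
  shows "(\<Sum>e\<in>pairs V. f e) = (\<Sum>e\<in>pairs D. f e) + (\<Sum>e\<in>pairs (V - D). f e)
    + (\<Sum>j\<in>V-D. \<Sum>i\<in>D. f (min i j, max i j))"
proof -
  let ?m = "\<lambda>(j,i). (min i j, max i j)"
  have fD: "finite D" using assms finite_subset by blast
  have "pairs V = (pairs D \<union> pairs (V - D)) \<union> ?m ` ((V - D) \<times> D)"
  proof (intro set_eqI iffI)
    fix e assume e: "e \<in> pairs V"
    then obtain i j where ij: "e = (i,j)" "i \<in> V" "j \<in> V" "i < j" by (auto simp: pairs_def)
    consider "i \<in> D" "j \<in> D" | "i \<notin> D" "j \<notin> D" | "i \<in> D" "j \<notin> D" | "i \<notin> D" "j \<in> D" by blast
    then show "e \<in> (pairs D \<union> pairs (V - D)) \<union> ?m ` ((V - D) \<times> D)"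
    proof cases
      case 3
      then have "e = ?m (j, i)" "(j,i) \<in> (V - D) \<times> D" using ij by (auto simp: min_def max_def)
      then show ?thesis by (intro UnI2 image_eqI)
    next
      case 4
      then have "e = ?m (i, j)" "(i,j) \<in> (V - D) \<times> D" using ij by (auto simp: min_def max_def)
      then show ?thesis by (intro UnI2 image_eqI)
    qed (use ij in \<open>auto simp: pairs_def\<close>)
  next
    fix e assume "e \<in> (pairs D \<union> pairs (V - D)) \<union> ?m ` ((V - D) \<times> D)"
    then show "e \<in> pairs V"
    proof (elim UnE imageE)
      fix x assume x: "e = ?m x" "x \<in> (V - D) \<times> D"
      then have "fst x \<noteq> snd x" "fst x \<in> V" "snd x \<in> V" using assms by auto
      then show "e \<in> pairs V" using x(1) by (auto simp: pairs_def min_def max_def split_beta)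
    qed (use assms in \<open>auto simp: pairs_def\<close>)
  qed
  moreover have "inj_on ?m ((V - D) \<times> D)"
    by (auto simp: inj_on_def min_def max_def split: if_splits)
  moreover have "(pairs D \<union> pairs (V - D)) \<inter> ?m ` ((V - D) \<times> D) = {}" "pairs D \<inter> pairs (V - D) = {}"
    by (auto simp: pairs_def min_def max_def split: if_splits)
  ultimately have "(\<Sum>e\<in>pairs V. f e) = (\<Sum>e\<in>pairs D. f e) + (\<Sum>e\<in>pairs (V - D). f e) + (\<Sum>e\<in>(V - D) \<times> D. f (?m e))"
    using assms fD by (simp add: sum.union_disjoint sum.reindex)
  also have "(\<Sum>e\<in>(V - D) \<times> D. f (?m e)) = (\<Sum>j\<in>V-D. \<Sum>i\<in>D. f (min i j, max i j))"
    by (simp add: sum.cartesian_product split_def)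
  finally show ?thesis .
qed

lemma mixed_mem:
  assumes "i \<in> D" "j \<in> V - D" "D \<subseteq> V"
  shows "(min i j, max i j) \<in> pairs V - pairs (V - D)"
proof -
  have "i < j \<or> j < i" using assms by (metis DiffD2 linorder_neqE_nat)
  then show ?thesis using assms by (elim disjE) (auto simp: pairs_def)
qed

lemma spin_Un:
  assumes "A \<subseteq> D" "B \<subseteq> V - D"
  shows "i \<in> D \<Longrightarrow> spin (A \<union> B) i = spin A i" "i \<in> V - D \<Longrightarrow> spin (A \<union> B) i = spin B i"
  using assms by (auto simp: spin_def)

text \<open>Test configuration: every site of \<open>D\<close> is aligned with its field, and the
  others are optimised in the field that \<open>D\<close> then exerts on them. The interactions
  inside \<open>D\<close> are kept with whatever sign they get.\<close>

lemma max_energy_batch: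
  fixes h :: "nat \<Rightarrow> real"
  assumes V: "finite V" and D: "D \<subseteq> V"
  defines "A \<equiv> {i\<in>D. h i \<ge> 0}"
  shows "(\<Sum>i\<in>D. \<bar>h i\<bar>) + \<tau> * (\<Sum>e\<in>pairs D. a e * (spin A (fst e) * spin A (snd e)))
     + max_energy \<tau> (V - D) a (\<lambda>j. h j + (\<Sum>i\<in>D. \<tau> * spin A i * a (min i j, max i j))) \<le> max_energy \<tau> V a h"
proof -
  let ?h = "\<lambda>j. h j + (\<Sum>i\<in>D. \<tau> * spin A i * a (min i j, max i j))"
  obtain B where B: "B \<subseteq> V - D" "max_energy \<tau> (V - D) a ?h = energy \<tau> (V - D) a ?h B"
    using max_energy_attained[of "V - D"] V by blast
  have AD: "A \<subseteq> D" by (auto simp: A_def)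
  note s = spin_Un[OF AD B(1)]
  have "energy \<tau> V a h (A \<union> B) = (\<Sum>i\<in>V. h i * spin (A \<union> B) i) + \<tau> * ((\<Sum>e\<in>pairs D. a e * (spin A (fst e) * spin A (snd e)))
      + (\<Sum>e\<in>pairs (V - D). a e * (spin B (fst e) * spin B (snd e)))
      + (\<Sum>j\<in>V-D. \<Sum>i\<in>D. a (min i j, max i j) * (spin A i * spin B j)))"
    unfolding energy_def mixed_sum[OF V D]
  proof -
    have 1: "(\<Sum>e\<in>pairs D. a e * (spin (A \<union> B) (fst e) * spin (A \<union> B) (snd e))) = (\<Sum>e\<in>pairs D. a e * (spin A (fst e) * spin A (snd e)))"
      using s by (intro sum.cong refl) (auto simp: pairs_def)
    have 2: "(\<Sum>e\<in>pairs (V - D). a e * (spin (A \<union> B) (fst e) * spin (A \<union> B) (snd e))) = (\<Sum>e\<in>pairs (V - D). a e * (spin B (fst e) * spin B (snd e)))"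
      using s by (intro sum.cong refl) (auto simp: pairs_def)
    have 3: "(\<Sum>j\<in>V-D. \<Sum>i\<in>D. a (min i j, max i j) * (spin (A \<union> B) (fst (min i j, max i j)) * spin (A \<union> B) (snd (min i j, max i j))))
       = (\<Sum>j\<in>V-D. \<Sum>i\<in>D. a (min i j, max i j) * (spin A i * spin B j))"
    proof (intro sum.cong refl)
      fix i j assume "j \<in> V - D" "i \<in> D"
      then show "a (min i j, max i j) * (spin (A \<union> B) (fst (min i j, max i j)) * spin (A \<union> B) (snd (min i j, max i j)))
        = a (min i j, max i j) * (spin A i * spin B j)"
        using s by (cases "i \<le> j") (auto simp: min_def max_def)
    qed
    show "(\<Sum>i\<in>V. h i * spin (A \<union> B) i) + \<tau> * ((\<Sum>e\<in>pairs D. a e * (spin (A \<union> B) (fst e) * spin (A \<union> B) (snd e)))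
      + (\<Sum>e\<in>pairs (V - D). a e * (spin (A \<union> B) (fst e) * spin (A \<union> B) (snd e)))
      + (\<Sum>j\<in>V-D. \<Sum>i\<in>D. a (min i j, max i j) * (spin (A \<union> B) (fst (min i j, max i j)) * spin (A \<union> B) (snd (min i j, max i j)))))
      = (\<Sum>i\<in>V. h i * spin (A \<union> B) i) + \<tau> * ((\<Sum>e\<in>pairs D. a e * (spin A (fst e) * spin A (snd e)))
      + (\<Sum>e\<in>pairs (V - D). a e * (spin B (fst e) * spin B (snd e)))
      + (\<Sum>j\<in>V-D. \<Sum>i\<in>D. a (min i j, max i j) * (spin A i * spin B j)))"
      unfolding 1 2 3 ..
  qed
  also have "(\<Sum>i\<in>V. h i * spin (A \<union> B) i) = (\<Sum>i\<in>D. h i * spin A i) + (\<Sum>i\<in>V-D. h i * spin B i)"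
    using s V D by (subst sum.subset_diff[OF D V]) (auto intro!: arg_cong2[where f="(+)"] sum.cong)
  also have "(\<Sum>i\<in>D. h i * spin A i) = (\<Sum>i\<in>D. \<bar>h i\<bar>)"
    by (intro sum.cong refl) (auto simp: A_def spin_def)
  finally have "energy \<tau> V a h (A \<union> B) = (\<Sum>i\<in>D. \<bar>h i\<bar>) + \<tau> * (\<Sum>e\<in>pairs D. a e * (spin A (fst e) * spin A (snd e)))
     + energy \<tau> (V - D) a ?h B"
    by (simp add: energy_def algebra_simps sum.distrib sum_distrib_left)
  moreover have "energy \<tau> V a h (A \<union> B) \<le> max_energy \<tau> V a h"
    using AD B D by (intro max_energy_ge V) auto
  ultimately show ?thesis using B(2) by simp
qed

lemma gauss_fold:
  fixes f :: "('i \<Rightarrow> real) \<Rightarrow> real"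
  assumes "I \<inter> J = {}" "finite I" "finite J" "integrable (gauss (I \<union> J)) f"
  shows "(\<integral>\<omega>. f \<omega> \<partial>gauss (I \<union> J)) = (\<integral>x. (\<integral>y. f (merge I J (x, y)) \<partial>gauss J) \<partial>gauss I)"
  using assms unfolding gauss_def by (rule gauss.product_integral_fold)

lemma gauss_fold_integrable:
  fixes f :: "('i \<Rightarrow> real) \<Rightarrow> real"
  assumes "I \<inter> J = {}" "finite I" "finite J" "integrable (gauss (I \<union> J)) f"
  shows "integrable (gauss I) (\<lambda>x. (\<integral>y. f (merge I J (x, y)) \<partial>gauss J))"
proof -
  interpret I: prob_space "gauss I" by (rule prob_space_gauss)
  interpret J: prob_space "gauss J" by (rule prob_space_gauss)
  interpret P: pair_sigma_finite "gauss I" "gauss J" by unfold_locales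
  have "integrable (gauss I \<Otimes>\<^sub>M gauss J) (\<lambda>x. f (merge I J x))"
  proof (rule integrable_distr[where f=f and T="merge I J" and M'="gauss (I \<union> J)"])
    show "merge I J \<in> gauss I \<Otimes>\<^sub>M gauss J \<rightarrow>\<^sub>M gauss (I \<union> J)" unfolding gauss_def by (rule measurable_merge)
    show "integrable (distr (gauss I \<Otimes>\<^sub>M gauss J) (gauss (I \<union> J)) (merge I J)) f"
      using assms(4) unfolding gauss_def gauss.distr_merge[OF assms(1-3)] .
  qed
  from P.integrable_fst'[OF this] show ?thesis by simp
qed

text \<open>The set \<open>A\<close> of up spins is a function of \<open>h\<close> alone, so the
  interactions inside \<open>D\<close> average to zero. The couplings among the remaining sites have
  not been looked at and form the inner expectation \<open>mean_max\<close>.\<close>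

lemma mean_max_batch_aux:
  fixes h :: "nat \<Rightarrow> real"
  assumes V: "finite V" and D: "D \<subseteq> V" and \<tau>: "\<tau> > 0"
  defines "A \<equiv> {i\<in>D. h i \<ge> 0}"
  shows "(\<Sum>i\<in>D. \<bar>h i\<bar>) + (\<integral>x. mean_max \<tau> (V - D) (\<lambda>j. h j + (\<Sum>i\<in>D. \<tau> * spin A i * x (min i j, max i j))) \<partial>gauss (pairs V - pairs (V - D)))
      \<le> mean_max \<tau> V h"
proof -
  let ?W = "V - D"
  let ?C = "pairs V - pairs ?W"
  let ?k = "\<lambda>a j. h j + (\<Sum>i\<in>D. \<tau> * spin A i * a (min i j, max i j))"
  let ?l = "\<lambda>a. (\<Sum>i\<in>D. \<bar>h i\<bar>) + \<tau> * (\<Sum>e\<in>pairs D. a e * (spin A (fst e) * spin A (snd e)))"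
  interpret C: prob_space "gauss ?C" by (rule prob_space_gauss)
  interpret W: prob_space "gauss (pairs ?W)" by (rule prob_space_gauss)
  have fW: "finite ?W" using V by simp
  have fD: "finite D" using V D finite_subset by blast
  have CV: "?C \<union> pairs ?W = pairs V" using pairs_mono[of ?W V] by auto
  have prsD: "e \<in> ?C" if "e \<in> pairs D" for e using that D by (auto simp: pairs_def)
  have mixC: "(min i j, max i j) \<in> ?C" if "i \<in> D" "j \<in> ?W" for i j
    using mixed_mem[OF that D] .
  have mm: "merge ?C (pairs ?W) (x, y) e = x e" if "e \<in> ?C" for x y e
    using that by (simp add: merge_def)
  have mw: "merge ?C (pairs ?W) (x, y) e = y e" if "e \<in> pairs ?W" for x y e
    using that by (simp add: merge_def)
    have l: "integrable (gauss ?C) ?l"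
    proof (intro Bochner_Integration.integrable_add integrable_mult_right C.integrable_const Bochner_Integration.integrable_sum integrable_mult_left)
      fix e assume "e \<in> pairs D"
      then show "integrable (gauss ?C) (\<lambda>x. x e)"
        using gauss_component_integrable[OF prsD std_normal_integrable] by simp
    qed
    have k: "integrable (gauss ?C) (\<lambda>x. mean_max \<tau> ?W (?k x))"
    proof (rule gauss_integrable_linear_growth)
      show "finite ?C" using V by simp
      show "(\<lambda>x. mean_max \<tau> ?W (?k x)) \<in> borel_measurable (gauss ?C)"
        using mixC by (intro mean_max_measurable fW) (auto intro!: borel_measurable_add borel_measurable_sum borel_measurable_times)
      show "\<bar>mean_max \<tau> ?W (?k x)\<bar> \<le> (\<bar>mean_max \<tau> ?W h\<bar>) + (\<Sum>e\<in>?C. (\<tau> * card (?W \<times> D)) * \<bar>x e\<bar>)" for x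
      proof -
        have "\<bar>mean_max \<tau> ?W (?k x) - mean_max \<tau> ?W h\<bar> \<le> (\<Sum>j\<in>?W. \<bar>?k x j - h j\<bar>)" by (rule mean_max_lipschitz[OF fW])
        also have "\<dots> \<le> (\<Sum>j\<in>?W. \<Sum>i\<in>D. \<tau> * (\<Sum>e\<in>?C. \<bar>x e\<bar>))"
        proof (rule sum_mono)
          fix j assume j: "j \<in> ?W"
          have "\<bar>?k x j - h j\<bar> \<le> (\<Sum>i\<in>D. \<bar>\<tau> * spin A i * x (min i j, max i j)\<bar>)" by (simp add: sum_abs)
          also have "\<dots> \<le> (\<Sum>i\<in>D. \<tau> * (\<Sum>e\<in>?C. \<bar>x e\<bar>))"
          proof (rule sum_mono)
            fix i assume i: "i \<in> D"
            have "\<bar>x (min i j, max i j)\<bar> \<le> (\<Sum>e\<in>?C. \<bar>x e\<bar>)"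
              using mixC[OF i j] V by (intro member_le_sum[of "(min i j, max i j)" ?C "\<lambda>e. \<bar>x e\<bar>"]) auto
            then show "\<bar>\<tau> * spin A i * x (min i j, max i j)\<bar> \<le> \<tau> * (\<Sum>e\<in>?C. \<bar>x e\<bar>)"
              using \<tau> by (simp add: abs_mult)
          qed
          finally show "\<bar>?k x j - h j\<bar> \<le> (\<Sum>i\<in>D. \<tau> * (\<Sum>e\<in>?C. \<bar>x e\<bar>))" .
        qed
        also have "\<dots> = (\<Sum>e\<in>?C. (\<tau> * card (?W \<times> D)) * \<bar>x e\<bar>)"
          unfolding sum_distrib_left[symmetric] by (simp add: card_cartesian_product)
        finally show ?thesis by linarith
      qed
    qed
  have "mean_max \<tau> V h = (\<integral>x. (\<integral>y. max_energy \<tau> V (merge ?C (pairs ?W) (x, y)) h \<partial>gauss (pairs ?W)) \<partial>gauss ?C)"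
    unfolding mean_max_def
    by (rule gauss_fold[of ?C "pairs ?W" "\<lambda>a. max_energy \<tau> V a h", unfolded CV]) (use V max_energy_integrable[OF V] in auto)
  also have "\<dots> \<ge> (\<integral>x. ?l x + mean_max \<tau> ?W (?k x) \<partial>gauss ?C)"
  proof (rule integral_mono)
    show "integrable (gauss ?C) (\<lambda>x. ?l x + mean_max \<tau> ?W (?k x))" using l k by (rule Bochner_Integration.integrable_add)
    show "integrable (gauss ?C) (\<lambda>x. \<integral>y. max_energy \<tau> V (merge ?C (pairs ?W) (x, y)) h \<partial>gauss (pairs ?W))"
      by (rule gauss_fold_integrable[of ?C "pairs ?W" "\<lambda>a. max_energy \<tau> V a h", unfolded CV]) (use V max_energy_integrable[OF V] in auto)
    fix x
    assume "x \<in> space (gauss ?C)"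
    have "?l x + mean_max \<tau> ?W (?k x) = (\<integral>y. ?l x + max_energy \<tau> ?W y (?k x) \<partial>gauss (pairs ?W))"
      unfolding mean_max_def using max_energy_integrable[OF fW] by (simp add: W.prob_space)
    also have "\<dots> \<le> (\<integral>y. max_energy \<tau> V (merge ?C (pairs ?W) (x, y)) h \<partial>gauss (pairs ?W))"
    proof (rule integral_mono)
      show "integrable (gauss (pairs ?W)) (\<lambda>y. ?l x + max_energy \<tau> ?W y (?k x))"
        using max_energy_integrable[OF fW] by simp
      show "integrable (gauss (pairs ?W)) (\<lambda>y. max_energy \<tau> V (merge ?C (pairs ?W) (x, y)) h)"
      proof (rule gauss_integrable_linear_growth)
        show "(\<lambda>y. max_energy \<tau> V (merge ?C (pairs ?W) (x, y)) h) \<in> borel_measurable (gauss (pairs ?W))"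
        proof (intro max_energy_measurable V borel_measurable_const)
          fix e assume "e \<in> pairs V"
          then show "(\<lambda>\<omega>. merge ?C (pairs ?W) (x, \<omega>) e) \<in> borel_measurable (gauss (pairs ?W))"
            using CV mm mw by (cases "e \<in> ?C") auto
        qed
        show "\<bar>max_energy \<tau> V (merge ?C (pairs ?W) (x, y)) h\<bar> \<le> ((\<Sum>i\<in>V. \<bar>h i\<bar>) + \<tau> * (\<Sum>e\<in>?C. \<bar>x e\<bar>)) + (\<Sum>e\<in>pairs ?W. \<tau> * \<bar>y e\<bar>)" for y
        proof -
          have "(\<Sum>e\<in>?C \<union> pairs ?W. \<bar>merge ?C (pairs ?W) (x, y) e\<bar>)
              = (\<Sum>e\<in>?C. \<bar>merge ?C (pairs ?W) (x, y) e\<bar>) + (\<Sum>e\<in>pairs ?W. \<bar>merge ?C (pairs ?W) (x, y) e\<bar>)"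
            using V by (intro sum.union_disjoint) auto
          also have "\<dots> = (\<Sum>e\<in>?C. \<bar>x e\<bar>) + (\<Sum>e\<in>pairs ?W. \<bar>y e\<bar>)"
            by (intro arg_cong2[where f="(+)"] sum.cong refl) (simp_all add: mm mw)
          finally have "(\<Sum>e\<in>pairs V. \<bar>merge ?C (pairs ?W) (x, y) e\<bar>) = (\<Sum>e\<in>?C. \<bar>x e\<bar>) + (\<Sum>e\<in>pairs ?W. \<bar>y e\<bar>)"
            unfolding CV .
          then show ?thesis using max_energy_bound[OF V, of \<tau> "merge ?C (pairs ?W) (x, y)" h] \<tau>
            by (simp add: algebra_simps sum_distrib_left)
        qed
      qed (use fW in simp)
      fix y
      have e1: "?l (merge ?C (pairs ?W) (x, y)) = ?l x"
        by (intro arg_cong2[where f="(+)"] arg_cong2[where f="(*)"] refl sum.cong) (use mm prsD in auto)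
      have e2: "max_energy \<tau> ?W (merge ?C (pairs ?W) (x, y)) (?k (merge ?C (pairs ?W) (x, y))) = max_energy \<tau> ?W y (?k x)"
        by (intro max_energy_cong arg_cong2[where f="(+)"] arg_cong2[where f="(*)"] refl sum.cong) (use mm mw mixC in auto)
      show "?l x + max_energy \<tau> ?W y (?k x) \<le> max_energy \<tau> V (merge ?C (pairs ?W) (x, y)) h"
        using max_energy_batch[OF V D, of h \<tau> "merge ?C (pairs ?W) (x, y)"] unfolding A_def[symmetric] e1 e2 by simp
    qed
    finally show "?l x + mean_max \<tau> ?W (?k x) \<le> (\<integral>y. max_energy \<tau> V (merge ?C (pairs ?W) (x, y)) h \<partial>gauss (pairs ?W))" .
  qed
  finally have main: "(\<integral>x. ?l x + mean_max \<tau> ?W (?k x) \<partial>gauss ?C) \<le> mean_max \<tau> V h" .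
  have E0: "(\<integral>x. x e \<partial>gauss ?C) = 0" "integrable (gauss ?C) (\<lambda>x. x e)" if "e \<in> pairs D" for e
    using gauss_component_integral[OF prsD[OF that], of "\<lambda>x. x"] std_normal_moments(3)
      gauss_component_integrable[OF prsD[OF that] std_normal_integrable] by auto
  have "(\<integral>x. ?l x \<partial>gauss ?C) = (\<Sum>i\<in>D. \<bar>h i\<bar>)"
    using E0 by (simp add: C.prob_space)
  then show ?thesis using main l k by simp
qed

text \<open>Each remaining site receives \<open>card D\<close> signed couplings. Different sites use
  different couplings and the signs do not change the law, so the increments of the fields are
  independent centred normal variables.\<close>

lemma mean_max_batch:
  assumes V: "finite V" and D: "D \<subseteq> V" "D \<noteq> {}" and W: "V - D \<noteq> {}" and \<tau>: "\<tau> > 0"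
  shows "(\<Sum>i\<in>D. \<bar>h i\<bar>) + (\<integral>g. mean_max \<tau> (V - D) (\<lambda>j. h j + g j) \<partial>PiM (V - D) (\<lambda>_. scaled_normal (\<tau> * sqrt (card D))))
      \<le> mean_max \<tau> V h"
proof -
  let ?W = "V - D"
  let ?C = "pairs V - pairs ?W"
  define A where "A = {i\<in>D. h i \<ge> 0}"
  define S where "S = (\<lambda>j. (\<lambda>i. (min i j, max i j)) ` D)"
  \<comment> \<open>For \<open>e\<close> in \<open>S j\<close> the end of \<open>e\<close> other
    than \<open>j\<close> lies in \<open>D\<close>, and its spin is the sign of this coupling in the
    field at \<open>j\<close>.\<close>
  define c where "c = (\<lambda>j e. \<tau> * spin A (if fst e = j then snd e else fst e))"
  have fD: "finite D" using V D finite_subset by blast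
  have inj: "inj_on (\<lambda>i. (min i j, max i j)) D" if "j \<in> ?W" for j
    using that by (auto simp: inj_on_def min_def max_def split: if_splits)
  have cS: "c j (min i j, max i j) = \<tau> * spin A i" if "i \<in> D" "j \<in> ?W" for i j
    using that by (auto simp: c_def min_def max_def)
  have sum: "(\<Sum>e\<in>S j. c j e * x e) = (\<Sum>i\<in>D. \<tau> * spin A i * x (min i j, max i j))" if "j \<in> ?W" for j x
    unfolding S_def using that by (subst sum.reindex[OF inj[OF that]]) (auto intro!: sum.cong simp: cS)
  have sq: "sqrt (\<Sum>e\<in>S j. (c j e)\<^sup>2) = \<tau> * sqrt (card D)" if "j \<in> ?W" for j
  proof -
    have "(\<Sum>e\<in>S j. (c j e)\<^sup>2) = (\<Sum>i\<in>D. \<tau>\<^sup>2)"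
      unfolding S_def using that by (subst sum.reindex[OF inj[OF that]]) (auto intro!: sum.cong simp: cS power_mult_distrib)
    then show ?thesis using \<tau> by (simp add: real_sqrt_mult)
  qed
  have law: "distr (gauss ?C) (PiM ?W (\<lambda>_. borel)) (\<lambda>x. \<lambda>j\<in>?W. \<Sum>e\<in>S j. c j e * x e)
     = PiM ?W (\<lambda>j. scaled_normal (sqrt (\<Sum>e\<in>S j. (c j e)\<^sup>2)))"
  proof (rule gauss_linear_forms)
    show "finite ?W" "?W \<noteq> {}" using V W by auto
    show "finite (S i) \<and> S i \<noteq> {} \<and> S i \<subseteq> ?C" if "i \<in> ?W" for i
      using that D fD mixed_mem[OF _ that D(1)] by (auto simp: S_def)
    show "c i j \<noteq> 0" for i j using \<tau> by (simp add: c_def)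
    show "disjoint_family_on S ?W"
      by (auto simp: disjoint_family_on_def S_def min_def max_def split: if_splits)
  qed
  also have "\<dots> = PiM ?W (\<lambda>_. scaled_normal (\<tau> * sqrt (card D)))"
    by (intro PiM_cong refl) (simp add: sq)
  finally have law: "distr (gauss ?C) (PiM ?W (\<lambda>_. borel)) (\<lambda>x. \<lambda>j\<in>?W. \<Sum>e\<in>S j. c j e * x e)
     = PiM ?W (\<lambda>_. scaled_normal (\<tau> * sqrt (card D)))" .
  have SC: "S j \<subseteq> ?C" if "j \<in> ?W" for j
    using mixed_mem[OF _ that D(1)] by (auto simp: S_def)
  have "(\<integral>g. mean_max \<tau> ?W (\<lambda>j. h j + g j) \<partial>PiM ?W (\<lambda>_. scaled_normal (\<tau> * sqrt (card D))))
     = (\<integral>x. mean_max \<tau> ?W (\<lambda>j. h j + (\<lambda>j\<in>?W. \<Sum>e\<in>S j. c j e * x e) j) \<partial>gauss ?C)"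
    unfolding law[symmetric]
  proof (rule integral_distr)
    show "(\<lambda>x. \<lambda>j\<in>?W. \<Sum>e\<in>S j. c j e * x e) \<in> gauss ?C \<rightarrow>\<^sub>M PiM ?W (\<lambda>_. borel)"
      using SC by (intro measurable_restrict borel_measurable_sum borel_measurable_times borel_measurable_const gauss_comp_measurable) auto
    show "(\<lambda>g. mean_max \<tau> ?W (\<lambda>j. h j + g j)) \<in> borel_measurable (PiM ?W (\<lambda>_. borel))"
      using V by (intro mean_max_measurable) auto
  qed
  also have "\<dots> = (\<integral>x. mean_max \<tau> ?W (\<lambda>j. h j + (\<Sum>i\<in>D. \<tau> * spin A i * x (min i j, max i j))) \<partial>gauss ?C)"
    by (intro Bochner_Integration.integral_cong refl mean_max_cong) (simp add: sum)
  finally show ?thesis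
    using mean_max_batch_aux[OF V D(1) \<tau>, of h] by (simp add: A_def)
qed

text \<open>The case of a single batch consisting of all sites. It ends the greedy induction, and
  for zero field it shows that the mean maximum is nonnegative.\<close>

lemma mean_max_ge_abs:
  assumes V: "finite V" and \<tau>: "\<tau> > 0"
  shows "(\<Sum>i\<in>V. \<bar>h i\<bar>) \<le> mean_max \<tau> V h"
proof -
  have "mean_max \<tau> {} g = 0" for g
    unfolding mean_max_def by (simp add: max_energy_def energy_def pairs_def)
  then show ?thesis using mean_max_batch_aux[OF V subset_refl \<tau>, of h] by simp
qed

section \<open>Fluctuations of sums of bounded independent variables\<close>

lemma PiM_component_bounded_integrable:
  fixes f :: "_ \<Rightarrow> real"
  assumes M: "\<And>i. prob_space (M i)" and i: "i \<in> I"
    and f[measurable]: "f \<in> borel_measurable (M i)" and b: "\<And>x. \<bar>f x\<bar> \<le> B"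
  shows "integrable (M i) f" "integrable (PiM I M) (\<lambda>\<omega>. f (\<omega> i))"
proof -
  interpret prob_space "M i" by (rule M)
  have "AE x in M i. norm (f x) \<le> B" using b by (intro AE_I2) simp
  then show *: "integrable (M i) f"
    by (rule integrable_const_bound[OF _ f])
  show "integrable (PiM I M) (\<lambda>\<omega>. f (\<omega> i))"
    using * PiM_component_integral(2)[of I M i f, OF M i f] by simp
qed

text \<open>Independence kills the cross terms and each term has variance at most 1, so a count of
  survivors fluctuates only by the square root of \<open>card L\<close>.\<close>

lemma PiM_variance_sum:
  fixes f :: "'i \<Rightarrow> 'a \<Rightarrow> real"
  assumes M: "\<And>i. prob_space (M i)" and I: "finite I" "L \<subseteq> I"
    and f: "\<And>i. i \<in> L \<Longrightarrow> f i \<in> borel_measurable (M i)" and b: "\<And>i x. i \<in> L \<Longrightarrow> \<bar>f i x\<bar> \<le> 1"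
  defines "m \<equiv> \<Sum>i\<in>L. (\<integral>x. f i x \<partial>M i)"
  shows "integrable (PiM I M) (\<lambda>\<omega>. (\<Sum>i\<in>L. f i (\<omega> i)) - m)"
    and "(\<integral>\<omega>. (\<Sum>i\<in>L. f i (\<omega> i)) - m \<partial>PiM I M) = 0"
    and "integrable (PiM I M) (\<lambda>\<omega>. ((\<Sum>i\<in>L. f i (\<omega> i)) - m)\<^sup>2)"
    and "(\<integral>\<omega>. ((\<Sum>i\<in>L. f i (\<omega> i)) - m)\<^sup>2 \<partial>PiM I M) \<le> card L"
proof -
  interpret P: prob_space "PiM I M" by (intro prob_space_PiM M)
  interpret product_sigma_finite M
    by (intro product_sigma_finite.intro) (meson M prob_space_imp_sigma_finite)
  define g where "g = (\<lambda>i x. f i x - (\<integral>x. f i x \<partial>M i))"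
  have fL: "finite L" using I finite_subset by blast
  have fi: "integrable (M i) (f i)" "integrable (PiM I M) (\<lambda>\<omega>. f i (\<omega> i))" if "i \<in> L" for i
    using PiM_component_bounded_integrable[of M i I "f i" 1, OF M _ f[OF that] b[OF that]] that I by auto
  have gi: "integrable (M i) (g i)" if "i \<in> L" for i
  proof -
    interpret prob_space "M i" by (rule M)
    show ?thesis unfolding g_def using fi[OF that] by simp
  qed
  have g0: "(\<integral>x. g i x \<partial>M i) = 0" if "i \<in> L" for i
  proof -
    interpret prob_space "M i" by (rule M)
    show ?thesis unfolding g_def using fi[OF that] by (simp add: prob_space)
  qed
  have eq: "(\<Sum>i\<in>L. f i (\<omega> i)) - m = (\<Sum>i\<in>L. g i (\<omega> i))" for \<omega>
    by (simp add: g_def m_def sum_subtractf)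
  have fint: "(\<integral>\<omega>. f i (\<omega> i) \<partial>PiM I M) = (\<integral>x. f i x \<partial>M i)" if "i \<in> L" for i
    using PiM_component_integral(1)[of I M i "f i", OF M _ f[OF that]] that I by auto
  show "integrable (PiM I M) (\<lambda>\<omega>. (\<Sum>i\<in>L. f i (\<omega> i)) - m)"
    using fi by simp
  show "(\<integral>\<omega>. (\<Sum>i\<in>L. f i (\<omega> i)) - m \<partial>PiM I M) = 0"
    using fi fint by (simp add: P.prob_space m_def)
  have gb: "\<bar>g i x\<bar> \<le> 2" if "i \<in> L" for i x
  proof -
    interpret prob_space "M i" by (rule M)
    have "\<bar>\<integral>x. f i x \<partial>M i\<bar> \<le> (\<integral>x. \<bar>f i x\<bar> \<partial>M i)" by (rule integral_abs_bound)
    also have "\<dots> \<le> (\<integral>x. 1 \<partial>M i)" using fi[OF that] b[OF that] by (intro integral_mono) auto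
    finally have "\<bar>\<integral>x. f i x \<partial>M i\<bar> \<le> 1" by (simp add: prob_space)
    then show ?thesis using b[OF that, of x] unfolding g_def by linarith
  qed
  have gm: "(\<lambda>\<omega>. g i (\<omega> i)) \<in> borel_measurable (PiM I M)" if "i \<in> L" for i
    unfolding g_def using fi[OF that] by simp
  have ggi: "integrable (PiM I M) (\<lambda>\<omega>. g i (\<omega> i) * g j (\<omega> j))" if "i \<in> L" "j \<in> L" for i j
  proof (rule P.integrable_const_bound[where B=4])
    show "AE \<omega> in PiM I M. norm (g i (\<omega> i) * g j (\<omega> j)) \<le> 4"
      using gb that mult_mono[of "\<bar>g i _\<bar>" 2 "\<bar>g j _\<bar>" 2] by (auto simp: abs_mult)
  qed (use gm that in auto)
  have gg0: "(\<integral>\<omega>. g i (\<omega> i) * g j (\<omega> j) \<partial>PiM I M) = 0" if "i \<in> L" "j \<in> L" "i \<noteq> j" for i j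
  proof -
    \<comment> \<open>Extended by 1 on all other coordinates, the two factors become a full product,
      to which \<open>product_integral_prod\<close> applies.\<close>
    let ?h = "\<lambda>k x. if k = i then g i x else if k = j then g j x else 1"
    have *: "(\<Prod>k\<in>I. ?h k (\<omega> k)) = g i (\<omega> i) * g j (\<omega> j)" for \<omega>
    proof -
      have "(\<Prod>k\<in>I. ?h k (\<omega> k)) = (\<Prod>k\<in>{i,j}. ?h k (\<omega> k))"
        using I that by (intro prod.mono_neutral_right) auto
      then show ?thesis using that by simp
    qed
    have "(\<integral>\<omega>. (\<Prod>k\<in>I. ?h k (\<omega> k)) \<partial>PiM I M) = (\<Prod>k\<in>I. (\<integral>x. ?h k x \<partial>M k))"
    proof (rule product_integral_prod[OF I(1)])
      fix k assume "k \<in> I"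
      interpret prob_space "M k" by (rule M)
      show "integrable (M k) (\<lambda>x. ?h k x)"
        by (cases "k = i"; cases "k = j") (use gi that in simp_all)
    qed
    also have "\<dots> = 0"
    proof (rule prod_zero)
      show "\<exists>k\<in>I. (\<integral>x. ?h k x \<partial>M k) = 0" using that I g0[OF that(1)] by (intro bexI[of _ i]) auto
    qed fact
    finally show ?thesis unfolding * .
  qed
  have sq: "((\<Sum>i\<in>L. f i (\<omega> i)) - m)\<^sup>2 = (\<Sum>i\<in>L. \<Sum>j\<in>L. g i (\<omega> i) * g j (\<omega> j))" for \<omega>
    unfolding eq by (simp add: power2_eq_square sum_product)
  show "integrable (PiM I M) (\<lambda>\<omega>. ((\<Sum>i\<in>L. f i (\<omega> i)) - m)\<^sup>2)"
    unfolding sq using ggi by (intro Bochner_Integration.integrable_sum) auto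
  have "(\<integral>\<omega>. ((\<Sum>i\<in>L. f i (\<omega> i)) - m)\<^sup>2 \<partial>PiM I M) = (\<Sum>i\<in>L. \<Sum>j\<in>L. (\<integral>\<omega>. g i (\<omega> i) * g j (\<omega> j) \<partial>PiM I M))"
    unfolding sq using ggi by (simp add: Bochner_Integration.integral_sum)
  also have "\<dots> = (\<Sum>i\<in>L. (\<integral>\<omega>. g i (\<omega> i) * g i (\<omega> i) \<partial>PiM I M))"
  proof (intro sum.cong refl)
    fix i assume i: "i \<in> L"
    have "(\<Sum>j\<in>L. (\<integral>\<omega>. g i (\<omega> i) * g j (\<omega> j) \<partial>PiM I M)) = (\<Sum>j\<in>{i}. (\<integral>\<omega>. g i (\<omega> i) * g j (\<omega> j) \<partial>PiM I M))"
      using i fL gg0 by (intro sum.mono_neutral_right) auto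
    then show "(\<Sum>j\<in>L. (\<integral>\<omega>. g i (\<omega> i) * g j (\<omega> j) \<partial>PiM I M)) = (\<integral>\<omega>. g i (\<omega> i) * g i (\<omega> i) \<partial>PiM I M)" by simp
  qed
  also have "\<dots> \<le> (\<Sum>i\<in>L. 1)"
  proof (intro sum_mono)
    fix i assume i: "i \<in> L"
    interpret Mi: prob_space "M i" by (rule M)
    have "(\<integral>\<omega>. g i (\<omega> i) * g i (\<omega> i) \<partial>PiM I M) = (\<integral>x. g i x * g i x \<partial>M i)"
      using gi[OF i] i I by (intro PiM_component_integral(1)[of I M i "\<lambda>x. g i x * g i x", OF M]) auto
    also have "\<dots> = Mi.variance (f i)"
      by (simp add: g_def power2_eq_square)
    also have "\<dots> = Mi.expectation (\<lambda>x. (f i x)\<^sup>2) - (Mi.expectation (f i))\<^sup>2"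
    proof (rule Mi.variance_eq)
      show "integrable (M i) (\<lambda>x. (f i x)\<^sup>2)"
        using b[OF i] fi[OF i] by (intro Mi.integrable_const_bound[where B=1]) (auto simp: abs_square_le_1)
    qed (use fi i in auto)
    also have "\<dots> \<le> Mi.expectation (\<lambda>x. (f i x)\<^sup>2)" by simp
    also have "\<dots> \<le> Mi.expectation (\<lambda>x. 1)"
      using b[OF i] fi[OF i] by (intro integral_mono Mi.integrable_const_bound[where B=1]) (auto simp: abs_square_le_1)
    finally show "(\<integral>\<omega>. g i (\<omega> i) * g i (\<omega> i) \<partial>PiM I M) \<le> 1" by (simp add: Mi.prob_space)
  qed
  finally show "(\<integral>\<omega>. ((\<Sum>i\<in>L. f i (\<omega> i)) - m)\<^sup>2 \<partial>PiM I M) \<le> card L" by simp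
qed

definition pos_sq :: "real \<Rightarrow> real" where "pos_sq x = (max 0 x)\<^sup>2"

lemma pos_sq_mono: "x \<le> y \<Longrightarrow> pos_sq x \<le> pos_sq y"
  unfolding pos_sq_def by (intro power_mono) auto

text \<open>The derivative \<open>2 * max 0 x\<close> is 2-Lipschitz, so the tangent plus
  \<open>d\<^sup>2\<close> is an upper bound. This is why the excess is squared: under averaging the
  tangent term vanishes and only a variance is added.\<close>

lemma pos_sq_expand: "pos_sq (x + d) \<le> pos_sq x + 2 * max 0 x * d + d\<^sup>2"
proof (cases "x \<ge> 0")
  case True
  show ?thesis
  proof (cases "x + d \<ge> 0")
    case False
    have "pos_sq x + 2 * max 0 x * d + d\<^sup>2 = (x + d)\<^sup>2" using True by (simp add: pos_sq_def power2_sum)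
    then show ?thesis using False by (simp add: pos_sq_def)
  qed (use True in \<open>simp add: pos_sq_def power2_sum\<close>)
next
  case False
  have "max 0 (x + d) \<le> \<bar>d\<bar>" using False by auto
  then have "(max 0 (x + d))\<^sup>2 \<le> \<bar>d\<bar>\<^sup>2" by (intro power_mono) auto
  then show ?thesis using False by (simp add: pos_sq_def)
qed

lemma (in prob_space) integral_affine_add:
  fixes f g :: "'a \<Rightarrow> real"
  assumes "integrable M f" "integrable M g"
  shows "(\<integral>x. a + b * f x + g x \<partial>M) = a + b * (\<integral>x. f x \<partial>M) + (\<integral>x. g x \<partial>M)"
  using assms by (simp add: prob_space)

lemma PiM_pos_sq_sum:
  fixes f :: "'i \<Rightarrow> 'a \<Rightarrow> real"
  assumes M: "\<And>i. prob_space (M i)" and I: "finite I" "L \<subseteq> I"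
    and f: "\<And>i. i \<in> L \<Longrightarrow> f i \<in> borel_measurable (M i)" and b: "\<And>i x. i \<in> L \<Longrightarrow> \<bar>f i x\<bar> \<le> 1"
  shows "integrable (PiM I M) (\<lambda>\<omega>. pos_sq ((\<Sum>i\<in>L. f i (\<omega> i)) - c))"
    and "(\<integral>\<omega>. pos_sq ((\<Sum>i\<in>L. f i (\<omega> i)) - c) \<partial>PiM I M) \<le> pos_sq ((\<Sum>i\<in>L. (\<integral>x. f i x \<partial>M i)) - c) + card L"
proof -
  interpret P: prob_space "PiM I M" by (intro prob_space_PiM M)
  define m where "m = (\<Sum>i\<in>L. (\<integral>x. f i x \<partial>M i))"
  have fL: "finite L" using I finite_subset by blast
  note V = PiM_variance_sum[of M I L f, OF M I f b, folded m_def]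
  show int: "integrable (PiM I M) (\<lambda>\<omega>. pos_sq ((\<Sum>i\<in>L. f i (\<omega> i)) - c))"
  proof (rule P.integrable_const_bound[where B="(real (card L) + \<bar>c\<bar>)\<^sup>2"])
    have "norm (pos_sq ((\<Sum>i\<in>L. f i (\<omega> i)) - c)) \<le> (real (card L) + \<bar>c\<bar>)\<^sup>2" for \<omega>
    proof -
      have "\<bar>\<Sum>i\<in>L. f i (\<omega> i)\<bar> \<le> (\<Sum>i\<in>L. \<bar>f i (\<omega> i)\<bar>)" by (rule sum_abs)
      also have "\<dots> \<le> (\<Sum>i\<in>L. 1)" using b by (intro sum_mono) auto
      finally have "\<bar>\<Sum>i\<in>L. f i (\<omega> i)\<bar> \<le> real (card L)" by simp
      then have "max 0 ((\<Sum>i\<in>L. f i (\<omega> i)) - c) \<le> real (card L) + \<bar>c\<bar>" by linarith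
      then show ?thesis unfolding pos_sq_def by (simp add: power_mono)
    qed
    then show "AE \<omega> in PiM I M. norm (pos_sq ((\<Sum>i\<in>L. f i (\<omega> i)) - c)) \<le> (real (card L) + \<bar>c\<bar>)\<^sup>2" by auto
    have "(\<lambda>\<omega>. (\<Sum>i\<in>L. f i (\<omega> i)) - m) \<in> borel_measurable (PiM I M)" using V(1) by (rule borel_measurable_integrable)
    then have "(\<lambda>\<omega>. pos_sq (((\<Sum>i\<in>L. f i (\<omega> i)) - m) + (m - c))) \<in> borel_measurable (PiM I M)"
      unfolding pos_sq_def by measurable
    moreover have "((\<Sum>i\<in>L. f i (\<omega> i)) - m) + (m - c) = (\<Sum>i\<in>L. f i (\<omega> i)) - c" for \<omega>
      by linarith
    ultimately show "(\<lambda>\<omega>. pos_sq ((\<Sum>i\<in>L. f i (\<omega> i)) - c)) \<in> borel_measurable (PiM I M)"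
      by (simp only:)
  qed
  have "(\<integral>\<omega>. pos_sq ((\<Sum>i\<in>L. f i (\<omega> i)) - c) \<partial>PiM I M)
     \<le> (\<integral>\<omega>. pos_sq (m - c) + 2 * max 0 (m - c) * ((\<Sum>i\<in>L. f i (\<omega> i)) - m) + ((\<Sum>i\<in>L. f i (\<omega> i)) - m)\<^sup>2 \<partial>PiM I M)"
  proof (rule integral_mono[OF int])
    show "integrable (PiM I M) (\<lambda>\<omega>. pos_sq (m - c) + 2 * max 0 (m - c) * ((\<Sum>i\<in>L. f i (\<omega> i)) - m) + ((\<Sum>i\<in>L. f i (\<omega> i)) - m)\<^sup>2)"
      by (intro Bochner_Integration.integrable_add integrable_mult_right P.integrable_const V(1) V(3))
    fix \<omega>
    have "m - c + ((\<Sum>i\<in>L. f i (\<omega> i)) - m) = (\<Sum>i\<in>L. f i (\<omega> i)) - c"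
      by linarith
    then show "pos_sq ((\<Sum>i\<in>L. f i (\<omega> i)) - c) \<le> pos_sq (m - c) + 2 * max 0 (m - c) * ((\<Sum>i\<in>L. f i (\<omega> i)) - m) + ((\<Sum>i\<in>L. f i (\<omega> i)) - m)\<^sup>2"
      using pos_sq_expand[of "m - c" "(\<Sum>i\<in>L. f i (\<omega> i)) - m"] by (simp only:)
  qed
  also have "\<dots> = pos_sq (m - c) + 2 * max 0 (m - c) * 0 + (\<integral>\<omega>. ((\<Sum>i\<in>L. f i (\<omega> i)) - m)\<^sup>2 \<partial>PiM I M)"
    by (simp only: P.integral_affine_add[OF V(1) V(3)] V(2))
  also have "\<dots> \<le> pos_sq (m - c) + card L" using V(4) by simp
  finally show "(\<integral>\<omega>. pos_sq ((\<Sum>i\<in>L. f i (\<omega> i)) - c) \<partial>PiM I M) \<le> pos_sq ((\<Sum>i\<in>L. (\<integral>x. f i x \<partial>M i)) - c) + card L"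
    by (simp add: m_def)
qed

section \<open>Greedy rounds\<close>

text \<open>The field of a site is a walker with Gaussian steps of variance \<open>\<sigma>\<^sup>2\<close>; after reaching \<open>x\<close> in
  round \<open>r\<close> it stays unfixed with probability \<open>S r x\<close>. The squared positive parts in \<open>greedy_bound\<close> pay for the fluctuations
  of the number of survivors above the capacity \<open>n - (r + m + 1) * k\<close>.\<close>

definition walk_drift :: "real \<Rightarrow> real \<Rightarrow> real" where
  "walk_drift \<sigma> h = (\<integral>y. \<bar>h + y\<bar> \<partial>scaled_normal \<sigma>) - \<bar>h\<bar>"

text \<open>The energy collected by a site is its absolute field at the moment of fixing. Since
  fields start at zero, the mean of that value is the sum of the drifts of the absolute field up to
  that time, so energy can be counted while the walk runs and not when it stops.\<close>

primrec walk_gain :: "real \<Rightarrow> (nat \<Rightarrow> real \<Rightarrow> real) \<Rightarrow> nat \<Rightarrow> nat \<Rightarrow> real \<Rightarrow> real" where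
  "walk_gain \<sigma> S 0 r h = 0"
| "walk_gain \<sigma> S (Suc j) r h = walk_drift \<sigma> h
     + (\<integral>y. S (Suc r) (h + y) * walk_gain \<sigma> S j (Suc r) (h + y) \<partial>scaled_normal \<sigma>)"

primrec walk_alive :: "real \<Rightarrow> (nat \<Rightarrow> real \<Rightarrow> real) \<Rightarrow> nat \<Rightarrow> nat \<Rightarrow> real \<Rightarrow> real" where
  "walk_alive \<sigma> S 0 r h = 1"
| "walk_alive \<sigma> S (Suc m) r h
     = (\<integral>y. S (Suc r) (h + y) * walk_alive \<sigma> S m (Suc r) (h + y) \<partial>scaled_normal \<sigma>)"

lemma measure_scaled_normal[simp]: "measure (scaled_normal \<sigma>) UNIV = 1"
  using prob_space.prob_space[OF prob_space_scaled_normal, of \<sigma>] by simp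

abbreviation mean_abs :: "real \<Rightarrow> real" where
  "mean_abs \<sigma> \<equiv> (\<integral>y. \<bar>y\<bar> \<partial>scaled_normal \<sigma>)"

lemma scaled_normal_shift_measurable:
  fixes f :: "real \<Rightarrow> real"
  assumes [measurable]: "f \<in> borel_measurable borel"
  shows "(\<lambda>h. \<integral>y. f (h + y) \<partial>scaled_normal \<sigma>) \<in> borel_measurable borel"
proof -
  interpret prob_space "scaled_normal \<sigma>" by (rule prob_space_scaled_normal)
  have "(\<lambda>p. fst p + snd p) \<in> borel_measurable ((borel :: real measure) \<Otimes>\<^sub>M scaled_normal \<sigma>)"
    by measurable
  then have "(\<lambda>(h, y). f (h + y)) \<in> borel_measurable (borel \<Otimes>\<^sub>M scaled_normal \<sigma>)"
    unfolding split_beta by (rule measurable_compose[OF _ assms])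
  then show ?thesis by (rule borel_measurable_lebesgue_integral)
qed

lemma scaled_normal_bounded_integral:
  fixes f :: "real \<Rightarrow> real"
  assumes [measurable]: "f \<in> borel_measurable borel" and b: "\<And>x. 0 \<le> f x \<and> f x \<le> B"
  shows "integrable (scaled_normal \<sigma>) (\<lambda>y. f (h + y))"
    and "0 \<le> (\<integral>y. f (h + y) \<partial>scaled_normal \<sigma>)" "(\<integral>y. f (h + y) \<partial>scaled_normal \<sigma>) \<le> B"
proof -
  interpret prob_space "scaled_normal \<sigma>" by (rule prob_space_scaled_normal)
  show i: "integrable (scaled_normal \<sigma>) (\<lambda>y. f (h + y))"
    using b by (intro integrable_const_bound[where B=B] AE_I2) simp_all
  show "0 \<le> (\<integral>y. f (h + y) \<partial>scaled_normal \<sigma>)"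
    using b by (intro integral_nonneg_AE) auto
  have "(\<integral>y. f (h + y) \<partial>scaled_normal \<sigma>) \<le> (\<integral>y. B \<partial>scaled_normal \<sigma>)"
    using b by (intro integral_mono i) auto
  then show "(\<integral>y. f (h + y) \<partial>scaled_normal \<sigma>) \<le> B" by (simp add: prob_space)
qed

lemma scaled_normal_abs_integrable: "integrable (scaled_normal \<sigma>) (\<lambda>y. \<bar>h + y\<bar>)"
proof -
  interpret prob_space "scaled_normal \<sigma>" by (rule prob_space_scaled_normal)
  show ?thesis using scaled_normal_integrable[of \<sigma>] by (intro integrable_abs Bochner_Integration.integrable_add) auto
qed

lemma scaled_normal_mean: "(\<integral>y. y \<partial>scaled_normal \<sigma>) = 0"
  unfolding scaled_normal_def by (subst integral_distr) (simp_all add: std_normal_moments(3))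

lemma walk_drift_bounds: "0 \<le> walk_drift \<sigma> h" "walk_drift \<sigma> h \<le> mean_abs \<sigma>"
proof -
  interpret prob_space "scaled_normal \<sigma>" by (rule prob_space_scaled_normal)
  have "(\<integral>y. h + y \<partial>scaled_normal \<sigma>) = h"
    using scaled_normal_integrable[of \<sigma>] by (simp add: prob_space scaled_normal_mean)
  then show "0 \<le> walk_drift \<sigma> h"
    using integral_abs_bound[of "scaled_normal \<sigma>" "\<lambda>y. h + y"] by (simp add: walk_drift_def)
  have "(\<integral>y. \<bar>h + y\<bar> \<partial>scaled_normal \<sigma>) \<le> (\<integral>y. \<bar>h\<bar> + \<bar>y\<bar> \<partial>scaled_normal \<sigma>)"
    using scaled_normal_abs_integrable[of \<sigma> 0] scaled_normal_abs_integrable[of \<sigma> h] by (intro integral_mono) auto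
  also have "\<dots> = \<bar>h\<bar> + mean_abs \<sigma>"
    using scaled_normal_abs_integrable[of \<sigma> 0] by (simp add: prob_space)
  finally show "walk_drift \<sigma> h \<le> mean_abs \<sigma>" by (simp add: walk_drift_def)
qed

lemma walk_drift_measurable[measurable]: "walk_drift \<sigma> \<in> borel_measurable borel"
  unfolding walk_drift_def using scaled_normal_shift_measurable[of abs \<sigma>] by measurable

lemma walk_alive_props:
  assumes S: "\<And>r x. 0 \<le> S r x \<and> S r x \<le> 1" and Sm: "\<And>r. S r \<in> borel_measurable borel"
  shows "walk_alive \<sigma> S m r \<in> borel_measurable borel \<and> (\<forall>h. 0 \<le> walk_alive \<sigma> S m r h \<and> walk_alive \<sigma> S m r h \<le> 1)"
proof (induction m arbitrary: r)
  case 0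
  have "walk_alive \<sigma> S 0 r = (\<lambda>_. 1)" by auto
  then show ?case by simp
next
  case (Suc m)
  let ?f = "\<lambda>x. S (Suc r) x * walk_alive \<sigma> S m (Suc r) x"
  have m: "?f \<in> borel_measurable borel" using Sm Suc by (intro borel_measurable_times) auto
  have b: "0 \<le> ?f x \<and> ?f x \<le> 1" for x
    using S[of "Suc r" x] Suc[of "Suc r"] by (auto intro: mult_le_one)
  have e: "walk_alive \<sigma> S (Suc m) r = (\<lambda>h. \<integral>y. ?f (h + y) \<partial>scaled_normal \<sigma>)" by (rule ext) simp
  show ?case unfolding e using scaled_normal_shift_measurable[OF m] scaled_normal_bounded_integral(2,3)[OF m b] by auto
qed

lemma walk_gain_props:
  assumes S: "\<And>r x. 0 \<le> S r x \<and> S r x \<le> 1" and Sm: "\<And>r. S r \<in> borel_measurable borel"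
  shows "walk_gain \<sigma> S j r \<in> borel_measurable borel
    \<and> (\<forall>h. 0 \<le> walk_gain \<sigma> S j r h \<and> walk_gain \<sigma> S j r h \<le> j * mean_abs \<sigma>)"
proof (induction j arbitrary: r)
  case 0
  have "walk_gain \<sigma> S 0 r = (\<lambda>_. 0)" by auto
  then show ?case by simp
next
  case (Suc j)
  let ?f = "\<lambda>x. S (Suc r) x * walk_gain \<sigma> S j (Suc r) x"
  have m: "?f \<in> borel_measurable borel" using Sm Suc by (intro borel_measurable_times) auto
  have b: "0 \<le> ?f x \<and> ?f x \<le> j * mean_abs \<sigma>" for x
    using S[of "Suc r" x] Suc[of "Suc r"] mult_left_le_one_le[of "walk_gain \<sigma> S j (Suc r) x" "S (Suc r) x"]
    by (auto intro: order_trans)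
  have e: "walk_gain \<sigma> S (Suc j) r = (\<lambda>h. walk_drift \<sigma> h + (\<integral>y. ?f (h + y) \<partial>scaled_normal \<sigma>))" by (rule ext) simp
  have "0 \<le> walk_drift \<sigma> h + (\<integral>y. ?f (h + y) \<partial>scaled_normal \<sigma>)"
    "walk_drift \<sigma> h + (\<integral>y. ?f (h + y) \<partial>scaled_normal \<sigma>) \<le> Suc j * mean_abs \<sigma>" for h
    using walk_drift_bounds[of \<sigma> h] scaled_normal_bounded_integral(2,3)[OF m b, of \<sigma> h] by (auto simp: algebra_simps)
  then show ?case unfolding e using scaled_normal_shift_measurable[OF m] by auto
qed

lemma bernoulli_sum_integral:
  assumes "0 \<le> p" "p \<le> 1"
  shows "(\<integral>b. (if b then x else 0) \<partial>measure_pmf (bernoulli_pmf p)) = p * (x::real)"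
  using assms by simp

text \<open>The hypothesis holds for every set \<open>L'\<close> of survivors. Averaging it over
  independent coin flips with bias \<open>p i\<close> turns the choice of a set into fractional
  survival. Only the penalties are not linear in the flips, and each of them grows by at most a
  variance.\<close>

lemma mean_max_average_survivors:
  assumes W: "finite W" "L \<subseteq> W" and p: "\<And>i. 0 \<le> p i \<and> p i \<le> (1::real)"
    and al: "\<And>m i. 0 \<le> al m i \<and> al m i \<le> (1::real)"
    and N: "N \<ge> 0"
    and b: "\<And>L'. L' \<subseteq> L \<Longrightarrow> A + (\<Sum>i\<in>L'. u i) - N * (\<Sum>m<j. pos_sq ((\<Sum>i\<in>L'. al m i) - c m)) \<le> G"
  shows "A + (\<Sum>i\<in>L. p i * u i) - N * (\<Sum>m<j. pos_sq ((\<Sum>i\<in>L. p i * al m i) - c m) + card L) \<le> G"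
proof -
  let ?M = "\<lambda>i. measure_pmf (bernoulli_pmf (p i))"
  have M: "prob_space (?M i)" for i by (rule prob_space_measure_pmf)
  interpret P: prob_space "PiM W ?M" by (intro prob_space_PiM M)
  have fL: "finite L" using W finite_subset by blast
  have sub: "(\<Sum>i\<in>{i\<in>L. \<omega> i}. f i) = (\<Sum>i\<in>L. (if \<omega> i then f i else 0))" for \<omega> and f :: "_ \<Rightarrow> real"
    using fL by (simp add: sum.inter_filter)
  have ui: "integrable (PiM W ?M) (\<lambda>\<omega>. if \<omega> i then u i else 0)"
      "(\<integral>\<omega>. (if \<omega> i then u i else 0) \<partial>PiM W ?M) = p i * u i" if "i \<in> L" for i
  proof -
    have iW: "i \<in> W" using that W by auto
    show "integrable (PiM W ?M) (\<lambda>\<omega>. if \<omega> i then u i else 0)"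
      by (rule PiM_component_bounded_integrable(2)[OF M iW, where f="\<lambda>b. if b then u i else 0" and B="\<bar>u i\<bar>"]) auto
    have "(\<integral>\<omega>. (if \<omega> i then u i else 0) \<partial>PiM W ?M) = (\<integral>b. (if b then u i else 0) \<partial>?M i)"
      by (rule PiM_component_integral(1)[of W ?M i "\<lambda>b. if b then u i else 0", OF M iW]) simp
    then show "(\<integral>\<omega>. (if \<omega> i then u i else 0) \<partial>PiM W ?M) = p i * u i"
      using p[of i] by (simp add: bernoulli_sum_integral)
  qed
  have ps: "integrable (PiM W ?M) (\<lambda>\<omega>. pos_sq ((\<Sum>i\<in>L. (if \<omega> i then al m i else 0)) - c m))"
     "(\<integral>\<omega>. pos_sq ((\<Sum>i\<in>L. (if \<omega> i then al m i else 0)) - c m) \<partial>PiM W ?M) \<le> pos_sq ((\<Sum>i\<in>L. p i * al m i) - c m) + card L" for m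
  proof -
    note * = PiM_pos_sq_sum[of ?M W L "\<lambda>i b. if b then al m i else 0" "c m", OF M W]
    show "integrable (PiM W ?M) (\<lambda>\<omega>. pos_sq ((\<Sum>i\<in>L. (if \<omega> i then al m i else 0)) - c m))"
      by (rule *(1)) (use al in \<open>simp_all split: if_split\<close>)
    have "(\<integral>\<omega>. pos_sq ((\<Sum>i\<in>L. (if \<omega> i then al m i else 0)) - c m) \<partial>PiM W ?M)
      \<le> pos_sq ((\<Sum>i\<in>L. (\<integral>b. (if b then al m i else 0) \<partial>?M i)) - c m) + card L"
      by (rule *(2)) (use al in \<open>simp_all split: if_split\<close>)
    then show "(\<integral>\<omega>. pos_sq ((\<Sum>i\<in>L. (if \<omega> i then al m i else 0)) - c m) \<partial>PiM W ?M) \<le> pos_sq ((\<Sum>i\<in>L. p i * al m i) - c m) + card L"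
      using p by (simp add: bernoulli_sum_integral mult.commute)
  qed
  let ?F = "\<lambda>\<omega>. A + (\<Sum>i\<in>L. (if \<omega> i then u i else 0)) - N * (\<Sum>m<j. pos_sq ((\<Sum>i\<in>L. (if \<omega> i then al m i else 0)) - c m))"
  have "(\<integral>\<omega>. ?F \<omega> \<partial>PiM W ?M) \<le> (\<integral>\<omega>. G \<partial>PiM W ?M)"
  proof (rule integral_mono)
    show "integrable (PiM W ?M) ?F" using ui(1) ps(1) by simp
    show "?F \<omega> \<le> G" for \<omega> using b[of "{i\<in>L. \<omega> i}"] by (simp add: sub)
  qed simp
  moreover have "(\<integral>\<omega>. ?F \<omega> \<partial>PiM W ?M) = A + (\<Sum>i\<in>L. p i * u i)
     - N * (\<Sum>m<j. (\<integral>\<omega>. pos_sq ((\<Sum>i\<in>L. (if \<omega> i then al m i else 0)) - c m) \<partial>PiM W ?M))"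
    using ui ps(1) by (simp add: P.prob_space)
  moreover have "N * (\<Sum>m<j. (\<integral>\<omega>. pos_sq ((\<Sum>i\<in>L. (if \<omega> i then al m i else 0)) - c m) \<partial>PiM W ?M))
     \<le> N * (\<Sum>m<j. pos_sq ((\<Sum>i\<in>L. p i * al m i) - c m) + card L)"
    by (intro mult_left_mono sum_mono ps(2) N)
  ultimately show ?thesis by (simp add: P.prob_space)
qed

text \<open>Sites outside \<open>L\<close> are taken first; walkers meant to survive are sacrificed
  only when the others do not fill the batch.\<close>

lemma choose_batch:
  fixes V L :: "nat set"
  assumes V: "finite V" "L \<subseteq> V" and k: "k \<le> card V"
  obtains D where "D \<subseteq> V" "card D = k" "real (card (D \<inter> L)) \<le> max 0 (real (card L) - (real (card V) - real k))"
proof (cases "k \<le> card (V - L)")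
  case True
  then obtain D where "D \<subseteq> V - L" "card D = k" by (rule obtain_subset_with_card_n)
  then have "D \<subseteq> V" "card D = k" "D \<inter> L = {}" by auto
  then show ?thesis using that by (metis card.empty max.cobounded1 of_nat_0)
next
  case False
  have fL: "finite L" using V finite_subset by blast
  have cVL: "card (V - L) = card V - card L" "card L \<le> card V"
    using V fL by (auto simp: card_Diff_subset card_mono)
  obtain D where D: "V - L \<subseteq> D" "D \<subseteq> V" "card D = k"
    using exists_subset_between[of "V - L" k V] False k V by auto
  have fD: "finite D" using D V finite_subset by blast
  have "D \<inter> L = D - (V - L)" using D V by auto
  then have "card (D \<inter> L) = k - card (V - L)" using D V fD by (simp add: card_Diff_subset)
  then have "real (card (D \<inter> L)) \<le> max 0 (real (card L) - (real (card V) - real k))"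
    using False cVL by (auto simp: of_nat_diff)
  then show ?thesis using that D by blast
qed

text \<open>Young's inequality. With \<open>s = sqrt n\<close> it converts a loss \<open>B\<close>
  per sacrificed walker into a squared excess divided by \<open>sqrt n\<close>, which is the form of
  the penalties, at the price of a term of order \<open>sqrt n\<close>.\<close>

lemma batch_loss:
  fixes x B :: real
  assumes "s > 0" shows "B * max 0 x \<le> pos_sq x / s + B\<^sup>2 * s"
proof -
  have "0 \<le> (max 0 x / sqrt s - B * sqrt s / 2)\<^sup>2" by simp
  also have "\<dots> = pos_sq x / s - B * max 0 x + B\<^sup>2 * s / 4"
    using assms by (simp add: power2_diff pos_sq_def power_divide power_mult_distrib)
  finally have "B * max 0 x \<le> pos_sq x / s + B\<^sup>2 * s / 4" by simp
  moreover have "B\<^sup>2 * s / 4 \<le> B\<^sup>2 * s" using assms by (simp add: mult_nonneg_nonneg)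
  ultimately show ?thesis by linarith
qed

text \<open>Induction on the number \<open>j\<close> of remaining rounds; \<open>L\<close> consists
  of the walkers that have survived so far, and the other sites of \<open>V\<close> are free to be
  fixed. A round costs at most \<open>C * sqrt n\<close>, negligible against an energy of order
  \<open>n\<close>. In \<open>C\<close>, the square \<open>(K * mean_abs \<sigma>)\<^sup>2\<close>
  pays for sacrificed walkers, and \<open>2 * K\<close> for averaging the penalties twice, over the
  coin flips and over the Gaussian step.\<close>

theorem greedy_bound:
  fixes S :: "nat \<Rightarrow> real \<Rightarrow> real" and n k r j K :: nat
  assumes S: "\<And>r x. 0 \<le> S r x \<and> S r x \<le> 1" and Sm: "\<And>r. S r \<in> borel_measurable borel"
    and n: "0 < k" "(r + j) * k < n" and j: "j \<le> K"
    and V: "finite V" "card V = n - r * k" "L \<subseteq> V"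
  defines "\<tau> \<equiv> 1 / sqrt n" and "\<sigma> \<equiv> sqrt (k / n)"
  defines "C \<equiv> (K * mean_abs \<sigma>)\<^sup>2 + 2 * K"
  shows "(\<Sum>i\<in>V. \<bar>h i\<bar>) + (\<Sum>i\<in>L. walk_gain \<sigma> S j r (h i))
    - 1 / sqrt n * (\<Sum>m<j. pos_sq ((\<Sum>i\<in>L. walk_alive \<sigma> S m r (h i)) - (real n - real ((r + m + 1) * k))))
    - j * (C * sqrt n) \<le> mean_max \<tau> V h"
  using n j V
proof (induction j arbitrary: r V L h)
  case 0
  then show ?case using mean_max_ge_abs[of V \<tau> h] by (auto simp: \<tau>_def)
next
  case (Suc j)
  have n0: "n > 0" using Suc.prems by auto
  then have sn: "sqrt n > 0" by simp
  have jn: "real j * real n / sqrt n = real j * sqrt n"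
    by (metis of_nat_0_le_iff real_div_sqrt times_divide_eq_right)
  have \<tau>: "\<tau> > 0" using n0 by (simp add: \<tau>_def)
  have rk: "(Suc r + j) * k < n" "Suc r * k < n"
    using Suc.prems(2) by (auto simp: algebra_simps intro: le_less_trans[rotated])
  have kV: "k < card V" using Suc.prems(5) rk by simp
  have fL: "finite L" using Suc.prems finite_subset by blast
  obtain D where D: "D \<subseteq> V" "card D = k" "real (card (D \<inter> L)) \<le> max 0 (real (card L) - (real (card V) - real k))"
    using choose_batch[of V L k] Suc.prems kV by (metis less_imp_le)
  have fD: "finite D" using D Suc.prems finite_subset by blast
  have D0: "D \<noteq> {}" using D Suc.prems by auto
  define W where "W = V - D"
  define L' where "L' = L - D"
  have W: "finite W" "card W = n - Suc r * k" "L' \<subseteq> W"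
    using Suc.prems D fD by (auto simp: W_def L'_def card_Diff_subset)
  have fL': "finite L'" using fL by (simp add: L'_def)
  have W0: "W \<noteq> {}" using W rk by auto
  have cL': "real (card L') \<le> n" using W card_mono[OF W(1) W(3)] by simp
  have \<sigma>: "\<tau> * sqrt (card D) = \<sigma>" by (simp add: \<tau>_def \<sigma>_def D real_sqrt_divide)
  define Q where "Q = scaled_normal \<sigma>"
  have Q: "prob_space Q" "sets Q = sets borel" "integrable Q (\<lambda>x. x)"
    by (auto simp: Q_def prob_space_scaled_normal scaled_normal_integrable)
  let ?P = "PiM W (\<lambda>_. Q)"
  interpret P: prob_space ?P by (intro prob_space_PiM Q)
  have mQ: "borel_measurable Q = (borel_measurable borel :: (real \<Rightarrow> real) set)"
    by (rule measurable_cong_sets[OF Q(2) refl])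
  have mP: "measurable ?P Q = borel_measurable ?P" by (rule measurable_cong_sets[OF refl Q(2)])
  have batch: "(\<Sum>i\<in>D. \<bar>h i\<bar>) + (\<integral>g. mean_max \<tau> W (\<lambda>i. h i + g i) \<partial>?P) \<le> mean_max \<tau> V h"
    using mean_max_batch[of V D \<tau> h] Suc.prems D D0 W0 \<tau> unfolding \<sigma> Q_def W_def by simp
  let ?al = "\<lambda>m x. walk_alive \<sigma> S m (Suc r) x"
  let ?u = "\<lambda>x. walk_gain \<sigma> S j (Suc r) x"
  let ?c = "\<lambda>m. real n - real ((Suc r + m + 1) * k)"
  let ?S = "S (Suc r)"
  note al = walk_alive_props[of S \<sigma>, OF S Sm]
  note ga = walk_gain_props[of S \<sigma>, OF S Sm]
  \<comment> \<open>For fixed increments \<open>g\<close>, the induction hypothesis is averaged over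
    the coin flips that decide which walkers of \<open>L'\<close> survive.\<close>
  have A: "(\<Sum>i\<in>W. \<bar>h i + g i\<bar>) + (\<Sum>i\<in>L'. ?S (h i + g i) * ?u (h i + g i))
      - 1 / sqrt n * (\<Sum>m<j. pos_sq ((\<Sum>i\<in>L'. ?S (h i + g i) * ?al m (h i + g i)) - ?c m))
      - j * sqrt n - j * (C * sqrt n) \<le> mean_max \<tau> W (\<lambda>i. h i + g i)" for g
  proof -
    have "((\<Sum>i\<in>W. \<bar>h i + g i\<bar>) - j * (C * sqrt n)) + (\<Sum>i\<in>L'. ?S (h i + g i) * ?u (h i + g i))
      - 1 / sqrt n * (\<Sum>m<j. pos_sq ((\<Sum>i\<in>L'. ?S (h i + g i) * ?al m (h i + g i)) - ?c m) + card L') \<le> mean_max \<tau> W (\<lambda>i. h i + g i)"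
    proof (rule mean_max_average_survivors[OF W(1,3)])
      fix L'' assume L'': "L'' \<subseteq> L'"
      have "L'' \<subseteq> W" using L'' W by auto
      from Suc.IH[OF Suc.prems(1) rk(1) _ W(1,2) this, of "\<lambda>i. h i + g i"] Suc.prems(3)
      show "((\<Sum>i\<in>W. \<bar>h i + g i\<bar>) - j * (C * sqrt n)) + (\<Sum>i\<in>L''. ?u (h i + g i))
        - 1 / sqrt n * (\<Sum>m<j. pos_sq ((\<Sum>i\<in>L''. ?al m (h i + g i)) - ?c m)) \<le> mean_max \<tau> W (\<lambda>i. h i + g i)"
        by (simp add: algebra_simps)
    qed (use S al sn in auto)
    moreover have "1 / sqrt n * (\<Sum>m<j. pos_sq ((\<Sum>i\<in>L'. ?S (h i + g i) * ?al m (h i + g i)) - ?c m) + card L')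
      \<le> 1 / sqrt n * (\<Sum>m<j. pos_sq ((\<Sum>i\<in>L'. ?S (h i + g i) * ?al m (h i + g i)) - ?c m) + n)"
      using cL' sn by (intro mult_left_mono sum_mono) auto
    moreover have "1 / sqrt n * (\<Sum>m<j. pos_sq ((\<Sum>i\<in>L'. ?S (h i + g i) * ?al m (h i + g i)) - ?c m) + n)
      = 1 / sqrt n * (\<Sum>m<j. pos_sq ((\<Sum>i\<in>L'. ?S (h i + g i) * ?al m (h i + g i)) - ?c m)) + j * sqrt n"
      using jn by (simp add: sum.distrib distrib_left)
    ultimately show ?thesis by linarith
  qed
  have Pc: "integrable ?P (\<lambda>g. f (g i))" "(\<integral>g. f (g i) \<partial>?P) = (\<integral>y. f y \<partial>Q)"
    if "i \<in> W" "f \<in> borel_measurable borel" "integrable Q f" for i and f :: "real \<Rightarrow> real"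
    using PiM_component_integral(1)[of W "\<lambda>_. Q" i f, OF Q(1) that(1)]
      PiM_component_integral(2)[of W "\<lambda>_. Q" i f, OF Q(1) that(1)] that(2,3) unfolding mQ by blast+
  have ia: "integrable ?P (\<lambda>g. \<bar>h i + g i\<bar>)" "(\<integral>g. \<bar>h i + g i\<bar> \<partial>?P) = \<bar>h i\<bar> + walk_drift \<sigma> (h i)" if "i \<in> W" for i
    using Pc[OF that, of "\<lambda>y. \<bar>h i + y\<bar>"] scaled_normal_abs_integrable[of \<sigma> "h i"] by (auto simp: Q_def walk_drift_def)
  have mSu: "(\<lambda>x. ?S x * ?u x) \<in> borel_measurable borel" using Sm ga by (intro borel_measurable_times) auto
  have mSa: "(\<lambda>x. ?S x * ?al m x) \<in> borel_measurable borel" for m using Sm al by (intro borel_measurable_times) auto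
  have bSu: "0 \<le> ?S x * ?u x \<and> ?S x * ?u x \<le> j * mean_abs \<sigma>" for x
    using S[of "Suc r" x] ga[of j "Suc r"] mult_left_le_one_le[of "?u x" "?S x"] by (auto intro: order_trans)
  have bSa: "0 \<le> ?S x * ?al m x \<and> ?S x * ?al m x \<le> 1" for x m
    using S[of "Suc r" x] al[of m "Suc r"] by (auto intro: mult_le_one)
  have iu: "integrable ?P (\<lambda>g. ?S (h i + g i) * ?u (h i + g i))"
     "(\<integral>g. ?S (h i + g i) * ?u (h i + g i) \<partial>?P) = walk_gain \<sigma> S (Suc j) r (h i) - walk_drift \<sigma> (h i)" if "i \<in> W" for i
    using Pc[OF that, of "\<lambda>y. ?S (h i + y) * ?u (h i + y)"] scaled_normal_bounded_integral(1)[OF mSu bSu, of \<sigma> "h i"]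
      measurable_compose[OF _ mSu, of "\<lambda>y. h i + y" borel] by (auto simp: Q_def)
  have ip: "integrable ?P (\<lambda>g. pos_sq ((\<Sum>i\<in>L'. ?S (h i + g i) * ?al m (h i + g i)) - ?c m))"
     "(\<integral>g. pos_sq ((\<Sum>i\<in>L'. ?S (h i + g i) * ?al m (h i + g i)) - ?c m) \<partial>?P)
       \<le> pos_sq ((\<Sum>i\<in>L'. walk_alive \<sigma> S (Suc m) r (h i)) - ?c m) + n" for m
  proof -
    have fm: "(\<lambda>y. ?S (h i + y) * ?al m (h i + y)) \<in> borel_measurable Q" for i
      using measurable_compose[OF _ mSa, of "\<lambda>y. h i + y" borel] unfolding mQ by simp
    note * = PiM_pos_sq_sum[of "\<lambda>_. Q" W L' "\<lambda>i y. ?S (h i + y) * ?al m (h i + y)" "?c m", OF Q(1) W(1,3)]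
    have b1: "\<bar>?S (h i + y) * ?al m (h i + y)\<bar> \<le> 1" for i y using bSa[of "h i + y" m] by simp
    show "integrable ?P (\<lambda>g. pos_sq ((\<Sum>i\<in>L'. ?S (h i + g i) * ?al m (h i + g i)) - ?c m))"
      by (rule *(1)) (use fm b1 in auto)
    have "(\<integral>g. pos_sq ((\<Sum>i\<in>L'. ?S (h i + g i) * ?al m (h i + g i)) - ?c m) \<partial>?P)
       \<le> pos_sq ((\<Sum>i\<in>L'. (\<integral>y. ?S (h i + y) * ?al m (h i + y) \<partial>Q)) - ?c m) + card L'"
      by (rule *(2)) (use fm b1 in auto)
    then show "(\<integral>g. pos_sq ((\<Sum>i\<in>L'. ?S (h i + g i) * ?al m (h i + g i)) - ?c m) \<partial>?P)
       \<le> pos_sq ((\<Sum>i\<in>L'. walk_alive \<sigma> S (Suc m) r (h i)) - ?c m) + n"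
      using cL' by (simp add: Q_def)
  qed
  let ?F = "\<lambda>g. (\<Sum>i\<in>W. \<bar>h i + g i\<bar>) + (\<Sum>i\<in>L'. ?S (h i + g i) * ?u (h i + g i))
      - 1 / sqrt n * (\<Sum>m<j. pos_sq ((\<Sum>i\<in>L'. ?S (h i + g i) * ?al m (h i + g i)) - ?c m))
      - (j * sqrt n + j * (C * sqrt n))"
  have L'W: "i \<in> W" if "i \<in> L'" for i using that W by auto
  have intF: "integrable ?P ?F"
    using ia(1) iu(1)[OF L'W] ip(1) by simp
  have "(\<integral>g. ?F g \<partial>?P) \<le> (\<integral>g. mean_max \<tau> W (\<lambda>i. h i + g i) \<partial>?P)"
  proof (rule integral_mono[OF intF])
    show "integrable ?P (\<lambda>g. mean_max \<tau> W (\<lambda>i. h i + g i))"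
    proof (rule PiM_integrable_linear_growth[OF W(1) Q(1,3,2)])
      show "(\<lambda>g. mean_max \<tau> W (\<lambda>i. h i + g i)) \<in> borel_measurable ?P"
      proof (rule mean_max_measurable[OF W(1)])
        fix i assume "i \<in> W"
        then have "(\<lambda>g. g i) \<in> measurable ?P Q" by (rule measurable_component_singleton)
        then have "(\<lambda>g. g i) \<in> borel_measurable ?P" unfolding mP .
        then show "(\<lambda>g. h i + g i) \<in> borel_measurable ?P" by simp
      qed
      show "\<bar>mean_max \<tau> W (\<lambda>i. h i + g i)\<bar> \<le> \<bar>mean_max \<tau> W h\<bar> + (\<Sum>i\<in>W. 1 * \<bar>g i\<bar>)" for g
        using mean_max_lipschitz[OF W(1), of \<tau> "\<lambda>i. h i + g i" h] by simp
    qed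
    show "?F g \<le> mean_max \<tau> W (\<lambda>i. h i + g i)" for g using A[of g] by linarith
  qed
  moreover have "(\<integral>g. ?F g \<partial>?P) = (\<Sum>i\<in>W. \<bar>h i\<bar> + walk_drift \<sigma> (h i))
      + (\<Sum>i\<in>L'. walk_gain \<sigma> S (Suc j) r (h i) - walk_drift \<sigma> (h i))
      - 1 / sqrt n * (\<Sum>m<j. (\<integral>g. pos_sq ((\<Sum>i\<in>L'. ?S (h i + g i) * ?al m (h i + g i)) - ?c m) \<partial>?P))
      - (j * sqrt n + j * (C * sqrt n))"
    using ia iu[OF L'W] ip(1) by (simp add: P.prob_space)
  moreover have "1 / sqrt n * (\<Sum>m<j. (\<integral>g. pos_sq ((\<Sum>i\<in>L'. ?S (h i + g i) * ?al m (h i + g i)) - ?c m) \<partial>?P))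
     \<le> 1 / sqrt n * (\<Sum>m<j. pos_sq ((\<Sum>i\<in>L. walk_alive \<sigma> S (Suc m) r (h i)) - ?c m) + n)"
  proof (intro mult_left_mono sum_mono order_trans[OF ip(2)] add_mono pos_sq_mono diff_right_mono order_refl sum_mono2 fL)
    show "L' \<subseteq> L" by (auto simp: L'_def)
    show "0 \<le> walk_alive \<sigma> S (Suc m) r (h i)" for i m using al[of "Suc m" r] by blast
  qed (use sn in auto)
  moreover have "1 / sqrt n * (\<Sum>m<j. pos_sq ((\<Sum>i\<in>L. walk_alive \<sigma> S (Suc m) r (h i)) - ?c m) + n)
     = 1 / sqrt n * (\<Sum>m<j. pos_sq ((\<Sum>i\<in>L. walk_alive \<sigma> S (Suc m) r (h i)) - ?c m)) + j * sqrt n"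
    using jn by (simp add: sum.distrib distrib_left)
  \<comment> \<open>The absolute fields of the sites outside \<open>L'\<close> increase in mean as
    well; this nonnegative part is dropped.\<close>
  moreover have "(\<Sum>i\<in>L'. walk_drift \<sigma> (h i)) \<le> (\<Sum>i\<in>W. walk_drift \<sigma> (h i))"
    using W walk_drift_bounds by (intro sum_mono2) auto
  moreover have "(\<Sum>i\<in>V. \<bar>h i\<bar>) = (\<Sum>i\<in>D. \<bar>h i\<bar>) + (\<Sum>i\<in>W. \<bar>h i\<bar>)"
    using D Suc.prems by (simp add: W_def sum.subset_diff)
  \<comment> \<open>Walkers in \<open>D \<inter> L\<close> are fixed ahead of their time and forfeit
    their future gain, at most \<open>K * mean_abs \<sigma>\<close> each.\<close>
  moreover have "(\<Sum>i\<in>L. walk_gain \<sigma> S (Suc j) r (h i)) - (\<Sum>i\<in>L'. walk_gain \<sigma> S (Suc j) r (h i))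
     \<le> pos_sq (real (card L) - (real n - real ((r + 1) * k))) / sqrt n + (K * mean_abs \<sigma>)\<^sup>2 * sqrt n"
  proof -
    have "(\<Sum>i\<in>L. walk_gain \<sigma> S (Suc j) r (h i)) = (\<Sum>i\<in>L'. walk_gain \<sigma> S (Suc j) r (h i)) + (\<Sum>i\<in>D \<inter> L. walk_gain \<sigma> S (Suc j) r (h i))"
      unfolding L'_def using fL by (subst sum.Int_Diff[OF fL, of _ D]) (simp add: Int_commute)
    moreover have mp: "0 \<le> mean_abs \<sigma>" by (intro integral_nonneg_AE) auto
    have "(\<Sum>i\<in>D \<inter> L. walk_gain \<sigma> S (Suc j) r (h i)) \<le> (\<Sum>i\<in>D \<inter> L. K * mean_abs \<sigma>)"
    proof (rule sum_mono)
      fix i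
      have "walk_gain \<sigma> S (Suc j) r (h i) \<le> Suc j * mean_abs \<sigma>" using ga[of "Suc j" r] by blast
      also have "\<dots> \<le> K * mean_abs \<sigma>" using mp Suc.prems(3) by (intro mult_right_mono) auto
      finally show "walk_gain \<sigma> S (Suc j) r (h i) \<le> K * mean_abs \<sigma>" .
    qed
    moreover have "(\<Sum>i\<in>D \<inter> L. K * mean_abs \<sigma>) \<le> K * mean_abs \<sigma> * max 0 (real (card L) - (real (card V) - real k))"
    proof -
      have "0 \<le> K * mean_abs \<sigma>" using mp Suc.prems(3) by (intro mult_nonneg_nonneg) auto
      from mult_left_mono[OF D(3) this] show ?thesis by (simp add: mult_ac)
    qed
    moreover have "real (card V) - real k = real n - real ((r + 1) * k)"
      using Suc.prems(5) rk by (simp add: of_nat_diff algebra_simps)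
    ultimately show ?thesis using batch_loss[OF sn, of "K * mean_abs \<sigma>" "real (card L) - (real n - real ((r + 1) * k))"]
      by simp
  qed
  \<comment> \<open>The penalty for \<open>m = 0\<close> is the one produced by
    \<open>batch_loss\<close>; the others are the penalties of the next round, shifted by
    one.\<close>
  moreover have "(\<Sum>m<Suc j. pos_sq ((\<Sum>i\<in>L. walk_alive \<sigma> S m r (h i)) - (real n - real ((r + m + 1) * k))))
     = pos_sq (real (card L) - (real n - real ((r + 1) * k))) + (\<Sum>m<j. pos_sq ((\<Sum>i\<in>L. walk_alive \<sigma> S (Suc m) r (h i)) - ?c m))"
    by (subst sum.lessThan_Suc_shift) (simp add: algebra_simps)
  then have "1 / sqrt n * (\<Sum>m<Suc j. pos_sq ((\<Sum>i\<in>L. walk_alive \<sigma> S m r (h i)) - (real n - real ((r + m + 1) * k))))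
     = pos_sq (real (card L) - (real n - real ((r + 1) * k))) / sqrt n
      + 1 / sqrt n * (\<Sum>m<j. pos_sq ((\<Sum>i\<in>L. walk_alive \<sigma> S (Suc m) r (h i)) - ?c m))"
    by (simp only: distrib_left) simp
  moreover have "2 * (j * sqrt n) + (K * mean_abs \<sigma>)\<^sup>2 * sqrt n \<le> C * sqrt n"
    using Suc.prems(3) sn by (simp add: C_def ring_distribs)
  moreover have "Suc j * (C * sqrt n) = C * sqrt n + j * (C * sqrt n)" by (simp add: algebra_simps)
  moreover have "(\<Sum>i\<in>W. \<bar>h i\<bar> + walk_drift \<sigma> (h i)) = (\<Sum>i\<in>W. \<bar>h i\<bar>) + (\<Sum>i\<in>W. walk_drift \<sigma> (h i))"
    by (rule sum.distrib)
  moreover have "(\<Sum>i\<in>L'. walk_gain \<sigma> S (Suc j) r (h i) - walk_drift \<sigma> (h i))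
     = (\<Sum>i\<in>L'. walk_gain \<sigma> S (Suc j) r (h i)) - (\<Sum>i\<in>L'. walk_drift \<sigma> (h i))"
    by (rule sum_subtractf)
  ultimately show ?case using batch by linarith
qed

section \<open>Gaussian steps acting on densities\<close>

definition heat :: "real \<Rightarrow> (real \<Rightarrow> real) \<Rightarrow> real \<Rightarrow> real" where
  "heat \<sigma> \<rho> x = (\<integral>y. \<rho> (x - y) \<partial>scaled_normal \<sigma>)"

lemma heat_measurable:
  assumes "\<rho> \<in> borel_measurable borel"
  shows "heat \<sigma> \<rho> \<in> borel_measurable borel"
proof -
  interpret prob_space "scaled_normal \<sigma>" by (rule prob_space_scaled_normal)
  have "(\<lambda>p. fst p - snd p) \<in> borel_measurable ((borel :: real measure) \<Otimes>\<^sub>M scaled_normal \<sigma>)"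
    by measurable
  then have "(\<lambda>(x, y). \<rho> (x - y)) \<in> borel_measurable (borel \<Otimes>\<^sub>M scaled_normal \<sigma>)"
    unfolding split_beta by (rule measurable_compose[OF _ assms])
  then show ?thesis unfolding heat_def by (rule borel_measurable_lebesgue_integral)
qed

lemma heat_bounds:
  assumes [measurable]: "\<rho> \<in> borel_measurable borel" and b: "\<And>x. 0 \<le> \<rho> x \<and> \<rho> x \<le> B"
  shows "integrable (scaled_normal \<sigma>) (\<lambda>y. \<rho> (x - y))" "0 \<le> heat \<sigma> \<rho> x" "heat \<sigma> \<rho> x \<le> B"
proof -
  interpret prob_space "scaled_normal \<sigma>" by (rule prob_space_scaled_normal)
  show i: "integrable (scaled_normal \<sigma>) (\<lambda>y. \<rho> (x - y))"
    using b by (intro integrable_const_bound[where B=B] AE_I2) simp_all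
  show "0 \<le> heat \<sigma> \<rho> x"
    unfolding heat_def using b by (intro integral_nonneg_AE) auto
  have "heat \<sigma> \<rho> x \<le> (\<integral>y. B \<partial>scaled_normal \<sigma>)"
    unfolding heat_def using b by (intro integral_mono i) auto
  then show "heat \<sigma> \<rho> x \<le> B" by simp
qed

text \<open>Exchange of integrals and a translation: convolving the density is adjoint to taking the
  expectation of a test function after one step. This turns the backward recursions
  \<open>walk_alive\<close> and \<open>walk_gain\<close> into a forward evolution of
  densities.\<close>

lemma heat_duality:
  fixes \<rho> k :: "real \<Rightarrow> real"
  assumes \<rho>: "\<rho> \<in> borel_measurable borel" "integrable lborel \<rho>" "\<And>x. 0 \<le> \<rho> x \<and> \<rho> x \<le> M"
    and k: "k \<in> borel_measurable borel" "\<And>x. 0 \<le> k x \<and> k x \<le> B"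
  shows "integrable lborel (\<lambda>h. \<rho> h * (\<integral>y. k (h + y) \<partial>scaled_normal \<sigma>))"
    and "integrable lborel (\<lambda>x. heat \<sigma> \<rho> x * k x)"
    and "(\<integral>h. \<rho> h * (\<integral>y. k (h + y) \<partial>scaled_normal \<sigma>) \<partial>lborel) = (\<integral>x. heat \<sigma> \<rho> x * k x \<partial>lborel)"
proof -
  let ?Q = "scaled_normal \<sigma>"
  interpret Q: prob_space ?Q by (rule prob_space_scaled_normal)
  interpret PQ: pair_sigma_finite lborel ?Q by unfold_locales
  note kb = scaled_normal_bounded_integral[OF k, of \<sigma>]
  note hb = heat_bounds[OF \<rho>(1,3), of \<sigma>]
  let ?I = "\<lambda>h. \<integral>y. k (h + y) \<partial>?Q"
  have mI: "?I \<in> borel_measurable borel" by (rule scaled_normal_shift_measurable[OF k(1)])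
  show i1: "integrable lborel (\<lambda>h. \<rho> h * ?I h)"
  proof (rule Bochner_Integration.integrable_bound[where f="\<lambda>h. B * \<rho> h"])
    show "integrable lborel (\<lambda>h. B * \<rho> h)" using \<rho>(2) by simp
    show "(\<lambda>h. \<rho> h * ?I h) \<in> borel_measurable lborel" using mI \<rho>(1) by simp
    show "AE h in lborel. norm (\<rho> h * ?I h) \<le> norm (B * \<rho> h)"
    proof (rule AE_I2)
      fix h
      have "0 \<le> \<rho> h * ?I h" "\<rho> h * ?I h \<le> \<rho> h * B"
        using kb(2,3)[of h] \<rho>(3)[of h] by (auto intro!: mult_left_mono mult_nonneg_nonneg)
      then show "norm (\<rho> h * ?I h) \<le> norm (B * \<rho> h)" by (simp add: mult.commute)
    qed
  qed
  have m1: "(\<lambda>p. ennreal (\<rho> (fst p) * k (fst p + snd p))) \<in> borel_measurable (lborel \<Otimes>\<^sub>M ?Q)"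
  proof -
    have "(\<lambda>p. fst p + snd p) \<in> borel_measurable (lborel \<Otimes>\<^sub>M ?Q)" by measurable
    moreover have "fst \<in> borel_measurable (lborel \<Otimes>\<^sub>M ?Q)" by measurable
    ultimately show ?thesis
      by (intro measurable_compose[OF _ measurable_ennreal] borel_measurable_times measurable_compose[OF _ k(1)] measurable_compose[OF _ \<rho>(1)])
  qed
  have m2: "(\<lambda>p. ennreal (\<rho> (fst p - snd p) * k (fst p))) \<in> borel_measurable (lborel \<Otimes>\<^sub>M ?Q)"
  proof -
    have "(\<lambda>p. fst p - snd p) \<in> borel_measurable (lborel \<Otimes>\<^sub>M ?Q)" by measurable
    moreover have "fst \<in> borel_measurable (lborel \<Otimes>\<^sub>M ?Q)" by measurable
    ultimately show ?thesis
      by (intro measurable_compose[OF _ measurable_ennreal] borel_measurable_times measurable_compose[OF _ k(1)] measurable_compose[OF _ \<rho>(1)])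
  qed
  have "(\<integral>\<^sup>+h. ennreal (\<rho> h * ?I h) \<partial>lborel) = (\<integral>\<^sup>+h. (\<integral>\<^sup>+y. ennreal (\<rho> h * k (h + y)) \<partial>?Q) \<partial>lborel)"
  proof (rule nn_integral_cong)
    fix h
    have "(\<integral>\<^sup>+y. ennreal (\<rho> h * k (h + y)) \<partial>?Q) = ennreal (\<integral>y. \<rho> h * k (h + y) \<partial>?Q)"
      using kb(1) \<rho>(3) k(2) by (intro nn_integral_eq_integral) auto
    then show "ennreal (\<rho> h * ?I h) = (\<integral>\<^sup>+y. ennreal (\<rho> h * k (h + y)) \<partial>?Q)" by simp
  qed
  also have "\<dots> = (\<integral>\<^sup>+y. (\<integral>\<^sup>+h. ennreal (\<rho> h * k (h + y)) \<partial>lborel) \<partial>?Q)"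
    using PQ.Fubini[OF m1] by simp
  also have "\<dots> = (\<integral>\<^sup>+y. (\<integral>\<^sup>+x. ennreal (\<rho> (x - y) * k x) \<partial>lborel) \<partial>?Q)"
  proof (rule nn_integral_cong)
    fix y
    have "(\<lambda>x. ennreal (\<rho> (x - y) * k x)) \<in> borel_measurable borel"
      by (intro measurable_compose[OF _ measurable_ennreal] borel_measurable_times k(1) measurable_compose[OF _ \<rho>(1)]) simp
    from nn_integral_real_affine[OF this, of 1 y]
    show "(\<integral>\<^sup>+h. ennreal (\<rho> h * k (h + y)) \<partial>lborel) = (\<integral>\<^sup>+x. ennreal (\<rho> (x - y) * k x) \<partial>lborel)"
      by (simp add: add.commute)
  qed
  also have "\<dots> = (\<integral>\<^sup>+x. (\<integral>\<^sup>+y. ennreal (\<rho> (x - y) * k x) \<partial>?Q) \<partial>lborel)"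
    using PQ.Fubini[OF m2] by simp
  also have "\<dots> = (\<integral>\<^sup>+x. ennreal (heat \<sigma> \<rho> x * k x) \<partial>lborel)"
  proof (rule nn_integral_cong)
    fix x
    have "(\<integral>\<^sup>+y. ennreal (\<rho> (x - y) * k x) \<partial>?Q) = ennreal (\<integral>y. \<rho> (x - y) * k x \<partial>?Q)"
      using hb(1) \<rho>(3) k(2) by (intro nn_integral_eq_integral) auto
    then show "(\<integral>\<^sup>+y. ennreal (\<rho> (x - y) * k x) \<partial>?Q) = ennreal (heat \<sigma> \<rho> x * k x)" by (simp add: heat_def)
  qed
  finally have eq: "(\<integral>\<^sup>+h. ennreal (\<rho> h * ?I h) \<partial>lborel) = (\<integral>\<^sup>+x. ennreal (heat \<sigma> \<rho> x * k x) \<partial>lborel)" .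
  have n1: "0 \<le> \<rho> h * ?I h" and n2: "0 \<le> heat \<sigma> \<rho> h * k h" for h
    using \<rho>(3) kb(2) hb(2) k(2) by (auto intro!: mult_nonneg_nonneg)
  have fin: "(\<integral>\<^sup>+h. ennreal (\<rho> h * ?I h) \<partial>lborel) = ennreal (\<integral>h. \<rho> h * ?I h \<partial>lborel)"
    using n1 by (intro nn_integral_eq_integral i1) auto
  have mk: "(\<lambda>x. heat \<sigma> \<rho> x * k x) \<in> borel_measurable lborel"
    using heat_measurable[OF \<rho>(1)] k(1) by simp
  show i2: "integrable lborel (\<lambda>x. heat \<sigma> \<rho> x * k x)"
  proof (rule integrableI_nonneg[OF mk])
    show "AE x in lborel. 0 \<le> heat \<sigma> \<rho> x * k x" using n2 by (intro AE_I2)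
    show "(\<integral>\<^sup>+x. ennreal (heat \<sigma> \<rho> x * k x) \<partial>lborel) < \<infinity>" unfolding eq[symmetric] fin by simp
  qed
  have "(\<integral>\<^sup>+x. ennreal (heat \<sigma> \<rho> x * k x) \<partial>lborel) = ennreal (\<integral>x. heat \<sigma> \<rho> x * k x \<partial>lborel)"
    using n2 by (intro nn_integral_eq_integral i2) auto
  then have "ennreal (\<integral>h. \<rho> h * ?I h \<partial>lborel) = ennreal (\<integral>x. heat \<sigma> \<rho> x * k x \<partial>lborel)"
    using eq fin by simp
  moreover have "0 \<le> (\<integral>h. \<rho> h * ?I h \<partial>lborel)" "0 \<le> (\<integral>x. heat \<sigma> \<rho> x * k x \<partial>lborel)"
    using n1 n2 by (auto intro!: integral_nonneg_AE)
  ultimately show "(\<integral>h. \<rho> h * ?I h \<partial>lborel) = (\<integral>x. heat \<sigma> \<rho> x * k x \<partial>lborel)" by simp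
qed

text \<open>A sequence of sub-densities of surviving walkers: each is dominated by the previous one after a
  Gaussian step, the first one by the law of a single step started from the origin.\<close>

definition survival :: "real \<Rightarrow> (nat \<Rightarrow> real \<Rightarrow> real) \<Rightarrow> nat \<Rightarrow> nat \<Rightarrow> real \<Rightarrow> real" where
  "survival \<sigma> \<rho> K r x = (if r = 0 \<or> K \<le> r then 0
     else if r = 1 then \<rho> 1 x / ((1 - \<sigma>\<^sup>2) * normal_density 0 \<sigma> x)
     else \<rho> r x / heat \<sigma> (\<rho> (r - 1)) x)"

definition surviving_densities :: "real \<Rightarrow> (nat \<Rightarrow> real \<Rightarrow> real) \<Rightarrow> nat \<Rightarrow> real \<Rightarrow> bool" where
  "surviving_densities \<sigma> \<rho> K B \<longleftrightarrow> 0 < \<sigma> \<and> \<sigma> < 1 \<and>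
     (\<forall>r\<in>{1..<K}. \<rho> r \<in> borel_measurable borel \<and> integrable lborel (\<rho> r) \<and> (\<forall>x. 0 \<le> \<rho> r x \<and> \<rho> r x \<le> B)) \<and>
     (\<forall>x. \<rho> 1 x \<le> (1 - \<sigma>\<^sup>2) * normal_density 0 \<sigma> x) \<and>
     (\<forall>r. 1 \<le> r \<and> Suc r < K \<longrightarrow> (\<forall>x. \<rho> (Suc r) x \<le> heat \<sigma> (\<rho> r) x))"

lemma surviving_densitiesD:
  assumes "surviving_densities \<sigma> \<rho> K B"
  shows "0 < \<sigma>" "\<sigma> < 1" "0 < 1 - \<sigma>\<^sup>2"
    "\<And>r. 1 \<le> r \<Longrightarrow> r < K \<Longrightarrow> \<rho> r \<in> borel_measurable borel"
    "\<And>r. 1 \<le> r \<Longrightarrow> r < K \<Longrightarrow> integrable lborel (\<rho> r)"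
    "\<And>r x. 1 \<le> r \<Longrightarrow> r < K \<Longrightarrow> 0 \<le> \<rho> r x \<and> \<rho> r x \<le> B"
    "\<And>x. \<rho> 1 x \<le> (1 - \<sigma>\<^sup>2) * normal_density 0 \<sigma> x"
    "\<And>r x. 1 \<le> r \<Longrightarrow> Suc r < K \<Longrightarrow> \<rho> (Suc r) x \<le> heat \<sigma> (\<rho> r) x"
  using assms unfolding surviving_densities_def
  by (auto simp: abs_square_less_1)

lemma survival_props:
  assumes D: "surviving_densities \<sigma> \<rho> K B"
  shows "0 \<le> survival \<sigma> \<rho> K r x \<and> survival \<sigma> \<rho> K r x \<le> 1" "survival \<sigma> \<rho> K r \<in> borel_measurable borel"
proof -
  note d = surviving_densitiesD[OF D]
  have h0: "0 \<le> heat \<sigma> (\<rho> r) x" if "1 \<le> r" "r < K" for r x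
    using heat_bounds(2)[OF d(4)[OF that] d(6)[OF that]] .
  show "0 \<le> survival \<sigma> \<rho> K r x \<and> survival \<sigma> \<rho> K r x \<le> 1"
  proof (cases "r = 0 \<or> K \<le> r")
    case False
    show ?thesis
    proof (cases "r = 1")
      case True
      have "0 < (1 - \<sigma>\<^sup>2) * normal_density 0 \<sigma> x" using d(1,3) normal_density_pos by simp
      then show ?thesis using True False d(6)[of 1 x] d(7)[of x] by (simp add: survival_def)
    next
      case r: False
      then have r2: "1 \<le> r - 1" "r - 1 < K" "Suc (r - 1) < K" "Suc (r - 1) = r" using False by auto
      have "\<rho> r x \<le> heat \<sigma> (\<rho> (r - 1)) x" using d(8)[OF r2(1,3)] r2(4) by simp
      moreover have "0 \<le> \<rho> r x" using d(6)[of r x] False by simp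
      ultimately have "0 \<le> \<rho> r x / heat \<sigma> (\<rho> (r - 1)) x" "\<rho> r x / heat \<sigma> (\<rho> (r - 1)) x \<le> 1"
        using h0[OF r2(1,2), of x] by (auto simp: divide_le_eq_1)
      then show ?thesis using r False by (simp add: survival_def)
    qed
  qed (simp add: survival_def)
  show "survival \<sigma> \<rho> K r \<in> borel_measurable borel"
  proof (cases "r = 0 \<or> K \<le> r")
    case True
    then have "survival \<sigma> \<rho> K r = (\<lambda>_. 0)" by (auto simp: survival_def)
    then show ?thesis by simp
  next
    case False
    show ?thesis
    proof (cases "r = 1")
      case True
      then have e: "survival \<sigma> \<rho> K r = (\<lambda>x. \<rho> 1 x / ((1 - \<sigma>\<^sup>2) * normal_density 0 \<sigma> x))"
        using False by (auto simp: survival_def)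
      have "\<rho> 1 \<in> borel_measurable borel" using d(4)[of 1] True False by simp
      then show ?thesis unfolding e by simp
    next
      case r: False
      then have e: "survival \<sigma> \<rho> K r = (\<lambda>x. \<rho> r x / heat \<sigma> (\<rho> (r - 1)) x)"
        using False by (auto simp: survival_def)
      have "\<rho> r \<in> borel_measurable borel" "heat \<sigma> (\<rho> (r - 1)) \<in> borel_measurable borel"
        using d(4)[of r] d(4)[of "r - 1"] r False by (auto intro!: heat_measurable)
      then show ?thesis unfolding e by simp
    qed
  qed
qed

text \<open>\<open>survival\<close> is the next density divided by the evolved current one, so the
  quotient cancels under duality. Where the evolved density vanishes, the next one does too, in
  accordance with division by zero giving zero.\<close>

lemma survival_step:
  assumes D: "surviving_densities \<sigma> \<rho> K B" and r: "1 \<le> r" "Suc r < K"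
    and f: "f \<in> borel_measurable borel" "\<And>x. 0 \<le> f x \<and> f x \<le> M"
  shows "integrable lborel (\<lambda>h. \<rho> r h * (\<integral>y. survival \<sigma> \<rho> K (Suc r) (h + y) * f (h + y) \<partial>scaled_normal \<sigma>))"
    and "(\<integral>h. \<rho> r h * (\<integral>y. survival \<sigma> \<rho> K (Suc r) (h + y) * f (h + y) \<partial>scaled_normal \<sigma>) \<partial>lborel)
      = (\<integral>x. \<rho> (Suc r) x * f x \<partial>lborel)"
proof -
  note d = surviving_densitiesD[OF D]
  have rK: "r < K" using r by simp
  let ?k = "\<lambda>x. survival \<sigma> \<rho> K (Suc r) x * f x"
  have km: "?k \<in> borel_measurable borel" using survival_props(2)[OF D, of "Suc r"] f(1) by simp
  have kb: "0 \<le> ?k x \<and> ?k x \<le> M" for x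
    using survival_props(1)[OF D, of "Suc r" x] f(2)[of x] mult_left_le_one_le[of "f x" "survival \<sigma> \<rho> K (Suc r) x"]
    by (auto intro: order_trans)
  note du = heat_duality[OF d(4)[OF r(1) rK] d(5)[OF r(1) rK] d(6)[OF r(1) rK] km kb, of \<sigma>]
  show "integrable lborel (\<lambda>h. \<rho> r h * (\<integral>y. ?k (h + y) \<partial>scaled_normal \<sigma>))" by (rule du(1))
  have e: "heat \<sigma> (\<rho> r) x * ?k x = \<rho> (Suc r) x * f x" for x
    using d(8)[OF r, of x] d(6)[of "Suc r" x] r heat_bounds(2)[OF d(4)[OF r(1) rK] d(6)[OF r(1) rK], of \<sigma> x]
    by (cases "heat \<sigma> (\<rho> r) x = 0") (auto simp: survival_def)
  show "(\<integral>h. \<rho> r h * (\<integral>y. ?k (h + y) \<partial>scaled_normal \<sigma>) \<partial>lborel) = (\<integral>x. \<rho> (Suc r) x * f x \<partial>lborel)"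
    using du(3) unfolding e .
qed

text \<open>All walkers start at the origin, so their law after one step is the normal density
  itself. The factor \<open>1 - \<sigma>\<^sup>2\<close> is the share of sites left after the batch
  that is fixed before any field exists.\<close>

lemma survival_first:
  assumes D: "surviving_densities \<sigma> \<rho> K B" and K: "1 < K"
    and f: "f \<in> borel_measurable borel"
  shows "(1 - \<sigma>\<^sup>2) * (\<integral>y. survival \<sigma> \<rho> K 1 y * f y \<partial>scaled_normal \<sigma>) = (\<integral>x. \<rho> 1 x * f x \<partial>lborel)"
proof -
  note d = surviving_densitiesD[OF D]
  have m: "(\<lambda>y. survival \<sigma> \<rho> K 1 y * f y) \<in> borel_measurable borel"
    using survival_props(2)[OF D, of 1] f by simp
  have "(\<integral>y. survival \<sigma> \<rho> K 1 y * f y \<partial>scaled_normal \<sigma>) = (\<integral>y. normal_density 0 \<sigma> y * (survival \<sigma> \<rho> K 1 y * f y) \<partial>lborel)"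
    using d(1) m by (simp add: scaled_normal_density integral_density)
  also have "(1 - \<sigma>\<^sup>2) * \<dots> = (\<integral>y. (1 - \<sigma>\<^sup>2) * (normal_density 0 \<sigma> y * (survival \<sigma> \<rho> K 1 y * f y)) \<partial>lborel)"
    by simp
  also have "\<dots> = (\<integral>x. \<rho> 1 x * f x \<partial>lborel)"
  proof (rule Bochner_Integration.integral_cong[OF refl])
    fix y
    have "0 < normal_density 0 \<sigma> y" using d(1) by (rule normal_density_pos)
    then show "(1 - \<sigma>\<^sup>2) * (normal_density 0 \<sigma> y * (survival \<sigma> \<rho> K 1 y * f y)) = \<rho> 1 y * f y"
      using d(3) K by (simp add: survival_def)
  qed
  finally show ?thesis .
qed

lemma density_alive:
  assumes D: "surviving_densities \<sigma> \<rho> K B"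
  shows "1 \<le> r \<Longrightarrow> r + m < K \<Longrightarrow> (\<integral>h. \<rho> r h * walk_alive \<sigma> (survival \<sigma> \<rho> K) m r h \<partial>lborel) = (\<integral>x. \<rho> (r + m) x \<partial>lborel)"
proof (induction m arbitrary: r)
  case (Suc m)
  note al = walk_alive_props[of "survival \<sigma> \<rho> K" \<sigma> m "Suc r", OF survival_props[OF D]]
  have "(\<integral>h. \<rho> r h * walk_alive \<sigma> (survival \<sigma> \<rho> K) (Suc m) r h \<partial>lborel)
     = (\<integral>x. \<rho> (Suc r) x * walk_alive \<sigma> (survival \<sigma> \<rho> K) m (Suc r) x \<partial>lborel)"
    using survival_step(2)[OF D Suc.prems(1), of "walk_alive \<sigma> (survival \<sigma> \<rho> K) m (Suc r)" 1] al Suc.prems by simp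
  then show ?case using Suc.IH[of "Suc r"] Suc.prems by simp
qed simp

lemma density_drift_integrable:
  assumes D: "surviving_densities \<sigma> \<rho> K B" and "1 \<le> r" "r < K"
  shows "integrable lborel (\<lambda>h. \<rho> r h * walk_drift \<sigma> h)"
proof (rule Bochner_Integration.integrable_bound[where f="\<lambda>h. mean_abs \<sigma> * \<rho> r h"])
  note d = surviving_densitiesD[OF D]
  show "integrable lborel (\<lambda>h. mean_abs \<sigma> * \<rho> r h)" using d(5) assms by simp
  show "(\<lambda>h. \<rho> r h * walk_drift \<sigma> h) \<in> borel_measurable lborel" using d(4) assms by simp
  show "AE h in lborel. norm (\<rho> r h * walk_drift \<sigma> h) \<le> norm (mean_abs \<sigma> * \<rho> r h)"
  proof (rule AE_I2)
    fix h
    have "walk_drift \<sigma> h * \<rho> r h \<le> mean_abs \<sigma> * \<rho> r h" "0 \<le> walk_drift \<sigma> h * \<rho> r h" "0 \<le> mean_abs \<sigma> * \<rho> r h"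
      using walk_drift_bounds[of \<sigma> h] d(6)[OF assms(2,3), of h] by (auto intro!: mult_right_mono mult_nonneg_nonneg)
    then show "norm (\<rho> r h * walk_drift \<sigma> h) \<le> norm (mean_abs \<sigma> * \<rho> r h)" by (simp add: mult.commute)
  qed
qed

text \<open>Iterated duality: each drift is integrated against the density of the round in which it
  occurs.\<close>

lemma density_gain:
  assumes D: "surviving_densities \<sigma> \<rho> K B"
  shows "1 \<le> r \<Longrightarrow> r + j \<le> K \<Longrightarrow> (\<integral>h. \<rho> r h * walk_gain \<sigma> (survival \<sigma> \<rho> K) j r h \<partial>lborel)
      = (\<Sum>i<j. (\<integral>x. \<rho> (r + i) x * walk_drift \<sigma> x \<partial>lborel))"
proof (induction j arbitrary: r)
  case (Suc j)
  note ga = walk_gain_props[of "survival \<sigma> \<rho> K" \<sigma> j "Suc r", OF survival_props[OF D]]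
  have rK: "r < K" using Suc.prems by simp
  note di = density_drift_integrable[OF D Suc.prems(1) rK]
  let ?J = "\<lambda>h. \<integral>y. survival \<sigma> \<rho> K (Suc r) (h + y) * walk_gain \<sigma> (survival \<sigma> \<rho> K) j (Suc r) (h + y) \<partial>scaled_normal \<sigma>"
  have J: "integrable lborel (\<lambda>h. \<rho> r h * ?J h) \<and> (\<integral>h. \<rho> r h * ?J h \<partial>lborel) = (\<Sum>i<j. (\<integral>x. \<rho> (Suc r + i) x * walk_drift \<sigma> x \<partial>lborel))"
  proof (cases "j = 0")
    case False
    then have "Suc r < K" using Suc.prems by simp
    note s = survival_step[OF D Suc.prems(1) this, of "walk_gain \<sigma> (survival \<sigma> \<rho> K) j (Suc r)" "j * mean_abs \<sigma>"]
    show ?thesis using s ga Suc.IH[of "Suc r"] Suc.prems by auto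
  qed simp
  have "(\<integral>h. \<rho> r h * walk_gain \<sigma> (survival \<sigma> \<rho> K) (Suc j) r h \<partial>lborel)
     = (\<integral>h. \<rho> r h * walk_drift \<sigma> h + \<rho> r h * ?J h \<partial>lborel)" by (simp add: distrib_left)
  also have "\<dots> = (\<integral>h. \<rho> r h * walk_drift \<sigma> h \<partial>lborel) + (\<integral>h. \<rho> r h * ?J h \<partial>lborel)"
    using di J by (intro Bochner_Integration.integral_add) auto
  finally show ?case using J by (subst sum.lessThan_Suc_shift) simp
qed simp

text \<open>The mass condition says that in every round the expected survivors fit into the sites
  left after the batch of that round. Then all penalties vanish at the start and only errors of
  order \<open>sqrt n\<close> remain.\<close>

theorem greedy_density_bound:
  fixes n k K :: nat
  assumes D: "surviving_densities \<sigma> \<rho> K B" and K: "1 < K"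
    and n: "0 < k" "K * k < n" and \<sigma>: "\<sigma> = sqrt (k / n)"
    and mass: "\<And>r. 1 \<le> r \<Longrightarrow> r < K \<Longrightarrow> (\<integral>x. \<rho> r x \<partial>lborel) \<le> 1 - (r + 1) * \<sigma>\<^sup>2"
  shows "n * ((1 - \<sigma>\<^sup>2) * mean_abs \<sigma> + (\<Sum>r=1..<K. (\<integral>x. \<rho> r x * walk_drift \<sigma> x \<partial>lborel)))
     - K * (((K * mean_abs \<sigma>)\<^sup>2 + 2 * K) * sqrt n) \<le> mean_max (1 / sqrt n) {..<n} (\<lambda>_. 0)"
proof -
  note d = surviving_densitiesD[OF D]
  let ?S = "survival \<sigma> \<rho> K"
  have n0: "n > 0" using n by simp
  have s2: "\<sigma>\<^sup>2 = k / n" using \<sigma> by simp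
  have kn: "k < n" using n K by (metis less_trans mult_less_cancel2 nat_mult_1)
  have nk: "real n - real k = n * (1 - \<sigma>\<^sup>2)" using n0 by (simp add: s2 field_simps)
  define L where "L = {k..<n}"
  have cL: "card L = n - k" "L \<subseteq> {..<n}" by (auto simp: L_def)
  have alive: "real (n - k) * walk_alive \<sigma> ?S m 0 0 \<le> real n - real ((0 + m + 1) * k)" if "m < K" for m
  proof (cases m)
    case 0
    then show ?thesis using kn by (simp add: of_nat_diff)
  next
    case (Suc m')
    have "(1 - \<sigma>\<^sup>2) * walk_alive \<sigma> ?S m 0 0 = (\<integral>x. \<rho> 1 x * walk_alive \<sigma> ?S m' 1 x \<partial>lborel)"
      using survival_first[OF D K, of "walk_alive \<sigma> ?S m' 1"] walk_alive_props[of ?S \<sigma> m' 1, OF survival_props[OF D]] Suc by simp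
    also have "\<dots> = (\<integral>x. \<rho> m x \<partial>lborel)" using density_alive[OF D, of 1 m'] that Suc by simp
    also have "\<dots> \<le> 1 - (m + 1) * \<sigma>\<^sup>2" using mass[of m] that Suc by simp
    finally have "n * ((1 - \<sigma>\<^sup>2) * walk_alive \<sigma> ?S m 0 0) \<le> n * (1 - (m + 1) * \<sigma>\<^sup>2)" by (intro mult_left_mono) auto
    moreover have "n * (1 - (m + 1) * \<sigma>\<^sup>2) = real n - real ((0 + m + 1) * k)"
      using n0 by (simp add: s2 field_simps)
    moreover have "real (n - k) * walk_alive \<sigma> ?S m 0 0 = n * ((1 - \<sigma>\<^sup>2) * walk_alive \<sigma> ?S m 0 0)"
      using nk kn by (simp add: of_nat_diff mult.assoc)
    ultimately show ?thesis by linarith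
  qed
  have "pos_sq ((\<Sum>i\<in>L. walk_alive \<sigma> ?S m 0 0) - (real n - real ((0 + m + 1) * k))) = 0" if "m < K" for m
    using alive[OF that] cL by (simp add: pos_sq_def)
  then have z: "(\<Sum>m<K. pos_sq ((\<Sum>i\<in>L. walk_alive \<sigma> ?S m 0 0) - (real n - real ((0 + m + 1) * k)))) = 0"
    by (intro sum.neutral) auto
  have drift0: "walk_drift \<sigma> 0 = mean_abs \<sigma>" by (simp add: walk_drift_def)
  obtain j where j: "K = Suc j" using K by (cases K) auto
  have "(1 - \<sigma>\<^sup>2) * walk_gain \<sigma> ?S K 0 0 = (1 - \<sigma>\<^sup>2) * mean_abs \<sigma> + (\<integral>x. \<rho> 1 x * walk_gain \<sigma> ?S j 1 x \<partial>lborel)"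
    using survival_first[OF D K, of "walk_gain \<sigma> ?S j 1"] walk_gain_props[of ?S \<sigma> j 1, OF survival_props[OF D]] j
    by (simp add: drift0 distrib_left)
  also have "(\<integral>x. \<rho> 1 x * walk_gain \<sigma> ?S j 1 x \<partial>lborel) = (\<Sum>i<j. (\<integral>x. \<rho> (1 + i) x * walk_drift \<sigma> x \<partial>lborel))"
    using density_gain[OF D, of 1 j] j by simp
  also have "\<dots> = (\<Sum>r=1..<K. (\<integral>x. \<rho> r x * walk_drift \<sigma> x \<partial>lborel))"
    by (rule sum.reindex_bij_witness[of _ "\<lambda>r. r - 1" "\<lambda>i. 1 + i"]) (auto simp: j)
  finally have gain: "(1 - \<sigma>\<^sup>2) * walk_gain \<sigma> ?S K 0 0
    = (1 - \<sigma>\<^sup>2) * mean_abs \<sigma> + (\<Sum>r=1..<K. (\<integral>x. \<rho> r x * walk_drift \<sigma> x \<partial>lborel))" .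
  have "(\<Sum>i\<in>L. walk_gain \<sigma> ?S K 0 0) = n * ((1 - \<sigma>\<^sup>2) * walk_gain \<sigma> ?S K 0 0)"
    using cL nk kn by (simp add: of_nat_diff mult.assoc)
  moreover have "(\<Sum>i\<in>{..<n}. \<bar>0\<bar>) + (\<Sum>i\<in>L. walk_gain \<sigma> ?S K 0 0)
    - 1 / sqrt n * (\<Sum>m<K. pos_sq ((\<Sum>i\<in>L. walk_alive \<sigma> ?S m 0 0) - (real n - real ((0 + m + 1) * k))))
    - K * (((K * mean_abs \<sigma>)\<^sup>2 + real (2 * K)) * sqrt n) \<le> mean_max (1 / sqrt n) {..<n} (\<lambda>_. 0)"
    unfolding \<sigma>
    by (rule greedy_bound[where r=0 and h="\<lambda>_. 0"]) (use survival_props[OF D] n cL \<sigma> in auto)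
  ultimately show ?thesis unfolding z gain by simp
qed

section \<open>Truncated Gaussian profiles\<close>

text \<open>The truncation at \<open>1 / sqrt \<theta>\<close> imitates the removal of the walkers
  with the largest fields, while a Gaussian times a quadratic polynomial is mapped by a Gaussian
  step to a function of the same kind. The exponent \<open>\<alpha>\<close> may be negative, as
  happens in the late rounds.\<close>

definition prof :: "real \<Rightarrow> real \<Rightarrow> real \<Rightarrow> real \<Rightarrow> real" where
  "prof A \<alpha> \<theta> x = A * (exp (- \<alpha> * x\<^sup>2) * max 0 (1 - \<theta> * x\<^sup>2))"

lemma prof_measurable[measurable]: "prof A \<alpha> \<theta> \<in> borel_measurable borel"
  unfolding prof_def by measurable

lemma prof_nonneg: "0 \<le> A \<Longrightarrow> 0 \<le> prof A \<alpha> \<theta> x"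
  unfolding prof_def by simp

lemma prof_bound:
  assumes "0 < \<theta>" "0 \<le> A"
  shows "prof A \<alpha> \<theta> x \<le> A * exp (\<bar>\<alpha>\<bar> / \<theta>)"
proof (cases "1 - \<theta> * x\<^sup>2 \<ge> 0")
  case True
  then have x: "x\<^sup>2 \<le> 1 / \<theta>" using assms by (simp add: field_simps)
  have "- \<alpha> * x\<^sup>2 \<le> \<bar>\<alpha>\<bar> * x\<^sup>2" by (intro mult_right_mono) auto
  also have "\<dots> \<le> \<bar>\<alpha>\<bar> * (1 / \<theta>)" by (intro mult_left_mono x) auto
  finally have "exp (- \<alpha> * x\<^sup>2) \<le> exp (\<bar>\<alpha>\<bar> / \<theta>)" by simp
  moreover have "max 0 (1 - \<theta> * x\<^sup>2) \<le> 1" using assms by auto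
  ultimately have "exp (- \<alpha> * x\<^sup>2) * max 0 (1 - \<theta> * x\<^sup>2) \<le> exp (\<bar>\<alpha>\<bar> / \<theta>) * 1"
    by (intro mult_mono) auto
  then show ?thesis unfolding prof_def using assms by (intro mult_left_mono) auto
next
  case False
  then show ?thesis using assms unfolding prof_def by simp
qed

lemma prof_eq_0:
  assumes "0 < \<theta>" "1 / sqrt \<theta> < \<bar>x\<bar>" shows "prof A \<alpha> \<theta> x = 0"
proof -
  have "(1 / sqrt \<theta>)\<^sup>2 < \<bar>x\<bar>\<^sup>2" using assms by (intro power_strict_mono) auto
  then have "1 < \<theta> * x\<^sup>2" using assms by (simp add: power_divide field_simps)
  then show ?thesis by (simp add: prof_def)
qed

lemma prof_integrable:
  assumes "0 < \<theta>" "0 \<le> A" shows "integrable lborel (prof A \<alpha> \<theta>)"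
proof (rule Bochner_Integration.integrable_bound[where f="\<lambda>x. indicator {-1 / sqrt \<theta>..1 / sqrt \<theta>} x * (A * exp (\<bar>\<alpha>\<bar> / \<theta>))"])
  show "integrable lborel (\<lambda>x. indicator {-1 / sqrt \<theta>..1 / sqrt \<theta>} x * (A * exp (\<bar>\<alpha>\<bar> / \<theta>)))"
    by (intro integrable_mult_left) (simp add: emeasure_lborel_Icc_eq)
  show "AE x in lborel. norm (prof A \<alpha> \<theta> x) \<le> norm (indicator {-1 / sqrt \<theta>..1 / sqrt \<theta>} x * (A * exp (\<bar>\<alpha>\<bar> / \<theta>)))"
  proof (rule AE_I2)
    fix x
    have "prof A \<alpha> \<theta> x = 0" if "x \<notin> {-1 / sqrt \<theta>..1 / sqrt \<theta>}"
      by (rule prof_eq_0) (use that assms in auto)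
    then show "norm (prof A \<alpha> \<theta> x) \<le> norm (indicator {-1 / sqrt \<theta>..1 / sqrt \<theta>} x * (A * exp (\<bar>\<alpha>\<bar> / \<theta>)))"
      using prof_bound[OF assms, of \<alpha> x] prof_nonneg[OF assms(2), of \<alpha> \<theta> x] assms by (auto simp: indicator_def)
  qed
qed measurable

text \<open>Completing the square: the weight multiplies the precision of the step by
  \<open>D\<close> and moves its mean from 0 to \<open>x - x / D\<close>.\<close>

lemma normal_density_tilt:
  fixes \<alpha> \<sigma> x y :: real
  assumes \<sigma>: "0 < \<sigma>" and D: "0 < 1 + 2 * \<alpha> * \<sigma>\<^sup>2"
  defines "D \<equiv> 1 + 2 * \<alpha> * \<sigma>\<^sup>2"
  shows "normal_density 0 \<sigma> y * exp (- \<alpha> * (x - y)\<^sup>2)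
    = exp (- \<alpha> / D * x\<^sup>2) / sqrt D * normal_density (x - x / D) (\<sigma> / sqrt D) y"
proof -
  have Dp: "D > 0" using D by (simp add: D_def)
  have "- (y - 0)\<^sup>2 / (2 * \<sigma>\<^sup>2) + - \<alpha> * (x - y)\<^sup>2 = - \<alpha> / D * x\<^sup>2 + - (y - (x - x / D))\<^sup>2 / (2 * (\<sigma> / sqrt D)\<^sup>2)"
  proof -
    have s: "(\<sigma> / sqrt D)\<^sup>2 = \<sigma>\<^sup>2 / D" using Dp by (simp add: power_divide)
    have a: "\<alpha> = (D - 1) / (2 * \<sigma>\<^sup>2)" using \<sigma> by (simp add: D_def)
    show ?thesis unfolding s a using \<sigma> Dp
      by (simp add: field_simps power2_eq_square)
  qed
  then have e: "exp (- (y - 0)\<^sup>2 / (2 * \<sigma>\<^sup>2)) * exp (- \<alpha> * (x - y)\<^sup>2)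
     = exp (- \<alpha> / D * x\<^sup>2) * exp (- (y - (x - x / D))\<^sup>2 / (2 * (\<sigma> / sqrt D)\<^sup>2))"
    by (simp only: exp_add[symmetric])
  have c: "1 / sqrt (2 * pi * (\<sigma> / sqrt D)\<^sup>2) = sqrt D * (1 / sqrt (2 * pi * \<sigma>\<^sup>2))"
    using Dp \<sigma> by (simp add: power_divide real_sqrt_divide real_sqrt_mult)
  show ?thesis
    unfolding normal_density_def c using e Dp by (simp add: field_simps)
qed

text \<open>Replacing the positive part by the quadratic itself only lowers the profile, and the
  quadratic is averaged exactly: under the tilted step \<open>x - y\<close> has mean
  \<open>x / D\<close> and variance \<open>\<sigma>\<^sup>2 / D\<close>.\<close>

lemma heat_prof:
  assumes \<sigma>: "0 < \<sigma>" and D: "0 < 1 + 2 * \<alpha> * \<sigma>\<^sup>2" and A: "0 < \<theta>" "0 \<le> A"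
  defines "D \<equiv> 1 + 2 * \<alpha> * \<sigma>\<^sup>2"
  shows "A / sqrt D * (exp (- \<alpha> / D * x\<^sup>2) * (1 - \<theta> * \<sigma>\<^sup>2 / D - \<theta> / D\<^sup>2 * x\<^sup>2)) \<le> heat \<sigma> (prof A \<alpha> \<theta>) x"
proof -
  have Dp: "D > 0" using D by (simp add: D_def)
  define s where "s = \<sigma> / sqrt D"
  define \<mu> where "\<mu> = x - x / D"
  define c where "c = x / D"
  have s: "s > 0" "s\<^sup>2 = \<sigma>\<^sup>2 / D" using \<sigma> Dp by (auto simp: s_def power_divide)
  let ?c = "A * exp (- \<alpha> / D * x\<^sup>2) / sqrt D"
  let ?q = "\<lambda>y. 1 - \<theta> * c\<^sup>2 + (2 * \<theta> * c) * (y - \<mu>) - \<theta> * (y - \<mu>)\<^sup>2"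
  have q: "1 - \<theta> * (x - y)\<^sup>2 = ?q y" for y
  proof -
    have "1 - \<theta> * (a - b)\<^sup>2 = 1 - \<theta> * a\<^sup>2 + (2 * \<theta> * a) * b - \<theta> * b\<^sup>2" for a b :: real
      by (simp add: power2_eq_square algebra_simps)
    moreover have "x - y = c - (y - \<mu>)" by (simp add: \<mu>_def c_def)
    ultimately show ?thesis by metis
  qed
  have 0: "integrable lborel (normal_density \<mu> s)" "(\<integral>y. normal_density \<mu> s y \<partial>lborel) = 1"
    using s by (auto intro: integrable_normal_density integral_normal_density)
  have 1: "integrable lborel (\<lambda>y. normal_density \<mu> s y * (y - \<mu>))" "(\<integral>y. normal_density \<mu> s y * (y - \<mu>) \<partial>lborel) = 0"
    using integrable_normal_moment[OF s(1), of \<mu> 1] integral_normal_moment_odd[OF s(1), of \<mu> 0] by auto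
  have 2: "integrable lborel (\<lambda>y. normal_density \<mu> s y * (y - \<mu>)\<^sup>2)" "(\<integral>y. normal_density \<mu> s y * (y - \<mu>)\<^sup>2 \<partial>lborel) = s\<^sup>2"
    using integrable_normal_moment[OF s(1), of \<mu> 2] integral_normal_moment_even[OF s(1), of \<mu> 1] by auto
  have nq: "normal_density \<mu> s y * ?q y = (1 - \<theta> * c\<^sup>2) * normal_density \<mu> s y
      + (2 * \<theta> * c) * (normal_density \<mu> s y * (y - \<mu>)) - \<theta> * (normal_density \<mu> s y * (y - \<mu>)\<^sup>2)" for y
    by (simp add: algebra_simps)
  have iq: "integrable lborel (\<lambda>y. normal_density \<mu> s y * ?q y)"
    unfolding nq using 0 1 2 by simp
  have Iq: "(\<integral>y. normal_density \<mu> s y * ?q y \<partial>lborel) = 1 - \<theta> * c\<^sup>2 - \<theta> * s\<^sup>2"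
    unfolding nq using 0 1 2 by simp
  have t: "normal_density 0 \<sigma> y * (A * (exp (- \<alpha> * (x - y)\<^sup>2) * (1 - \<theta> * (x - y)\<^sup>2))) = ?c * (normal_density \<mu> s y * ?q y)" for y
  proof -
    have "normal_density 0 \<sigma> y * (A * (exp (- \<alpha> * (x - y)\<^sup>2) * (1 - \<theta> * (x - y)\<^sup>2)))
       = A * (1 - \<theta> * (x - y)\<^sup>2) * (normal_density 0 \<sigma> y * exp (- \<alpha> * (x - y)\<^sup>2))" by simp
    also have "normal_density 0 \<sigma> y * exp (- \<alpha> * (x - y)\<^sup>2) = exp (- \<alpha> / D * x\<^sup>2) / sqrt D * normal_density \<mu> s y"
      unfolding D_def \<mu>_def s_def by (rule normal_density_tilt[OF \<sigma> D])
    finally show ?thesis unfolding q by simp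
  qed
  have ie: "integrable lborel (\<lambda>y. normal_density 0 \<sigma> y * (A * (exp (- \<alpha> * (x - y)\<^sup>2) * (1 - \<theta> * (x - y)\<^sup>2))))"
    unfolding t using iq by (rule integrable_mult_right)
  have Ie: "(\<integral>y. normal_density 0 \<sigma> y * (A * (exp (- \<alpha> * (x - y)\<^sup>2) * (1 - \<theta> * (x - y)\<^sup>2))) \<partial>lborel) = ?c * (1 - \<theta> * c\<^sup>2 - \<theta> * s\<^sup>2)"
    unfolding t integral_mult_right_zero Iq ..
  have dens: "scaled_normal \<sigma> = density lborel (normal_density 0 \<sigma>)"
    using scaled_normal_density[of \<sigma>] \<sigma> by simp
  have int: "integrable (scaled_normal \<sigma>) (\<lambda>y. A * (exp (- \<alpha> * (x - y)\<^sup>2) * (1 - \<theta> * (x - y)\<^sup>2)))"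
    unfolding dens by (subst integrable_density) (use ie in simp_all)
  have "(\<integral>y. A * (exp (- \<alpha> * (x - y)\<^sup>2) * (1 - \<theta> * (x - y)\<^sup>2)) \<partial>scaled_normal \<sigma>) = ?c * (1 - \<theta> * c\<^sup>2 - \<theta> * s\<^sup>2)"
    unfolding dens by (subst integral_density) (use Ie in simp_all)
  moreover have "(\<integral>y. A * (exp (- \<alpha> * (x - y)\<^sup>2) * (1 - \<theta> * (x - y)\<^sup>2)) \<partial>scaled_normal \<sigma>) \<le> heat \<sigma> (prof A \<alpha> \<theta>) x"
    unfolding heat_def
  proof (rule integral_mono[OF int])
    show "integrable (scaled_normal \<sigma>) (\<lambda>y. prof A \<alpha> \<theta> (x - y))"
      using prof_nonneg[OF A(2)] prof_bound[OF A] by (intro heat_bounds(1)) auto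
    show "A * (exp (- \<alpha> * (x - y)\<^sup>2) * (1 - \<theta> * (x - y)\<^sup>2)) \<le> prof A \<alpha> \<theta> (x - y)" for y
      unfolding prof_def using A by (intro mult_left_mono) auto
  qed
  ultimately show ?thesis using s by (simp add: c_def power_divide algebra_simps)
qed

text \<open>In the variable \<open>x\<^sup>2\<close> the logarithm of a profile has slope
  \<open>- (\<alpha> + \<theta>)\<close> at 0. Raising \<open>\<theta>\<close> with this sum fixed
  keeps the profile to first order in \<open>x\<^sup>2\<close> and lowers it further out. So mass
  can be removed at large fields with almost no loss near the origin, where the drift is
  earned.\<close>

lemma prof_domination:
  assumes A: "0 \<le> A'" "A' \<le> A" and \<theta>: "0 \<le> \<theta>" "\<theta> \<le> \<theta>'" and s: "\<alpha> + \<theta> \<le> \<alpha>' + \<theta>'"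
  shows "prof A' \<alpha>' \<theta>' x \<le> A * (exp (- \<alpha> * x\<^sup>2) * max 0 (1 - \<theta> * x\<^sup>2))"
proof (cases "1 - \<theta>' * x\<^sup>2 > 0")
  case True
  define z where "z = x\<^sup>2"
  have z: "0 \<le> z" "1 - \<theta>' * z > 0" using True by (auto simp: z_def)
  have z2: "1 - \<theta> * z > 0" using z \<theta> mult_right_mono[OF \<theta>(2) z(1)] by simp
  have "exp ((\<theta>' - \<theta>) * z) * (1 - \<theta>' * z) \<le> 1 - \<theta> * z"
  proof -
    \<comment> \<open>Chosen so that
      \<open>1 - \<theta>' * z = (1 - w) * (1 - \<theta> * z)\<close>; then
      \<open>1 - w \<le> exp (- w)\<close> and \<open>w \<ge> (\<theta>' - \<theta>) * z\<close>
      give the claim.\<close>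
    define w where "w = (\<theta>' - \<theta>) * z / (1 - \<theta> * z)"
    have "(\<theta>' - \<theta>) * z \<le> w"
      unfolding w_def
    proof -
      have "0 \<le> (\<theta>' - \<theta>) * z" using \<theta> z by simp
      moreover have "0 \<le> \<theta> * z" using \<theta> z by simp
      ultimately have "(\<theta>' - \<theta>) * z * (1 - \<theta> * z) \<le> (\<theta>' - \<theta>) * z" by (intro mult_left_le) auto
      then show "(\<theta>' - \<theta>) * z \<le> (\<theta>' - \<theta>) * z / (1 - \<theta> * z)" using z2 by (simp only: pos_le_divide_eq)
    qed
    then have "exp ((\<theta>' - \<theta>) * z) \<le> exp w" by simp
    have "1 - w = (1 - \<theta>' * z) / (1 - \<theta> * z)" using z2 by (simp add: w_def field_simps)
    then have "1 - \<theta>' * z = (1 - w) * (1 - \<theta> * z)" using z2 by simp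
    moreover have "1 - w \<le> exp (- w)" using exp_ge_add_one_self[of "- w"] by simp
    ultimately have "1 - \<theta>' * z \<le> exp (- w) * (1 - \<theta> * z)" using z2 by (simp add: mult_right_mono)
    then have "exp ((\<theta>' - \<theta>) * z) * (1 - \<theta>' * z) \<le> exp w * (exp (- w) * (1 - \<theta> * z))"
      using \<open>exp ((\<theta>' - \<theta>) * z) \<le> exp w\<close> z by (intro mult_mono) auto
    also have "\<dots> = 1 - \<theta> * z" by (simp add: exp_minus)
    finally show ?thesis .
  qed
  moreover have "exp (- \<alpha>' * z) \<le> exp (- \<alpha> * z) * exp ((\<theta>' - \<theta>) * z)"
  proof -
    have "(\<alpha> + \<theta> - \<theta>') * z \<le> \<alpha>' * z" using s z by (intro mult_right_mono) auto
    then show ?thesis by (simp add: exp_add[symmetric] algebra_simps)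
  qed
  ultimately have "exp (- \<alpha>' * z) * (1 - \<theta>' * z) \<le> exp (- \<alpha> * z) * (1 - \<theta> * z)"
  proof -
    have "exp (- \<alpha>' * z) * (1 - \<theta>' * z) \<le> exp (- \<alpha> * z) * exp ((\<theta>' - \<theta>) * z) * (1 - \<theta>' * z)"
      using z \<open>exp (- \<alpha>' * z) \<le> exp (- \<alpha> * z) * exp ((\<theta>' - \<theta>) * z)\<close> by (intro mult_right_mono) auto
    also have "\<dots> = exp (- \<alpha> * z) * (exp ((\<theta>' - \<theta>) * z) * (1 - \<theta>' * z))" by simp
    also have "\<dots> \<le> exp (- \<alpha> * z) * (1 - \<theta> * z)"
      using \<open>exp ((\<theta>' - \<theta>) * z) * (1 - \<theta>' * z) \<le> 1 - \<theta> * z\<close> by (intro mult_left_mono) auto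
    finally show ?thesis .
  qed
  then have "A' * (exp (- \<alpha>' * z) * (1 - \<theta>' * z)) \<le> A * (exp (- \<alpha> * z) * (1 - \<theta> * z))"
    using A z by (intro mult_mono[OF A(2)]) auto
  then show ?thesis using z z2 by (simp add: prof_def z_def)
next
  case False
  then show ?thesis using A by (simp add: prof_def)
qed

text \<open>By \<open>heat_prof\<close> the evolved profile dominates the one with height
  \<open>A / sqrt D * (E / D)\<close> and parameters \<open>\<alpha> / D\<close> and
  \<open>\<theta> / (D * E)\<close>. The hypotheses are the conditions of
  \<open>prof_domination\<close> against it, cleared of denominators and of the square root, ready
  for integer checks.\<close>

lemma prof_step:
  assumes \<sigma>: "0 < \<sigma>" and \<theta>: "0 < \<theta>" and A: "0 \<le> A" "0 \<le> A'"
    and D: "0 < D" "D = 1 + 2 * \<alpha> * \<sigma>\<^sup>2" and E: "0 < E" "E = D - \<theta> * \<sigma>\<^sup>2"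
    and c1: "A'\<^sup>2 * D ^ 3 \<le> A\<^sup>2 * E\<^sup>2" and c2: "\<theta> \<le> \<theta>' * D * E" and c3: "\<alpha> * E + \<theta> \<le> (\<alpha>' + \<theta>') * D * E"
  shows "prof A' \<alpha>' \<theta>' x \<le> heat \<sigma> (prof A \<alpha> \<theta>) x"
proof -
  let ?A = "A / sqrt D * (E / D)" and ?\<alpha> = "\<alpha> / D" and ?\<theta> = "\<theta> / (D * E)"
  have "A' * (sqrt D * D) \<le> A * E"
  proof (rule power2_le_imp_le)
    have "(A' * (sqrt D * D))\<^sup>2 = A'\<^sup>2 * D ^ 3" using D(1) by (simp add: power_mult_distrib power2_eq_square power3_eq_cube)
    also have "\<dots> \<le> A\<^sup>2 * E\<^sup>2" by (rule c1)
    finally show "(A' * (sqrt D * D))\<^sup>2 \<le> (A * E)\<^sup>2" by (simp add: power_mult_distrib)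
  qed (use A E in simp)
  then have 1: "A' \<le> ?A" using D(1) by (simp add: field_simps)
  have 2: "?\<theta> \<le> \<theta>'" using c2 D(1) E(1) by (simp add: field_simps)
  have "?\<alpha> + ?\<theta> = (\<alpha> * E + \<theta>) / (D * E)" using D(1) E(1) by (simp add: field_simps)
  also have "\<dots> \<le> \<alpha>' + \<theta>'" using c3 D(1) E(1) by (simp add: pos_divide_le_eq mult_ac)
  finally have 3: "?\<alpha> + ?\<theta> \<le> \<alpha>' + \<theta>'" .
  have "prof A' \<alpha>' \<theta>' x \<le> ?A * (exp (- ?\<alpha> * x\<^sup>2) * max 0 (1 - ?\<theta> * x\<^sup>2))"
    using prof_domination[OF A(2) 1 _ 2 3] \<theta> D(1) E(1) by simp
  also have "\<dots> \<le> heat \<sigma> (prof A \<alpha> \<theta>) x"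
  proof (cases "1 - ?\<theta> * x\<^sup>2 \<ge> 0")
    case True
    have "?A * (exp (- ?\<alpha> * x\<^sup>2) * max 0 (1 - ?\<theta> * x\<^sup>2)) = A / sqrt D * (exp (- \<alpha> / D * x\<^sup>2) * (E / D * (1 - ?\<theta> * x\<^sup>2)))"
      using True by simp
    also have "E / D * (1 - ?\<theta> * x\<^sup>2) = 1 - \<theta> * \<sigma>\<^sup>2 / D - \<theta> / D\<^sup>2 * x\<^sup>2"
    proof -
      have "E / D * (1 - ?\<theta> * x\<^sup>2) = E / D - \<theta> / D\<^sup>2 * x\<^sup>2" using D(1) E(1) by (simp add: field_simps power2_eq_square)
      moreover have "E / D = 1 - \<theta> * \<sigma>\<^sup>2 / D" using D(1) unfolding E(2) by (simp add: field_simps)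
      ultimately show ?thesis by simp
    qed
    finally show ?thesis using heat_prof[OF \<sigma> _ \<theta> A(1), of \<alpha> x] D by simp
  next
    case False
    have "0 \<le> heat \<sigma> (prof A \<alpha> \<theta>) x"
      using prof_nonneg[OF A(1)] prof_bound[OF \<theta> A(1)] by (intro heat_bounds(2)) auto
    then show ?thesis using False by simp
  qed
  finally show ?thesis .
qed


text \<open>The normal density is an untruncated profile, with \<open>\<theta> = 0\<close> and
  \<open>\<alpha> = 1 / (2 * \<sigma>\<^sup>2)\<close>.\<close>

lemma prof_first:
  assumes \<sigma>: "0 < \<sigma>" and A: "0 \<le> A" "A * sqrt (2 * pi * \<sigma>\<^sup>2) \<le> 1 - \<sigma>\<^sup>2" and \<theta>: "0 \<le> \<theta>" "1 / (2 * \<sigma>\<^sup>2) \<le> \<alpha> + \<theta>"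
  shows "prof A \<alpha> \<theta> x \<le> (1 - \<sigma>\<^sup>2) * normal_density 0 \<sigma> x"
proof -
  have "A \<le> (1 - \<sigma>\<^sup>2) / sqrt (2 * pi * \<sigma>\<^sup>2)" using A(2) \<sigma> by (simp add: pos_le_divide_eq)
  from prof_domination[OF A(1) this, of 0 \<theta> "1 / (2 * \<sigma>\<^sup>2)" \<alpha> x] \<theta>
  show ?thesis by (simp add: normal_density_def)
qed

section \<open>Integrals against the drift\<close>

lemma scaled_normal_sym:
  fixes f :: "real \<Rightarrow> real"
  assumes "f \<in> borel_measurable borel"
  shows "(\<integral>y. f (- y) \<partial>scaled_normal \<sigma>) = (\<integral>y. f y \<partial>scaled_normal \<sigma>)"
proof -
  have "scaled_normal (- \<sigma>) = scaled_normal \<sigma>"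
    using scaled_normal_abs[of \<sigma>] scaled_normal_abs[of "- \<sigma>"] by simp
  moreover have "scaled_normal (- \<sigma>) = distr (scaled_normal \<sigma>) borel uminus"
    unfolding scaled_normal_def by (subst distr_distr) (auto simp: comp_def intro!: distr_cong)
  ultimately have "(\<integral>y. f y \<partial>scaled_normal \<sigma>) = (\<integral>y. f y \<partial>distr (scaled_normal \<sigma>) borel uminus)" by simp
  also have "\<dots> = (\<integral>y. f (- y) \<partial>scaled_normal \<sigma>)"
    using assms by (intro integral_distr) auto
  finally show ?thesis ..
qed

text \<open>Averaging over \<open>y\<close> and \<open>- y\<close>: the sum
  \<open>\<bar>h + y\<bar> + \<bar>h - y\<bar>\<close> is twice the larger of
  \<open>\<bar>h\<bar>\<close> and \<open>\<bar>y\<bar>\<close>. As a function of \<open>h\<close>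
  the drift thus becomes a mixture of tents.\<close>

lemma walk_drift_eq: "walk_drift \<sigma> h = (\<integral>y. max 0 (\<bar>y\<bar> - \<bar>h\<bar>) \<partial>scaled_normal \<sigma>)"
proof -
  interpret prob_space "scaled_normal \<sigma>" by (rule prob_space_scaled_normal)
  have i: "integrable (scaled_normal \<sigma>) (\<lambda>y. \<bar>h + y\<bar>)" "integrable (scaled_normal \<sigma>) (\<lambda>y. \<bar>h - y\<bar>)"
    using scaled_normal_integrable[of \<sigma>] by simp_all
  have "(\<integral>y. \<bar>h - y\<bar> \<partial>scaled_normal \<sigma>) = (\<integral>y. \<bar>h + y\<bar> \<partial>scaled_normal \<sigma>)"
    using scaled_normal_sym[of "\<lambda>y. \<bar>h + y\<bar>" \<sigma>] by simp
  then have "walk_drift \<sigma> h = ((\<integral>y. \<bar>h + y\<bar> \<partial>scaled_normal \<sigma>) + (\<integral>y. \<bar>h - y\<bar> \<partial>scaled_normal \<sigma>)) / 2 - \<bar>h\<bar>"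
    by (simp add: walk_drift_def)
  also have "\<dots> = (\<integral>y. (\<bar>h + y\<bar> + \<bar>h - y\<bar>) / 2 - \<bar>h\<bar> \<partial>scaled_normal \<sigma>)"
    using i by simp
  also have "\<dots> = (\<integral>y. max 0 (\<bar>y\<bar> - \<bar>h\<bar>) \<partial>scaled_normal \<sigma>)"
    by (intro Bochner_Integration.integral_cong refl) (auto simp: abs_if max_def field_simps)
  finally show ?thesis .
qed

lemma tent_moment:
  assumes a: "0 \<le> (a::real)"
  shows "(\<integral>\<^sup>+h. ennreal (h ^ (2 * k) * max 0 (a - \<bar>h\<bar>)) \<partial>lborel) = ennreal (2 * a ^ (2 * k + 2) / ((2 * k + 1) * (2 * k + 2)))"
proof -
  let ?f = "\<lambda>h. h ^ (2 * k) * (a - h)"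
  let ?F = "\<lambda>h. a * h ^ (2 * k + 1) / (2 * k + 1) - h ^ (2 * k + 2) / (2 * k + 2)"
  let ?v = "a ^ (2 * k + 2) / ((2 * k + 1) * (2 * k + 2))"
  let ?g = "\<lambda>h. ?f h * indicator {0..a} h"
  have D: "(?F has_real_derivative ?f h) (at h)" for h
  proof -
    have "(?F has_real_derivative (a * ((2 * k + 1) * h ^ (2 * k)) / (2 * k + 1) - (2 * k + 2) * h ^ (2 * k + 1) / (2 * k + 2))) (at h)"
      by (rule derivative_eq_intros refl | simp)+
    also have "(a * ((2 * k + 1) * h ^ (2 * k)) / (2 * k + 1) - (2 * k + 2) * h ^ (2 * k + 1) / (2 * k + 2)) = ?f h"
      by (simp add: field_simps del: of_nat_Suc of_nat_add)
    finally show ?thesis .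
  qed
  have "has_bochner_integral lborel ?g (?F a - ?F 0)"
    by (rule has_bochner_integral_FTC_Icc_nonneg) (use D a in auto)
  also have "?F a - ?F 0 = ?v"
  proof -
    have "x * (1 / (r + 1) - 1 / (r + 2)) = x / ((r + 1) * (r + 2))" if "r \<ge> 0" for x r :: real
      using that by (simp add: field_simps)
    from this[of "real (2 * k)" "a ^ (2 * k + 2)"] show ?thesis by (simp add: algebra_simps diff_divide_distrib)
  qed
  finally have g: "has_bochner_integral lborel ?g ?v" .
  have g': "has_bochner_integral lborel (\<lambda>h. ?g (- h)) ?v"
    using lborel_has_bochner_integral_real_affine_iff[of "-1" ?g ?v 0] g by simp
  have s: "has_bochner_integral lborel (\<lambda>h. ?g h + ?g (- h)) (?v + ?v)"
    by (rule has_bochner_integral_add[OF g g'])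
  have "(\<integral>\<^sup>+h. ennreal (h ^ (2 * k) * max 0 (a - \<bar>h\<bar>)) \<partial>lborel) = (\<integral>\<^sup>+h. ennreal (?g h + ?g (- h)) \<partial>lborel)"
  proof (rule nn_integral_cong_AE)
    \<comment> \<open>The two halves overlap at 0, where their sum counts twice.\<close>
    have "AE h in lborel. h \<noteq> (0::real)" by (rule AE_lborel_singleton)
    then show "AE h in lborel. ennreal (h ^ (2 * k) * max 0 (a - \<bar>h\<bar>)) = ennreal (?g h + ?g (- h))"
    proof eventually_elim
      case (elim h)
      then show ?case by (cases "h > 0") (auto simp: indicator_def max_def)
    qed
  qed
  also have "\<dots> = ennreal (?v + ?v)"
    using s by (subst nn_integral_eq_integral)
      (auto simp: has_bochner_integral_iff indicator_def intro!: AE_I2 add_nonneg_nonneg mult_nonneg_nonneg)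
  finally show ?thesis by simp
qed

lemma scaled_normal_moments:
  "integrable (scaled_normal \<sigma>) (\<lambda>y. y ^ k)"
  "(\<integral>y. y ^ 2 \<partial>scaled_normal \<sigma>) = \<sigma> ^ 2" "(\<integral>y. y ^ 4 \<partial>scaled_normal \<sigma>) = 3 * \<sigma> ^ 4"
  "mean_abs \<sigma> = \<bar>\<sigma>\<bar> * sqrt (2 / pi)"
proof -
  have "integrable std_normal (\<lambda>y. (\<sigma> * y) ^ k)"
    unfolding power_mult_distrib by (intro integrable_mult_right std_normal_moments(1))
  then show "integrable (scaled_normal \<sigma>) (\<lambda>y. y ^ k)"
    unfolding scaled_normal_def by (intro integrable_distr_eq[THEN iffD2]) simp_all
  have I: "(\<integral>y. f y \<partial>scaled_normal \<sigma>) = (\<integral>y. f (\<sigma> * y) \<partial>std_normal)" if "f \<in> borel_measurable borel" for f :: "real \<Rightarrow> real"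
    unfolding scaled_normal_def using that by (intro integral_distr) auto
  show "(\<integral>y. y ^ 2 \<partial>scaled_normal \<sigma>) = \<sigma> ^ 2" "(\<integral>y. y ^ 4 \<partial>scaled_normal \<sigma>) = 3 * \<sigma> ^ 4"
    by (simp_all add: I power_mult_distrib std_normal_moments)
  show "mean_abs \<sigma> = \<bar>\<sigma>\<bar> * sqrt (2 / pi)"
    by (simp add: I abs_mult std_normal_moments)
qed

text \<open>After the exchange of integrals the tents leave plain even moments of the step, so the
  moments of the drift are exact polynomials in \<open>\<sigma>\<close> and need no numerical
  approximation.\<close>

lemma drift_moment_nn:
  "(\<integral>\<^sup>+h. ennreal (h ^ (2 * k) * walk_drift \<sigma> h) \<partial>lborel)
    = ennreal (2 / real ((2 * k + 1) * (2 * k + 2)) * (\<integral>y. y ^ (2 * k + 2) \<partial>scaled_normal \<sigma>))"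
proof -
  let ?Q = "scaled_normal \<sigma>"
  interpret Q: prob_space ?Q by (rule prob_space_scaled_normal)
  interpret PQ: pair_sigma_finite lborel ?Q by unfold_locales
  have m: "(\<lambda>p. ennreal (fst p ^ (2 * k) * max 0 (\<bar>snd p\<bar> - \<bar>fst p\<bar>))) \<in> borel_measurable (lborel \<Otimes>\<^sub>M ?Q)"
    by measurable
  have i: "integrable ?Q (\<lambda>y. max 0 (\<bar>y\<bar> - \<bar>h\<bar>))" for h
    using scaled_normal_integrable[of \<sigma>] by (intro integrable_max) auto
  have "(\<integral>\<^sup>+h. ennreal (h ^ (2 * k) * walk_drift \<sigma> h) \<partial>lborel)
     = (\<integral>\<^sup>+h. (\<integral>\<^sup>+y. ennreal (h ^ (2 * k) * max 0 (\<bar>y\<bar> - \<bar>h\<bar>)) \<partial>?Q) \<partial>lborel)"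
  proof (rule nn_integral_cong)
    fix h
    have "(\<integral>\<^sup>+y. ennreal (h ^ (2 * k) * max 0 (\<bar>y\<bar> - \<bar>h\<bar>)) \<partial>?Q) = ennreal (\<integral>y. h ^ (2 * k) * max 0 (\<bar>y\<bar> - \<bar>h\<bar>) \<partial>?Q)"
      using i by (intro nn_integral_eq_integral) (auto intro!: AE_I2 mult_nonneg_nonneg)
    then show "ennreal (h ^ (2 * k) * walk_drift \<sigma> h) = (\<integral>\<^sup>+y. ennreal (h ^ (2 * k) * max 0 (\<bar>y\<bar> - \<bar>h\<bar>)) \<partial>?Q)"
      by (simp add: walk_drift_eq)
  qed
  also have "\<dots> = (\<integral>\<^sup>+y. (\<integral>\<^sup>+h. ennreal (h ^ (2 * k) * max 0 (\<bar>y\<bar> - \<bar>h\<bar>)) \<partial>lborel) \<partial>?Q)"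
    using PQ.Fubini[OF m] by simp
  also have "\<dots> = (\<integral>\<^sup>+y. ennreal (2 / ((2 * k + 1) * (2 * k + 2)) * y ^ (2 * k + 2)) \<partial>?Q)"
    unfolding tent_moment[OF abs_ge_zero]
    by (intro nn_integral_cong arg_cong[where f=ennreal]) (simp add: power_even_abs)
  also have "\<dots> = ennreal (\<integral>y. 2 / ((2 * k + 1) * (2 * k + 2)) * y ^ (2 * k + 2) \<partial>?Q)"
    by (intro nn_integral_eq_integral integrable_mult_right scaled_normal_moments(1) AE_I2)
      (rule mult_nonneg_nonneg[OF divide_nonneg_nonneg zero_le_even_power], simp_all)
  finally show ?thesis unfolding integral_mult_right_zero .
qed

lemma drift_integrals:
  "integrable lborel (walk_drift \<sigma>)" "(\<integral>h. walk_drift \<sigma> h \<partial>lborel) = \<sigma>\<^sup>2"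
  "integrable lborel (\<lambda>h. h\<^sup>2 * walk_drift \<sigma> h)" "(\<integral>h. h\<^sup>2 * walk_drift \<sigma> h \<partial>lborel) = \<sigma> ^ 4 / 2"
proof -
  have 0: "(\<integral>\<^sup>+h. ennreal (walk_drift \<sigma> h) \<partial>lborel) = ennreal (\<sigma>\<^sup>2)"
    using drift_moment_nn[of 0 \<sigma>] scaled_normal_moments(2)[of \<sigma>] by (simp add: power2_eq_square)
  have 1: "(\<integral>\<^sup>+h. ennreal (h\<^sup>2 * walk_drift \<sigma> h) \<partial>lborel) = ennreal (\<sigma> ^ 4 / 2)"
    using drift_moment_nn[of 1 \<sigma>] scaled_normal_moments(3)[of \<sigma>] by (simp add: numeral_eq_Suc)
  show i0: "integrable lborel (walk_drift \<sigma>)"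
    using 0 walk_drift_bounds(1)[of \<sigma>] by (intro integrableI_nonneg) auto
  show i1: "integrable lborel (\<lambda>h. h\<^sup>2 * walk_drift \<sigma> h)"
    using 1 walk_drift_bounds(1)[of \<sigma>] by (intro integrableI_nonneg) auto
  show "(\<integral>h. walk_drift \<sigma> h \<partial>lborel) = \<sigma>\<^sup>2"
    using 0 walk_drift_bounds(1)[of \<sigma>] by (subst integral_eq_nn_integral) auto
  show "(\<integral>h. h\<^sup>2 * walk_drift \<sigma> h \<partial>lborel) = \<sigma> ^ 4 / 2"
    using 1 walk_drift_bounds(1)[of \<sigma>] by (subst integral_eq_nn_integral) auto
qed

text \<open>The drift is concentrated within a few \<open>\<sigma>\<close> of the origin, where this
  parabola is close to the profile, and integrating it takes only the two moments of
  \<open>drift_integrals\<close>.\<close>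

lemma prof_ge_parabola:
  assumes "0 \<le> A" "0 \<le> \<theta>" shows "A * (1 - (\<theta> + max 0 \<alpha>) * x\<^sup>2) \<le> prof A \<alpha> \<theta> x"
proof -
  define z where "z = x\<^sup>2"
  have z: "0 \<le> z" by (simp add: z_def)
  have "1 - (\<theta> + max 0 \<alpha>) * z \<le> exp (- \<alpha> * z) * max 0 (1 - \<theta> * z)"
  proof (cases "1 - \<theta> * z \<ge> 0")
    case True
    show ?thesis
    proof (cases "\<alpha> \<ge> 0")
      case \<alpha>: True
      have "0 \<le> (\<alpha> * z) * (\<theta> * z)" using \<alpha> z assms by simp
      then have "1 - \<alpha> * z - \<theta> * z \<le> (1 - \<alpha> * z) * (1 - \<theta> * z)" by (simp add: algebra_simps)
      also have "\<dots> \<le> exp (- \<alpha> * z) * (1 - \<theta> * z)"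
        using True exp_ge_add_one_self[of "- \<alpha> * z"] by (intro mult_right_mono) auto
      finally show ?thesis using True \<alpha> by (simp add: algebra_simps)
    next
      case False
      then have "1 \<le> exp (- \<alpha> * z)" using z by (simp add: mult_nonpos_nonneg)
      then have "1 * (1 - \<theta> * z) \<le> exp (- \<alpha> * z) * (1 - \<theta> * z)" using True by (intro mult_right_mono) auto
      then show ?thesis using True False by simp
    qed
  next
    case False
    moreover have "0 \<le> max 0 \<alpha> * z" using z by simp
    ultimately show ?thesis by (simp add: algebra_simps)
  qed
  then show ?thesis using assms unfolding prof_def z_def by (intro mult_left_mono) auto
qed

lemma prof_drift:
  assumes A: "0 < \<theta>" "0 \<le> A"
  shows "A * (\<sigma>\<^sup>2 - (\<theta> + max 0 \<alpha>) * \<sigma> ^ 4 / 2) \<le> (\<integral>h. prof A \<alpha> \<theta> h * walk_drift \<sigma> h \<partial>lborel)"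
proof -
  let ?c = "\<theta> + max 0 \<alpha>"
  have i: "integrable lborel (\<lambda>h. A * (walk_drift \<sigma> h - ?c * (h\<^sup>2 * walk_drift \<sigma> h)))"
    using drift_integrals(1,3) by simp
  have "(\<integral>h. A * (walk_drift \<sigma> h - ?c * (h\<^sup>2 * walk_drift \<sigma> h)) \<partial>lborel) = A * (\<sigma>\<^sup>2 - ?c * (\<sigma> ^ 4 / 2))"
    using drift_integrals by simp
  moreover have "(\<integral>h. A * (walk_drift \<sigma> h - ?c * (h\<^sup>2 * walk_drift \<sigma> h)) \<partial>lborel) \<le> (\<integral>h. prof A \<alpha> \<theta> h * walk_drift \<sigma> h \<partial>lborel)"
  proof (rule integral_mono[OF i])
    show "integrable lborel (\<lambda>h. prof A \<alpha> \<theta> h * walk_drift \<sigma> h)"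
    proof (rule Bochner_Integration.integrable_bound[where f="\<lambda>h. A * exp (\<bar>\<alpha>\<bar> / \<theta>) * walk_drift \<sigma> h"])
      show "integrable lborel (\<lambda>h. A * exp (\<bar>\<alpha>\<bar> / \<theta>) * walk_drift \<sigma> h)" using drift_integrals(1) by simp
      show "AE h in lborel. norm (prof A \<alpha> \<theta> h * walk_drift \<sigma> h) \<le> norm (A * exp (\<bar>\<alpha>\<bar> / \<theta>) * walk_drift \<sigma> h)"
        using prof_bound[OF A, of \<alpha>] prof_nonneg[OF A(2), of \<alpha> \<theta>] walk_drift_bounds(1)[of \<sigma>] A
        by (intro AE_I2) (auto simp: abs_mult intro!: mult_right_mono)
    qed measurable
    fix h
    have "A * (1 - ?c * h\<^sup>2) * walk_drift \<sigma> h \<le> prof A \<alpha> \<theta> h * walk_drift \<sigma> h"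
      using prof_ge_parabola[OF A(2) less_imp_le[OF A(1)]] walk_drift_bounds(1)[of \<sigma> h] by (intro mult_right_mono) auto
    then show "A * (walk_drift \<sigma> h - ?c * (h\<^sup>2 * walk_drift \<sigma> h)) \<le> prof A \<alpha> \<theta> h * walk_drift \<sigma> h"
      by (simp add: algebra_simps)
  qed
  ultimately show ?thesis by (simp only: times_divide_eq_right)
qed


section \<open>Mass of a normalised profile\<close>

definition tmass :: "real \<Rightarrow> real" where
  "tmass u = (\<integral>t. exp (- u * t\<^sup>2) * max 0 (1 - t\<^sup>2) \<partial>lborel)"

lemma prof_mass:
  assumes "0 < \<theta>" shows "(\<integral>x. prof A \<alpha> \<theta> x \<partial>lborel) = A / sqrt \<theta> * tmass (\<alpha> / \<theta>)"
proof -
  have "(\<integral>x. prof A \<alpha> \<theta> x \<partial>lborel) = 1 / sqrt \<theta> * (\<integral>t. prof A \<alpha> \<theta> (1 / sqrt \<theta> * t) \<partial>lborel)"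
    using lborel_integral_real_affine[of "1 / sqrt \<theta>" "prof A \<alpha> \<theta>" 0] assms by simp
  also have "(\<lambda>t. prof A \<alpha> \<theta> (1 / sqrt \<theta> * t)) = (\<lambda>t. A * (exp (- (\<alpha> / \<theta>) * t\<^sup>2) * max 0 (1 - t\<^sup>2)))"
    using assms by (intro ext) (simp add: prof_def power_divide)
  finally show ?thesis by (simp add: tmass_def)
qed

lemma tmass_integrable:
  fixes u :: real
  shows "integrable lborel (\<lambda>t. exp (- u * t\<^sup>2) * max 0 (1 - t\<^sup>2))"
proof -
  have "prof 1 u 1 = (\<lambda>t. exp (- u * t\<^sup>2) * max 0 (1 - t\<^sup>2))" by (intro ext) (simp add: prof_def)
  then show ?thesis using prof_integrable[of 1 1 u] by simp
qed

text \<open>The integrand is convex in \<open>u\<close> pointwise. Chords between the nodes of a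
  table therefore bound \<open>tmass\<close> from above in between.\<close>

lemma tmass_convex:
  assumes "a \<le> u" "u \<le> b"
  shows "(b - a) * tmass u \<le> (b - u) * tmass a + (u - a) * tmass b"
proof -
  have "(\<integral>t. (b - a) * (exp (- u * t\<^sup>2) * max 0 (1 - t\<^sup>2)) \<partial>lborel)
     \<le> (\<integral>t. (b - u) * (exp (- a * t\<^sup>2) * max 0 (1 - t\<^sup>2)) + (u - a) * (exp (- b * t\<^sup>2) * max 0 (1 - t\<^sup>2)) \<partial>lborel)"
  proof (rule integral_mono)
    fix t :: real
    have "(b - a) * exp (- u * t\<^sup>2) \<le> (b - u) * exp (- a * t\<^sup>2) + (u - a) * exp (- b * t\<^sup>2)"
    proof (cases "a = b")
      case False
      then have ab: "a < b" using assms by simp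
      define w where "w = (u - a) / (b - a)"
      have w: "0 \<le> w" "w \<le> 1" using assms ab by (auto simp: w_def)
      have "exp ((1 - w) *\<^sub>R (- a * t\<^sup>2) + w *\<^sub>R (- b * t\<^sup>2)) \<le> (1 - w) * exp (- a * t\<^sup>2) + w * exp (- b * t\<^sup>2)"
        using w by (intro convex_onD[OF exp_convex]) auto
      moreover have "(1 - w) *\<^sub>R (- a * t\<^sup>2) + w *\<^sub>R (- b * t\<^sup>2) = - u * t\<^sup>2"
      proof -
        have "u = a + w * (b - a)" using ab by (simp add: w_def)
        moreover have "(1 - w) *\<^sub>R (- a * t\<^sup>2) + w *\<^sub>R (- b * t\<^sup>2) = - (a + w * (b - a)) * t\<^sup>2"
          by (simp add: algebra_simps)
        ultimately show ?thesis by simp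
      qed
      ultimately have "(b - a) * exp (- u * t\<^sup>2) \<le> (b - a) * ((1 - w) * exp (- a * t\<^sup>2) + w * exp (- b * t\<^sup>2))"
        using ab by (intro mult_left_mono) auto
      also have "\<dots> = ((b - a) * (1 - w)) * exp (- a * t\<^sup>2) + ((b - a) * w) * exp (- b * t\<^sup>2)" by (simp add: algebra_simps)
      also have "(b - a) * w = u - a" using ab by (simp add: w_def)
      also have "(b - a) * (1 - w) = b - u" using ab by (simp add: w_def field_simps)
      finally show ?thesis .
    qed (use assms in auto)
    then have "(b - a) * exp (- u * t\<^sup>2) * max 0 (1 - t\<^sup>2) \<le> ((b - u) * exp (- a * t\<^sup>2) + (u - a) * exp (- b * t\<^sup>2)) * max 0 (1 - t\<^sup>2)"
      by (intro mult_right_mono) auto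
    then show "(b - a) * (exp (- u * t\<^sup>2) * max 0 (1 - t\<^sup>2)) \<le> (b - u) * (exp (- a * t\<^sup>2) * max 0 (1 - t\<^sup>2)) + (u - a) * (exp (- b * t\<^sup>2) * max 0 (1 - t\<^sup>2))"
      by (simp add: algebra_simps)
  qed (intro integrable_mult_right tmass_integrable Bochner_Integration.integrable_add)+
  also have "\<dots> = (b - u) * tmass a + (u - a) * tmass b"
    unfolding tmass_def using tmass_integrable[of a] tmass_integrable[of b] by simp
  finally show ?thesis by (simp add: tmass_def)
qed

text \<open>For every \<open>x \<ge> 0\<close>, however large, the Taylor polynomial of degree 20 is
  an upper bound, because the remainder has odd order and is nonpositive. For negative
  \<open>x\<close> down to -1/5, the smallest node of the table, the remainder stays below
  10^-12.\<close>

lemma exp_minus_upper: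
  fixes x :: real
  assumes "- (1/5) \<le> x"
  shows "exp (- x) \<le> (\<Sum>m<21. (- x) ^ m / fact m) + 1 / 10 ^ 12"
proof -
  obtain t where t: "\<bar>t\<bar> \<le> \<bar>- x\<bar>" "exp (- x) = (\<Sum>m<21. (- x) ^ m / fact m) + exp t / fact 21 * (- x) ^ 21"
    using Maclaurin_exp_le[of "- x" 21] by blast
  have "exp t / fact 21 * (- x) ^ 21 \<le> 1 / 10 ^ 12"
  proof (cases "x \<ge> 0")
    case True
    have "(- x) ^ 21 \<le> 0" using True by (simp add: power_minus_odd)
    then have "exp t / fact 21 * (- x) ^ 21 \<le> 0" by (intro mult_nonneg_nonpos) auto
    then show ?thesis by (rule order_trans) simp
  next
    case False
    then have x: "0 \<le> - x" "- x \<le> 1/5" using assms by auto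
    have "t \<le> 1" using t(1) x by auto
    then have "exp t \<le> exp 1" by simp
    also have "\<dots> \<le> 3" by (rule exp_le)
    finally have "exp t / fact 21 \<le> 3 / fact 21" by (intro divide_right_mono) auto
    moreover have "(- x) ^ 21 \<le> (1/5) ^ 21" using x by (intro power_mono) auto
    ultimately have "exp t / fact 21 * (- x) ^ 21 \<le> 3 / fact 21 * (1/5) ^ 21" using x by (intro mult_mono) auto
    also have "\<dots> \<le> 1 / 10 ^ 12" by (simp add: fact_numeral power_divide)
    finally show ?thesis .
  qed
  then show ?thesis using t(2) by simp
qed

lemma bump_moment:
  "has_bochner_integral lborel (\<lambda>t::real. t ^ (2 * k) * (1 - t\<^sup>2) * indicator {-1..1} t) (4 / (real (2 * k + 1) * real (2 * k + 3)))"
proof -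
  let ?F = "\<lambda>t::real. t ^ (2 * k + 1) / real (2 * k + 1) - t ^ (2 * k + 3) / real (2 * k + 3)"
  have D: "(?F has_real_derivative (t ^ (2 * k) * (1 - t\<^sup>2))) (at t)" for t
  proof -
    have "(?F has_real_derivative (real (2 * k + 1) * t ^ (2 * k) / real (2 * k + 1) - real (2 * k + 3) * t ^ (2 * k + 2) / real (2 * k + 3))) (at t)"
      by (rule derivative_eq_intros refl | simp)+
    also have "real (2 * k + 1) * t ^ (2 * k) / real (2 * k + 1) = t ^ (2 * k)" by simp
    also have "real (2 * k + 3) * t ^ (2 * k + 2) / real (2 * k + 3) = t ^ (2 * k + 2)"
      by (rule nonzero_mult_div_cancel_left) linarith
    also have "t ^ (2 * k) - t ^ (2 * k + 2) = t ^ (2 * k) * (1 - t\<^sup>2)"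
      by (simp add: right_diff_distrib power_add power2_eq_square)
    finally show ?thesis .
  qed
  have nn: "0 \<le> t ^ (2 * k) * (1 - t\<^sup>2)" if "-1 \<le> t" "t \<le> 1" for t :: real
    using that by (intro mult_nonneg_nonneg) (auto simp: abs_square_le_1 zero_le_even_power)
  have "has_bochner_integral lborel (\<lambda>t. t ^ (2 * k) * (1 - t\<^sup>2) * indicator {-1..1} t) (?F 1 - ?F (-1))"
    by (rule has_bochner_integral_FTC_Icc_nonneg) (use D nn in auto)
  also have "?F 1 - ?F (-1) = 4 / (real (2 * k + 1) * real (2 * k + 3))"
  proof -
    have o: "(-1::real) ^ (2 * k + 1) = -1" "(-1::real) ^ (2 * k + 3) = -1"
      by (simp_all add: power_add)
    have "1 / r + 1 / r - (1 / (r + 2) + 1 / (r + 2)) = 4 / (r * (r + 2))" if "r > 0" for r :: real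
      using that by (simp add: field_simps)
    from this[of "real (2 * k + 1)"] show ?thesis unfolding o by (simp add: add.commute)
  qed
  finally show ?thesis .
qed

text \<open>The Taylor bound at \<open>u * t\<^sup>2\<close>, integrated term by term;
  \<open>t\<^sup>2 \<le> 1\<close> on the support keeps the argument above -1/5.\<close>

lemma tmass_upper:
  assumes "- (1/5) \<le> u"
  shows "tmass u \<le> (\<Sum>m<21. (- u) ^ m / fact m * (4 / (real (2 * m + 1) * real (2 * m + 3)))) + 4 / 3 / 10 ^ 12"
proof -
  let ?b = "\<lambda>m t. t ^ (2 * m) * (1 - t\<^sup>2) * indicator {-1..1::real} t"
  have "has_bochner_integral lborel (\<lambda>t. (\<Sum>m<21. (- u) ^ m / fact m * ?b m t) + 1 / 10 ^ 12 * ?b 0 t)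
    ((\<Sum>m<21. (- u) ^ m / fact m * (4 / (real (2 * m + 1) * real (2 * m + 3)))) + 1 / 10 ^ 12 * (4 / (real (2 * 0 + 1) * real (2 * 0 + 3))))"
    by (intro has_bochner_integral_add has_bochner_integral_sum has_bochner_integral_mult_right bump_moment)
  then have I: "integrable lborel (\<lambda>t. (\<Sum>m<21. (- u) ^ m / fact m * ?b m t) + 1 / 10 ^ 12 * ?b 0 t)"
    "(\<integral>t. (\<Sum>m<21. (- u) ^ m / fact m * ?b m t) + 1 / 10 ^ 12 * ?b 0 t \<partial>lborel)
     = (\<Sum>m<21. (- u) ^ m / fact m * (4 / (real (2 * m + 1) * real (2 * m + 3)))) + 4 / 3 / 10 ^ 12"
    by (auto simp: has_bochner_integral_iff)
  have "tmass u \<le> (\<integral>t. (\<Sum>m<21. (- u) ^ m / fact m * ?b m t) + 1 / 10 ^ 12 * ?b 0 t \<partial>lborel)"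
    unfolding tmass_def
  proof (rule integral_mono[OF tmass_integrable I(1)])
    fix t :: real
    show "exp (- u * t\<^sup>2) * max 0 (1 - t\<^sup>2) \<le> (\<Sum>m<21. (- u) ^ m / fact m * ?b m t) + 1 / 10 ^ 12 * ?b 0 t"
    proof (cases "\<bar>t\<bar> \<le> 1")
      case True
      then have t: "0 \<le> 1 - t\<^sup>2" "t\<^sup>2 \<le> 1" by (auto simp: abs_square_le_1)
      have "- (1/5) \<le> u * t\<^sup>2"
      proof (cases "u \<ge> 0")
        case False
        then have "u * 1 \<le> u * t\<^sup>2" using t by (intro mult_left_mono_neg) auto
        then show ?thesis using assms by simp
      next
        case True
        then have "0 \<le> u * t\<^sup>2" by simp
        then show ?thesis by linarith
      qed
      have pw: "(- u * t\<^sup>2) ^ m = (- u) ^ m * t ^ (2 * m)" for m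
        by (simp only: power_mult_distrib power_mult)
      from exp_minus_upper[OF \<open>- (1/5) \<le> u * t\<^sup>2\<close>, unfolded minus_mult_left] have "exp (- u * t\<^sup>2) * (1 - t\<^sup>2) \<le> ((\<Sum>m<21. (- u * t\<^sup>2) ^ m / fact m) + 1 / 10 ^ 12) * (1 - t\<^sup>2)"
        using t by (intro mult_right_mono) auto
      also have "\<dots> = (\<Sum>m<21. (- u) ^ m / fact m * (t ^ (2 * m) * (1 - t\<^sup>2))) + 1 / 10 ^ 12 * (1 - t\<^sup>2)"
        unfolding distrib_right sum_distrib_right pw
        by (intro arg_cong2[where f="(+)"] sum.cong refl)
          simp
      finally show ?thesis using True t by (simp add: indicator_def abs_le_iff)
    next
      case False
      then have "t\<^sup>2 \<ge> 1" using abs_square_less_1[of t] by (simp add: not_less)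
      then show ?thesis using False by (auto simp: indicator_def)
    qed
  qed
  then show ?thesis unfolding I(2) .
qed

section \<open>A concrete schedule\<close>

text \<open>Values of \<open>(10\<^sup>4 A, 10\<^sup>4 \<theta>, 10\<^sup>4 \<alpha> / \<theta>, 10\<^sup>5 J)\<close> for the surviving profile after each of the rounds
  1 to 97 of length 1/100, where \<open>J\<close> bounds the normalised mass. Each entry was found numerically by increasing \<open>\<theta>\<close>
  at constant \<open>\<alpha> + \<theta>\<close> until the mass constraint is met.\<close>

definition schedule :: "(int \<times> int \<times> int \<times> int) list" where
  "schedule = [
   (39495, 73842, 57713, 67427), (27862, 41464, 50893, 70891), (22683, 31331, 44105, 74912), (19584,
   26000, 39224, 78218), (17462, 22798, 35197, 81279), (15891, 20508, 32137, 83809), (14666, 19042,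
   29143, 86563), (13675, 17805, 26870, 88794), (12851, 16802, 24961, 90779), (12152, 16011, 23241,
   92672), (11548, 15402, 21628, 94572), (11020, 14794, 20396, 96023), (10552, 14359, 19112, 97662),
   (10133, 13971, 17985, 99149), (9756, 13599, 17033, 100406), (9413, 13368, 15975, 101949), (9100,
   13128, 15089, 103245), (8812, 12891, 14324, 104364), (8546, 12711, 13561, 105539), (8299, 12564,
   12834, 106700), (8068, 12412, 12203, 107708), (7852, 12304, 11568, 108775), (7649, 12211, 10975,
   109795), (7458, 12123, 10435, 110724), (7278, 12050, 9924, 111612), (7107, 12012, 9406, 112572),
   (6945, 11975, 8934, 113447), (6791, 11945, 8493, 114265), (6644, 11918, 8086, 115019), (6503, 11918,
   7673, 115833), (6368, 11927, 7281, 116618), (6239, 11943, 6911, 117359), (6115, 11965, 6562,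
   118058), (5996, 11995, 6229, 118725), (5881, 12032, 5913, 119370), (5770, 12091, 5592, 120059),
   (5663, 12157, 5287, 120713), (5559, 12224, 5004, 121320), (5458, 12295, 4737, 121893), (5360, 12374,
   4481, 122445), (5265, 12476, 4218, 123044), (5172, 12577, 3977, 123594), (5082, 12690, 3741,
   124132), (4994, 12809, 3517, 124643), (4908, 12934, 3305, 125126), (4824, 13067, 3102, 125589),
   (4742, 13216, 2900, 126061), (4661, 13370, 2710, 126517), (4582, 13538, 2523, 126966), (4505, 13722,
   2338, 127410), (4429, 13912, 2165, 127825), (4354, 14108, 2003, 128214), (4280, 14321, 1842,
   128617), (4207, 14545, 1688, 129002), (4135, 14782, 1540, 129372), (4064, 15033, 1398, 129728),
   (3994, 15301, 1259, 130075), (3925, 15587, 1124, 130413), (3857, 15896, 990, 130750), (3789, 16217,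
   865, 131076), (3722, 16565, 740, 131402), (3656, 16943, 615, 131729), (3590, 17334, 502, 132024),
   (3524, 17745, 396, 132301), (3459, 18195, 287, 132585), (3394, 18669, 186, 132849), (3329, 19173,
   90, 133100), (3264, 19710, -1, 133337), (3199, 20290, -91, 133582), (3134, 20915, -178, 133820),
   (3069, 21588, -262, 134048), (3004, 22318, -344, 134272), (2939, 23113, -425, 134493), (2873, 23957,
   -495, 134683), (2807, 24887, -567, 134880), (2740, 25884, -629, 135049), (2673, 26998, -697,
   135234), (2605, 28211, -758, 135400), (2536, 29545, -815, 135555), (2466, 31022, -869, 135703),
   (2395, 32672, -922, 135847), (2323, 34532, -975, 135991), (2249, 36606, -1019, 136114), (2174,
   39002, -1071, 136262), (2097, 41737, -1117, 136392), (2018, 44912, -1162, 136521), (1936, 48578,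
   -1195, 136614), (1851, 52918, -1227, 136706), (1763, 58177, -1264, 136811), (1671, 64614, -1298,
   136908), (1574, 72639, -1325, 136984), (1471, 82952, -1350, 137056), (1361, 96788, -1384, 137152),
   (1242, 116252, -1422, 137261), (1111, 145628, -1469, 137394), (962, 194414, -1507, 137502), (786,
   293699, -1646, 137898)]"

text \<open>Upper bounds for the convex function \<open>tmass\<close> at the nodes of a grid: \<open>(10\<^sup>4 u, 10\<^sup>5 J)\<close>.\<close>

definition tmass_table :: "(int \<times> int) list" where
  "tmass_table = [
   (-2000, 138905), (-1000, 136059), (0, 133334), (1000, 130723), (2000, 128221), (3000, 125821),
   (4500, 122401), (6000, 119183), (8000, 115178), (10000, 111471), (12000, 108032), (14000, 104837),
   (17000, 100449), (20000, 96489), (24000, 91778), (28000, 87619), (32000, 83922), (36000, 80615),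
   (40000, 77641), (45000, 74317), (50000, 71363), (55000, 68719), (60000, 66337)]"

text \<open>All certificates are integer inequalities with cleared denominators, so that they can be
  evaluated. Here the first table interval whose right end reaches \<open>v\<close> is located and
  the chord over it is compared with \<open>j\<close>.\<close>

fun chord_ok :: "int \<Rightarrow> int \<Rightarrow> (int \<times> int) list \<Rightarrow> bool" where
  "chord_ok v j ((p, jp) # (q, jq) # xs) =
    (if q < v then chord_ok v j ((q, jq) # xs) else p \<le> v \<and> p < q \<and> (q - v) * jp + (v - p) * jq \<le> (q - p) * j)"
| "chord_ok v j _ = False"

text \<open>\<open>m\<close> is the percentage of sites available to survivors, namely
  \<open>99 - r\<close> in round \<open>r\<close>; the inequality is
  \<open>A * J \<le> m / 100 * sqrt \<theta>\<close>, squared. The final \<open>0 < m\<close> makes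
  all earlier percentages positive.\<close>

fun mass_ok :: "int \<Rightarrow> (int \<times> int \<times> int \<times> int) list \<Rightarrow> bool" where
  "mass_ok m ((a, t, v, j) # xs) =
    (0 < a \<and> 0 < t \<and> 0 < j \<and> a * a * (j * j) \<le> m * m * t * 10000000000 \<and> chord_ok v j tmass_table \<and> mass_ok (m - 1) xs)"
| "mass_ok m [] = (0 < m)"

text \<open>The conditions of \<open>prof_step\<close> for \<open>\<sigma> = 1/10\<close>, with
  \<open>D = d / (5 * 10 ^ 9)\<close> and \<open>E = e / (5 * 10 ^ 9)\<close>. The denominator
  results from the units 10^-4 of \<open>\<theta>\<close> and of \<open>\<alpha> / \<theta>\<close>
  together with \<open>2 * \<sigma>\<^sup>2 = 1/50\<close>.\<close>

definition step_ok :: "int \<Rightarrow> int \<Rightarrow> int \<Rightarrow> int \<Rightarrow> int \<Rightarrow> int \<Rightarrow> int \<Rightarrow> int \<Rightarrow> bool" where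
  "step_ok a t v d e a' t' v' \<longleftrightarrow> 0 < d \<and> 0 < e \<and> a' * a' * (d * d * d) \<le> a * a * (e * e) * 5000000000 \<and>
      t * 25000000000000000000 \<le> t' * d * e \<and>
      v * t * e * 5000000000 + t * 250000000000000000000000 \<le> t' * (10000 + v') * d * e"

fun steps_ok :: "(int \<times> int \<times> int \<times> int) list \<Rightarrow> bool" where
  "steps_ok ((a, t, v, j) # (a', t', v', j') # xs) =
    (step_ok a t v (5000000000 + v * t) (5000000000 + v * t - 5000 * t) a' t' v' \<and> steps_ok ((a', t', v', j') # xs))"
| "steps_ok _ = True"

text \<open>The lower bound of \<open>prof_drift\<close> at \<open>\<sigma> = 1/10\<close>, summed
  over the rounds and multiplied by \<open>2 * 10 ^ 16\<close>.\<close>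

fun gain :: "(int \<times> int \<times> int \<times> int) list \<Rightarrow> int" where
  "gain ((a, t, v, j) # xs) = a * (20000000000 - t * (10000 + max 0 v)) + gain xs"
| "gain [] = 0"

lemma schedule_mass_ok: "mass_ok 98 schedule"
  by code_simp

lemma schedule_steps_ok: "steps_ok schedule"
  by code_simp

text \<open>This is a gain of 0.57935; with at least \<open>0.99 * 0.0797\<close> from the very
  first step it exceeds 0.658.\<close>

lemma schedule_gain: "11587000000000000 \<le> gain schedule"
  by code_simp

lemma schedule_length: "length schedule = 97"
  unfolding schedule_def by simp

text \<open>The Taylor coefficients of \<open>tmass\<close> in \<open>- u\<close>, multiplied by \<open>tmass_den\<close>.\<close>

definition tmass_den :: int where "tmass_den = 2463550798476448060529909760000"

definition tmass_coeffs :: "int list" where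
  "tmass_coeffs = [
   3284734397968597414039879680000, 656946879593719482807975936000, 140774331341511317744566272000,
   26069320618798392174919680000, 4147391916627016936919040000, 574254265379125422034944000,
   70186632435226440470937600, 7667447240823056522035200, 756655977712801630464000,
   68059003286336654592000, 5622265488871288857600, 429336637331989330944, 30477600798258501888,
   2021061060892473600, 125734213465660800, 7366246849503360, 407774379168936, 21393568382472,
   1066630902260, 50661544780, 2297442147]"

text \<open>Horner's scheme at \<open>y / 20\<close>, multiplied by 20 to the power of the degree.
  The nodes of the table are multiples of 1/20.\<close>

fun horner20 :: "int list \<Rightarrow> int \<Rightarrow> int" where
  "horner20 [] y = 0"
| "horner20 (c # cs) y = c * 20 ^ length cs + y * horner20 cs y"

lemma horner20_sum:
  "20 * real_of_int (horner20 cs y) = 20 ^ length cs * (\<Sum>m<length cs. real_of_int (cs ! m) * (y / 20) ^ m)"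
proof (induction cs)
  case (Cons c cs)
  have "20 * real_of_int (horner20 (c # cs) y) = 20 ^ length (c # cs) * c + y * (20 * real_of_int (horner20 cs y))"
    by (simp add: algebra_simps)
  also have "\<dots> = 20 ^ length (c # cs) * (c + y / 20 * (\<Sum>m<length cs. real_of_int (cs ! m) * (y / 20) ^ m))"
    unfolding Cons.IH by (simp add: algebra_simps)
  also have "c + y / 20 * (\<Sum>m<length cs. real_of_int (cs ! m) * (y / 20) ^ m) = (\<Sum>m<length (c # cs). real_of_int ((c # cs) ! m) * (y / 20) ^ m)"
    by (simp add: sum.lessThan_Suc_shift sum_distrib_left mult_ac del: sum.lessThan_Suc)
  finally show ?case .
qed simp

lemma tmass_coeffs_eq:
  "m < 21 \<Longrightarrow> real_of_int (tmass_coeffs ! m) * (fact m * (real (2 * m + 1) * real (2 * m + 3))) = 4 * real_of_int tmass_den"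
proof -
  have "\<forall>m\<in>{..<21}. real_of_int (tmass_coeffs ! m) * (fact m * (real (2 * m + 1) * real (2 * m + 3))) = 4 * real_of_int tmass_den"
    unfolding tmass_coeffs_def tmass_den_def by (simp add: lessThan_nat_numeral fact_numeral)
  then show "m < 21 \<Longrightarrow> ?thesis" by auto
qed

text \<open>The summand \<open>2 * tmass_den * 20 ^ 20\<close> stands for an error of
  \<open>2 / 10 ^ 12\<close>, which covers the remainder \<open>4 / 3 / 10 ^ 12\<close> of
  \<open>tmass_upper\<close>.\<close>

definition node_ok :: "int \<Rightarrow> int \<Rightarrow> bool" where
  "node_ok p j \<longleftrightarrow> - 2000 \<le> p \<and> p mod 500 = 0 \<and>
     horner20 tmass_coeffs (- (p div 500)) * 10 ^ 12 + 2 * tmass_den * 20 ^ 20 \<le> j * tmass_den * 20 ^ 20 * 10 ^ 7"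

lemma tmass_table_nodes_ok: "list_all (\<lambda>(p, j). node_ok p j) tmass_table"
  by code_simp

lemma node_ok_tmass:
  assumes "node_ok p j" shows "tmass (real_of_int p / 10000) \<le> real_of_int j / 100000"
proof -
  define q where "q = p div 500"
  let ?L = "real_of_int tmass_den"
  have p: "p = 500 * q" using assms by (auto simp: node_ok_def q_def)
  have L: "0 < ?L" by (simp add: tmass_den_def)
  have len: "length tmass_coeffs = 21" by (simp add: tmass_coeffs_def)
  let ?u = "real_of_int p / 10000"
  have u: "?u = real_of_int q / 20" using p by simp
  have "tmass ?u \<le> (\<Sum>m<21. (- ?u) ^ m / fact m * (4 / (real (2 * m + 1) * real (2 * m + 3)))) + 4 / 3 / 10 ^ 12"
    using assms by (intro tmass_upper) (simp add: node_ok_def)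
  also have "(\<Sum>m<21. (- ?u) ^ m / fact m * (4 / (real (2 * m + 1) * real (2 * m + 3)))) = (\<Sum>m<21. real_of_int (tmass_coeffs ! m) * (- q / 20) ^ m) / ?L"
    unfolding sum_divide_distrib
  proof (intro sum.cong refl)
    fix m :: nat assume "m \<in> {..<21}"
    then have "real_of_int (tmass_coeffs ! m) = 4 * ?L / (fact m * (real (2 * m + 1) * real (2 * m + 3)))"
      using tmass_coeffs_eq[of m] by (simp add: nonzero_eq_divide_eq del: of_nat_add of_nat_mult)
    then show "(- ?u) ^ m / fact m * (4 / (real (2 * m + 1) * real (2 * m + 3))) = real_of_int (tmass_coeffs ! m) * (- q / 20) ^ m / ?L"
      using L by (simp add: u)
  qed
  also have "(\<Sum>m<21. real_of_int (tmass_coeffs ! m) * (- q / 20) ^ m) = real_of_int (horner20 tmass_coeffs (- q)) / 20 ^ 20"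
    using horner20_sum[of tmass_coeffs "- q"] unfolding len by simp
  finally have T: "tmass ?u \<le> real_of_int (horner20 tmass_coeffs (- q)) / 20 ^ 20 / ?L + 4 / 3 / 10 ^ 12" .
  have "real_of_int (horner20 tmass_coeffs (- q) * 10 ^ 12 + 2 * tmass_den * 20 ^ 20) \<le> real_of_int (j * tmass_den * 20 ^ 20 * 10 ^ 7)"
    using assms unfolding node_ok_def q_def of_int_le_iff by simp
  then have "real_of_int (horner20 tmass_coeffs (- q)) * 10 ^ 12 + 2 * ?L * 20 ^ 20 \<le> j * ?L * 20 ^ 20 * 10 ^ 7" by simp
  then have "(real_of_int (horner20 tmass_coeffs (- q)) * 10 ^ 12 + 2 * ?L * 20 ^ 20) / (?L * 20 ^ 20 * 10 ^ 12) \<le> (j * ?L * 20 ^ 20 * 10 ^ 7) / (?L * 20 ^ 20 * 10 ^ 12)"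
    using L by (intro divide_right_mono) auto
  then have "real_of_int (horner20 tmass_coeffs (- q)) / 20 ^ 20 / ?L + 2 / 10 ^ 12 \<le> j / 100000"
    using L by (simp add: add_divide_distrib)
  then show ?thesis using T by simp
qed

lemma tmass_table_upper:
  "list_all (\<lambda>(p, j). tmass (real_of_int p / 10000) \<le> real_of_int j / 100000) tmass_table"
  by (rule list.pred_mono_strong[OF tmass_table_nodes_ok]) (auto dest: node_ok_tmass)

lemma chord_ok_tmass:
  assumes "chord_ok v j xs" "list_all (\<lambda>(p, j). tmass (real_of_int p / 10000) \<le> real_of_int j / 100000) xs"
  shows "tmass (real_of_int v / 10000) \<le> real_of_int j / 100000"
  using assms
proof (induction v j xs rule: chord_ok.induct)
  case (1 v j p jp q jq xs)
  show ?case
  proof (cases "q < v")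
    case False
    then have c: "p \<le> v" "v \<le> q" "p < q" "(q - v) * jp + (v - p) * jq \<le> (q - p) * j" using 1 by auto
    have "(real_of_int q / 10000 - real_of_int p / 10000) * tmass (real_of_int v / 10000)
      \<le> (real_of_int q / 10000 - real_of_int v / 10000) * tmass (real_of_int p / 10000)
        + (real_of_int v / 10000 - real_of_int p / 10000) * tmass (real_of_int q / 10000)"
      using c by (intro tmass_convex) auto
    also have "\<dots> \<le> (real_of_int q / 10000 - real_of_int v / 10000) * (real_of_int jp / 100000)
        + (real_of_int v / 10000 - real_of_int p / 10000) * (real_of_int jq / 100000)"
      using 1(3) c by (intro add_mono mult_left_mono) auto
    also have "\<dots> = real_of_int ((q - v) * jp + (v - p) * jq) / 1000000000"
      by (simp add: field_simps)
    also have "\<dots> \<le> real_of_int ((q - p) * j) / 1000000000"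
      by (intro divide_right_mono of_int_le_iff[THEN iffD2] c(4)) simp
    also have "\<dots> = (real_of_int q / 10000 - real_of_int p / 10000) * (real_of_int j / 100000)"
      by (simp add: field_simps)
    finally show ?thesis using c(3) by (simp add: mult_le_cancel_left)
  qed (use 1 in auto)
qed auto

lemma mass_ok_nth:
  assumes "mass_ok m xs" "i < length xs" "xs ! i = (a, t, v, j)"
  shows "0 < a \<and> 0 < t \<and> 0 < j \<and> 0 < m - int i \<and> a * a * (j * j) \<le> (m - int i) * (m - int i) * t * 10000000000 \<and> chord_ok v j tmass_table"
  using assms
proof (induction xs arbitrary: m i)
  case (Cons x xs)
  obtain a' t' v' j' where x: "x = (a', t', v', j')" by (cases x)
  have pos: "0 < m" if "mass_ok m ys" for m ys
    using that by (induction m ys rule: mass_ok.induct) auto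
  show ?case
  proof (cases i)
    case 0
    then show ?thesis using Cons.prems x pos[OF Cons.prems(1)] by auto
  next
    case (Suc i')
    then show ?thesis using Cons.IH[of "m - 1" i'] Cons.prems x by (auto simp: algebra_simps)
  qed
qed simp

lemma steps_ok_nth:
  assumes "steps_ok xs" "Suc i < length xs" "xs ! i = (a, t, v, j)" "xs ! Suc i = (a', t', v', j')"
  shows "step_ok a t v (5000000000 + v * t) (5000000000 + v * t - 5000 * t) a' t' v'"
  using assms
proof (induction xs arbitrary: i rule: steps_ok.induct)
  case (1 a1 t1 v1 j1 a2 t2 v2 j2 xs)
  then show ?case by (cases i) auto
qed auto

lemma gain_sum: "gain xs = (\<Sum>i<length xs. case xs ! i of (a, t, v, j) \<Rightarrow> a * (20000000000 - t * (10000 + max 0 v)))"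
  by (induction xs rule: gain.induct) (simp_all add: sum.lessThan_Suc_shift del: sum.lessThan_Suc)

section \<open>From the integer schedule to surviving densities\<close>

text \<open>Round \<open>r\<close> sits at list position \<open>r - 1\<close>. \<open>pU\<close> is
  the ratio of \<open>\<alpha>\<close> to \<open>\<theta>\<close>, hence the exponent
  \<open>pU r * pT r\<close> in \<open>walk_density\<close>.\<close>

definition pA :: "nat \<Rightarrow> real" where "pA r = real_of_int (fst (schedule ! (r - 1))) / 10000"
definition pT :: "nat \<Rightarrow> real" where "pT r = real_of_int (fst (snd (schedule ! (r - 1)))) / 10000"
definition pU :: "nat \<Rightarrow> real" where "pU r = real_of_int (fst (snd (snd (schedule ! (r - 1))))) / 10000"

definition walk_density :: "nat \<Rightarrow> real \<Rightarrow> real" where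
  "walk_density r = prof (pA r) (pU r * pT r) (pT r)"

lemma schedule_pos: "1 \<le> r \<Longrightarrow> r < 98 \<Longrightarrow> 0 < pA r \<and> 0 < pT r"
  using mass_ok_nth[OF schedule_mass_ok, of "r - 1"] schedule_length
  by (cases "schedule ! (r - 1)") (auto simp: pA_def pT_def)

lemma walk_density_mass:
  assumes r: "1 \<le> r" "r < 98"
  shows "(\<integral>x. walk_density r x \<partial>lborel) \<le> 1 - (real r + 1) * (1/10)\<^sup>2"
proof -
  obtain a t v j where s: "schedule ! (r - 1) = (a, t, v, j)" by (cases "schedule ! (r - 1)")
  have ok: "0 < a" "0 < t" "0 < j" "0 < 98 - int (r - 1)" "a * a * (j * j) \<le> (98 - int (r - 1)) * (98 - int (r - 1)) * t * 10000000000" "chord_ok v j tmass_table"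
    using mass_ok_nth[OF schedule_mass_ok, of "r - 1"] s r schedule_length by auto
  have m: "98 - int (r - 1) = 99 - int r" using r by (simp add: of_nat_diff)
  have p: "pA r = a / 10000" "pT r = t / 10000" "pU r = v / 10000" unfolding pA_def pT_def pU_def s by simp_all
  have J: "tmass (pU r) \<le> j / 100000" unfolding p by (rule chord_ok_tmass[OF ok(6) tmass_table_upper])
  have T: "0 < pT r" using ok(2) by (simp add: p)
  have "pA r * (j / 100000) \<le> (99 - real r) / 100 * sqrt (pT r)"
  proof (rule power2_le_imp_le)
    have "real_of_int (a * a * (j * j)) \<le> real_of_int ((99 - int r) * (99 - int r) * t * 10000000000)"
      using ok(5) unfolding m by (simp only: of_int_le_iff)
    then have "real_of_int a * a * (j * j) \<le> (99 - real r) * (99 - real r) * t * 10000000000" by simp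
    then show "(pA r * (j / 100000))\<^sup>2 \<le> ((99 - real r) / 100 * sqrt (pT r))\<^sup>2"
      using ok(2) by (simp add: p power2_eq_square field_simps)
    show "0 \<le> (99 - real r) / 100 * sqrt (pT r)" using r ok(2) by (simp add: p)
  qed
  moreover have "pA r * tmass (pU r) \<le> pA r * (j / 100000)" using J ok(1) by (intro mult_left_mono) (auto simp: p)
  ultimately have "pA r * tmass (pU r) \<le> (99 - real r) / 100 * sqrt (pT r)" by linarith
  then have "pA r * tmass (pU r) / sqrt (pT r) \<le> (99 - real r) / 100"
    using T by (subst pos_divide_le_eq) simp_all
  then show ?thesis unfolding walk_density_def prof_mass[OF T] using T by (simp add: power2_eq_square field_simps)
qed

lemma walk_density_step:
  assumes r: "1 \<le> r" "Suc r < 98"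
  shows "walk_density (Suc r) x \<le> heat (1/10) (walk_density r) x"
proof -
  obtain a t v j where s: "schedule ! (r - 1) = (a, t, v, j)" by (cases "schedule ! (r - 1)")
  obtain a' t' v' j' where s': "schedule ! (Suc r - 1) = (a', t', v', j')" by (cases "schedule ! (Suc r - 1)")
  define d where "d = 5000000000 + v * t"
  define e where "e = d - 5000 * t"
  have ok: "step_ok a t v d e a' t' v'"
    using steps_ok_nth[OF schedule_steps_ok, of "r - 1"] s s' r schedule_length by (simp add: d_def e_def)
  have pos: "0 < pA r" "0 < pT r" "0 < pA (Suc r)" using schedule_pos[of r] schedule_pos[of "Suc r"] r by auto
  have p: "pA r = a / 10000" "pT r = t / 10000" "pU r = v / 10000" unfolding pA_def pT_def pU_def s by simp_all
  have p': "pA (Suc r) = a' / 10000" "pT (Suc r) = t' / 10000" "pU (Suc r) = v' / 10000"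
    unfolding pA_def pT_def pU_def s' by simp_all
  define D where "D = real_of_int d / 5000000000"
  define E where "E = real_of_int e / 5000000000"
  have o: "0 < d" "0 < e" using ok by (auto simp: step_ok_def)
  have "real_of_int (a' * a' * (d * d * d)) \<le> real_of_int (a * a * (e * e) * 5000000000)"
    "real_of_int (t * 25000000000000000000) \<le> real_of_int (t' * d * e)"
    "real_of_int (v * t * e * 5000000000 + t * 250000000000000000000000) \<le> real_of_int (t' * (10000 + v') * d * e)"
    using ok unfolding step_ok_def of_int_le_iff by auto
  then have i: "real_of_int a' * a' * (real_of_int d * d * d) \<le> real_of_int a * a * (real_of_int e * e) * 5000000000"
    "real_of_int t * 25000000000000000000 \<le> real_of_int t' * d * e"
    "real_of_int v * t * e * 5000000000 + real_of_int t * 250000000000000000000000 \<le> real_of_int t' * (10000 + real_of_int v') * d * e"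
    by simp_all
  show ?thesis unfolding walk_density_def
  proof (rule prof_step[where D=D and E=E])
    show "D = 1 + 2 * (pU r * pT r) * (1/10)\<^sup>2" by (simp add: D_def d_def p power2_eq_square field_simps)
    show "E = D - pT r * (1/10)\<^sup>2" by (simp add: E_def e_def D_def p power2_eq_square field_simps)
    show "0 < D" "0 < E" using o by (simp_all add: D_def E_def)
    show "(pA (Suc r))\<^sup>2 * D ^ 3 \<le> (pA r)\<^sup>2 * E\<^sup>2"
      using i(1) by (simp add: p p' D_def E_def power2_eq_square power3_eq_cube field_simps)
    show "pT r \<le> pT (Suc r) * D * E"
      using i(2) by (simp add: p p' D_def E_def field_simps)
    show "pU r * pT r * E + pT r \<le> (pU (Suc r) * pT (Suc r) + pT (Suc r)) * D * E"
      using i(3) by (simp add: p p' D_def E_def field_simps)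
  qed (use pos in auto)
qed

lemma walk_density_surviving:
  "surviving_densities (1/10) walk_density 98 (\<Sum>r=1..<98. pA r * exp (\<bar>pU r * pT r\<bar> / pT r))"
  unfolding surviving_densities_def
proof (intro conjI ballI allI impI)
  fix r x assume r: "r \<in> {1..<98::nat}"
  then have pos: "0 < pT r" "0 \<le> pA r" using schedule_pos[of r] by auto
  show "walk_density r \<in> borel_measurable borel" "integrable lborel (walk_density r)"
    unfolding walk_density_def by (simp_all add: prof_integrable[OF pos])
  show "0 \<le> walk_density r x" unfolding walk_density_def by (rule prof_nonneg[OF pos(2)])
  have "walk_density r x \<le> pA r * exp (\<bar>pU r * pT r\<bar> / pT r)"
    unfolding walk_density_def by (rule prof_bound[OF pos])
  \<comment> \<open>Any common bound will do, and the sum of the individual bounds is one.\<close>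
  also have "\<dots> \<le> (\<Sum>r=1..<98. pA r * exp (\<bar>pU r * pT r\<bar> / pT r))"
    using schedule_pos r by (intro member_le_sum) (auto intro!: mult_nonneg_nonneg less_imp_le)
  finally show "walk_density r x \<le> (\<Sum>r=1..<98. pA r * exp (\<bar>pU r * pT r\<bar> / pT r))" .
next
  fix x
  \<comment> \<open>The first entry is fitted to the law of the first step:
    \<open>\<alpha> + \<theta>\<close> only just exceeds
    \<open>1 / (2 * \<sigma>\<^sup>2) = 50\<close>, and the height is just below 99/100 of the peak
    of the normal density.\<close>
  have p: "pA 1 = 39495 / 10000" "pT 1 = 73842 / 10000" "pU 1 = 57713 / 10000"
    by (simp_all add: pA_def pT_def pU_def schedule_def)
  have "(pA 1 * sqrt (2 * pi * (1/10)\<^sup>2))\<^sup>2 \<le> (1 - (1/10)\<^sup>2)\<^sup>2"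
  proof -
    have "(pA 1 * sqrt (2 * pi * (1/10)\<^sup>2))\<^sup>2 = (39495 / 10000)\<^sup>2 * (2 * pi / 100)"
      unfolding p power_mult_distrib by (subst real_sqrt_pow2) (simp_all add: power2_eq_square)
    also have "\<dots> \<le> (1 - (1/10)\<^sup>2)\<^sup>2" using pi_approx(2) by (simp add: power2_eq_square)
    finally show ?thesis .
  qed
  then have "pA 1 * sqrt (2 * pi * (1/10)\<^sup>2) \<le> 1 - (1/10)\<^sup>2" by (rule power2_le_imp_le) (simp add: power2_eq_square)
  then show "walk_density 1 x \<le> (1 - (1/10)\<^sup>2) * normal_density 0 (1/10) x"
    unfolding walk_density_def by (intro prof_first) (simp_all add: p[unfolded One_nat_def] power2_eq_square)
next
  fix r x assume "1 \<le> r \<and> Suc r < (98::nat)"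
  then show "walk_density (Suc r) x \<le> heat (1/10) (walk_density r) x" by (intro walk_density_step) auto
qed auto

lemma walk_density_gain:
  "658 / 1000 \<le> (1 - (1/10)\<^sup>2) * mean_abs (1/10) + (\<Sum>r=1..<98. (\<integral>x. walk_density r x * walk_drift (1/10) x \<partial>lborel))"
proof -
  let ?g = "\<lambda>i. case schedule ! i of (a, t, v, j) \<Rightarrow> a * (20000000000 - t * (10000 + max 0 v))"
  have "(\<Sum>r=1..<98. real_of_int (?g (r - 1)) / 20000000000000000) \<le> (\<Sum>r=1..<98. (\<integral>x. walk_density r x * walk_drift (1/10) x \<partial>lborel))"
  proof (rule sum_mono)
    fix r assume r: "r \<in> {1..<98::nat}"
    obtain a t v j where s: "schedule ! (r - 1) = (a, t, v, j)" by (cases "schedule ! (r - 1)")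
    have p: "pA r = a / 10000" "pT r = t / 10000" "pU r = v / 10000" unfolding pA_def pT_def pU_def s by simp_all
    have pos: "0 < pT r" "0 \<le> pA r" using schedule_pos[of r] r by auto
    have max_energy: "max 0 (pU r * pT r) = real_of_int (max 0 v) / 10000 * pT r"
      using pos(1) by (auto simp: max_def p zero_le_mult_iff mult_le_0_iff not_le)
    have "real_of_int (?g (r - 1)) / 20000000000000000 = pA r * ((1/10)\<^sup>2 - (pT r + max 0 (pU r * pT r)) * (1/10) ^ 4 / 2)"
      unfolding max_energy unfolding s prod.case p by (simp add: power2_eq_square power4_eq_xxxx field_simps)
    also have "\<dots> \<le> (\<integral>x. walk_density r x * walk_drift (1/10) x \<partial>lborel)"
      unfolding walk_density_def by (rule prof_drift[OF pos])
    finally show "real_of_int (?g (r - 1)) / 20000000000000000 \<le> (\<integral>x. walk_density r x * walk_drift (1/10) x \<partial>lborel)" .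
  qed
  also have "(\<Sum>r=1..<98. real_of_int (?g (r - 1)) / 20000000000000000) = real_of_int (gain schedule) / 20000000000000000"
  proof -
    have "(\<Sum>r=1..<98. real_of_int (?g (r - 1))) = (\<Sum>i<97. real_of_int (?g i))"
      by (rule sum.reindex_bij_witness[of _ Suc "\<lambda>r. r - 1"]) auto
    then show ?thesis unfolding gain_sum schedule_length by (simp only: sum_divide_distrib[symmetric] of_int_sum)
  qed
  finally have "11587000000000000 / 20000000000000000 \<le> (\<Sum>r=1..<98. (\<integral>x. walk_density r x * walk_drift (1/10) x \<partial>lborel))"
    using of_int_le_iff[where 'a=real, THEN iffD2, OF schedule_gain] by simp
  moreover have "0.0797 \<le> mean_abs (1/10)"
  proof -
    have "(0.797)\<^sup>2 * pi \<le> 2" using pi_approx(2) by (simp add: power2_eq_square)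
    then have "(0.797)\<^sup>2 \<le> 2 / pi" by (simp add: pos_le_divide_eq)
    then have "0.797 \<le> sqrt (2 / pi)" by (rule real_le_rsqrt)
    then show ?thesis by (simp add: scaled_normal_moments(4))
  qed
  ultimately show ?thesis by (simp add: power2_eq_square)
qed

text \<open>For multiples of 100 a batch of \<open>k\<close> sites gives exactly
  \<open>\<sigma> = 1/10\<close>. This subsequence is enough, since the bound is used only for a
  limit.\<close>

theorem ground_state_lower:
  fixes k :: nat
  assumes "0 < k"
  shows "100 * real k * (658 / 1000) - 98 * (((98 * mean_abs (1/10))\<^sup>2 + 2 * 98) * sqrt (100 * k))
    \<le> mean_max (1 / sqrt (100 * k)) {..<100 * k} (\<lambda>_. 0)"
proof -
  have \<sigma>: "(1/10::real) = sqrt (real k / real (100 * k))" using assms by (simp add: real_sqrt_divide)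
  have "real (100 * k) * (658 / 1000) \<le> real (100 * k) * ((1 - (1/10)\<^sup>2) * mean_abs (1/10) + (\<Sum>r=1..<98. (\<integral>x. walk_density r x * walk_drift (1/10) x \<partial>lborel)))"
    by (intro mult_left_mono walk_density_gain) auto
  moreover have "real (100 * k) * ((1 - (1/10)\<^sup>2) * mean_abs (1/10) + (\<Sum>r=1..<98. (\<integral>x. walk_density r x * walk_drift (1/10) x \<partial>lborel)))
     - real 98 * (((real 98 * mean_abs (1/10))\<^sup>2 + real (2 * 98)) * sqrt (real (100 * k))) \<le> mean_max (1 / sqrt (real (100 * k))) {..<100 * k} (\<lambda>_. 0)"
    by (rule greedy_density_bound[OF walk_density_surviving _ assms _ \<sigma>])
      (use walk_density_mass assms in \<open>simp_all add: add.commute\<close>)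
  ultimately show ?thesis by (simp only: of_nat_mult of_nat_numeral)
qed

section \<open>Comparison of Gaussian maxima\<close>

text \<open>The free energy at inverse temperature \<open>\<beta>\<close>: unlike the maximum it can
  be expanded to second order in small Gaussian increments.\<close>

definition smax :: "real \<Rightarrow> 'x set \<Rightarrow> ('x \<Rightarrow> real) \<Rightarrow> real" where
  "smax \<beta> X H = ln (\<Sum>x\<in>X. exp (\<beta> * H x)) / \<beta>"

lemma smax_bounds:
  assumes X: "finite X" "X \<noteq> {}" and \<beta>: "0 < \<beta>"
  shows "Max (H ` X) \<le> smax \<beta> X H" "smax \<beta> X H \<le> Max (H ` X) + ln (card X) / \<beta>"
proof -
  let ?m = "Max (H ` X)"
  have "?m \<in> H ` X" using X by (intro Max_in) auto
  then obtain x where x: "x \<in> X" "?m = H x" by auto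
  have "exp (\<beta> * ?m) \<le> (\<Sum>x\<in>X. exp (\<beta> * H x))"
    unfolding x(2) using X x by (intro member_le_sum) auto
  then have "ln (exp (\<beta> * ?m)) \<le> ln (\<Sum>x\<in>X. exp (\<beta> * H x))" by (intro ln_mono) (auto intro: less_le_trans[OF exp_gt_zero])
  then show "?m \<le> smax \<beta> X H" using \<beta> by (simp add: smax_def pos_le_divide_eq mult.commute)
  have "(\<Sum>x\<in>X. exp (\<beta> * H x)) \<le> (\<Sum>x\<in>X. exp (\<beta> * ?m))"
    using X \<beta> by (intro sum_mono) (auto intro!: mult_left_mono)
  then have le: "(\<Sum>x\<in>X. exp (\<beta> * H x)) \<le> card X * exp (\<beta> * ?m)" by simp
  have c: "0 < real (card X)" using X by (simp add: card_gt_0_iff)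
  have "0 < (\<Sum>x\<in>X. exp (\<beta> * H x))" using X by (intro sum_pos) auto
  then have "ln (\<Sum>x\<in>X. exp (\<beta> * H x)) \<le> ln (card X * exp (\<beta> * ?m))" using le by (intro ln_mono) auto
  also have "\<dots> = ln (card X) + \<beta> * ?m" using c by (simp add: ln_mult)
  finally show "smax \<beta> X H \<le> ?m + ln (card X) / \<beta>" using \<beta> by (simp add: smax_def field_simps)
qed

text \<open>Cumulant expansion. The third derivative of the logarithm is the third cumulant of a
  tilted law on values of modulus at most \<open>m\<close>, hence at most \<open>6 * m ^ 3\<close>,
  and the factor 6 cancels against the factorial.\<close>

lemma log_mgf_taylor:
  fixes p c :: "'x \<Rightarrow> real"
  assumes X: "finite X" and p: "\<And>x. x \<in> X \<Longrightarrow> 0 \<le> p x" "(\<Sum>x\<in>X. p x) = 1"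
    and c: "\<And>x. x \<in> X \<Longrightarrow> \<bar>c x\<bar> \<le> m"
  shows "\<bar>ln (\<Sum>x\<in>X. p x * exp (c x)) - (\<Sum>x\<in>X. p x * c x)
     - ((\<Sum>x\<in>X. p x * (c x)\<^sup>2) - (\<Sum>x\<in>X. p x * c x)\<^sup>2) / 2\<bar> \<le> m ^ 3"
proof -
  \<comment> \<open>Unnormalised moments of the law tilted by \<open>t\<close>; divided by
    \<open>M 0 t\<close> below they become its moments \<open>r k t\<close>.\<close>
  define M where "M = (\<lambda>k t. \<Sum>x\<in>X. p x * (c x ^ k * exp (t * c x)))"
  have M0: "0 < M 0 t" for t
  proof -
    obtain x where "x \<in> X" "p x \<noteq> 0" using p(2) by (metis sum.neutral zero_neq_one)
    then have "0 < p x" using p(1)[of x] by simp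
    then show ?thesis unfolding M_def using \<open>x \<in> X\<close> X p(1)
      by (intro sum_pos2[of X x]) auto
  qed
  have dM: "(M k has_real_derivative M (Suc k) t) (at t)" for k t
    unfolding M_def by (auto intro!: derivative_eq_intros sum.cong simp: algebra_simps)
  have m0: "0 \<le> m" 
  proof -
    obtain x where "x \<in> X" using p(2) by fastforce
    then show ?thesis using c[of x] by linarith
  qed
  have Mb: "\<bar>M k t\<bar> \<le> m ^ k * M 0 t" for k t
  proof -
    have "\<bar>M k t\<bar> \<le> (\<Sum>x\<in>X. \<bar>p x * (c x ^ k * exp (t * c x))\<bar>)" unfolding M_def by (rule sum_abs)
    also have "\<dots> \<le> (\<Sum>x\<in>X. p x * (m ^ k * exp (t * c x)))"
      using p c by (intro sum_mono) (auto simp: abs_mult power_abs intro!: mult_left_mono mult_right_mono power_mono)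
    also have "\<dots> = m ^ k * M 0 t" by (simp add: M_def sum_distrib_left mult_ac)
    finally show ?thesis .
  qed
  define r where "r = (\<lambda>k t. M k t / M 0 t)"
  have rb: "\<bar>r k t\<bar> \<le> m ^ k" for k t using Mb[of k t] M0[of t] by (simp add: r_def divide_le_eq)
  have dr: "(r k has_real_derivative r (Suc k) t - r k t * r 1 t) (at t)" for k t
    unfolding r_def using M0[of t]
    by (auto intro!: derivative_eq_intros dM simp: field_simps power2_eq_square)
  let ?f = "\<lambda>t. ln (M 0 t)"
  define diff where "diff = (\<lambda>k::nat. if k = 0 then ?f else if k = 1 then r 1 else if k = 2 then (\<lambda>t. r 2 t - r 1 t * r 1 t)
     else (\<lambda>t. r 3 t - r 2 t * r 1 t - 2 * (r 1 t * (r 2 t - r 1 t * r 1 t))))"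
  have d0: "(?f has_real_derivative r 1 t) (at t)" for t
    using M0[of t] dM[of 0 t] unfolding r_def by (auto intro!: derivative_eq_intros)
  have d1: "(r 1 has_real_derivative r 2 t - r 1 t * r 1 t) (at t)" for t
    using dr[of 1 t] by (simp add: numeral_2_eq_2)
  have d2: "((\<lambda>t. r 2 t - r 1 t * r 1 t) has_real_derivative r 3 t - r 2 t * r 1 t - 2 * (r 1 t * (r 2 t - r 1 t * r 1 t))) (at t)" for t
    using dr[of 2 t] d1[of t] by (auto intro!: derivative_eq_intros simp: numeral_3_eq_3 numeral_2_eq_2 algebra_simps)
  have "\<exists>t. 0 < t \<and> t < 1 \<and> ?f 1 = (\<Sum>k<3. diff k 0 / fact k * (1 - 0) ^ k) + diff 3 t / fact 3 * (1 - 0) ^ 3"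
  proof (rule Taylor_up[where a=0 and b=1])
    show "\<forall>k t. k < 3 \<and> 0 \<le> t \<and> t \<le> 1 \<longrightarrow> (diff k has_real_derivative diff (Suc k) t) (at t)"
    proof (intro allI impI)
      fix k :: nat and t :: real assume "k < 3 \<and> 0 \<le> t \<and> t \<le> 1"
      then consider "k = 0" | "k = 1" | "k = 2" by linarith
      then show "(diff k has_real_derivative diff (Suc k) t) (at t)"
        by cases (use d0[of t] d1[of t] d2[of t] in \<open>simp_all add: diff_def\<close>)
    qed
  qed (auto simp: diff_def)
  then obtain t where t: "?f 1 = (\<Sum>k<3. diff k 0 / fact k * (1 - 0) ^ k) + diff 3 t / fact 3 * (1 - 0) ^ 3" by blast
  have "(\<Sum>k<3. diff k 0 / fact k * (1 - 0) ^ k) = ?f 0 + r 1 0 + (r 2 0 - r 1 0 * r 1 0) / 2"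
    by (simp add: diff_def eval_nat_numeral)
  moreover have "M 0 0 = 1" using p by (simp add: M_def)
  moreover have "r 1 0 = (\<Sum>x\<in>X. p x * c x)" "r 2 0 = (\<Sum>x\<in>X. p x * (c x)\<^sup>2)"
    using \<open>M 0 0 = 1\<close> by (simp_all add: r_def M_def)
  moreover have "?f 1 = ln (\<Sum>x\<in>X. p x * exp (c x))" by (simp add: M_def)
  moreover have "\<bar>diff 3 t\<bar> \<le> 6 * m ^ 3"
  proof -
    have a: "\<bar>r 2 t * r 1 t\<bar> \<le> m ^ 2 * m ^ 1" "\<bar>r 1 t * r 2 t\<bar> \<le> m ^ 1 * m ^ 2" "\<bar>r 1 t * (r 1 t * r 1 t)\<bar> \<le> m ^ 1 * (m ^ 1 * m ^ 1)"
      unfolding abs_mult by (intro mult_mono rb; use m0 in simp)+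
    have "diff 3 t = r 3 t - r 2 t * r 1 t - 2 * (r 1 t * r 2 t) + 2 * (r 1 t * (r 1 t * r 1 t))"
      by (simp add: diff_def algebra_simps)
    moreover have mm: "m ^ 2 * m ^ 1 = m ^ 3" "m ^ 1 * m ^ 2 = m ^ 3" "m ^ 1 * (m ^ 1 * m ^ 1) = m ^ 3"
      by (simp_all add: power2_eq_square power3_eq_cube)
    moreover have "\<bar>x - u - 2 * v + 2 * w\<bar> \<le> 6 * K" if "\<bar>x\<bar> \<le> K" "\<bar>u\<bar> \<le> K" "\<bar>v\<bar> \<le> K" "\<bar>w\<bar> \<le> K" for x u v w K :: real
      using that by linarith
    ultimately show ?thesis using a[unfolded mm] rb[of 3 t] by presburger
  qed
  ultimately show ?thesis using t by (simp add: power2_eq_square fact_numeral)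
qed

definition gibbs :: "real \<Rightarrow> 'x set \<Rightarrow> ('x \<Rightarrow> real) \<Rightarrow> 'x \<Rightarrow> real" where
  "gibbs \<beta> X H x = exp (\<beta> * H x) / (\<Sum>y\<in>X. exp (\<beta> * H y))"

lemma gibbs_props:
  assumes "finite X" "X \<noteq> {}"
  shows "0 \<le> gibbs \<beta> X H x" "(\<Sum>x\<in>X. gibbs \<beta> X H x) = 1"
proof -
  have "0 < (\<Sum>y\<in>X. exp (\<beta> * H y))" using assms by (intro sum_pos) auto
  then show "0 \<le> gibbs \<beta> X H x" "(\<Sum>x\<in>X. gibbs \<beta> X H x) = 1"
    by (auto simp: gibbs_def sum_divide_distrib[symmetric])
qed

text \<open>The variance is half the mean squared difference of two independent copies. In this form
  the second-order term sees the increments only through their differences, the quantity compared in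
  the Gaussian comparison.\<close>

lemma variance_pairs:
  fixes p c :: "'x \<Rightarrow> real"
  assumes "(\<Sum>x\<in>X. p x) = 1"
  shows "(\<Sum>x\<in>X. p x * (c x)\<^sup>2) - (\<Sum>x\<in>X. p x * c x)\<^sup>2 = (\<Sum>x\<in>X. \<Sum>y\<in>X. p x * p y * (c x - c y)\<^sup>2) / 2"
proof -
  have "(\<Sum>x\<in>X. \<Sum>y\<in>X. p x * p y * (c x - c y)\<^sup>2)
     = (\<Sum>x\<in>X. \<Sum>y\<in>X. (p x * (c x)\<^sup>2) * p y + p x * (p y * (c y)\<^sup>2) - 2 * ((p x * c x) * (p y * c y)))"
    by (intro sum.cong refl) (simp add: power2_eq_square algebra_simps)
  also have "\<dots> = (\<Sum>x\<in>X. p x * (c x)\<^sup>2) * (\<Sum>y\<in>X. p y) + (\<Sum>x\<in>X. p x) * (\<Sum>y\<in>X. p y * (c y)\<^sup>2) - 2 * ((\<Sum>x\<in>X. p x * c x) * (\<Sum>y\<in>X. p y * c y))"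
    by (simp only: sum_product) (simp add: sum.distrib sum_subtractf sum_distrib_left)
  finally show ?thesis using assms by (simp add: power2_eq_square)
qed

lemma smax_step:
  assumes X: "finite X" "X \<noteq> {}" and \<beta>: "0 < \<beta>" and c: "\<And>x. x \<in> X \<Longrightarrow> \<bar>D x\<bar> \<le> m"
  shows "\<bar>smax \<beta> X (\<lambda>x. H x + D x) - smax \<beta> X H - (\<Sum>x\<in>X. gibbs \<beta> X H x * D x)
    - \<beta> / 4 * (\<Sum>x\<in>X. \<Sum>y\<in>X. gibbs \<beta> X H x * gibbs \<beta> X H y * (D x - D y)\<^sup>2)\<bar> \<le> \<beta>\<^sup>2 * m ^ 3"
proof -
  let ?p = "gibbs \<beta> X H" and ?c = "\<lambda>x. \<beta> * D x"
  let ?Z = "\<Sum>y\<in>X. exp (\<beta> * H y)"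
  have Z: "0 < ?Z" using X by (intro sum_pos) auto
  note p = gibbs_props[OF X, of \<beta> H]
  have cb: "\<bar>?c x\<bar> \<le> \<beta> * m" if "x \<in> X" for x using c[OF that] \<beta> by (simp add: abs_mult)
  have "(\<Sum>x\<in>X. ?p x * exp (?c x)) = (\<Sum>x\<in>X. exp (\<beta> * (H x + D x))) / ?Z"
    by (simp add: gibbs_def exp_add distrib_left sum_divide_distrib)
  moreover have "0 < (\<Sum>x\<in>X. exp (\<beta> * (H x + D x)))" using X by (intro sum_pos) auto
  ultimately have L: "ln (\<Sum>x\<in>X. ?p x * exp (?c x)) = \<beta> * (smax \<beta> X (\<lambda>x. H x + D x) - smax \<beta> X H)"
    using Z \<beta> by (simp add: ln_div smax_def right_diff_distrib)
  have E: "(\<Sum>x\<in>X. ?p x * ?c x) = \<beta> * (\<Sum>x\<in>X. ?p x * D x)" by (simp add: sum_distrib_left mult_ac)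
  have V: "((\<Sum>x\<in>X. ?p x * (?c x)\<^sup>2) - (\<Sum>x\<in>X. ?p x * ?c x)\<^sup>2) / 2
     = \<beta> * (\<beta> / 4 * (\<Sum>x\<in>X. \<Sum>y\<in>X. ?p x * ?p y * (D x - D y)\<^sup>2))"
  proof -
    have "(\<Sum>x\<in>X. \<Sum>y\<in>X. ?p x * ?p y * (?c x - ?c y)\<^sup>2) = \<beta>\<^sup>2 * (\<Sum>x\<in>X. \<Sum>y\<in>X. ?p x * ?p y * (D x - D y)\<^sup>2)"
      by (simp add: sum_distrib_left right_diff_distrib[symmetric] power_mult_distrib mult_ac)
    then show ?thesis unfolding variance_pairs[OF p(2)] by (simp add: power2_eq_square)
  qed
  have "\<bar>\<beta> * (smax \<beta> X (\<lambda>x. H x + D x) - smax \<beta> X H - (\<Sum>x\<in>X. ?p x * D x)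
    - \<beta> / 4 * (\<Sum>x\<in>X. \<Sum>y\<in>X. ?p x * ?p y * (D x - D y)\<^sup>2))\<bar> \<le> (\<beta> * m) ^ 3"
    using log_mgf_taylor[of X ?p ?c "\<beta> * m", OF X(1) p cb] unfolding L V unfolding E by (simp add: right_diff_distrib)
  then have "\<beta> * \<bar>smax \<beta> X (\<lambda>x. H x + D x) - smax \<beta> X H - (\<Sum>x\<in>X. ?p x * D x)
    - \<beta> / 4 * (\<Sum>x\<in>X. \<Sum>y\<in>X. ?p x * ?p y * (D x - D y)\<^sup>2)\<bar> \<le> \<beta> * (\<beta>\<^sup>2 * m ^ 3)"
    using \<beta> unfolding abs_mult power_mult_distrib power3_eq_cube[of \<beta>] power2_eq_square[of \<beta>] by (simp only: abs_of_pos mult.assoc)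
  then show ?thesis using \<beta> by simp
qed


lemma cube_sum_bound:
  fixes \<xi> :: "'e \<Rightarrow> real"
  assumes "finite E"
  shows "(\<Sum>e\<in>E. \<bar>\<xi> e\<bar>) ^ 3 \<le> real (card E) ^ 3 * (\<Sum>e\<in>E. \<bar>\<xi> e\<bar> ^ 3)"
proof (cases "E = {}")
  case False
  let ?m = "Max ((\<lambda>e. \<bar>\<xi> e\<bar>) ` E)"
  have "?m \<in> (\<lambda>e. \<bar>\<xi> e\<bar>) ` E" using assms False by (intro Max_in) auto
  then obtain e where e: "e \<in> E" "?m = \<bar>\<xi> e\<bar>" by auto
  have "(\<Sum>e\<in>E. \<bar>\<xi> e\<bar>) \<le> real (card E) * ?m"
    using sum_bounded_above[of E "\<lambda>e. \<bar>\<xi> e\<bar>" ?m] assms by simp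
  then have "(\<Sum>e\<in>E. \<bar>\<xi> e\<bar>) ^ 3 \<le> (real (card E) * ?m) ^ 3" by (intro power_mono sum_nonneg) auto
  also have "\<dots> = real (card E) ^ 3 * \<bar>\<xi> e\<bar> ^ 3" by (simp add: e power_mult_distrib)
  also have "\<dots> \<le> real (card E) ^ 3 * (\<Sum>e\<in>E. \<bar>\<xi> e\<bar> ^ 3)"
    using e(1) assms by (intro mult_left_mono member_le_sum) auto
  finally show ?thesis .
qed simp

lemma gauss_cubes_integrable:
  assumes "finite E" shows "integrable (gauss E) (\<lambda>\<xi>. real (card E) ^ 3 * (\<Sum>e\<in>E. \<bar>\<xi> e\<bar> ^ 3))"
  using gauss_component_integrable[OF _ std_normal_moments(2)[of 3]]
  by (intro integrable_mult_right Bochner_Integration.integrable_sum) auto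

lemma gauss_cube_bound:
  assumes "finite E"
  shows "(\<integral>\<xi>. (\<Sum>e\<in>E. \<bar>\<xi> e\<bar>) ^ 3 \<partial>gauss E) \<le> real (card E) ^ 4 * (\<integral>x. \<bar>x\<bar> ^ 3 \<partial>std_normal)"
proof -
  have m: "(\<lambda>x::real. \<bar>x\<bar> ^ 3) \<in> borel_measurable borel" by simp
  have int: "integrable (gauss E) (\<lambda>\<xi>. \<bar>\<xi> e\<bar> ^ 3)" "(\<integral>\<xi>. \<bar>\<xi> e\<bar> ^ 3 \<partial>gauss E) = (\<integral>x. \<bar>x\<bar> ^ 3 \<partial>std_normal)" if "e \<in> E" for e
    by (rule gauss_component_integrable[OF that std_normal_moments(2)], rule gauss_component_integral[OF that m])
  have "(\<integral>\<xi>. (\<Sum>e\<in>E. \<bar>\<xi> e\<bar>) ^ 3 \<partial>gauss E) \<le> (\<integral>\<xi>. real (card E) ^ 3 * (\<Sum>e\<in>E. \<bar>\<xi> e\<bar> ^ 3) \<partial>gauss E)"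
    by (rule integral_mono'[OF gauss_cubes_integrable[OF assms] cube_sum_bound[OF assms]]) (simp add: sum_nonneg)
  also have "\<dots> = real (card E) ^ 4 * (\<integral>x. \<bar>x\<bar> ^ 3 \<partial>std_normal)"
    using int by (simp add: Bochner_Integration.integral_sum power4_eq_xxxx power3_eq_cube)
  finally show ?thesis .
qed

text \<open>One small independent Gaussian increment: its effect on the smoothed maximum is, to leading order,
  determined by the squared distances of the increments.\<close>

lemma smax_gaussian_step:
  fixes s :: "'x \<Rightarrow> 'e \<Rightarrow> real" and w :: "'e \<Rightarrow> real"
  assumes X: "finite X" "X \<noteq> {}" and \<beta>: "0 < \<beta>" and E: "finite E" and s: "\<And>x e. \<bar>s x e\<bar> \<le> 1"
    and w: "\<And>e. e \<in> E \<Longrightarrow> 0 \<le> w e \<and> w e \<le> W" and h: "0 \<le> h"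
  defines "B \<equiv> (\<integral>\<xi>. (\<Sum>e\<in>E. \<bar>\<xi> e\<bar>) ^ 3 \<partial>gauss E)"
  shows "integrable (gauss E) (\<lambda>\<xi>. smax \<beta> X (\<lambda>x. H x + (\<Sum>e\<in>E. sqrt (h * w e) * \<xi> e * s x e)))"
    and "\<bar>(\<integral>\<xi>. smax \<beta> X (\<lambda>x. H x + (\<Sum>e\<in>E. sqrt (h * w e) * \<xi> e * s x e)) \<partial>gauss E) - smax \<beta> X H
      - h * \<beta> / 4 * (\<Sum>x\<in>X. \<Sum>y\<in>X. gibbs \<beta> X H x * gibbs \<beta> X H y * (\<Sum>e\<in>E. w e * (s x e - s y e)\<^sup>2))\<bar>
      \<le> \<beta>\<^sup>2 * (sqrt (h * W)) ^ 3 * B"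
proof -
  interpret prob_space "gauss E" by (rule prob_space_gauss)
  let ?D = "\<lambda>\<xi> x. \<Sum>e\<in>E. sqrt (h * w e) * \<xi> e * s x e"
  let ?F = "\<lambda>\<xi>. smax \<beta> X (\<lambda>x. H x + ?D \<xi> x)"
  let ?p = "gibbs \<beta> X H"
  let ?L = "\<lambda>\<xi>. \<Sum>x\<in>X. ?p x * ?D \<xi> x"
  let ?V = "\<lambda>\<xi>. \<Sum>x\<in>X. \<Sum>y\<in>X. ?p x * ?p y * (?D \<xi> x - ?D \<xi> y)\<^sup>2"
  let ?C = "\<lambda>\<xi>. (\<Sum>e\<in>E. \<bar>\<xi> e\<bar>) ^ 3"
  have Db: "\<bar>?D \<xi> x\<bar> \<le> sqrt (h * W) * (\<Sum>e\<in>E. \<bar>\<xi> e\<bar>)" for \<xi> x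
  proof -
    have "\<bar>?D \<xi> x\<bar> \<le> (\<Sum>e\<in>E. \<bar>sqrt (h * w e) * \<xi> e * s x e\<bar>)" by (rule sum_abs)
    also have "\<dots> \<le> (\<Sum>e\<in>E. sqrt (h * W) * \<bar>\<xi> e\<bar>)"
    proof (rule sum_mono)
      fix e assume e: "e \<in> E"
      have "sqrt (h * w e) \<le> sqrt (h * W)" using w[OF e] h by (intro real_sqrt_le_mono mult_left_mono) auto
      then have "\<bar>sqrt (h * w e)\<bar> * \<bar>\<xi> e\<bar> * \<bar>s x e\<bar> \<le> sqrt (h * W) * \<bar>\<xi> e\<bar> * 1"
        using s[of x e] w[OF e] h by (intro mult_mono) auto
      then show "\<bar>sqrt (h * w e) * \<xi> e * s x e\<bar> \<le> sqrt (h * W) * \<bar>\<xi> e\<bar>" by (simp add: abs_mult)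
    qed
    finally show ?thesis by (simp add: sum_distrib_left)
  qed
  have mxi: "(\<lambda>\<xi>. \<xi> e) \<in> borel_measurable (gauss E)" if "e \<in> E" for e using that by (rule gauss_comp_measurable)
  have mD: "(\<lambda>\<xi>. ?D \<xi> x) \<in> borel_measurable (gauss E)" for x
    using mxi by (intro borel_measurable_sum borel_measurable_times borel_measurable_const)
  have mF: "?F \<in> borel_measurable (gauss E)"
    unfolding smax_def
    by (intro borel_measurable_divide borel_measurable_ln borel_measurable_sum borel_measurable_const
        measurable_compose[OF _ borel_measurable_exp] borel_measurable_times borel_measurable_add mD)
  have cub: "integrable (gauss E) ?C"
  proof (rule Bochner_Integration.integrable_bound[OF gauss_cubes_integrable[OF E]])
    show "?C \<in> borel_measurable (gauss E)"
      using mxi by (intro borel_measurable_power borel_measurable_sum borel_measurable_abs)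
    show "AE \<xi> in gauss E. norm (?C \<xi>) \<le> norm (real (card E) ^ 3 * (\<Sum>e\<in>E. \<bar>\<xi> e\<bar> ^ 3))"
      using cube_sum_bound[OF E] by (intro AE_I2) (simp add: sum_nonneg)
  qed
  have iL: "integrable (gauss E) ?L" "(\<integral>\<xi>. ?L \<xi> \<partial>gauss E) = 0"
  proof -
    have *: "integrable (gauss E) (\<lambda>\<xi>. \<xi> e)" "(\<integral>\<xi>. \<xi> e \<partial>gauss E) = 0" if "e \<in> E" for e
      using gauss_component_integrable[OF that std_normal_integrable] gauss_component_integral[OF that, of "\<lambda>x. x"] std_normal_moments(3) by auto
    show "integrable (gauss E) ?L"
      using * by (intro Bochner_Integration.integrable_sum integrable_mult_right integrable_mult_left) auto
    show "(\<integral>\<xi>. ?L \<xi> \<partial>gauss E) = 0"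
      using * by (simp add: Bochner_Integration.integral_sum)
  qed
  have ee: "integrable (gauss E) (\<lambda>\<xi>. \<xi> e * \<xi> f)" "(\<integral>\<xi>. \<xi> e * \<xi> f \<partial>gauss E) = (if e = f then 1 else 0)" if "e \<in> E" "f \<in> E" for e f
  proof -
    have sq: "integrable (gauss E) (\<lambda>\<xi>. (\<xi> e)\<^sup>2)" if "e \<in> E" for e
      using gauss_component_integrable[OF that std_normal_moments(1)[of 2]] .
    show "integrable (gauss E) (\<lambda>\<xi>. \<xi> e * \<xi> f)"
    proof (rule Bochner_Integration.integrable_bound[where f="\<lambda>\<xi>. (\<xi> e)\<^sup>2 + (\<xi> f)\<^sup>2"])
      show "AE \<xi> in gauss E. norm (\<xi> e * \<xi> f) \<le> norm ((\<xi> e)\<^sup>2 + (\<xi> f)\<^sup>2)"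
      proof (rule AE_I2)
        fix \<xi> :: "'e \<Rightarrow> real"
        have "0 \<le> (\<bar>\<xi> e\<bar> - \<bar>\<xi> f\<bar>)\<^sup>2" by simp
        then have "2 * (\<bar>\<xi> e\<bar> * \<bar>\<xi> f\<bar>) \<le> (\<xi> e)\<^sup>2 + (\<xi> f)\<^sup>2" by (simp add: power2_diff)
        moreover have "0 \<le> \<bar>\<xi> e\<bar> * \<bar>\<xi> f\<bar>" by simp
        ultimately show "norm (\<xi> e * \<xi> f) \<le> norm ((\<xi> e)\<^sup>2 + (\<xi> f)\<^sup>2)" unfolding real_norm_def abs_mult by linarith
      qed
    qed (use sq that mxi in \<open>auto intro: borel_measurable_times\<close>)
    show "(\<integral>\<xi>. \<xi> e * \<xi> f \<partial>gauss E) = (if e = f then 1 else 0)"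
    proof (cases "e = f")
      case True
      then show ?thesis using gauss_component_integral[OF that(1), of "\<lambda>x. x ^ 2"] std_normal_moments(4) by (simp add: power2_eq_square)
    next
      case False
      let ?h = "\<lambda>k x. if k = e \<or> k = f then x else 1 :: real"
      have "(\<integral>\<xi>. (\<Prod>k\<in>E. ?h k (\<xi> k)) \<partial>gauss E) = (\<Prod>k\<in>E. (\<integral>x. ?h k x \<partial>std_normal))"
        unfolding gauss_def
      proof (rule gauss.product_integral_prod[OF E])
        fix k
        show "integrable std_normal (?h k)"
          using std_normal_integrable by (cases "k = e \<or> k = f") simp_all
      qed
      also have "\<dots> = 0"
        using E that(1) std_normal_moments(3) by (intro prod_zero bexI[of _ e]) auto
      also have "(\<lambda>\<xi>. \<Prod>k\<in>E. ?h k (\<xi> k)) = (\<lambda>\<xi>. \<xi> e * \<xi> f)"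
      proof
        fix \<xi> :: "'e \<Rightarrow> real"
        have "(\<Prod>k\<in>E. ?h k (\<xi> k)) = (\<Prod>k\<in>{e,f}. ?h k (\<xi> k))"
          using E that by (intro prod.mono_neutral_right) auto
        then show "(\<Prod>k\<in>E. ?h k (\<xi> k)) = \<xi> e * \<xi> f" using False by simp
      qed
      finally show ?thesis using False by simp
    qed
  qed
  \<comment> \<open>Second order: orthogonality of the coordinates leaves the squared distances,
    weighted by \<open>h * w e\<close>.\<close>
  have iD: "integrable (gauss E) (\<lambda>\<xi>. (?D \<xi> x - ?D \<xi> y)\<^sup>2)"
    "(\<integral>\<xi>. (?D \<xi> x - ?D \<xi> y)\<^sup>2 \<partial>gauss E) = h * (\<Sum>e\<in>E. w e * (s x e - s y e)\<^sup>2)" for x y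
  proof -
    let ?c = "\<lambda>e. sqrt (h * w e) * (s x e - s y e)"
    have eq: "(?D \<xi> x - ?D \<xi> y)\<^sup>2 = (\<Sum>e\<in>E. \<Sum>f\<in>E. (?c e * ?c f) * (\<xi> e * \<xi> f))" for \<xi>
    proof -
      have "?D \<xi> x - ?D \<xi> y = (\<Sum>e\<in>E. ?c e * \<xi> e)"
        unfolding sum_subtractf[symmetric] by (intro sum.cong refl) (simp add: algebra_simps)
      then show ?thesis by (simp only: power2_eq_square sum_product) (simp add: mult_ac)
    qed
    show "integrable (gauss E) (\<lambda>\<xi>. (?D \<xi> x - ?D \<xi> y)\<^sup>2)"
      unfolding eq using ee(1) by (intro Bochner_Integration.integrable_sum integrable_mult_right) auto
    have "(\<integral>\<xi>. (?D \<xi> x - ?D \<xi> y)\<^sup>2 \<partial>gauss E) = (\<Sum>e\<in>E. \<Sum>f\<in>E. (?c e * ?c f) * (\<integral>\<xi>. \<xi> e * \<xi> f \<partial>gauss E))"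
      unfolding eq using ee(1) by (simp add: Bochner_Integration.integral_sum Bochner_Integration.integrable_sum)
    also have "\<dots> = (\<Sum>e\<in>E. \<Sum>f\<in>E. if e = f then ?c e * ?c f else 0)"
      using ee(2) by (intro sum.cong refl) auto
    also have "\<dots> = (\<Sum>e\<in>E. ?c e * ?c e)" using E by simp
    also have "\<dots> = (\<Sum>e\<in>E. h * (w e * (s x e - s y e)\<^sup>2))"
    proof (intro sum.cong refl)
      fix e assume "e \<in> E"
      then have "sqrt (h * w e) * sqrt (h * w e) = h * w e" using w h by simp
      then show "?c e * ?c e = h * (w e * (s x e - s y e)\<^sup>2)"
        by (simp add: power2_eq_square mult_ac)
    qed
    finally show "(\<integral>\<xi>. (?D \<xi> x - ?D \<xi> y)\<^sup>2 \<partial>gauss E) = h * (\<Sum>e\<in>E. w e * (s x e - s y e)\<^sup>2)"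
      by (simp add: sum_distrib_left)
  qed
  have iV: "integrable (gauss E) ?V" "(\<integral>\<xi>. ?V \<xi> \<partial>gauss E) = h * (\<Sum>x\<in>X. \<Sum>y\<in>X. ?p x * ?p y * (\<Sum>e\<in>E. w e * (s x e - s y e)\<^sup>2))"
  proof -
    show "integrable (gauss E) ?V" by (intro Bochner_Integration.integrable_sum integrable_mult_right iD(1))
    have "(\<integral>\<xi>. ?V \<xi> \<partial>gauss E) = (\<Sum>x\<in>X. \<Sum>y\<in>X. ?p x * ?p y * (\<integral>\<xi>. (?D \<xi> x - ?D \<xi> y)\<^sup>2 \<partial>gauss E))"
      using iD(1) by (simp only: Bochner_Integration.integral_sum Bochner_Integration.integrable_sum integrable_mult_right integral_mult_right_zero)
    then show "(\<integral>\<xi>. ?V \<xi> \<partial>gauss E) = h * (\<Sum>x\<in>X. \<Sum>y\<in>X. ?p x * ?p y * (\<Sum>e\<in>E. w e * (s x e - s y e)\<^sup>2))"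
      unfolding iD(2) by (simp add: sum_distrib_left mult_ac)
  qed
  let ?G = "\<lambda>\<xi>. smax \<beta> X H + ?L \<xi> + \<beta> / 4 * ?V \<xi>"
  let ?R = "\<lambda>\<xi>. \<beta>\<^sup>2 * (sqrt (h * W)) ^ 3 * ?C \<xi>"
  have pt: "\<bar>?F \<xi> - ?G \<xi>\<bar> \<le> ?R \<xi>" for \<xi>
    using smax_step[where D="?D \<xi>" and H=H, OF X \<beta> Db] by (simp add: power_mult_distrib algebra_simps)
  have iG: "integrable (gauss E) ?G" using iL(1) iV(1) by simp
  have iR: "integrable (gauss E) ?R" using cub by simp
  show iF: "integrable (gauss E) ?F"
  proof (rule Bochner_Integration.integrable_bound[where f="\<lambda>\<xi>. \<bar>?G \<xi>\<bar> + ?R \<xi>"])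
    show "integrable (gauss E) (\<lambda>\<xi>. \<bar>?G \<xi>\<bar> + ?R \<xi>)" by (rule Bochner_Integration.integrable_add[OF integrable_abs[OF iG] iR])
    show "AE \<xi> in gauss E. norm (?F \<xi>) \<le> norm (\<bar>?G \<xi>\<bar> + ?R \<xi>)"
    proof (rule AE_I2)
      fix \<xi> show "norm (?F \<xi>) \<le> norm (\<bar>?G \<xi>\<bar> + ?R \<xi>)"
        unfolding real_norm_def using pt[of \<xi>] by linarith
    qed
  qed (rule mF)
  have "\<bar>(\<integral>\<xi>. ?F \<xi> - ?G \<xi> \<partial>gauss E)\<bar> \<le> (\<integral>\<xi>. \<bar>?F \<xi> - ?G \<xi>\<bar> \<partial>gauss E)" by (rule integral_abs_bound)
  also have "\<dots> \<le> (\<integral>\<xi>. ?R \<xi> \<partial>gauss E)"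
    by (intro integral_mono[OF integrable_abs[OF Bochner_Integration.integrable_diff[OF iF iG]] iR] pt)
  also have "\<dots> = \<beta>\<^sup>2 * (sqrt (h * W)) ^ 3 * B" by (simp add: B_def)
  also have "(\<integral>\<xi>. ?F \<xi> - ?G \<xi> \<partial>gauss E) = (\<integral>\<xi>. ?F \<xi> \<partial>gauss E) - (\<integral>\<xi>. ?G \<xi> \<partial>gauss E)"
    by (rule Bochner_Integration.integral_diff[OF iF iG])
  also have "(\<integral>\<xi>. ?G \<xi> \<partial>gauss E) = smax \<beta> X H + \<beta> / 4 * (h * (\<Sum>x\<in>X. \<Sum>y\<in>X. ?p x * ?p y * (\<Sum>e\<in>E. w e * (s x e - s y e)\<^sup>2)))"
  proof -
    have "(\<integral>\<xi>. ?G \<xi> \<partial>gauss E) = smax \<beta> X H + (\<integral>\<xi>. ?L \<xi> \<partial>gauss E) + \<beta> / 4 * (\<integral>\<xi>. ?V \<xi> \<partial>gauss E)"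
      using integral_affine_add[OF iL(1) integrable_mult_right[OF iV(1), of "\<beta> / 4"], of "smax \<beta> X H" 1]
      by (simp only: mult_1 integral_mult_right_zero)
    then show ?thesis unfolding iL(2) iV(2) by simp
  qed
  finally show "\<bar>(\<integral>\<xi>. ?F \<xi> \<partial>gauss E) - smax \<beta> X H
      - h * \<beta> / 4 * (\<Sum>x\<in>X. \<Sum>y\<in>X. ?p x * ?p y * (\<Sum>e\<in>E. w e * (s x e - s y e)\<^sup>2))\<bar>
      \<le> \<beta>\<^sup>2 * (sqrt (h * W)) ^ 3 * B"
    by (simp add: algebra_simps)
qed

definition smean :: "real \<Rightarrow> 'x set \<Rightarrow> 'e set \<Rightarrow> ('e \<Rightarrow> real) \<Rightarrow> ('x \<Rightarrow> 'e \<Rightarrow> real) \<Rightarrow> real" where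
  "smean \<beta> X E w s = (\<integral>\<omega>. smax \<beta> X (\<lambda>x. \<Sum>e\<in>E. sqrt (w e) * \<omega> e * s x e) \<partial>gauss E)"

lemma smax_integrable:
  assumes X: "finite X" "X \<noteq> {}" and \<beta>: "0 < \<beta>" and E: "finite E" and s: "\<And>x e. \<bar>s x e\<bar> \<le> 1"
    and w: "\<And>e. e \<in> E \<Longrightarrow> 0 \<le> w e \<and> w e \<le> W"
  shows "integrable (gauss E) (\<lambda>\<omega>. smax \<beta> X (\<lambda>x. \<Sum>e\<in>E. sqrt (w e) * \<omega> e * s x e))"
proof -
  have "integrable (gauss E) (\<lambda>\<xi>. smax \<beta> X (\<lambda>x. (\<lambda>_. 0) x + (\<Sum>e\<in>E. sqrt (1 * w e) * \<xi> e * s x e)))"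
    by (rule smax_gaussian_step(1)[OF X \<beta> E s w]) auto
  then show ?thesis by simp
qed

text \<open>Conditionally on the coordinates in \<open>I\<close>, the two choices of weights on
  \<open>J\<close> start from the same value. Their expansions differ in the quadratic term, which
  is monotone in the squared distances because Gibbs weights are nonnegative, and in two error
  terms.\<close>

lemma smean_step:
  assumes X: "finite X" "X \<noteq> {}" and \<beta>: "0 < \<beta>" and fin: "finite I" "finite J" and IJ: "I \<inter> J = {}"
    and s: "\<And>x e. \<bar>s x e\<bar> \<le> 1" and h: "0 \<le> h"
    and w: "\<And>e. e \<in> I \<union> J \<Longrightarrow> 0 \<le> w e \<and> w e \<le> W" and v: "\<And>e. e \<in> I \<union> J \<Longrightarrow> 0 \<le> v e \<and> v e \<le> W"
    and eq: "\<And>e. e \<in> I \<Longrightarrow> w e = v e"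
    and le: "\<And>x y. x \<in> X \<Longrightarrow> y \<in> X \<Longrightarrow> (\<Sum>e\<in>J. w e * (s x e - s y e)\<^sup>2) \<le> (\<Sum>e\<in>J. v e * (s x e - s y e)\<^sup>2)"
  shows "smean \<beta> X (I \<union> J) (\<lambda>e. h * w e) s
    \<le> smean \<beta> X (I \<union> J) (\<lambda>e. h * v e) s + 2 * (\<beta>\<^sup>2 * (sqrt (h * W)) ^ 3 * (\<integral>\<xi>. (\<Sum>e\<in>J. \<bar>\<xi> e\<bar>) ^ 3 \<partial>gauss J))"
proof -
  interpret I: prob_space "gauss I" by (rule prob_space_gauss)
  let ?R = "\<beta>\<^sup>2 * (sqrt (h * W)) ^ 3 * (\<integral>\<xi>. (\<Sum>e\<in>J. \<bar>\<xi> e\<bar>) ^ 3 \<partial>gauss J)"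
  let ?f = "\<lambda>u \<omega>. smax \<beta> X (\<lambda>x. \<Sum>e\<in>I\<union>J. sqrt (h * u e) * \<omega> e * s x e)"
  let ?g = "\<lambda>u \<xi>. \<integral>\<eta>. smax \<beta> X (\<lambda>x. (\<Sum>e\<in>I. sqrt (h * v e) * \<xi> e * s x e) + (\<Sum>e\<in>J. sqrt (h * u e) * \<eta> e * s x e)) \<partial>gauss J"
  have hb: "0 \<le> h * u e \<and> h * u e \<le> h * W" if "0 \<le> u e \<and> u e \<le> W" for u :: "'b \<Rightarrow> real" and e
    using that h by (auto intro: mult_left_mono)
  have split: "?f u (merge I J (\<xi>, \<eta>)) = smax \<beta> X (\<lambda>x. (\<Sum>e\<in>I. sqrt (h * v e) * \<xi> e * s x e) + (\<Sum>e\<in>J. sqrt (h * u e) * \<eta> e * s x e))"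
    if "\<And>e. e \<in> I \<Longrightarrow> u e = v e" for u \<xi> \<eta>
  proof -
    have "(\<Sum>e\<in>I\<union>J. sqrt (h * u e) * merge I J (\<xi>, \<eta>) e * s x e) = (\<Sum>e\<in>I. sqrt (h * v e) * \<xi> e * s x e) + (\<Sum>e\<in>J. sqrt (h * u e) * \<eta> e * s x e)" for x
      unfolding sum.union_disjoint[OF fin IJ] using that IJ
      by (intro arg_cong2[where f="(+)"] sum.cong refl) (auto simp: merge_def)
    then show ?thesis by simp
  qed
  have fold: "smean \<beta> X (I \<union> J) (\<lambda>e. h * u e) s = (\<integral>\<xi>. ?g u \<xi> \<partial>gauss I)" "integrable (gauss I) (?g u)"
    if u: "\<And>e. e \<in> I \<union> J \<Longrightarrow> 0 \<le> u e \<and> u e \<le> W" and uv: "\<And>e. e \<in> I \<Longrightarrow> u e = v e" for u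
  proof -
    have int: "integrable (gauss (I \<union> J)) (?f u)"
    proof (rule smax_integrable[OF X \<beta> _ s])
      show "finite (I \<union> J)" using fin by simp
      show "0 \<le> h * u e \<and> h * u e \<le> h * W" if "e \<in> I \<union> J" for e by (rule hb[of u e, OF u[OF that]])
    qed
    have sp: "?f u (merge I J (\<xi>, \<eta>)) = smax \<beta> X (\<lambda>x. (\<Sum>e\<in>I. sqrt (h * v e) * \<xi> e * s x e) + (\<Sum>e\<in>J. sqrt (h * u e) * \<eta> e * s x e))" for \<xi> \<eta>
      by (rule split) (rule uv)
    show "smean \<beta> X (I \<union> J) (\<lambda>e. h * u e) s = (\<integral>\<xi>. ?g u \<xi> \<partial>gauss I)"
      unfolding smean_def gauss_fold[OF IJ fin int] sp ..
    show "integrable (gauss I) (?g u)"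
      using gauss_fold_integrable[OF IJ fin int] unfolding sp .
  qed
  have pt: "?g w \<xi> \<le> ?g v \<xi> + 2 * ?R" for \<xi>
  proof -
    let ?H = "\<lambda>x. \<Sum>e\<in>I. sqrt (h * v e) * \<xi> e * s x e"
    let ?Q = "\<lambda>u. h * \<beta> / 4 * (\<Sum>x\<in>X. \<Sum>y\<in>X. gibbs \<beta> X ?H x * gibbs \<beta> X ?H y * (\<Sum>e\<in>J. u e * (s x e - s y e)\<^sup>2))"
    have 1: "\<bar>?g w \<xi> - smax \<beta> X ?H - ?Q w\<bar> \<le> ?R"
      by (rule smax_gaussian_step(2)[OF X \<beta> fin(2) s _ h]) (use w in auto)
    have 2: "\<bar>?g v \<xi> - smax \<beta> X ?H - ?Q v\<bar> \<le> ?R"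
      by (rule smax_gaussian_step(2)[OF X \<beta> fin(2) s _ h]) (use v in auto)
    have "?Q w \<le> ?Q v"
      by (rule mult_left_mono[OF sum_mono[OF sum_mono[OF mult_left_mono[OF le]]]])
        (use gibbs_props(1)[OF X] h \<beta> in \<open>auto intro: mult_nonneg_nonneg\<close>)
    then show ?thesis using 1 2 by linarith
  qed
  have "(\<integral>\<xi>. ?g w \<xi> \<partial>gauss I) \<le> (\<integral>\<xi>. ?g v \<xi> + 2 * ?R \<partial>gauss I)"
    by (intro integral_mono pt Bochner_Integration.integrable_add fold(2) I.integrable_const) (use w v eq in auto)
  also have "\<dots> = (\<integral>\<xi>. ?g v \<xi> \<partial>gauss I) + 2 * ?R"
    using fold(2)[of v] v by (subst Bochner_Integration.integral_add) (auto simp: I.prob_space)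
  finally show ?thesis using fold(1)[of w] fold(1)[of v] w v eq by simp
qed

section \<open>Comparison by exchanging thin layers of coordinates\<close>

text \<open>Every coordinate is written as a sum of \<open>N\<close> independent pieces of variance
  \<open>1 / N\<close>. This discretises the usual continuous interpolation between two Gaussian
  families.\<close>

lemma gauss_block_law:
  assumes E: "finite E" "E \<noteq> {}" and N: "0 < (N::nat)"
  shows "distr (gauss (E \<times> {..<N})) (PiM E (\<lambda>_. borel)) (\<lambda>\<omega>. \<lambda>e\<in>E. \<Sum>p\<in>{e} \<times> {..<N}. sqrt (1 / N) * \<omega> p) = gauss E"
proof -
  have "distr (gauss (E \<times> {..<N})) (PiM E (\<lambda>_. borel)) (\<lambda>\<omega>. \<lambda>e\<in>E. \<Sum>p\<in>{e} \<times> {..<N}. sqrt (1 / N) * \<omega> p)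
     = PiM E (\<lambda>i. scaled_normal (sqrt (\<Sum>j\<in>{i} \<times> {..<N}. (sqrt (1 / N))\<^sup>2)))"
    by (rule gauss_linear_forms[OF E]) (use N in \<open>auto simp: disjoint_family_on_def\<close>)
  also have "\<dots> = gauss E"
    unfolding gauss_def using N by (intro PiM_cong) (simp_all add: scaled_normal_1)
  finally show ?thesis .
qed

lemma smean_blocks:
  assumes X: "finite X" and E: "finite E" "E \<noteq> {}" and N: "0 < (N::nat)"
    and w: "\<And>e. e \<in> E \<Longrightarrow> 0 \<le> w e"
  shows "smean \<beta> X (E \<times> {..<N}) (\<lambda>p. 1 / N * w (fst p)) (\<lambda>x p. s x (fst p)) = smean \<beta> X E w s"
proof -
  let ?T = "\<lambda>\<omega>. \<lambda>e\<in>E. \<Sum>p\<in>{e} \<times> {..<N}. sqrt (1 / N) * \<omega> p"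
  let ?f = "\<lambda>z. smax \<beta> X (\<lambda>x. \<Sum>e\<in>E. sqrt (w e) * z e * s x e)"
  have mT: "?T \<in> gauss (E \<times> {..<N}) \<rightarrow>\<^sub>M PiM E (\<lambda>_. borel)"
    by (intro measurable_restrict borel_measurable_sum borel_measurable_times borel_measurable_const gauss_comp_measurable) auto
  have mf: "?f \<in> borel_measurable (PiM E (\<lambda>_. borel))"
    unfolding smax_def by (intro borel_measurable_divide borel_measurable_ln borel_measurable_sum measurable_compose[OF _ borel_measurable_exp]
       borel_measurable_times borel_measurable_const measurable_component_singleton)
  have "smean \<beta> X E w s = (\<integral>z. ?f z \<partial>distr (gauss (E \<times> {..<N})) (PiM E (\<lambda>_. borel)) ?T)"
    unfolding gauss_block_law[OF E N] smean_def ..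
  also have "\<dots> = (\<integral>\<omega>. ?f (?T \<omega>) \<partial>gauss (E \<times> {..<N}))" by (rule integral_distr[OF mT mf])
  also have "(\<lambda>\<omega>. ?f (?T \<omega>)) = (\<lambda>\<omega>. smax \<beta> X (\<lambda>x. \<Sum>p\<in>E \<times> {..<N}. sqrt (1 / N * w (fst p)) * \<omega> p * s x (fst p)))"
  proof (intro ext arg_cong[where f="smax \<beta> X"])
    fix \<omega> x
    have "(\<Sum>p\<in>E \<times> {..<N}. sqrt (1 / N * w (fst p)) * \<omega> p * s x (fst p)) = (\<Sum>e\<in>E. \<Sum>k<N. sqrt (1 / N * w e) * \<omega> (e, k) * s x e)"
      by (subst sum.cartesian_product) (auto intro: sum.cong)
    also have "\<dots> = (\<Sum>e\<in>E. sqrt (w e) * ?T \<omega> e * s x e)"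
    proof (intro sum.cong refl)
      fix e assume e: "e \<in> E"
      have "(\<Sum>p\<in>{e} \<times> {..<N}. sqrt (1 / N) * \<omega> p) = (\<Sum>k<N. sqrt (1 / N) * \<omega> (e, k))"
        using sum.cartesian_product[of "\<lambda>a k. sqrt (1 / N) * \<omega> (a, k)" "{..<N}" "{e}"] by (simp add: split_beta)
      then show "(\<Sum>k<N. sqrt (1 / N * w e) * \<omega> (e, k) * s x e) = sqrt (w e) * ?T \<omega> e * s x e"
        unfolding restrict_apply'[OF e] real_sqrt_mult by (simp add: sum_distrib_left sum_distrib_right mult_ac)
    qed
    finally show "(\<Sum>e\<in>E. sqrt (w e) * ?T \<omega> e * s x e) = (\<Sum>p\<in>E \<times> {..<N}. sqrt (1 / N * w (fst p)) * \<omega> p * s x (fst p))" ..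
  qed
  finally show ?thesis unfolding smean_def ..
qed

text \<open>Passing from one family of weights to the other one thin layer of coordinates at a time: each layer
  contributes an error of order \<open>N powr (-3/2)\<close>.\<close>

lemma smean_comparison:
  assumes X: "finite X" "X \<noteq> {}" and \<beta>: "0 < \<beta>" and E: "finite E" "E \<noteq> {}" and s: "\<And>x e. \<bar>s x e\<bar> \<le> 1"
    and b: "\<And>e. e \<in> E \<Longrightarrow> 0 \<le> b e \<and> b e \<le> W" and a: "\<And>e. e \<in> E \<Longrightarrow> 0 \<le> a e \<and> a e \<le> W"
    and le: "\<And>x y. x \<in> X \<Longrightarrow> y \<in> X \<Longrightarrow> (\<Sum>e\<in>E. b e * (s x e - s y e)\<^sup>2) \<le> (\<Sum>e\<in>E. a e * (s x e - s y e)\<^sup>2)"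
  shows "smean \<beta> X E b s \<le> smean \<beta> X E a s"
proof -
  define K where "K = real (card E) ^ 4 * (\<integral>x. \<bar>x\<bar> ^ 3 \<partial>std_normal)"
  have W: "0 \<le> W" using b E by fastforce
  have bound: "smean \<beta> X E b s \<le> smean \<beta> X E a s + 2 * \<beta>\<^sup>2 * (sqrt W ^ 3 * K) * inverse (sqrt (real N))" if N: "0 < N" for N :: nat
  proof -
    let ?s = "\<lambda>x (p::'b \<times> nat). s x (fst p)"
    \<comment> \<open>The layers below \<open>m\<close> already carry the weights \<open>a\<close>,
      the others still carry \<open>b\<close>.\<close>
    let ?w = "\<lambda>m (p::'b \<times> nat). if snd p < m then a (fst p) else b (fst p)"
    let ?F = "\<lambda>m. smean \<beta> X (E \<times> {..<N}) (\<lambda>p. 1 / N * ?w m p) ?s"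
    let ?r = "2 * (\<beta>\<^sup>2 * (sqrt (1 / N * W)) ^ 3 * K)"
    have step: "?F m \<le> ?F (Suc m) + ?r" if m: "m < N" for m
    proof -
      have U: "E \<times> {..<N} = E \<times> ({..<N} - {m}) \<union> E \<times> {m}" using m by auto
      have Q: "(\<Sum>p\<in>E \<times> {m}. u (fst p) * (?s x p - ?s y p)\<^sup>2) = (\<Sum>e\<in>E. u e * (s x e - s y e)\<^sup>2)" for u :: "'b \<Rightarrow> real" and x y
        by (rule sum.reindex_bij_witness[of _ "\<lambda>e. (e, m)" fst]) auto
      have w1: "(\<Sum>p\<in>E \<times> {m}. ?w m p * (?s x p - ?s y p)\<^sup>2) = (\<Sum>p\<in>E \<times> {m}. b (fst p) * (?s x p - ?s y p)\<^sup>2)" for x y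
        by (rule sum.cong) auto
      have w2: "(\<Sum>p\<in>E \<times> {m}. ?w (Suc m) p * (?s x p - ?s y p)\<^sup>2) = (\<Sum>p\<in>E \<times> {m}. a (fst p) * (?s x p - ?s y p)\<^sup>2)" for x y
        by (rule sum.cong) auto
      have "?F m \<le> ?F (Suc m) + 2 * (\<beta>\<^sup>2 * (sqrt (1 / N * W)) ^ 3 * (\<integral>\<xi>. (\<Sum>p\<in>E \<times> {m}. \<bar>\<xi> p\<bar>) ^ 3 \<partial>gauss (E \<times> {m})))"
        unfolding U
      proof (rule smean_step[OF X \<beta>])
        fix x y assume "x \<in> X" "y \<in> X"
        then show "(\<Sum>p\<in>E \<times> {m}. ?w m p * (?s x p - ?s y p)\<^sup>2) \<le> (\<Sum>p\<in>E \<times> {m}. ?w (Suc m) p * (?s x p - ?s y p)\<^sup>2)"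
          unfolding w1 w2 Q by (rule le)
      qed (use E a b s in auto)
      also have "\<dots> \<le> ?F (Suc m) + ?r"
      proof -
        have "(\<integral>\<xi>. (\<Sum>p\<in>E \<times> {m}. \<bar>\<xi> p\<bar>) ^ 3 \<partial>gauss (E \<times> {m})) \<le> K"
          using gauss_cube_bound[of "E \<times> {m}"] E by (simp add: K_def)
        then show ?thesis using W by (intro add_left_mono mult_left_mono) auto
      qed
      finally show ?thesis .
    qed
    have "m \<le> N \<Longrightarrow> ?F 0 \<le> ?F m + real m * ?r" for m
    proof (induction m)
      case (Suc m)
      then show ?case using step[of m] by (simp add: distrib_right)
    qed simp
    from this[of N] have "?F 0 \<le> ?F N + real N * ?r" by simp
    moreover have "?F 0 = smean \<beta> X E b s"
      using smean_blocks[OF X(1) E N, of b \<beta> s] b by simp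
    moreover have "?F N = smean \<beta> X E a s"
    proof -
      have "?F N = smean \<beta> X (E \<times> {..<N}) (\<lambda>p. 1 / N * a (fst p)) ?s"
        unfolding smean_def by (intro Bochner_Integration.integral_cong refl arg_cong[where f="smax \<beta> X"] ext sum.cong) auto
      then show ?thesis using smean_blocks[OF X(1) E N, of a \<beta> s] a by simp
    qed
    \<comment> \<open>There are \<open>N\<close> exchanges of order \<open>N powr (-3/2)\<close>
      each.\<close>
    moreover have "real N * ?r = 2 * \<beta>\<^sup>2 * (sqrt W ^ 3 * K) * inverse (sqrt (real N))"
    proof -
      define q where "q = sqrt (real N)"
      have q: "q > 0" "real N = q * q" using N by (auto simp: q_def)
      have "sqrt (1 / N * W) = sqrt W / q" by (simp add: q_def real_sqrt_divide)
      then show ?thesis using q by (simp add: q_def[symmetric] power_divide power3_eq_cube field_simps)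
    qed
    ultimately show ?thesis by linarith
  qed
  show ?thesis
  proof (rule tendsto_lowerbound[where F=sequentially])
    have "(\<lambda>N. inverse (sqrt (real N))) \<longlonglongrightarrow> 0"
      by (intro tendsto_inverse_0_at_top filterlim_compose[OF sqrt_at_top] filterlim_real_sequentially)
    then have "(\<lambda>N. smean \<beta> X E a s + 2 * \<beta>\<^sup>2 * (sqrt W ^ 3 * K) * inverse (sqrt (real N))) \<longlonglongrightarrow> smean \<beta> X E a s + 2 * \<beta>\<^sup>2 * (sqrt W ^ 3 * K) * 0"
      by (intro tendsto_intros)
    then show "(\<lambda>N. smean \<beta> X E a s + 2 * \<beta>\<^sup>2 * (sqrt W ^ 3 * K) * inverse (sqrt (real N))) \<longlonglongrightarrow> smean \<beta> X E a s" by simp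
    show "\<forall>\<^sub>F N in sequentially. smean \<beta> X E b s \<le> smean \<beta> X E a s + 2 * \<beta>\<^sup>2 * (sqrt W ^ 3 * K) * inverse (sqrt (real N))"
      using eventually_gt_at_top[of 0] by eventually_elim (rule bound)
  qed simp
qed

text \<open>The smoothed comparison with \<open>\<beta>\<close> tending to infinity, where smoothing
  costs at most \<open>ln (card X) / \<beta>\<close>. Both families use the same coordinates and
  coefficients \<open>s\<close> and differ only in the variances; this covers two different systems,
  since each can be given variance zero on the coordinates of the other.\<close>

theorem sudakov_fernique:
  fixes s :: "'x \<Rightarrow> 'e \<Rightarrow> real"
  assumes X: "finite X" "X \<noteq> {}" and E: "finite E" "E \<noteq> {}" and s: "\<And>x e. \<bar>s x e\<bar> \<le> 1"
    and b: "\<And>e. e \<in> E \<Longrightarrow> 0 \<le> b e \<and> b e \<le> W" and a: "\<And>e. e \<in> E \<Longrightarrow> 0 \<le> a e \<and> a e \<le> W"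
    and le: "\<And>x y. x \<in> X \<Longrightarrow> y \<in> X \<Longrightarrow> (\<Sum>e\<in>E. b e * (s x e - s y e)\<^sup>2) \<le> (\<Sum>e\<in>E. a e * (s x e - s y e)\<^sup>2)"
  shows "(\<integral>\<omega>. Max ((\<lambda>x. \<Sum>e\<in>E. sqrt (b e) * \<omega> e * s x e) ` X) \<partial>gauss E) \<le> (\<integral>\<omega>. Max ((\<lambda>x. \<Sum>e\<in>E. sqrt (a e) * \<omega> e * s x e) ` X) \<partial>gauss E)"
proof -
  interpret prob_space "gauss E" by (rule prob_space_gauss)
  let ?H = "\<lambda>w \<omega> x. \<Sum>e\<in>E. sqrt (w e) * \<omega> e * s x e"
  let ?M = "\<lambda>w. \<integral>\<omega>. Max (?H w \<omega> ` X) \<partial>gauss E"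
  have meas: "(\<lambda>\<omega>. Max (?H w \<omega> ` X)) \<in> borel_measurable (gauss E)" for w
    using X by (intro borel_measurable_Max borel_measurable_sum borel_measurable_times borel_measurable_const gauss_comp_measurable) auto
  have c: "0 \<le> ln (real (card X))" using X by (simp add: Suc_le_eq card_gt_0_iff)
  have sand: "?M w \<le> smean \<beta> X E w s" "smean \<beta> X E w s \<le> ?M w + ln (card X) / \<beta>"
    if w: "\<And>e. e \<in> E \<Longrightarrow> 0 \<le> w e \<and> w e \<le> W" and \<beta>: "0 < \<beta>" for w \<beta>
  proof -
    note i = smax_integrable[OF X \<beta> E(1) s w]
    have iM: "integrable (gauss E) (\<lambda>\<omega>. Max (?H w \<omega> ` X))"
    proof (rule Bochner_Integration.integrable_bound[OF _ meas])
      show "integrable (gauss E) (\<lambda>\<omega>. \<bar>smax \<beta> X (?H w \<omega>)\<bar> + ln (card X) / \<beta>)"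
        by (rule Bochner_Integration.integrable_add[OF integrable_abs[OF i] integrable_const])
      show "AE \<omega> in gauss E. norm (Max (?H w \<omega> ` X)) \<le> norm (\<bar>smax \<beta> X (?H w \<omega>)\<bar> + ln (card X) / \<beta>)"
      proof (rule AE_I2)
        fix \<omega>
        have "0 \<le> ln (card X) / \<beta>" using c \<beta> by simp
        then show "norm (Max (?H w \<omega> ` X)) \<le> norm (\<bar>smax \<beta> X (?H w \<omega>)\<bar> + ln (card X) / \<beta>)"
          using smax_bounds[OF X \<beta>, of "?H w \<omega>"] unfolding real_norm_def by linarith
      qed
    qed
    show "?M w \<le> smean \<beta> X E w s"
      unfolding smean_def by (intro integral_mono iM i smax_bounds X \<beta>)
    have "smean \<beta> X E w s \<le> (\<integral>\<omega>. Max (?H w \<omega> ` X) + ln (card X) / \<beta> \<partial>gauss E)"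
      unfolding smean_def by (intro integral_mono i smax_bounds X \<beta> Bochner_Integration.integrable_add iM integrable_const)
    also have "\<dots> = ?M w + ln (card X) / \<beta>" using iM by (simp add: prob_space)
    finally show "smean \<beta> X E w s \<le> ?M w + ln (card X) / \<beta>" .
  qed
  show ?thesis
  proof (rule tendsto_lowerbound[where F=sequentially])
    have "(\<lambda>N. ?M a + ln (card X) * (1 / real N)) \<longlonglongrightarrow> ?M a + ln (card X) * 0"
      by (intro tendsto_intros lim_1_over_n)
    then show "(\<lambda>N. ?M a + ln (card X) / real N) \<longlonglongrightarrow> ?M a" by simp
    show "\<forall>\<^sub>F N in sequentially. ?M b \<le> ?M a + ln (card X) / real N"
      using eventually_gt_at_top[of 0]
    proof eventually_elim
      case (elim N)
      then have N: "0 < real N" by simp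
      have "?M b \<le> smean (real N) X E b s" by (rule sand(1)[OF b N])
      also have "\<dots> \<le> smean (real N) X E a s" by (rule smean_comparison[OF X N E s b a le])
      also have "\<dots> \<le> ?M a + ln (card X) / real N" by (rule sand(2)[OF a N])
      finally show ?case .
    qed
  qed simp
qed

section \<open>Superadditivity of the ground state energy\<close>

lemma gauss_reindex:
  assumes f: "inj_on f I" "f \<in> I \<rightarrow> J"
  shows "distr (gauss J) (gauss I) (\<lambda>\<omega>. \<lambda>i\<in>I. \<omega> (f i)) = gauss I"
  using distr_PiM_reindex[of J "\<lambda>_. std_normal" f I] f
  unfolding gauss_def by (simp add: std_normal.prob_space_axioms)

lemma gauss_reindex_measurable:
  assumes f: "f \<in> I \<rightarrow> J"
  shows "(\<lambda>\<omega>. \<lambda>i\<in>I. \<omega> (f i)) \<in> gauss J \<rightarrow>\<^sub>M gauss I"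
  unfolding gauss_def using f by (intro measurable_restrict measurable_component_singleton) auto

lemma gauss_reindex_integral:
  fixes F :: "('i \<Rightarrow> real) \<Rightarrow> real"
  assumes f: "inj_on f I" "f \<in> I \<rightarrow> J" and F: "F \<in> borel_measurable (gauss I)"
    and eq: "\<And>\<omega>. F (\<lambda>i\<in>I. \<omega> (f i)) = F' \<omega>"
  shows "(\<integral>\<omega>. F \<omega> \<partial>gauss I) = (\<integral>\<omega>. F' \<omega> \<partial>gauss J)" "integrable (gauss I) F \<Longrightarrow> integrable (gauss J) F'"
proof -
  note m = gauss_reindex_measurable[OF f(2)]
  have "(\<integral>\<omega>. F \<omega> \<partial>distr (gauss J) (gauss I) (\<lambda>\<omega>. \<lambda>i\<in>I. \<omega> (f i))) = (\<integral>\<omega>. F (\<lambda>i\<in>I. \<omega> (f i)) \<partial>gauss J)"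
    by (rule integral_distr[OF m F])
  then show "(\<integral>\<omega>. F \<omega> \<partial>gauss I) = (\<integral>\<omega>. F' \<omega> \<partial>gauss J)" unfolding gauss_reindex[OF f] eq .
  assume "integrable (gauss I) F"
  then have "integrable (distr (gauss J) (gauss I) (\<lambda>\<omega>. \<lambda>i\<in>I. \<omega> (f i))) F" unfolding gauss_reindex[OF f] .
  then show "integrable (gauss J) F'" using integrable_distr_eq[OF m F] unfolding eq by blast
qed

lemma max_energy_measurable_gauss: "finite V \<Longrightarrow> (\<lambda>a. max_energy \<tau> V a h) \<in> borel_measurable (gauss (pairs V))"
  by (intro max_energy_measurable gauss_comp_measurable borel_measurable_const)

definition shift :: "nat \<Rightarrow> nat \<times> nat \<Rightarrow> nat \<times> nat" where
  "shift l e = (fst e + l, snd e + l)"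

lemma shift_props: "inj_on (shift l) I" "shift l \<in> pairs {..<k} \<rightarrow> pairs {l..<l+k}"
  by (auto simp: inj_on_def shift_def pairs_def prod_eq_iff)

lemma max_energy_shift: "max_energy \<tau> {l..<l+k} a (\<lambda>_. 0) = max_energy \<tau> {..<k} (\<lambda>e. a (shift l e)) (\<lambda>_. 0)"
proof -
  have img: "(\<lambda>i. i + l) ` {..<k} = {l..<l+k}"
    using image_add_atLeastLessThan'[of l 0 k] by (simp add: lessThan_atLeast0 add.commute)
  have P: "Pow {l..<l+k} = (`) (\<lambda>i. i + l) ` Pow {..<k}"
    unfolding img[symmetric] image_Pow_surj[OF refl] ..
  have "energy \<tau> {l..<l+k} a (\<lambda>_. 0) ((\<lambda>i. i + l) ` X) = energy \<tau> {..<k} (\<lambda>e. a (shift l e)) (\<lambda>_. 0) X" for X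
  proof -
    have spin: "spin ((\<lambda>i. i + l) ` X) (i + l) = spin X i" for i by (auto simp: spin_def)
    have "pairs {l..<l+k} = shift l ` pairs {..<k}"
      unfolding img[symmetric] by (force simp: pairs_def shift_def)
    moreover have "spin ((\<lambda>i. i + l) ` X) (fst (shift l e)) = spin X (fst e)" "spin ((\<lambda>i. i + l) ` X) (snd (shift l e)) = spin X (snd e)" for e
      unfolding shift_def by (simp_all add: spin)
    ultimately show ?thesis
      unfolding energy_def by (simp add: sum.reindex[OF shift_props(1)])
  qed
  then show ?thesis unfolding max_energy_def P by (simp add: image_image)
qed

text \<open>The sites in a window form a copy of a smaller system within the same space of
  couplings; the blocks of the superadditivity argument and the tail terms of the nodes are both of
  this kind.\<close>

lemma mean_max_shift: "mean_max \<tau> {..<k} (\<lambda>_. 0) = (\<integral>a. max_energy \<tau> {l..<l+k} a (\<lambda>_. 0) \<partial>gauss (pairs V))"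
  "integrable (gauss (pairs V)) (\<lambda>a. max_energy \<tau> {l..<l+k} a (\<lambda>_. 0))" if V: "{l..<l+k} \<subseteq> V"
proof -
  have s: "shift l \<in> pairs {..<k} \<rightarrow> pairs V" using shift_props(2) pairs_mono[OF V] by blast
  have eq: "max_energy \<tau> {..<k} (\<lambda>i\<in>pairs {..<k}. \<omega> (shift l i)) (\<lambda>_. 0) = max_energy \<tau> {l..<l+k} \<omega> (\<lambda>_. 0)" for \<omega>
    unfolding max_energy_shift by (rule max_energy_cong) auto
  show "mean_max \<tau> {..<k} (\<lambda>_. 0) = (\<integral>a. max_energy \<tau> {l..<l+k} a (\<lambda>_. 0) \<partial>gauss (pairs V))"
    unfolding mean_max_def by (rule gauss_reindex_integral(1)[OF shift_props(1) s max_energy_measurable_gauss eq]) simp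
  show "integrable (gauss (pairs V)) (\<lambda>a. max_energy \<tau> {l..<l+k} a (\<lambda>_. 0))"
    by (rule gauss_reindex_integral(2)[OF shift_props(1) s max_energy_measurable_gauss eq max_energy_integrable]) simp_all
qed

lemma sum_square_pairs:
  fixes f :: "nat \<Rightarrow> real"
  assumes "finite U"
  shows "(\<Sum>i\<in>U. f i)\<^sup>2 = (\<Sum>i\<in>U. (f i)\<^sup>2) + 2 * (\<Sum>e\<in>pairs U. f (fst e) * f (snd e))"
  using assms
proof (induction U)
  case (insert x U)
  have D: "insert x U - {x} = U" using insert by auto
  have [simp]: "pairs {x} = {}" by (auto simp: pairs_def)
  have "(\<Sum>e\<in>pairs (insert x U). f (fst e) * f (snd e)) = (\<Sum>e\<in>pairs U. f (fst e) * f (snd e)) + (\<Sum>j\<in>U. f (min x j) * f (max x j))"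
    using mixed_sum[of "insert x U" "{x}" "\<lambda>e. f (fst e) * f (snd e)"] insert unfolding D by simp
  also have "(\<Sum>j\<in>U. f (min x j) * f (max x j)) = f x * (\<Sum>j\<in>U. f j)"
    unfolding sum_distrib_left by (intro sum.cong refl) (simp add: min_def max_def mult.commute)
  finally show ?case using insert by (simp add: power2_sum algebra_simps)
qed (simp add: pairs_def)

text \<open>Spins square to 1, so with \<open>r i = spin X i * spin Y i\<close> a pair contributes
  \<open>2 - 2 * r i * r j\<close>, and summing over pairs gives the square of the overlap.\<close>

lemma overlap_distance:
  assumes U: "finite U"
  shows "(\<Sum>e\<in>pairs U. (spin X (fst e) * spin X (snd e) - spin Y (fst e) * spin Y (snd e))\<^sup>2)
    = (real (card U))\<^sup>2 - (\<Sum>i\<in>U. spin X i * spin Y i)\<^sup>2"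
proof -
  let ?r = "\<lambda>i. spin X i * spin Y i"
  have "(\<Sum>e\<in>pairs U. (spin X (fst e) * spin X (snd e) - spin Y (fst e) * spin Y (snd e))\<^sup>2) = (\<Sum>e\<in>pairs U. 2 * (1 * 1) - 2 * (?r (fst e) * ?r (snd e)))"
    by (intro sum.cong refl) (simp add: power2_diff power_mult_distrib mult_ac)
  also have "\<dots> = 2 * (\<Sum>e\<in>pairs U. 1 * 1) - 2 * (\<Sum>e\<in>pairs U. ?r (fst e) * ?r (snd e))"
    by (simp only: sum_subtractf sum_distrib_left)
  also have "\<dots> = ((\<Sum>i\<in>U. 1)\<^sup>2 - (\<Sum>i\<in>U. 1\<^sup>2)) - ((\<Sum>i\<in>U. ?r i)\<^sup>2 - (\<Sum>i\<in>U. (?r i)\<^sup>2))"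
    using sum_square_pairs[OF U, of "\<lambda>_. 1"] sum_square_pairs[OF U, of ?r] by linarith
  also have "\<dots> = (real (card U))\<^sup>2 - (\<Sum>i\<in>U. ?r i)\<^sup>2" by (simp add: power_mult_distrib)
  finally show ?thesis .
qed

text \<open>Convexity of the square: the overlap per site of the whole system is the weighted mean
  of the overlaps per site of its two blocks.\<close>

lemma square_sum_convex:
  fixes m k x y :: real
  assumes "0 < m" "0 < k"
  shows "(x + y)\<^sup>2 / (m + k) \<le> x\<^sup>2 / m + y\<^sup>2 / k"
proof -
  have "x\<^sup>2 / m + y\<^sup>2 / k - (x + y)\<^sup>2 / (m + k) = (k * x - m * y)\<^sup>2 / (m * k * (m + k))"
    using assms by (simp add: divide_simps power2_eq_square) (simp add: algebra_simps)
  moreover have "0 \<le> (k * x - m * y)\<^sup>2 / (m * k * (m + k))" using assms by simp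
  ultimately show ?thesis by linarith
qed

text \<open>With couplings scaled by \<open>1 / sqrt n\<close> the mean maximum grows linearly in
  \<open>n\<close>, the normalisation under which it is superadditive.\<close>

definition ground :: "nat \<Rightarrow> real" where
  "ground n = mean_max (1 / sqrt n) {..<n} (\<lambda>_. 0)"

lemma ground_Max: "ground n = (\<integral>\<omega>. Max ((\<lambda>X. \<Sum>e\<in>pairs {..<n}. sqrt (1 / n) * \<omega> e * (spin X (fst e) * spin X (snd e))) ` Pow {..<n}) \<partial>gauss (pairs {..<n}))"
  unfolding ground_def mean_max_def max_energy_def energy_def by (simp add: sum_distrib_left real_sqrt_divide mult_ac)

lemma energy_Un:
  assumes "X1 \<subseteq> V" "X2 \<inter> V = {}"
  shows "energy \<tau> V a h (X1 \<union> X2) = energy \<tau> V a h X1"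
  unfolding energy_def using assms
  by (intro arg_cong2[where f="(+)"] arg_cong2[where f="(*)"] sum.cong refl) (auto simp: spin_def pairs_def)

text \<open>Two decoupled blocks are compared with the full system. Their squared distances are
  \<open>m + k - R1\<^sup>2 / m - R2\<^sup>2 / k\<close>, with block overlaps \<open>R1\<close> and
  \<open>R2\<close>, against \<open>m + k - (R1 + R2)\<^sup>2 / (m + k)\<close>. By convexity the
  full system has the larger distances, hence the larger mean maximum.\<close>

theorem ground_superadditive:
  assumes m: "0 < m" and k: "0 < k"
  shows "ground m + ground k \<le> ground (m + k)"
proof -
  let ?n = "m + k" and ?V1 = "{0..<0+m}" and ?V2 = "{m..<m+k}"
  let ?E = "pairs {..<?n}"
  let ?s = "\<lambda>X e. spin X (fst e) * spin X (snd e)"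
  let ?b = "\<lambda>e. if e \<in> pairs ?V1 then 1 / real m else if e \<in> pairs ?V2 then 1 / real k else 0"
  let ?mb = "\<lambda>\<omega>. Max ((\<lambda>X. \<Sum>e\<in>?E. sqrt (?b e) * \<omega> e * ?s X e) ` Pow {..<?n})"
  have sub: "pairs ?V1 \<subseteq> ?E" "pairs ?V2 \<subseteq> ?E" and dj: "pairs ?V1 \<inter> pairs ?V2 = {}"
    by (auto simp: pairs_def)
  have split: "(\<Sum>e\<in>?E. f e * g e) = (\<Sum>e\<in>pairs ?V1. f1 * g e) + (\<Sum>e\<in>pairs ?V2. f2 * g e)"
    if "\<And>e. f e = (if e \<in> pairs ?V1 then f1 else if e \<in> pairs ?V2 then f2 else 0)" for f g :: "nat \<times> nat \<Rightarrow> real" and f1 f2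
  proof -
    have "(\<Sum>e\<in>?E. f e * g e) = (\<Sum>e\<in>pairs ?V1 \<union> pairs ?V2. f e * g e)"
      using sub by (intro sum.mono_neutral_right) (auto simp: that)
    also have "\<dots> = (\<Sum>e\<in>pairs ?V1. f e * g e) + (\<Sum>e\<in>pairs ?V2. f e * g e)"
      by (rule sum.union_disjoint[OF _ _ dj]) auto
    finally show ?thesis using dj by (auto simp: that intro!: arg_cong2[where f="(+)"] sum.cong)
  qed
  have pt: "max_energy (1 / sqrt m) ?V1 \<omega> (\<lambda>_. 0) + max_energy (1 / sqrt k) ?V2 \<omega> (\<lambda>_. 0) \<le> ?mb \<omega>" for \<omega>
  proof -
    obtain X1 where X1: "X1 \<subseteq> ?V1" "max_energy (1 / sqrt m) ?V1 \<omega> (\<lambda>_. 0) = energy (1 / sqrt m) ?V1 \<omega> (\<lambda>_. 0) X1"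
      by (rule max_energy_attained[of ?V1]) auto
    obtain X2 where X2: "X2 \<subseteq> ?V2" "max_energy (1 / sqrt k) ?V2 \<omega> (\<lambda>_. 0) = energy (1 / sqrt k) ?V2 \<omega> (\<lambda>_. 0) X2"
      by (rule max_energy_attained[of ?V2]) auto
    let ?X = "X1 \<union> X2"
    have "energy (1 / sqrt m) ?V1 \<omega> (\<lambda>_. 0) X1 = energy (1 / sqrt m) ?V1 \<omega> (\<lambda>_. 0) ?X"
      using X1 X2 by (intro energy_Un[symmetric]) auto
    moreover have "energy (1 / sqrt k) ?V2 \<omega> (\<lambda>_. 0) X2 = energy (1 / sqrt k) ?V2 \<omega> (\<lambda>_. 0) ?X"
      using X1 X2 unfolding Un_commute[of X1] by (intro energy_Un[symmetric]) auto
    moreover have "(\<Sum>e\<in>?E. sqrt (?b e) * (\<omega> e * ?s ?X e)) = (\<Sum>e\<in>pairs ?V1. 1 / sqrt m * (\<omega> e * ?s ?X e)) + (\<Sum>e\<in>pairs ?V2. 1 / sqrt k * (\<omega> e * ?s ?X e))"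
      by (rule split) (auto simp: real_sqrt_divide)
    then have "(\<Sum>e\<in>?E. sqrt (?b e) * \<omega> e * ?s ?X e) = energy (1 / sqrt m) ?V1 \<omega> (\<lambda>_. 0) ?X + energy (1 / sqrt k) ?V2 \<omega> (\<lambda>_. 0) ?X"
      unfolding energy_def mult.assoc by (simp add: sum_distrib_left)
    moreover have "(\<Sum>e\<in>?E. sqrt (?b e) * \<omega> e * ?s ?X e) \<le> ?mb \<omega>"
    proof (intro Max_ge imageI)
      show "?X \<in> Pow {..<?n}" using X1(1) X2(1) by fastforce
    qed simp
    ultimately show ?thesis using X1(2) X2(2) by linarith
  qed
  have V1: "?V1 \<subseteq> {..<?n}" and V2: "?V2 \<subseteq> {..<?n}" by auto
  have "(0, 1) \<in> ?E" using m k by (auto simp: pairs_def)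
  then have ne: "?E \<noteq> {}" by blast
  have dist: "(\<Sum>e\<in>?E. ?b e * (?s X e - ?s Y e)\<^sup>2) \<le> (\<Sum>e\<in>?E. 1 / real ?n * (?s X e - ?s Y e)\<^sup>2)" for X Y
  proof -
    let ?R = "\<lambda>U. \<Sum>i\<in>U. spin X i * spin Y i"
    have "(\<Sum>e\<in>?E. ?b e * (?s X e - ?s Y e)\<^sup>2) = (\<Sum>e\<in>pairs ?V1. 1 / real m * (?s X e - ?s Y e)\<^sup>2) + (\<Sum>e\<in>pairs ?V2. 1 / real k * (?s X e - ?s Y e)\<^sup>2)"
      by (rule split) auto
    also have "\<dots> = ((real m)\<^sup>2 - (?R ?V1)\<^sup>2) / real m + ((real k)\<^sup>2 - (?R ?V2)\<^sup>2) / real k"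
      unfolding sum_distrib_left[symmetric] by (simp add: overlap_distance)
    also have "\<dots> = real ?n - ((?R ?V1)\<^sup>2 / real m + (?R ?V2)\<^sup>2 / real k)"
      using m k by (simp add: diff_divide_distrib power2_eq_square)
    also have "\<dots> \<le> real ?n - (?R ?V1 + ?R ?V2)\<^sup>2 / real ?n"
      using square_sum_convex[of "real m" "real k" "?R ?V1" "?R ?V2"] m k by simp
    also have "?R ?V1 + ?R ?V2 = ?R {..<?n}"
      using sum.union_disjoint[of ?V1 ?V2 "\<lambda>i. spin X i * spin Y i"] by (simp add: ivl_disj_un lessThan_atLeast0)
    also have "real ?n - (?R {..<?n})\<^sup>2 / real ?n = (\<Sum>e\<in>?E. 1 / real ?n * (?s X e - ?s Y e)\<^sup>2)"
      unfolding sum_distrib_left[symmetric] overlap_distance[OF finite_lessThan] using m k by (simp add: diff_divide_distrib power2_eq_square)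
    finally show ?thesis .
  qed
  have cmp: "(\<integral>\<omega>. ?mb \<omega> \<partial>gauss ?E) \<le> ground ?n"
    unfolding ground_Max
  proof (rule sudakov_fernique[where W=1])
    show "\<bar>?s X e\<bar> \<le> 1" for X e by (simp add: abs_mult)
    show "0 \<le> ?b e \<and> ?b e \<le> 1" "0 \<le> 1 / real ?n \<and> 1 / real ?n \<le> 1" for e using m k by auto
  qed (use dist ne in auto)
  have g: "ground m = (\<integral>\<omega>. max_energy (1 / sqrt m) ?V1 \<omega> (\<lambda>_. 0) \<partial>gauss ?E)" "ground k = (\<integral>\<omega>. max_energy (1 / sqrt k) ?V2 \<omega> (\<lambda>_. 0) \<partial>gauss ?E)"
    unfolding ground_def by (rule mean_max_shift(1)[OF V1], rule mean_max_shift(1)[OF V2])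
  have "ground m + ground k = (\<integral>\<omega>. max_energy (1 / sqrt m) ?V1 \<omega> (\<lambda>_. 0) + max_energy (1 / sqrt k) ?V2 \<omega> (\<lambda>_. 0) \<partial>gauss ?E)"
    unfolding g by (rule Bochner_Integration.integral_add[symmetric, OF mean_max_shift(2)[OF V1] mean_max_shift(2)[OF V2]])
  also have "\<dots> \<le> (\<integral>\<omega>. ?mb \<omega> \<partial>gauss ?E)"
  proof (rule integral_mono[OF Bochner_Integration.integrable_add[OF mean_max_shift(2)[OF V1] mean_max_shift(2)[OF V2]] _ pt])
    have b1: "\<bar>\<Sum>e\<in>?E. sqrt (?b e) * \<omega> e * ?s X e\<bar> \<le> 0 + (\<Sum>e\<in>?E. 1 * \<bar>\<omega> e\<bar>)" for \<omega> X
    proof -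
      have "\<bar>\<Sum>e\<in>?E. sqrt (?b e) * \<omega> e * ?s X e\<bar> \<le> (\<Sum>e\<in>?E. \<bar>sqrt (?b e) * \<omega> e * ?s X e\<bar>)" by (rule sum_abs)
      also have "\<dots> \<le> (\<Sum>e\<in>?E. 1 * \<bar>\<omega> e\<bar>)"
      proof (rule sum_mono)
        fix e
        have "sqrt (?b e) \<le> sqrt 1" using m k by (intro real_sqrt_le_mono) auto
        moreover have "0 \<le> sqrt (?b e)" by simp
        ultimately show "\<bar>sqrt (?b e) * \<omega> e * ?s X e\<bar> \<le> 1 * \<bar>\<omega> e\<bar>"
          unfolding abs_mult by (simp add: mult_left_le_one_le)
      qed
      finally show ?thesis by simp
    qed
    show "integrable (gauss ?E) ?mb"
    proof (rule gauss_integrable_linear_growth)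
      show "?mb \<in> borel_measurable (gauss ?E)"
        by (intro borel_measurable_Max borel_measurable_sum borel_measurable_times borel_measurable_const gauss_comp_measurable) auto
      fix \<omega> :: "nat \<times> nat \<Rightarrow> real"
      have "?mb \<omega> \<in> (\<lambda>X. \<Sum>e\<in>?E. sqrt (?b e) * \<omega> e * ?s X e) ` Pow {..<?n}" by (intro Max_in) auto
      then obtain X where X: "?mb \<omega> = (\<Sum>e\<in>?E. sqrt (?b e) * \<omega> e * ?s X e)" by blast
      show "\<bar>?mb \<omega>\<bar> \<le> 0 + (\<Sum>e\<in>?E. 1 * \<bar>\<omega> e\<bar>)" unfolding X by (rule b1)
    qed simp
  qed
  finally show ?thesis using cmp by linarith
qed


text \<open>Comparison with the independent field \<open>\<Sum>i. \<xi> i * spin X i\<close>, placed on the diagonal index pairs.\<close>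

lemma ground_upper:
  assumes n: "2 \<le> n"
  shows "ground n \<le> real n * sqrt (2 / pi)"
proof -
  let ?V = "{..<n}" and ?D = "(\<lambda>i. (i, i)) ` {..<n}"
  let ?E = "pairs ?V \<union> ?D"
  let ?s = "\<lambda>X (e::nat \<times> nat). if fst e = snd e then spin X (fst e) else spin X (fst e) * spin X (snd e)"
  let ?b = "\<lambda>e. if e \<in> pairs ?V then 1 / real n else 0"
  let ?a = "\<lambda>e. if e \<in> pairs ?V then 0 else 1 :: real"
  have dj: "pairs ?V \<inter> ?D = {}" by (auto simp: pairs_def)
  have inj: "inj_on (\<lambda>i. (i, i)) {..<n}" by (auto simp: inj_on_def)
  have off: "fst e \<noteq> snd e" if "e \<in> pairs ?V" for e using that by (auto simp: pairs_def)
  have iabs: "integrable (gauss ?E) (\<lambda>\<omega>. \<bar>\<omega> (i, i)\<bar>)" if "i < n" for i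
    by (rule gauss_component_integrable[OF _ std_normal_moments(2)[of 1, unfolded power_one_right]]) (use that in auto)
  have diag: "(i, i) \<notin> pairs ?V" for i by (auto simp: pairs_def)
  have D: "(\<Sum>e\<in>?D. f e) = (\<Sum>i<n. f (i, i))" for f :: "nat \<times> nat \<Rightarrow> real"
    using sum.reindex[OF inj, of f] by simp
  have sb: "(\<Sum>e\<in>?E. (if e \<in> pairs ?V then c else d) * g e) = (\<Sum>e\<in>pairs ?V. c * g e) + (\<Sum>i<n. d * g (i, i))"
    for g :: "nat \<times> nat \<Rightarrow> real" and c d
    using dj by (subst sum.union_disjoint) (auto simp: D diag intro!: arg_cong2[where f="(+)"] sum.cong)
  have iff: "sqrt (if P then x else y) = (if P then sqrt x else sqrt y)" for P and x y :: real by simp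
  have "ground n = (\<integral>\<omega>. Max ((\<lambda>X. \<Sum>e\<in>?E. sqrt (?b e) * \<omega> e * ?s X e) ` Pow ?V) \<partial>gauss ?E)"
  proof -
    have f: "inj_on (\<lambda>e. e) (pairs ?V)" "(\<lambda>e. e) \<in> pairs ?V \<rightarrow> ?E" by auto
    have eq: "max_energy (1 / sqrt n) ?V (\<lambda>e\<in>pairs ?V. \<omega> e) (\<lambda>_. 0) = Max ((\<lambda>X. \<Sum>e\<in>?E. sqrt (?b e) * \<omega> e * ?s X e) ` Pow ?V)" for \<omega>
    proof -
      have "energy (1 / sqrt n) ?V (\<lambda>e\<in>pairs ?V. \<omega> e) (\<lambda>_. 0) X = (\<Sum>e\<in>?E. sqrt (?b e) * \<omega> e * ?s X e)" for X
      proof -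
        have "(\<Sum>e\<in>?E. sqrt (?b e) * (\<omega> e * ?s X e)) = (\<Sum>e\<in>pairs ?V. sqrt (1 / n) * (\<omega> e * ?s X e))"
          unfolding iff sb by simp
        also have "\<dots> = (\<Sum>e\<in>pairs ?V. 1 / sqrt n * ((\<lambda>e\<in>pairs ?V. \<omega> e) e * (spin X (fst e) * spin X (snd e))))"
          by (intro sum.cong refl) (simp add: off real_sqrt_divide)
        finally show ?thesis unfolding energy_def by (simp add: sum_distrib_left mult.assoc)
      qed
      then show ?thesis unfolding max_energy_def by simp
    qed
    show ?thesis unfolding ground_def mean_max_def
      by (rule gauss_reindex_integral(1)[OF f max_energy_measurable_gauss eq]) simp
  qed
  also have "\<dots> \<le> (\<integral>\<omega>. Max ((\<lambda>X. \<Sum>e\<in>?E. sqrt (?a e) * \<omega> e * ?s X e) ` Pow ?V) \<partial>gauss ?E)"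
  proof (rule sudakov_fernique[where W=1])
    show "\<bar>?s X e\<bar> \<le> 1" for X e by (simp add: abs_mult)
    show "0 \<le> ?b e \<and> ?b e \<le> 1" "0 \<le> ?a e \<and> ?a e \<le> 1" for e using n by auto
    show "?E \<noteq> {}" using n by (auto simp: lessThan_empty_iff)
    fix X Y :: "nat set"
    let ?R = "\<Sum>i<n. spin X i * spin Y i"
    have b: "(\<Sum>e\<in>?E. ?b e * (?s X e - ?s Y e)\<^sup>2) = ((real n)\<^sup>2 - ?R\<^sup>2) / n"
    proof -
      have "(\<Sum>e\<in>?E. ?b e * (?s X e - ?s Y e)\<^sup>2) = (\<Sum>e\<in>pairs ?V. 1 / real n * (?s X e - ?s Y e)\<^sup>2)"
        unfolding sb by simp
      also have "\<dots> = 1 / real n * (\<Sum>e\<in>pairs ?V. (spin X (fst e) * spin X (snd e) - spin Y (fst e) * spin Y (snd e))\<^sup>2)"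
        unfolding sum_distrib_left by (intro sum.cong refl) (simp add: off)
      finally show ?thesis unfolding overlap_distance[OF finite_lessThan] by simp
    qed
    have a: "(\<Sum>e\<in>?E. ?a e * (?s X e - ?s Y e)\<^sup>2) = 2 * (real n - ?R)"
    proof -
      have "(\<Sum>e\<in>?E. ?a e * (?s X e - ?s Y e)\<^sup>2) = (\<Sum>i<n. 2 * (1 - spin X i * spin Y i))"
        unfolding sb by (simp add: power2_diff mult.assoc)
      then show ?thesis by (simp add: sum_distrib_left[symmetric] sum_subtractf)
    qed
    have "\<bar>?R\<bar> \<le> (\<Sum>i<n. \<bar>spin X i * spin Y i\<bar>)" by (rule sum_abs)
    then have R: "\<bar>?R\<bar> \<le> n" by (simp add: abs_mult)
    \<comment> \<open>Distances of the pair energies vanish at overlap \<open>- n\<close> as well as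
      at \<open>n\<close>, those of the independent field only at \<open>n\<close>; the bound uses
      \<open>n + R \<le> 2 * n\<close>.\<close>
    have "(real n)\<^sup>2 - ?R\<^sup>2 = (real n - ?R) * (real n + ?R)" by (simp add: power2_eq_square algebra_simps)
    also have "\<dots> \<le> (real n - ?R) * (2 * real n)" using R by (intro mult_left_mono) auto
    finally show "(\<Sum>e\<in>?E. ?b e * (?s X e - ?s Y e)\<^sup>2) \<le> (\<Sum>e\<in>?E. ?a e * (?s X e - ?s Y e)\<^sup>2)"
      unfolding a b using n by (simp add: divide_le_eq mult_ac)
  qed auto
  also have "\<dots> \<le> (\<integral>\<omega>. (\<Sum>i<n. \<bar>\<omega> (i, i)\<bar>) \<partial>gauss ?E)"
  proof (rule integral_mono')
    show "integrable (gauss ?E) (\<lambda>\<omega>. \<Sum>i<n. \<bar>\<omega> (i, i)\<bar>)"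
      using iabs by (intro Bochner_Integration.integrable_sum) auto
    fix \<omega> :: "nat \<times> nat \<Rightarrow> real"
    show "Max ((\<lambda>X. \<Sum>e\<in>?E. sqrt (?a e) * \<omega> e * ?s X e) ` Pow ?V) \<le> (\<Sum>i<n. \<bar>\<omega> (i, i)\<bar>)"
    proof (rule Max.boundedI)
      fix y assume "y \<in> (\<lambda>X. \<Sum>e\<in>?E. sqrt (?a e) * \<omega> e * ?s X e) ` Pow ?V"
      then obtain X where y: "y = (\<Sum>e\<in>?E. sqrt (?a e) * (\<omega> e * ?s X e))" by (auto simp: mult.assoc)
      have "y = (\<Sum>i<n. \<omega> (i, i) * spin X i)" unfolding y iff sb by simp
      also have "\<dots> \<le> (\<Sum>i<n. \<bar>\<omega> (i, i) * spin X i\<bar>)" by (intro sum_mono) simp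
      finally show "y \<le> (\<Sum>i<n. \<bar>\<omega> (i, i)\<bar>)" by (simp add: abs_mult)
    qed auto
  qed (simp add: sum_nonneg)
  also have "\<dots> = (\<Sum>i<n. (\<integral>\<omega>. \<bar>\<omega> (i, i)\<bar> \<partial>gauss ?E))"
    using iabs by (intro Bochner_Integration.integral_sum) auto
  also have "\<dots> = (\<Sum>i<n. sqrt (2 / pi))"
  proof (intro sum.cong refl)
    fix i assume "i \<in> {..<n}"
    then have "(i, i) \<in> ?E" by auto
    from gauss_component_integral[OF this, of abs] show "(\<integral>\<omega>. \<bar>\<omega> (i, i)\<bar> \<partial>gauss ?E) = sqrt (2 / pi)"
      using std_normal_moments(7) by simp
  qed
  finally show ?thesis by simp
qed

text \<open>Fekete's lemma: the limit is the supremum of the ratios, which yields the upper bound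
  for every \<open>n\<close> besides convergence.\<close>

lemma superadditive_limit:
  fixes f :: "nat \<Rightarrow> real"
  assumes nn: "\<And>n. 0 < n \<Longrightarrow> 0 \<le> f n" and sup: "\<And>m k. 0 < m \<Longrightarrow> 0 < k \<Longrightarrow> f m + f k \<le> f (m + k)"
    and C: "\<And>n. N \<le> n \<Longrightarrow> f n \<le> real n * C"
  obtains P where "(\<lambda>n. f n / real n) \<longlonglongrightarrow> P" "\<And>n. 0 < n \<Longrightarrow> f n \<le> real n * P"
proof -
  have iter: "real q * f m \<le> f (q * m)" if "0 < q" "0 < m" for q m
    using that
  proof (induction q rule: nat_induct_non_zero)
    case (Suc q)
    then show ?case using sup[of m "q * m"] by (simp add: distrib_right)
  qed simp
  have bd: "f n / real n \<le> C" if "0 < n" for n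
  proof -
    \<comment> \<open>A multiple of \<open>n\<close> beyond \<open>N\<close> satisfies the bound,
      and superadditivity carries it back to \<open>n\<close>.\<close>
    have "real (Suc N) * f n \<le> f (Suc N * n)" by (rule iter) (use that in auto)
    also have "\<dots> \<le> real (Suc N * n) * C" using that by (intro C) (cases n, auto)
    finally have "real (Suc N) * f n \<le> real (Suc N) * (real n * C)" by (simp only: of_nat_mult mult.assoc)
    then have "f n \<le> real n * C" by (rule mult_left_le_imp_le) simp
    then show ?thesis using that by (simp add: divide_le_eq mult.commute)
  qed
  define P where "P = (SUP n\<in>{0<..}. f n / real n)"
  have bdd: "bdd_above ((\<lambda>n. f n / real n) ` {0<..})" using bd by (intro bdd_aboveI2) auto
  have le: "f n / real n \<le> P" if "0 < n" for n
    unfolding P_def using that bdd by (intro cSUP_upper) auto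
  have "(\<lambda>n. f n / real n) \<longlonglongrightarrow> P"
  proof (rule order_tendstoI)
    fix a assume a: "P < a"
    show "\<forall>\<^sub>F n in sequentially. f n / real n < a"
      using eventually_gt_at_top[of 0] by eventually_elim (rule le_less_trans[OF le a])
  next
    fix a assume "a < P"
    then obtain m where m: "0 < m" "a < f m / real m"
      unfolding P_def using less_cSUP_iff[OF _ bdd, of a] by auto
    let ?c = "f m / real m"
    have lim: "(\<lambda>n. ?c - ?c * real m * (1 / real n)) \<longlonglongrightarrow> ?c - ?c * real m * 0"
      by (intro tendsto_intros lim_1_over_n)
    have "\<forall>\<^sub>F n in sequentially. a < ?c - ?c * real m * (1 / real n)"
      using order_tendstoD(1)[OF lim, of a] m by simp
    from this show "\<forall>\<^sub>F n in sequentially. a < f n / real n"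
      using eventually_ge_at_top[of m]
    proof eventually_elim
      case (elim n)
      let ?q = "n div m" and ?r = "n mod m"
      have n: "0 < n" "0 < ?q" using elim m by (auto simp: div_greater_zero_iff)
      have c: "0 \<le> ?c" using nn m by simp
      have "real ?q * f m \<le> f n"
      proof (cases "?r = 0")
        case True
        then show ?thesis using iter[of ?q m] n m by (metis add.right_neutral div_mult_mod_eq)
      next
        case False
        then have "f (?q * m) + f ?r \<le> f (?q * m + ?r)" using n m by (intro sup) auto
        then show ?thesis using iter[of ?q m] nn[of ?r] n m False by simp
      qed
      moreover have "real n - real m \<le> real ?q * real m"
      proof -
        have "n = ?q * m + ?r" "?r \<le> m" using m by (simp_all add: less_imp_le)
        then have "n \<le> ?q * m + m" by linarith
        then have "real n \<le> real (?q * m + m)" by (simp only: of_nat_le_iff)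
        then show ?thesis by simp
      qed
      then have "(real n - real m) * ?c \<le> (real ?q * real m) * ?c" using c by (rule mult_right_mono)
      moreover have "(real ?q * real m) * ?c = real ?q * f m" using m by simp
      ultimately have "(real n - real m) * ?c \<le> f n" by linarith
      then have "(real n - real m) * ?c / real n \<le> f n / real n" by (rule divide_right_mono) simp
      moreover have "(real n - real m) * ?c / real n = ?c - ?c * real m * (1 / real n)"
        using n by (simp add: field_simps)
      ultimately show ?case using elim by linarith
    qed
  qed
  moreover have "f n \<le> real n * P" if "0 < n" for n
    using le[OF that] that by (simp add: divide_le_eq mult.commute)
  ultimately show ?thesis by (rule that)
qed

text \<open>Since every ratio is at most \<open>P\<close>, the greedy bound along multiples of 100
  already bounds \<open>P\<close> from below; its error of order \<open>1 / sqrt k\<close>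
  disappears in the limit.\<close>

theorem ground_limit:
  obtains P where "(\<lambda>n. ground n / real n) \<longlonglongrightarrow> P" "\<And>n. 0 < n \<Longrightarrow> ground n \<le> real n * P" "658 / 1000 \<le> P"
proof -
  have nn: "0 \<le> ground n" if "0 < n" for n
    using mean_max_ge_abs[of "{..<n}" "1 / sqrt n" "\<lambda>_. 0"] that by (simp add: ground_def)
  obtain P where P: "(\<lambda>n. ground n / real n) \<longlonglongrightarrow> P" "\<And>n. 0 < n \<Longrightarrow> ground n \<le> real n * P"
    using superadditive_limit[of ground 2 "sqrt (2 / pi)", OF nn ground_superadditive ground_upper] by blast
  moreover have "658 / 1000 \<le> P"
  proof (rule tendsto_upperbound[where F=sequentially])
    let ?C = "98 * ((98 * mean_abs (1/10))\<^sup>2 + 2 * 98)"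
    have "filterlim (\<lambda>k. sqrt (100 * real k)) at_top sequentially"
      by (intro filterlim_compose[OF sqrt_at_top] filterlim_tendsto_pos_mult_at_top[OF tendsto_const] filterlim_real_sequentially) simp
    then have "(\<lambda>k. 658 / 1000 - ?C * inverse (sqrt (100 * real k))) \<longlonglongrightarrow> 658 / 1000 - ?C * 0"
      by (intro tendsto_intros tendsto_inverse_0_at_top)
    then show "(\<lambda>k. 658 / 1000 - ?C * inverse (sqrt (100 * real k))) \<longlonglongrightarrow> 658 / 1000" by simp
    show "\<forall>\<^sub>F k in sequentially. 658 / 1000 - ?C * inverse (sqrt (100 * real k)) \<le> P"
      using eventually_gt_at_top[of 0]
    proof eventually_elim
      case (elim k)
      let ?q = "sqrt (100 * real k)"
      have q: "0 < ?q" "?q * ?q = 100 * real k" using elim by auto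
      have "100 * real k * (658 / 1000) - ?C * ?q \<le> ground (100 * k)"
        using ground_state_lower[OF elim] unfolding ground_def mult.assoc of_nat_mult of_nat_numeral .
      also have "\<dots> \<le> 100 * real k * P" using P(2)[of "100 * k"] elim by simp
      finally have "?q * ?q * (658 / 1000) - ?C * ?q \<le> ?q * ?q * P" unfolding q(2) .
      moreover have "?q * ?q * (658 / 1000) - ?C * ?q = ?q * ?q * (658 / 1000 - ?C * inverse ?q)"
      proof -
        have "r * r * a - c * r = r * r * (a - c * inverse r)" if "0 < r" for r a c :: real
          using that by (simp add: right_diff_distrib)
        then show ?thesis using q(1) by blast
      qed
      ultimately have "?q * ?q * (658 / 1000 - ?C * inverse ?q) \<le> ?q * ?q * P" by linarith
      then show ?case by (rule mult_left_le_imp_le) (use q(1) in simp)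
    qed
  qed simp
  ultimately show ?thesis by (rule that)
qed

section \<open>Concentration\<close>

text \<open>The variance is at most the second moment about \<open>h 0\<close>, and this is at most
  the second moment of \<open>y\<close>. The arbitrary centre \<open>c\<close> splits the deviation
  into a variance and a squared bias, the form that the induction over coordinates consumes.\<close>

lemma lipschitz_second_moment:
  fixes h :: "real \<Rightarrow> real"
  assumes m: "h \<in> borel_measurable borel" and l: "\<And>y. \<bar>h y - h 0\<bar> \<le> \<bar>y\<bar>"
  shows "integrable std_normal h" "(\<integral>y. (h y - c)\<^sup>2 \<partial>std_normal) \<le> 1 + ((\<integral>y. h y \<partial>std_normal) - c)\<^sup>2"
proof -
  note [measurable] = m
  have i2: "integrable std_normal (\<lambda>y. (h y - h 0)\<^sup>2)"
  proof (rule Bochner_Integration.integrable_bound[OF std_normal_moments(1)[of 2]])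
    show "AE y in std_normal. norm ((h y - h 0)\<^sup>2) \<le> norm (y\<^sup>2)"
      using l by (intro AE_I2) (simp add: abs_le_square_iff[symmetric])
  qed simp
  have i1: "integrable std_normal (\<lambda>y. h y - h 0)"
  proof (rule Bochner_Integration.integrable_bound[OF std_normal_integrable])
    show "AE y in std_normal. norm (h y - h 0) \<le> norm y" using l by (intro AE_I2) simp
  qed simp
  have "integrable std_normal (\<lambda>y. (h y - h 0) + h 0)"
    by (intro Bochner_Integration.integrable_add i1 std_normal.integrable_const)
  then show int: "integrable std_normal h" by simp
  let ?e = "\<integral>y. h y \<partial>std_normal"
  have e: "(\<integral>y. h y - h 0 \<partial>std_normal) = ?e - h 0"
    using int by (simp add: std_normal.prob_space[simplified])
  have "(\<integral>y. (h y - c)\<^sup>2 \<partial>std_normal) = (\<integral>y. (h y - h 0)\<^sup>2 + 2 * (h 0 - c) * (h y - h 0) + (h 0 - c)\<^sup>2 \<partial>std_normal)"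
    by (intro Bochner_Integration.integral_cong refl) (simp add: power2_eq_square algebra_simps)
  also have "\<dots> = (\<integral>y. (h y - h 0)\<^sup>2 \<partial>std_normal) + 2 * (h 0 - c) * (?e - h 0) + (h 0 - c)\<^sup>2"
    using i1 i2 by (simp add: e std_normal.prob_space[simplified] del: Bochner_Integration.integral_diff)
  also have "(\<integral>y. (h y - h 0)\<^sup>2 \<partial>std_normal) \<le> (\<integral>y. y\<^sup>2 \<partial>std_normal)"
    using l by (intro integral_mono i2 std_normal_moments(1)) (simp add: abs_le_square_iff[symmetric])
  also have "(\<integral>y. y\<^sup>2 \<partial>std_normal) = 1" by (rule std_normal_moments(4))
  finally show "(\<integral>y. (h y - c)\<^sup>2 \<partial>std_normal) \<le> 1 + (?e - c)\<^sup>2"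
    using zero_le_power2[of "?e - h 0"] by (simp add: power2_eq_square algebra_simps)
qed

lemma gauss_square_integrable:
  assumes I: "finite I" and f: "f \<in> borel_measurable (gauss I)"
    and b: "\<And>\<omega>. \<omega> \<in> space (gauss I) \<Longrightarrow> \<bar>f \<omega>\<bar> \<le> c + (\<Sum>i\<in>I. \<bar>\<omega> i\<bar>)"
  shows "integrable (gauss I) (\<lambda>\<omega>. (f \<omega>)\<^sup>2)"
proof -
  interpret prob_space "gauss I" by (rule prob_space_gauss)
  have "integrable (gauss I) (\<lambda>\<omega>. (\<omega> i)\<^sup>2)" if "i \<in> I" for i
    by (rule gauss_component_integrable[OF that std_normal_moments(1)[of 2]])
  then have "integrable (gauss I) (\<lambda>\<omega>. 2 * c\<^sup>2 + 2 * real (card I) * (\<Sum>i\<in>I. (\<omega> i)\<^sup>2))"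
    by (intro Bochner_Integration.integrable_add integrable_const integrable_mult_right Bochner_Integration.integrable_sum) auto
  then show ?thesis
  proof (rule Bochner_Integration.integrable_bound)
    show "(\<lambda>\<omega>. (f \<omega>)\<^sup>2) \<in> borel_measurable (gauss I)" using f by (rule borel_measurable_power)
    show "AE \<omega> in gauss I. norm ((f \<omega>)\<^sup>2) \<le> norm (2 * c\<^sup>2 + 2 * real (card I) * (\<Sum>i\<in>I. (\<omega> i)\<^sup>2))"
    proof (rule AE_I2)
      fix \<omega> assume w: "\<omega> \<in> space (gauss I)"
      let ?s = "\<Sum>i\<in>I. \<bar>\<omega> i\<bar>"
      have s: "?s\<^sup>2 \<le> (\<Sum>i\<in>I. (\<omega> i)\<^sup>2) * card I" using sum_squared_le_sum_of_squares[of "\<lambda>i. \<bar>\<omega> i\<bar>" I] by simp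
      have "(f \<omega>)\<^sup>2 \<le> (c + ?s)\<^sup>2" using power_mono[OF b[OF w], of 2] by simp
      also have "\<dots> \<le> 2 * c\<^sup>2 + 2 * ?s\<^sup>2"
        using zero_le_power2[of "c - ?s"] by (simp add: power2_eq_square algebra_simps)
      also have "\<dots> \<le> 2 * c\<^sup>2 + 2 * real (card I) * (\<Sum>i\<in>I. (\<omega> i)\<^sup>2)" using s by (simp add: mult_ac)
      finally show "norm ((f \<omega>)\<^sup>2) \<le> norm (2 * c\<^sup>2 + 2 * real (card I) * (\<Sum>i\<in>I. (\<omega> i)\<^sup>2))" by simp
    qed
  qed
qed

lemma gauss_insert_space: "x \<in> space (gauss I) \<Longrightarrow> x(i := y) \<in> space (gauss (insert i I))"
  by (auto simp: space_gauss PiE_iff extensional_def)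

lemma gauss_lipschitz_bound:
  assumes l: "\<And>\<omega> \<omega>'. \<omega> \<in> space (gauss I) \<Longrightarrow> \<omega>' \<in> space (gauss I) \<Longrightarrow> \<bar>f \<omega> - f \<omega>'\<bar> \<le> (\<Sum>i\<in>I. \<bar>\<omega> i - \<omega>' i\<bar>)"
    and w: "\<omega> \<in> space (gauss I)"
  shows "\<bar>f \<omega> - c\<bar> \<le> \<bar>f (\<lambda>i\<in>I. 0) - c\<bar> + (\<Sum>i\<in>I. \<bar>\<omega> i\<bar>)"
proof -
  have "(\<lambda>i\<in>I. 0) \<in> space (gauss I)" by (auto simp: space_gauss)
  from l[OF w this] have "\<bar>f \<omega> - f (\<lambda>i\<in>I. 0)\<bar> \<le> (\<Sum>i\<in>I. \<bar>\<omega> i\<bar>)" by simp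
  then show ?thesis by linarith
qed

text \<open>The variance bound accumulates coordinate by coordinate, since averaging over one
  coordinate keeps the Lipschitz condition in the others.\<close>

lemma gauss_variance_lipschitz:
  fixes f :: "('i \<Rightarrow> real) \<Rightarrow> real"
  assumes "finite I" "f \<in> borel_measurable (gauss I)"
    and "\<And>\<omega> \<omega>'. \<omega> \<in> space (gauss I) \<Longrightarrow> \<omega>' \<in> space (gauss I) \<Longrightarrow> \<bar>f \<omega> - f \<omega>'\<bar> \<le> (\<Sum>i\<in>I. \<bar>\<omega> i - \<omega>' i\<bar>)"
  shows "(\<integral>\<omega>. (f \<omega> - (\<integral>\<omega>. f \<omega> \<partial>gauss I))\<^sup>2 \<partial>gauss I) \<le> real (card I)"
  using assms
proof (induction I arbitrary: f)
  case empty
  interpret E: prob_space "gauss {}" by (rule prob_space_gauss)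
  have c: "f \<omega> = f (\<lambda>_. undefined)" if "\<omega> \<in> space (gauss {})" for \<omega>
    using that by (simp add: space_gauss)
  have "(\<integral>\<omega>. f \<omega> \<partial>gauss {}) = (\<integral>\<omega>. f (\<lambda>_. undefined) \<partial>(gauss {} :: ('i \<Rightarrow> real) measure))"
    by (rule Bochner_Integration.integral_cong[OF refl]) (erule c)
  then have e: "(\<integral>\<omega>. f \<omega> \<partial>gauss {}) = f (\<lambda>_. undefined)" by (simp add: E.prob_space)
  have "(\<integral>\<omega>. (f \<omega> - f (\<lambda>_. undefined))\<^sup>2 \<partial>gauss {}) = (\<integral>\<omega>. 0 \<partial>(gauss {} :: ('i \<Rightarrow> real) measure))"
    by (rule Bochner_Integration.integral_cong[OF refl]) (simp add: c[symmetric])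
  then show ?case unfolding e by simp
next
  case (insert i I)
  interpret I: prob_space "gauss I" by (rule prob_space_gauss)
  interpret J: prob_space "gauss (insert i I)" by (rule prob_space_gauss)
  let ?J = "insert i I"
  let ?g = "\<lambda>x y. f (x(i := y))"
  let ?h = "\<lambda>x. \<integral>y. ?g x y \<partial>std_normal"
  define \<mu> where "\<mu> = (\<integral>\<omega>. f \<omega> \<partial>gauss ?J)"
  note f = insert.prems(1) and lip = insert.prems(2)
  have mg: "(\<lambda>(x, y). ?g x y) \<in> borel_measurable (gauss I \<Otimes>\<^sub>M std_normal)"
    using measurable_compose[OF measurable_add_dim[of i I "\<lambda>_. std_normal"], of f borel] f
    unfolding gauss_def by (simp add: split_beta')
  have mgx: "?g x \<in> borel_measurable borel" if "x \<in> space (gauss I)" for x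
    using measurable_Pair2[OF mg that] by (simp cong: measurable_cong_sets)
  have lip1: "\<bar>?g x y - ?g x' y'\<bar> \<le> \<bar>y - y'\<bar> + (\<Sum>k\<in>I. \<bar>x k - x' k\<bar>)" if "x \<in> space (gauss I)" "x' \<in> space (gauss I)" for x x' y y'
  proof -
    have "(\<Sum>k\<in>?J. \<bar>(x(i := y)) k - (x'(i := y')) k\<bar>) = \<bar>y - y'\<bar> + (\<Sum>k\<in>I. \<bar>x k - x' k\<bar>)"
      using insert.hyps by (simp add: sum.insert) (intro sum.cong, auto)
    moreover have "x(i := y) \<in> space (gauss ?J)" "x'(i := y') \<in> space (gauss ?J)"
      by (rule gauss_insert_space[OF that(1)], rule gauss_insert_space[OF that(2)])
    ultimately show ?thesis using lip by metis
  qed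
  have sec: "integrable std_normal (?g x)" "(\<integral>y. (?g x y - c)\<^sup>2 \<partial>std_normal) \<le> 1 + (?h x - c)\<^sup>2"
    if x: "x \<in> space (gauss I)" for x c
  proof -
    have *: "\<bar>?g x y - ?g x 0\<bar> \<le> \<bar>y\<bar>" for y using lip1[OF x x, of y 0] by simp
    show "integrable std_normal (?g x)" "(\<integral>y. (?g x y - c)\<^sup>2 \<partial>std_normal) \<le> 1 + (?h x - c)\<^sup>2"
      by (rule lipschitz_second_moment[OF mgx[OF x] *])+
  qed
  have liph: "\<bar>?h x - ?h x'\<bar> \<le> (\<Sum>k\<in>I. \<bar>x k - x' k\<bar>)" if x: "x \<in> space (gauss I)" "x' \<in> space (gauss I)" for x x'
  proof -
    have "?h x - ?h x' = (\<integral>y. ?g x y - ?g x' y \<partial>std_normal)" using sec(1) x by simp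
    also have "\<bar>\<dots>\<bar> \<le> (\<integral>y. \<bar>?g x y - ?g x' y\<bar> \<partial>std_normal)" by (rule integral_abs_bound)
    also have "\<dots> \<le> (\<integral>y. (\<Sum>k\<in>I. \<bar>x k - x' k\<bar>) \<partial>std_normal)"
    proof (rule integral_mono)
      show "integrable std_normal (\<lambda>y. \<bar>?g x y - ?g x' y\<bar>)"
        using sec(1) x by (intro integrable_abs Bochner_Integration.integrable_diff)
      show "\<bar>?g x y - ?g x' y\<bar> \<le> (\<Sum>k\<in>I. \<bar>x k - x' k\<bar>)" for y using lip1[OF x, of y y] by simp
    qed simp
    also have "\<dots> = (\<Sum>k\<in>I. \<bar>x k - x' k\<bar>)" by (simp add: std_normal.prob_space[simplified])
    finally show ?thesis .
  qed
  have mh: "?h \<in> borel_measurable (gauss I)"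
    using std_normal.borel_measurable_lebesgue_integral[OF mg] by simp
  have IH: "(\<integral>x. (?h x - (\<integral>x. ?h x \<partial>gauss I))\<^sup>2 \<partial>gauss I) \<le> real (card I)"
    by (rule insert.IH[OF mh liph])
  have fsq: "integrable (gauss ?J) (\<lambda>\<omega>. (f \<omega> - c)\<^sup>2)" for c
    by (rule gauss_square_integrable[OF _ _ gauss_lipschitz_bound[OF lip]]) (use insert.hyps f in \<open>auto intro: borel_measurable_diff\<close>)
  have fi: "integrable (gauss ?J) f"
    using J.square_integrable_imp_integrable[OF f] fsq[of 0] by simp
  have hsq: "integrable (gauss I) (\<lambda>x. (?h x - c)\<^sup>2)" for c
    by (rule gauss_square_integrable[OF _ _ gauss_lipschitz_bound[OF liph]]) (use insert.hyps mh in \<open>auto intro: borel_measurable_diff\<close>)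
  have \<mu>: "\<mu> = (\<integral>x. ?h x \<partial>gauss I)"
    unfolding \<mu>_def using gauss.product_integral_insert[OF insert.hyps(1,2), of f] fi unfolding gauss_def by simp
  have "(\<integral>\<omega>. (f \<omega> - \<mu>)\<^sup>2 \<partial>gauss ?J) = (\<integral>x. (\<integral>y. (?g x y - \<mu>)\<^sup>2 \<partial>std_normal) \<partial>gauss I)"
    using gauss.product_integral_insert[OF insert.hyps(1,2), of "\<lambda>\<omega>. (f \<omega> - \<mu>)\<^sup>2"] fsq[of \<mu>] unfolding gauss_def by simp
  also have "\<dots> \<le> (\<integral>x. 1 + (?h x - \<mu>)\<^sup>2 \<partial>gauss I)"
  proof (rule integral_mono')
    show "integrable (gauss I) (\<lambda>x. 1 + (?h x - \<mu>)\<^sup>2)" using hsq by (intro Bochner_Integration.integrable_add I.integrable_const)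
    show "(\<integral>y. (?g x y - \<mu>)\<^sup>2 \<partial>std_normal) \<le> 1 + (?h x - \<mu>)\<^sup>2" if "x \<in> space (gauss I)" for x by (rule sec(2)[OF that])
  qed simp
  also have "\<dots> = 1 + (\<integral>x. (?h x - \<mu>)\<^sup>2 \<partial>gauss I)" using hsq by (simp add: I.prob_space)
  also have "\<dots> \<le> real (card ?J)" using IH insert.hyps unfolding \<mu> by simp
  finally show ?case unfolding \<mu>_def .
qed

lemma gauss_lipschitz_concentration:
  fixes f :: "('i \<Rightarrow> real) \<Rightarrow> real"
  assumes I: "finite I" and f: "f \<in> borel_measurable (gauss I)" and t: "0 < t"
    and l: "\<And>\<omega> \<omega>'. \<omega> \<in> space (gauss I) \<Longrightarrow> \<omega>' \<in> space (gauss I) \<Longrightarrow> \<bar>f \<omega> - f \<omega>'\<bar> \<le> (\<Sum>i\<in>I. \<bar>\<omega> i - \<omega>' i\<bar>)"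
  shows "measure (gauss I) {\<omega> \<in> space (gauss I). t \<le> \<bar>f \<omega> - (\<integral>\<omega>. f \<omega> \<partial>gauss I)\<bar>} \<le> real (card I) / t\<^sup>2"
proof -
  interpret prob_space "gauss I" by (rule prob_space_gauss)
  have "\<bar>f \<omega>\<bar> \<le> \<bar>f (\<lambda>i\<in>I. 0)\<bar> + (\<Sum>i\<in>I. \<bar>\<omega> i\<bar>)" if "\<omega> \<in> space (gauss I)" for \<omega>
    using gauss_lipschitz_bound[of I f \<omega> 0, OF l that] by simp
  then have "integrable (gauss I) (\<lambda>\<omega>. (f \<omega>)\<^sup>2)" by (rule gauss_square_integrable[OF I f])
  from Chebyshev_inequality[OF f this t]
  have "measure (gauss I) {\<omega> \<in> space (gauss I). t \<le> \<bar>f \<omega> - (\<integral>\<omega>. f \<omega> \<partial>gauss I)\<bar>} \<le> (\<integral>\<omega>. (f \<omega> - (\<integral>\<omega>. f \<omega> \<partial>gauss I))\<^sup>2 \<partial>gauss I) / t\<^sup>2" .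
  also have "\<dots> \<le> real (card I) / t\<^sup>2"
    by (intro divide_right_mono gauss_variance_lipschitz[OF I f l]) auto
  finally show ?thesis .
qed

section \<open>Monotonicity in the set of sites and concentration of tail maxima\<close>

text \<open>Reversing all spins preserves the pair energy and changes the sign of the field term, so
  for an optimal configuration or its reversal the field does not hurt.\<close>

lemma max_energy_field_ge:
  assumes V: "finite V"
  shows "max_energy \<tau> V a (\<lambda>_. 0) \<le> max_energy \<tau> V a h"
proof -
  obtain X where X: "X \<subseteq> V" "max_energy \<tau> V a (\<lambda>_. 0) = energy \<tau> V a (\<lambda>_. 0) X" by (rule max_energy_attained[OF V])
  have "spin (V - X) i = - spin X i" if "i \<in> V" for i using that by (auto simp: spin_def)
  then have "(\<Sum>i\<in>V. h i * spin (V - X) i) = - (\<Sum>i\<in>V. h i * spin X i)"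
    "(\<Sum>e\<in>pairs V. a e * (spin (V - X) (fst e) * spin (V - X) (snd e))) = (\<Sum>e\<in>pairs V. a e * (spin X (fst e) * spin X (snd e)))"
    unfolding sum_negf[symmetric] by (auto simp: pairs_def intro!: sum.cong)
  then have "energy \<tau> V a h (V - X) = - (\<Sum>i\<in>V. h i * spin X i) + \<tau> * (\<Sum>e\<in>pairs V. a e * (spin X (fst e) * spin X (snd e)))"
    unfolding energy_def by simp
  moreover have "energy \<tau> V a h (V - X) \<le> max_energy \<tau> V a h" "energy \<tau> V a h X \<le> max_energy \<tau> V a h" using X V by (auto intro!: max_energy_ge)
  ultimately show ?thesis unfolding X(2) by (simp add: energy_def)
qed

text \<open>Sites are added one at a time. A new site with spin fixed to \<open>+1\<close> acts on
  the others as an external field, which cannot lower the maximum.\<close>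

lemma max_energy_mono:
  assumes V: "finite V" and W: "W \<subseteq> V"
  shows "max_energy \<tau> W a (\<lambda>_. 0) \<le> max_energy \<tau> V a (\<lambda>_. 0)"
proof -
  have "max_energy \<tau> W a (\<lambda>_. 0) \<le> max_energy \<tau> (W \<union> D) a (\<lambda>_. 0)" if "finite D" for D
    using that
  proof (induction D)
    case (insert x D)
    show ?case
    proof (cases "x \<in> W \<union> D")
      case True then show ?thesis using insert by (simp add: insert_absorb)
    next
      case False
      have fin: "finite (W \<union> D)" using insert V W finite_subset by auto
      have "pairs {x} = {}" by (auto simp: pairs_def)
      have "max_energy \<tau> W a (\<lambda>_. 0) \<le> max_energy \<tau> (W \<union> D) a (\<lambda>_. 0)" by (rule insert.IH)
      also have "\<dots> \<le> max_energy \<tau> (W \<union> D) a (\<lambda>j. 0 + (\<Sum>i\<in>{x}. \<tau> * spin {i\<in>{x}. (0::real) \<ge> 0} i * a (min i j, max i j)))"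
        by (rule max_energy_field_ge[OF fin])
      also have "max_energy \<tau> (W \<union> D) a (\<lambda>j. 0 + (\<Sum>i\<in>{x}. \<tau> * spin {i\<in>{x}. (0::real) \<ge> 0} i * a (min i j, max i j))) \<le> max_energy \<tau> (insert x (W \<union> D)) a (\<lambda>_. 0)"
        using max_energy_batch[of "insert x (W \<union> D)" "{x}" "\<lambda>_. 0" \<tau> a] fin False \<open>pairs {x} = {}\<close> by simp
      finally show ?thesis by simp
    qed
  qed simp
  from this[of V] show ?thesis using V W by (simp add: Un_absorb1)
qed

lemma max_energy_scale: "0 \<le> \<tau> \<Longrightarrow> finite V \<Longrightarrow> max_energy \<tau> V a (\<lambda>_. 0) = \<tau> * max_energy 1 V a (\<lambda>_. 0)"
  unfolding max_energy_def energy_def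
  by (subst mono_Max_commute[of "(*) \<tau>"]) (auto simp: image_image mono_def mult_left_mono)

lemma ground_tail:
  assumes "0 < k" and V: "{l..<l+k} \<subseteq> V"
  shows "(\<integral>a. max_energy 1 {l..<l+k} a (\<lambda>_. 0) \<partial>gauss (pairs V)) = sqrt k * ground k"
proof -
  have "ground k = (\<integral>a. 1 / sqrt k * max_energy 1 {l..<l+k} a (\<lambda>_. 0) \<partial>gauss (pairs V))"
    unfolding ground_def mean_max_shift(1)[OF V] by (subst max_energy_scale) auto
  then show ?thesis using assms by simp
qed

text \<open>Chebyshev with a variance of order \<open>n\<^sup>2\<close> is crude, but the deviations
  tolerated are of order \<open>n * sqrt n\<close>, which leaves a probability of order
  \<open>1 / n\<close> for each of finitely many windows.\<close>

lemma tail_concentration: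
  assumes k: "0 < k" and n: "l + k \<le> n" and t: "0 < t"
  shows "measure (gauss (pairs {..<n})) {a \<in> space (gauss (pairs {..<n})). t \<le> \<bar>max_energy 1 {l..<l+k} a (\<lambda>_. 0) - sqrt k * ground k\<bar>} \<le> (real n)\<^sup>2 / t\<^sup>2"
proof -
  have V: "{l..<l+k} \<subseteq> {..<n}" using n by auto
  let ?f = "\<lambda>a. max_energy 1 {l..<l+k} a (\<lambda>_. 0)"
  have lip: "\<bar>?f a - ?f b\<bar> \<le> (\<Sum>e\<in>pairs {..<n}. \<bar>a e - b e\<bar>)" for a b
  proof -
    have "\<bar>?f a - ?f b\<bar> \<le> (\<Sum>e\<in>pairs {l..<l+k}. \<bar>a e - b e\<bar>)" using max_energy_lipschitz[of "{l..<l+k}" 1 a "\<lambda>_. 0" b "\<lambda>_. 0"] by simp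
    also have "\<dots> \<le> (\<Sum>e\<in>pairs {..<n}. \<bar>a e - b e\<bar>)" using pairs_mono[OF V] by (intro sum_mono2) auto
    finally show ?thesis .
  qed
  have "measure (gauss (pairs {..<n})) {a \<in> space (gauss (pairs {..<n})). t \<le> \<bar>?f a - (\<integral>a. ?f a \<partial>gauss (pairs {..<n}))\<bar>} \<le> real (card (pairs {..<n})) / t\<^sup>2"
    using pairs_mono[OF V] by (intro gauss_lipschitz_concentration t lip max_energy_measurable gauss_comp_measurable borel_measurable_const) auto
  also have "\<dots> \<le> (real n)\<^sup>2 / t\<^sup>2"
  proof -
    have "card (pairs {..<n}) \<le> card ({..<n} \<times> {..<n})" by (intro card_mono) (auto simp: pairs_def)
    then have "card (pairs {..<n}) \<le> n\<^sup>2" by (simp add: card_cartesian_product power2_eq_square)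
    then have "real (card (pairs {..<n})) \<le> real (n\<^sup>2)" by (simp only: of_nat_le_iff)
    then show ?thesis by (intro divide_right_mono) auto
  qed
  finally show ?thesis unfolding ground_tail[OF k V] .
qed

section \<open>Exponential moments\<close>

definition absmgf :: "real \<Rightarrow> real" where
  "absmgf \<mu> = (\<integral>x. exp (\<mu> * \<bar>x\<bar>) \<partial>std_normal)"

lemma gaussian_tilt:
  fixes F :: "real \<Rightarrow> real"
  assumes [measurable]: "F \<in> borel_measurable borel"
  shows "(\<integral>x. exp (\<mu> * x) * F x \<partial>std_normal) = exp (\<mu>\<^sup>2 / 2) * (\<integral>x. F (x + \<mu>) \<partial>std_normal)"
proof -
  have e: "std_normal_density x * exp (\<mu> * x) = exp (\<mu>\<^sup>2 / 2) * std_normal_density (x - \<mu>)" for x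
    unfolding std_normal_density_def
    by (simp add: mult_exp_exp) (simp add: power2_eq_square field_simps)
  have "(\<integral>x. exp (\<mu> * x) * F x \<partial>std_normal) = (\<integral>x. exp (\<mu>\<^sup>2 / 2) * (std_normal_density (x - \<mu>) * F x) \<partial>lborel)"
    by (subst integral_std_normal) (auto simp: mult.assoc[symmetric] e intro!: Bochner_Integration.integral_cong)
  also have "\<dots> = exp (\<mu>\<^sup>2 / 2) * (\<integral>x. std_normal_density (x - \<mu>) * F x \<partial>lborel)" by simp
  also have "(\<integral>x. std_normal_density (x - \<mu>) * F x \<partial>lborel) = (\<integral>x. std_normal_density x * F (x + \<mu>) \<partial>lborel)"
    by (subst lborel_integral_real_affine[where c=1 and t=\<mu>]) (auto simp: add.commute)
  also have "\<dots> = (\<integral>x. F (x + \<mu>) \<partial>std_normal)" by (subst integral_std_normal) auto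
  finally show ?thesis .
qed

lemma std_normal_exp_integrable: "integrable std_normal (\<lambda>x. exp (\<mu> * x))"
proof -
  have "std_normal_density x * exp (\<mu> * x) = exp (\<mu>\<^sup>2 / 2) * normal_density \<mu> 1 x" for x
    unfolding std_normal_density_def normal_density_def
    by (simp add: mult_exp_exp) (simp add: power2_eq_square field_simps)
  then show ?thesis by (simp add: integrable_std_normal)
qed

lemma std_normal_mgf: "(\<integral>x. exp (\<mu> * x) \<partial>std_normal) = exp (\<mu>\<^sup>2 / 2)"
  using gaussian_tilt[of "\<lambda>_. 1" \<mu>] by (simp add: std_normal.prob_space[simplified])

lemma std_normal_exp_abs_integrable: "integrable std_normal (\<lambda>x. exp (\<mu> * \<bar>x\<bar>))"
proof (rule Bochner_Integration.integrable_bound)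
  show "integrable std_normal (\<lambda>x. exp (\<mu> * x) + exp (- \<mu> * x))"
    by (intro Bochner_Integration.integrable_add std_normal_exp_integrable)
  show "AE x in std_normal. norm (exp (\<mu> * \<bar>x\<bar>)) \<le> norm (exp (\<mu> * x) + exp (- \<mu> * x))"
  proof (rule AE_I2)
    fix x
    have "0 < exp (\<mu> * x)" "0 < exp (- \<mu> * x)" by auto
    then show "norm (exp (\<mu> * \<bar>x\<bar>)) \<le> norm (exp (\<mu> * x) + exp (- \<mu> * x))"
      unfolding real_norm_def by (cases "x < 0") (simp_all only: abs_of_neg abs_of_nonneg not_less abs_exp_cancel, auto)
  qed
qed simp

lemma integral_std_normal_reflect:
  fixes F :: "real \<Rightarrow> real"
  assumes [measurable]: "F \<in> borel_measurable borel"
  shows "(\<integral>x. F (- x) \<partial>std_normal) = (\<integral>x. F x \<partial>std_normal)"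
proof -
  have "(\<integral>x. F x \<partial>std_normal) = (\<integral>x. std_normal_density x * F x \<partial>lborel)" by (rule integral_std_normal) simp
  also have "\<dots> = (\<integral>x. std_normal_density x * F (- x) \<partial>lborel)"
    by (subst lborel_integral_real_affine[where c="-1" and t=0]) (auto simp: std_normal_density_def)
  also have "\<dots> = (\<integral>x. F (- x) \<partial>std_normal)" by (rule integral_std_normal[symmetric]) simp
  finally show ?thesis by simp
qed

lemma exp_minus_upper_quadratic: "exp (- x) \<le> 1 - x + x\<^sup>2 / 2" if "0 \<le> x" for x :: real
proof -
  have "1 + x + x\<^sup>2 / 2 \<le> exp x" by (rule exp_lower_Taylor_quadratic[OF that])
  then have "exp (- x) \<le> 1 / (1 + x + x\<^sup>2 / 2)"
    using that by (simp add: exp_minus field_simps add_pos_nonneg)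
  also have "\<dots> \<le> 1 - x + x\<^sup>2 / 2"
  proof -
    have "(1 - x + x\<^sup>2 / 2) * (1 + x + x\<^sup>2 / 2) = 1 + x ^ 4 / 4" by (simp add: field_simps power2_eq_square power4_eq_xxxx)
    then have "1 \<le> (1 - x + x\<^sup>2 / 2) * (1 + x + x\<^sup>2 / 2)" by simp
    moreover have "0 < 1 + x + x\<^sup>2 / 2" using that by (simp add: add_pos_nonneg)
    ultimately show ?thesis by (simp add: divide_le_eq)
  qed
  finally show ?thesis .
qed

text \<open>By reflection and a shift, \<open>absmgf \<mu>\<close> is
  \<open>2 * exp (\<mu>\<^sup>2 / 2)\<close> times the normal probability of
  \<open>{-\<mu>..}\<close>, which is 1/2 plus a strip of width \<open>\<mu>\<close>. The constants
  round \<open>sqrt (2 / pi)\<close> and \<open>exp (- 2 / 5)\<close> upwards, and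
  \<open>- 3 / 5\<close> is \<open>2 / 5 - 1\<close>.\<close>

lemma absmgf_upper:
  assumes \<mu>: "0 \<le> \<mu>"
  shows "absmgf \<mu> \<le> exp (\<mu>\<^sup>2 / 2 - 3 / 5 + 67033 / 100000 * (1 + 7979 / 10000 * (\<mu> - \<mu> ^ 3 / 6 + \<mu> ^ 5 / 40)))"
proof -
  let ?I = "\<lambda>A x. indicator A x :: real"
  let ?q = "\<mu> - \<mu> ^ 3 / 6 + \<mu> ^ 5 / 40"
  define \<kappa> where "\<kappa> = 1 / sqrt (2 * pi)"
  have ii: "integrable std_normal (\<lambda>x. ?I A x)" if [measurable]: "A \<in> sets borel" for A
    by (rule std_normal.integrable_const_bound[where B=1]) (auto intro: AE_I2)
  have ei: "integrable std_normal (\<lambda>x. exp (c * x) * ?I A x)" if [measurable]: "A \<in> sets borel" for A and c :: real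
    by (rule Bochner_Integration.integrable_bound[OF std_normal_exp_integrable[of c]]) (auto simp: indicator_def intro!: AE_I2)
  have half: "(\<integral>x. ?I {0..} x \<partial>std_normal) = 1 / 2"
  proof -
    have n0: "AE x in std_normal. x \<noteq> 0"
      unfolding std_normal_def by (subst AE_density) (auto intro: AE_mp[OF AE_lborel_singleton])
    have "2 * (\<integral>x. ?I {0..} x \<partial>std_normal) = (\<integral>x. ?I {0..} x \<partial>std_normal) + (\<integral>x. ?I {0..} (- x) \<partial>std_normal)"
      by (subst integral_std_normal_reflect) auto
    also have "(\<lambda>x::real. ?I {0..} (- x)) = ?I {..0}" by (auto simp: indicator_def fun_eq_iff)
    also have "(\<integral>x. ?I {0..} x \<partial>std_normal) + (\<integral>x. ?I {..0} x \<partial>std_normal) = (\<integral>x. ?I {0..} x + ?I {..0} x \<partial>std_normal)"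
      by (rule Bochner_Integration.integral_add[symmetric]) (auto intro: ii)
    also have "\<dots> = (\<integral>x. 1 \<partial>std_normal)"
      by (rule integral_cong_AE) (use n0 in \<open>auto simp: indicator_def elim!: eventually_mono\<close>)
    finally show ?thesis by (simp add: std_normal.prob_space[simplified])
  qed
  \<comment> \<open>On the strip the density is bounded by a polynomial, from
    \<open>exp_minus_upper_quadratic\<close> at \<open>x\<^sup>2 / 2\<close>; its integral is
    \<open>?q\<close>.\<close>
  have strip: "(\<integral>x. ?I {-\<mu>..0} x \<partial>std_normal) \<le> \<kappa> * ?q"
  proof -
    let ?p = "\<lambda>x::real. 1 - x\<^sup>2 / 2 + x ^ 4 / 8"
    have bi: "has_bochner_integral lborel (\<lambda>x. ?p x * ?I {-\<mu>..0} x) ((\<lambda>x. x - x ^ 3 / 6 + x ^ 5 / 40) 0 - (\<lambda>x. x - x ^ 3 / 6 + x ^ 5 / 40) (-\<mu>))"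
      using \<mu> by (intro has_bochner_integral_FTC_Icc_real) (auto intro!: derivative_eq_intros simp: power2_eq_square)
    have "(\<integral>x. ?I {-\<mu>..0} x \<partial>std_normal) = (\<integral>x. std_normal_density x * ?I {-\<mu>..0} x \<partial>lborel)"
      by (rule integral_std_normal) simp
    also have "\<dots> \<le> (\<integral>x. \<kappa> * (?p x * ?I {-\<mu>..0} x) \<partial>lborel)"
    proof (rule integral_mono)
      show "integrable lborel (\<lambda>x. std_normal_density x * ?I {-\<mu>..0} x)"
        using ii[of "{-\<mu>..0}"] by (simp add: integrable_std_normal)
      show "integrable lborel (\<lambda>x. \<kappa> * (?p x * ?I {-\<mu>..0} x))" using bi by (intro integrable_mult_right) (simp add: has_bochner_integral_iff)
      show "std_normal_density x * ?I {-\<mu>..0} x \<le> \<kappa> * (?p x * ?I {-\<mu>..0} x)" for x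
      proof -
        have "exp (- (x\<^sup>2 / 2)) \<le> ?p x" using exp_minus_upper_quadratic[of "x\<^sup>2 / 2"] by (simp add: power2_eq_square power4_eq_xxxx)
        then have "\<kappa> * exp (- (x\<^sup>2 / 2)) \<le> \<kappa> * ?p x" by (intro mult_left_mono) (auto simp: \<kappa>_def)
        then have "\<kappa> * exp (- (x\<^sup>2 / 2)) * ?I {-\<mu>..0} x \<le> \<kappa> * ?p x * ?I {-\<mu>..0} x" by (intro mult_right_mono) auto
        then show ?thesis by (simp add: std_normal_density_def \<kappa>_def mult.assoc)
      qed
    qed
    also have "\<dots> = \<kappa> * ?q" using bi by (simp add: has_bochner_integral_iff)
    finally show ?thesis .
  qed
  have tail: "(\<integral>x. ?I {-\<mu>..} x \<partial>std_normal) \<le> 1 / 2 + \<kappa> * ?q"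
  proof -
    have "(\<integral>x. ?I {-\<mu>..} x \<partial>std_normal) \<le> (\<integral>x. ?I {0..} x + ?I {-\<mu>..0} x \<partial>std_normal)"
      by (intro integral_mono ii Bochner_Integration.integrable_add) (auto simp: indicator_def)
    also have "\<dots> = (\<integral>x. ?I {0..} x \<partial>std_normal) + (\<integral>x. ?I {-\<mu>..0} x \<partial>std_normal)"
      by (intro Bochner_Integration.integral_add ii) auto
    finally show ?thesis using half strip by linarith
  qed
  have "absmgf \<mu> \<le> (\<integral>x. exp (\<mu> * x) * ?I {0..} x + exp (- \<mu> * x) * ?I {..0} x \<partial>std_normal)"
    unfolding absmgf_def
    by (intro integral_mono std_normal_exp_abs_integrable Bochner_Integration.integrable_add ei) (auto simp: indicator_def abs_if)
  also have "\<dots> = (\<integral>x. exp (\<mu> * x) * ?I {0..} x \<partial>std_normal) + (\<integral>x. exp (- \<mu> * x) * ?I {..0} x \<partial>std_normal)"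
    by (intro Bochner_Integration.integral_add ei) auto
  also have "(\<integral>x. exp (- \<mu> * x) * ?I {..0} x \<partial>std_normal) = (\<integral>x. exp (\<mu> * x) * ?I {0..} x \<partial>std_normal)"
    by (subst integral_std_normal_reflect[symmetric]) (auto simp: indicator_def intro!: Bochner_Integration.integral_cong)
  also have "(\<integral>x. exp (\<mu> * x) * ?I {0..} x \<partial>std_normal) = exp (\<mu>\<^sup>2 / 2) * (\<integral>x. ?I {-\<mu>..} x \<partial>std_normal)"
  proof -
    have "(\<lambda>x. ?I {0..} (x + \<mu>)) = ?I {-\<mu>..}" by (auto simp: indicator_def fun_eq_iff)
    then show ?thesis by (subst gaussian_tilt) auto
  qed
  also have "exp (\<mu>\<^sup>2 / 2) * (\<integral>x. ?I {-\<mu>..} x \<partial>std_normal) + exp (\<mu>\<^sup>2 / 2) * (\<integral>x. ?I {-\<mu>..} x \<partial>std_normal)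
      \<le> exp (\<mu>\<^sup>2 / 2) * (1 + 2 * \<kappa> * ?q)"
    using tail mult_left_mono[OF tail, of "exp (\<mu>\<^sup>2 / 2)"] by (simp add: algebra_simps)
  also have "\<dots> \<le> exp (\<mu>\<^sup>2 / 2) * exp (- 3 / 5 + 67033 / 100000 * (1 + 7979 / 10000 * ?q))"
  proof (rule mult_left_mono)
    have q: "0 \<le> ?q"
    proof -
      have "0 \<le> (\<integral>x. ?I {-\<mu>..0} x \<partial>std_normal)" by (intro integral_nonneg_AE) auto
      then have "0 \<le> \<kappa> * ?q" using strip by linarith
      moreover have "0 < \<kappa>" by (simp add: \<kappa>_def)
      ultimately show ?thesis by (simp add: zero_le_mult_iff)
    qed
    have k: "2 * \<kappa> \<le> 7979 / 10000"
    proof -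
      have "(20000 / 7979)\<^sup>2 \<le> 2 * pi" using pi_approx by (simp add: power2_eq_square)
      then have "20000 / 7979 \<le> sqrt (2 * pi)" by (rule real_le_rsqrt)
      then have "2 / sqrt (2 * pi) \<le> 2 / (20000 / 7979)" by (intro divide_left_mono) auto
      then show ?thesis by (simp add: \<kappa>_def)
    qed
    let ?v = "1 + 7979 / 10000 * ?q"
    have e: "exp (- (2 / 5)) \<le> (67033 / 100000 :: real)"
    proof -
      have "1 + 2/5 + (2/5)^2/2 + (2/5)^3/6 + (2/5)^4/24 + (2/5)^5/120 \<le> exp (2/5 :: real)"
      proof -
        have "(\<Sum>n<6. inverse (fact n) * (2/5 :: real) ^ n) \<le> (\<Sum>n. inverse (fact n) * (2/5) ^ n)"
          by (rule sum_le_suminf[OF summable_exp]) auto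
        then show ?thesis by (simp add: exp_def eval_nat_numeral divideR_right scaleR_conv_of_real)
      qed
      then have "100000 / 67033 \<le> exp (2/5 :: real)" by (simp add: power_divide)
      then have "inverse (exp (2/5)) \<le> inverse (100000 / 67033 :: real)" by (intro le_imp_inverse_le) auto
      then show ?thesis by (simp add: exp_minus)
    qed
    have "1 + 2 * \<kappa> * ?q \<le> ?v" using mult_right_mono[OF k q] by simp
    \<comment> \<open>The logarithm of \<open>?v\<close> is bounded by the tangent of
      \<open>ln\<close> at \<open>exp (2 / 5)\<close>, a point inside the range of \<open>?v\<close>
      for the \<open>\<mu>\<close> used later. This makes the final exponent a polynomial in
      \<open>\<mu>\<close>.\<close>
    also have "?v = exp (2 / 5) * (exp (- (2 / 5)) * ?v)" by (simp add: exp_minus)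
    also have "\<dots> \<le> exp (2 / 5) * (67033 / 100000 * ?v)" using e q by (intro mult_left_mono mult_right_mono) auto
    also have "\<dots> \<le> exp (2 / 5) * exp (67033 / 100000 * ?v - 1)"
      using exp_ge_add_one_self[of "67033 / 100000 * ?v - 1"] by (intro mult_left_mono) auto
    also have "\<dots> = exp (- 3 / 5 + 67033 / 100000 * ?v)" by (simp add: mult_exp_exp)
    finally show "1 + 2 * \<kappa> * ?q \<le> exp (- 3 / 5 + 67033 / 100000 * ?v)" .
  qed simp
  also have "\<dots> = exp (\<mu>\<^sup>2 / 2 - 3 / 5 + 67033 / 100000 * (1 + 7979 / 10000 * ?q))" by (simp add: mult_exp_exp)
  finally show ?thesis .
qed


text \<open>Minus the bound of a node without its tail term, for the couplings \<open>- a\<close>. Working with maxima instead of minima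
  costs only a reflection of all couplings, which preserves their law.\<close>

definition prefix_energy :: "nat \<Rightarrow> nat \<Rightarrow> (nat \<times> nat \<Rightarrow> real) \<Rightarrow> nat set \<Rightarrow> real" where
  "prefix_energy n l a X = (\<Sum>e\<in>pairs {..<l}. a e * (spin X (fst e) * spin X (snd e))) + (\<Sum>j\<in>{l..<n}. \<bar>\<Sum>i<l. a (i,j) * spin X i\<bar>)"

lemma prefix_energy_measurable: "l \<le> n \<Longrightarrow> (\<lambda>a. prefix_energy n l a X) \<in> borel_measurable (gauss (pairs {..<n}))"
  unfolding prefix_energy_def
  by (intro borel_measurable_add borel_measurable_sum borel_measurable_times borel_measurable_abs borel_measurable_const gauss_comp_measurable)
    (auto simp: pairs_def)

lemma scaled_normal_integral:
  fixes F :: "real \<Rightarrow> real"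
  assumes [measurable]: "F \<in> borel_measurable borel"
  shows "(\<integral>y. F y \<partial>scaled_normal \<sigma>) = (\<integral>x. F (\<sigma> * x) \<partial>std_normal)"
    "integrable (scaled_normal \<sigma>) F \<longleftrightarrow> integrable std_normal (\<lambda>x. F (\<sigma> * x))"
  unfolding scaled_normal_def by (simp_all add: integral_distr integrable_distr_eq)

text \<open>The interactions inside the prefix and the fields acting on the remaining sites are independent,
  since they use disjoint sets of couplings; index \<open>n\<close> stands for the prefix.\<close>

lemma prefix_energy_mgf:
  assumes l: "2 \<le> l" "l \<le> n" and \<theta>: "0 \<le> \<theta>"
  shows "integrable (gauss (pairs {..<n})) (\<lambda>a. exp (\<theta> * prefix_energy n l a X))"
    "(\<integral>a. exp (\<theta> * prefix_energy n l a X) \<partial>gauss (pairs {..<n})) = exp (\<theta>\<^sup>2 * real (card (pairs {..<l})) / 2) * absmgf (\<theta> * sqrt l) ^ (n - l)"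
proof -
  let ?I = "{l..n}"
  define S where "S = (\<lambda>j. if j = n then pairs {..<l} else (\<lambda>i. (i, j)) ` {..<l})"
  define c where "c = (\<lambda>j e. if j = n then spin X (fst e) * spin X (snd e) else spin X (fst e))"
  define F where "F = (\<lambda>j y. if j = n then exp (\<theta> * y) else exp (\<theta> * \<bar>y\<bar>))"
  let ?T = "\<lambda>a. \<lambda>j\<in>?I. \<Sum>e\<in>S j. c j e * a e"
  let ?Q = "\<lambda>j. scaled_normal (sqrt (\<Sum>e\<in>S j. (c j e)\<^sup>2))"
  interpret Q: product_sigma_finite ?Q
    by (rule product_sigma_finite.intro) (intro prob_space_imp_sigma_finite prob_space_scaled_normal)
  have ne: "(0, 1) \<in> pairs {..<l}" using l by (auto simp: pairs_def)
  have law: "distr (gauss (pairs {..<n})) (PiM ?I (\<lambda>_. borel)) ?T = PiM ?I ?Q"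
  proof (rule gauss_linear_forms)
    show "finite (S j) \<and> S j \<noteq> {} \<and> S j \<subseteq> pairs {..<n}" if "j \<in> ?I" for j
    proof (cases "j = n")
      case True
      then show ?thesis using ne l pairs_mono[of "{..<l}" "{..<n}"] by (auto simp: S_def)
    next
      case False
      then show ?thesis using that l by (auto simp: S_def pairs_def lessThan_empty_iff)
    qed
    show "disjoint_family_on S ?I" by (auto simp: disjoint_family_on_def S_def pairs_def)
  qed (use l in \<open>auto simp: c_def\<close>)
  have cS: "(\<Sum>e\<in>S j. (c j e)\<^sup>2) = (if j = n then real (card (pairs {..<l})) else real l)" for j
  proof -
    have "(\<Sum>e\<in>S j. (c j e)\<^sup>2) = real (card (S j))" by (cases "j = n") (simp_all add: c_def power_mult_distrib)
    then show ?thesis by (simp add: S_def card_image inj_on_def)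
  qed
  have mF: "F j \<in> borel_measurable borel" for j by (simp add: F_def)
  have iF: "integrable (?Q j) (F j)" for j
    unfolding scaled_normal_integral(2)[OF mF]
    using std_normal_exp_integrable[of "\<theta> * \<sigma>" for \<sigma>] std_normal_exp_abs_integrable[of "\<theta> * \<bar>\<sigma>\<bar>" for \<sigma>]
    by (cases "j = n") (simp_all add: F_def mult.assoc abs_mult)
  have eF: "(\<integral>y. F j y \<partial>?Q j) = (if j = n then exp (\<theta>\<^sup>2 * real (card (pairs {..<l})) / 2) else absmgf (\<theta> * sqrt l))" for j
    unfolding scaled_normal_integral(1)[OF mF] cS
    using std_normal_mgf[of "\<theta> * sqrt (real (card (pairs {..<l})))"]
    by (cases "j = n") (simp_all add: F_def mult.assoc abs_mult absmgf_def power_mult_distrib)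
  have G: "exp (\<theta> * prefix_energy n l a X) = (\<Prod>j\<in>?I. F j (?T a j))" for a
  proof -
    have I: "?I = insert n {l..<n}" using l by auto
    have col: "(\<Sum>e\<in>S j. c j e * a e) = (\<Sum>i<l. a (i, j) * spin X i)" if "j \<in> {l..<n}" for j
      using that by (simp add: S_def c_def sum.reindex inj_on_def mult.commute)
    have "(\<Prod>j\<in>?I. F j (?T a j)) = F n (\<Sum>e\<in>S n. c n e * a e) * (\<Prod>j\<in>{l..<n}. F j (\<Sum>e\<in>S j. c j e * a e))"
      unfolding I by (simp add: prod.insert)
    also have "F n (\<Sum>e\<in>S n. c n e * a e) = exp (\<theta> * (\<Sum>e\<in>pairs {..<l}. a e * (spin X (fst e) * spin X (snd e))))"
      by (simp add: F_def S_def c_def mult_ac)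
    also have "(\<Prod>j\<in>{l..<n}. F j (\<Sum>e\<in>S j. c j e * a e)) = (\<Prod>j\<in>{l..<n}. exp (\<theta> * \<bar>\<Sum>i<l. a (i, j) * spin X i\<bar>))"
      by (intro prod.cong refl) (simp add: col F_def)
    also have "\<dots> = exp (\<theta> * (\<Sum>j\<in>{l..<n}. \<bar>\<Sum>i<l. a (i, j) * spin X i\<bar>))"
      by (simp add: exp_sum sum_distrib_left)
    finally show ?thesis by (simp add: prefix_energy_def exp_add[symmetric] distrib_left)
  qed
  let ?P = "\<lambda>z. \<Prod>j\<in>?I. F j (z j)"
  have mT: "?T \<in> gauss (pairs {..<n}) \<rightarrow>\<^sub>M PiM ?I (\<lambda>_. borel)"
  proof (intro measurable_restrict borel_measurable_sum borel_measurable_times borel_measurable_const gauss_comp_measurable)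
    fix j e assume "j \<in> ?I" "e \<in> S j"
    then show "e \<in> pairs {..<n}" using l by (auto simp: S_def pairs_def split: if_splits)
  qed
  have mP: "?P \<in> borel_measurable (PiM ?I (\<lambda>_. borel))"
  proof (rule borel_measurable_prod)
    fix j assume "j \<in> ?I"
    then have "(\<lambda>z. z j) \<in> borel_measurable (PiM ?I (\<lambda>_. borel))" by (rule measurable_component_singleton)
    then show "(\<lambda>z. F j (z j)) \<in> borel_measurable (PiM ?I (\<lambda>_. borel))" by (rule measurable_compose[OF _ mF])
  qed
  have iP: "integrable (PiM ?I ?Q) ?P" by (rule Q.product_integrable_prod) (use iF in auto)
  then have "integrable (distr (gauss (pairs {..<n})) (PiM ?I (\<lambda>_. borel)) ?T) ?P" unfolding law .
  then show "integrable (gauss (pairs {..<n})) (\<lambda>a. exp (\<theta> * prefix_energy n l a X))"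
    unfolding G by (subst (asm) integrable_distr_eq[OF mT mP])
  have "(\<integral>a. exp (\<theta> * prefix_energy n l a X) \<partial>gauss (pairs {..<n})) = (\<integral>z. ?P z \<partial>distr (gauss (pairs {..<n})) (PiM ?I (\<lambda>_. borel)) ?T)"
    unfolding G by (rule integral_distr[OF mT mP, symmetric])
  also have "\<dots> = (\<Prod>j\<in>?I. (\<integral>y. F j y \<partial>?Q j))"
    unfolding law by (rule Q.product_integral_prod) (use iF in auto)
  also have "\<dots> = (\<Prod>j\<in>insert n {l..<n}. if j = n then exp (\<theta>\<^sup>2 * real (card (pairs {..<l})) / 2) else absmgf (\<theta> * sqrt l))"
    unfolding eF using l by (intro prod.cong) auto
  also have "\<dots> = exp (\<theta>\<^sup>2 * real (card (pairs {..<l})) / 2) * absmgf (\<theta> * sqrt l) ^ (n - l)"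
    by simp
  finally show "(\<integral>a. exp (\<theta> * prefix_energy n l a X) \<partial>gauss (pairs {..<n})) = exp (\<theta>\<^sup>2 * real (card (pairs {..<l})) / 2) * absmgf (\<theta> * sqrt l) ^ (n - l)" .
qed

text \<open>Markov's inequality for the exponential; the prefix has fewer than
  \<open>l\<^sup>2 / 2\<close> pairs.\<close>

lemma prefix_energy_tail:
  assumes l: "2 \<le> l" "l \<le> n" and \<theta>: "0 \<le> \<theta>"
  shows "measure (gauss (pairs {..<n})) {a \<in> space (gauss (pairs {..<n})). t \<le> prefix_energy n l a X} \<le> exp (\<theta>\<^sup>2 * (real l)\<^sup>2 / 4 - \<theta> * t) * absmgf (\<theta> * sqrt l) ^ (n - l)"
proof -
  interpret prob_space "gauss (pairs {..<n})" by (rule prob_space_gauss)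
  note m = prefix_energy_mgf[OF l \<theta>]
  have am: "0 \<le> absmgf (\<theta> * sqrt l)" unfolding absmgf_def by (intro integral_nonneg_AE) auto
  have meas: "{a \<in> space (gauss (pairs {..<n})). exp (\<theta> * t) \<le> exp (\<theta> * prefix_energy n l a X)} \<in> events"
    by (intro borel_measurable_le borel_measurable_integrable[OF m(1)] borel_measurable_const)
  have "prob {a \<in> space (gauss (pairs {..<n})). t \<le> prefix_energy n l a X} \<le> prob {a \<in> space (gauss (pairs {..<n})). exp (\<theta> * t) \<le> exp (\<theta> * prefix_energy n l a X)}"
    by (rule finite_measure_mono[OF _ meas]) (use \<theta> in \<open>auto intro: mult_left_mono\<close>)
  also have "\<dots> \<le> (\<integral>a. exp (\<theta> * prefix_energy n l a X) \<partial>gauss (pairs {..<n})) / exp (\<theta> * t)"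
    by (rule integral_Markov_inequality_measure[OF m(1) sets.empty_sets]) auto
  also have "\<dots> = exp (\<theta>\<^sup>2 * real (card (pairs {..<l})) / 2 - \<theta> * t) * absmgf (\<theta> * sqrt l) ^ (n - l)"
    unfolding m(2) by (simp add: exp_diff)
  also have "\<dots> \<le> exp (\<theta>\<^sup>2 * (real l)\<^sup>2 / 4 - \<theta> * t) * absmgf (\<theta> * sqrt l) ^ (n - l)"
  proof (intro mult_right_mono zero_le_power am)
    have "(real l)\<^sup>2 = real l + 2 * real (card (pairs {..<l}))"
      using sum_square_pairs[of "{..<l}" "\<lambda>_. 1"] by simp
    then have "real (card (pairs {..<l})) / 2 \<le> (real l)\<^sup>2 / 4" by simp
    then have "\<theta>\<^sup>2 * (real (card (pairs {..<l})) / 2) \<le> \<theta>\<^sup>2 * ((real l)\<^sup>2 / 4)" by (rule mult_left_mono) simp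
    then show "exp (\<theta>\<^sup>2 * real (card (pairs {..<l})) / 2 - \<theta> * t) \<le> exp (\<theta>\<^sup>2 * (real l)\<^sup>2 / 4 - \<theta> * t)" by simp
  qed
  finally show ?thesis .
qed

section \<open>The exponent per site\<close>

text \<open>The logarithm of the expected count per site, relative to \<open>0.4505 * ln 2\<close>,
  at depth \<open>\<alpha> * n\<close> and with parameter \<open>22 / 25 / sqrt n\<close>, so that
  \<open>\<mu> = 22 / 25 * sqrt \<alpha>\<close>. \<open>ln 2\<close>, \<open>sqrt y\<close>,
  \<open>P\<close> and \<open>absmgf\<close> have been replaced by bounds that leave a polynomial of
  degree 7 in \<open>\<mu>\<close>. The margin 0.00088 is \<open>22 / 25\<close> times the loss
  1/1000 in the gap.\<close>

lemma exponent_polynomial: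
  fixes \<mu> :: real
  assumes \<mu>: "59 / 100 \<le> \<mu>" "\<mu> \<le> 22 / 25"
  defines "\<alpha> \<equiv> 625 / 484 * \<mu>\<^sup>2"
  defines "y \<equiv> 1 - \<alpha>"
  shows "(\<alpha> - 4505 / 10000) * (25 / 36) - 22 / 25 * (658 / 1000) * (1 - y * (y + 4356 / 10000) / (132 / 100)) + (22 / 25)\<^sup>2 / 4 * \<alpha>\<^sup>2
    + y * (\<mu>\<^sup>2 / 2 - 3 / 5 + 67033 / 100000 * (1 + 7979 / 10000 * (\<mu> - \<mu> ^ 3 / 6 + \<mu> ^ 5 / 40))) \<le> - 88 / 100000" (is "?f \<le> _")
proof -
  \<comment> \<open>0.59 lies just below \<open>22 / 25 * sqrt 0.4505\<close>, the value of
    \<open>\<mu>\<close> at the shallowest depth considered.\<close>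
  define u where "u = \<mu> - 59 / 100"
  have u: "0 \<le> u" "u \<le> 29 / 100" and \<mu>u: "\<mu> = 59 / 100 + u" using \<mu> by (auto simp: u_def)
  have eq: "- 88 / 100000 - ?f = (9829380461971669788850249 / 3373286400000000000000000000) + (-1414953343995549916719859 / 33732864000000000000000000) * u + (122296500525396416389637 / 337328640000000000000000) * u ^ 2 + (-125626768207946379641 / 224885760000000000000) * u ^ 3 + (-497417026260987721 / 749619200000000000) * u ^ 4 + (-2101450430203 / 929280000000000) * u ^ 5 + (220895654791 / 3097600000000) * u ^ 6 + (534856307 / 30976000000) * u ^ 7"
    unfolding \<alpha>_def y_def \<mu>u by (simp add: eval_nat_numeral field_simps)
  \<comment> \<open>Coefficients rounded down, and the positive terms of degree 6 and 7
    dropped.\<close>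
  have low: "29 / 10000 - 41946 / 1000000 * u + u\<^sup>2 * (36254 / 100000 - 55863 / 100000 * u - 66360 / 100000 * u\<^sup>2 - 227 / 100000 * u ^ 3) \<le> - 88 / 100000 - ?f"
  proof -
    have p: "0 \<le> u ^ k" for k using u by simp
    have m: "u\<^sup>2 * (36254 / 100000 - 55863 / 100000 * u - 66360 / 100000 * u\<^sup>2 - 227 / 100000 * u ^ 3)
      = 36254 / 100000 * u ^ 2 - 55863 / 100000 * u ^ 3 - 66360 / 100000 * u ^ 4 - 227 / 100000 * u ^ 5"
      by (simp add: eval_nat_numeral algebra_simps)
    show ?thesis unfolding eq m using u(1) p[of 2] p[of 3] p[of 4] p[of 5] p[of 6] p[of 7] by linarith
  qed
  have q: "u\<^sup>2 * m \<le> u\<^sup>2 * (36254 / 100000 - 55863 / 100000 * u - 66360 / 100000 * u\<^sup>2 - 227 / 100000 * u ^ 3)"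
    if "u \<le> b" "m \<le> 36254 / 100000 - 55863 / 100000 * b - 66360 / 100000 * b\<^sup>2 - 227 / 100000 * b ^ 3" for m b
  proof (rule mult_left_mono)
    have "u\<^sup>2 \<le> b\<^sup>2" "u ^ 3 \<le> b ^ 3" using u that by (auto intro: power_mono)
    then show "m \<le> 36254 / 100000 - 55863 / 100000 * u - 66360 / 100000 * u\<^sup>2 - 227 / 100000 * u ^ 3"
      using that by linarith
  qed simp
  \<comment> \<open>The bracket decreases in \<open>u\<close>, so on each piece it is at least its
    value at the right end. Then \<open>u\<^sup>2\<close> is replaced by a tangent line, at 0.095
    and at 0.2, which leaves linear inequalities.\<close>
  have "0 \<le> 29 / 10000 - 41946 / 1000000 * u + u\<^sup>2 * (36254 / 100000 - 55863 / 100000 * u - 66360 / 100000 * u\<^sup>2 - 227 / 100000 * u ^ 3)"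
  proof (cases "u \<le> 1 / 5")
    case True
    have "0 \<le> (u - 95 / 1000)\<^sup>2" by simp
    then have "u\<^sup>2 \<ge> 19 / 100 * u - 9025 / 1000000" by (simp add: power2_eq_square algebra_simps)
    moreover have "u\<^sup>2 * (22 / 100) \<le> u\<^sup>2 * (36254 / 100000 - 55863 / 100000 * u - 66360 / 100000 * u\<^sup>2 - 227 / 100000 * u ^ 3)"
      by (rule q[of "1/5"]) (use True in \<open>simp_all add: power_divide\<close>)
    ultimately show ?thesis using True u(1) by linarith
  next
    case False
    then have "0 \<le> (u - 1 / 5) * (u - 1 / 5)" "0 \<le> u - 1 / 5" by simp_all
    then have "u\<^sup>2 \<ge> 2 / 5 * u - 1 / 25" by (simp add: power2_eq_square algebra_simps)
    moreover have "u\<^sup>2 * (144 / 1000) \<le> u\<^sup>2 * (36254 / 100000 - 55863 / 100000 * u - 66360 / 100000 * u\<^sup>2 - 227 / 100000 * u ^ 3)"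
      by (rule q[of "29/100"]) (use u in \<open>simp_all add: power_divide\<close>)
    ultimately show ?thesis using False u(2) by linarith
  qed
  then show ?thesis using low by linarith
qed

section \<open>Counting the surviving nodes\<close>

text \<open>Union bound over the \<open>2 ^ l\<close> prefixes of a given depth. A single
  exponential parameter, proportional to \<open>1 / sqrt n\<close>, serves all depths from
  \<open>0.4505 * n\<close> on.\<close>

lemma prefix_tail:
  fixes P :: real
  assumes l: "2 \<le> l" "l \<le> n" "4505 / 10000 * real n \<le> real l" and P: "658 / 1000 \<le> P"
  defines "y \<equiv> 1 - real l / real n"
  shows "2 ^ l * measure (gauss (pairs {..<n})) {a \<in> space (gauss (pairs {..<n})). real n * sqrt n * (P * (1 - y * sqrt y) - 1 / 1000) \<le> prefix_energy n l a X}
    \<le> 2 powr (4505 / 10000 * real n)"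
proof -
  define s where "s = sqrt (real n)"
  have n: "0 < real n" using l by simp
  have s: "0 < s" "s * s = real n" using n by (auto simp: s_def)
  define \<alpha> where "\<alpha> = real l / real n"
  define \<mu> where "\<mu> = 22 / 25 * sqrt \<alpha>"
  have \<alpha>: "4505 / 10000 \<le> \<alpha>" "\<alpha> \<le> 1" "real l = \<alpha> * real n" using l n by (auto simp: \<alpha>_def field_simps)
  have y: "y = 1 - \<alpha>" "0 \<le> y" "y \<le> 1" unfolding y_def \<alpha>_def[symmetric] using \<alpha>(1,2) by auto
  \<comment> \<open>Tangent of the square root at \<open>0.66\<^sup>2 = 0.4356\<close>, close to the
    value of \<open>y\<close> at which \<open>exponent_polynomial\<close> has least room.\<close>
  have ry: "sqrt y * (66 / 100) \<le> (y + 4356 / 10000) / 2" "0 \<le> sqrt y" "sqrt y \<le> 1"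
  proof -
    have "0 \<le> (sqrt y - 66 / 100)\<^sup>2" by simp
    then show "sqrt y * (66 / 100) \<le> (y + 4356 / 10000) / 2" using y(2) by (simp add: power2_eq_square algebra_simps)
  qed (use y(2,3) in auto)
  have m2: "\<mu>\<^sup>2 = 484 / 625 * \<alpha>" using \<alpha> by (simp add: \<mu>_def power_mult_distrib power_divide)
  have \<mu>0: "0 \<le> \<mu>" using \<alpha> by (simp add: \<mu>_def)
  have \<mu>: "59 / 100 \<le> \<mu>" "\<mu> \<le> 22 / 25"
  proof -
    show "59 / 100 \<le> \<mu>" by (rule power2_le_imp_le) (use \<mu>0 m2 \<alpha> in \<open>simp_all add: power_divide\<close>)
    show "\<mu> \<le> 22 / 25" by (rule power2_le_imp_le) (use m2 \<alpha> in \<open>simp_all add: power_divide\<close>)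
  qed
  have am: "625 / 484 * \<mu>\<^sup>2 = \<alpha>" using m2 by simp
  define b where "b = \<mu>\<^sup>2 / 2 - 3 / 5 + 67033 / 100000 * (1 + 7979 / 10000 * (\<mu> - \<mu> ^ 3 / 6 + \<mu> ^ 5 / 40))"
  let ?\<theta> = "22 / 25 / s"
  let ?t = "real n * s * (P * (1 - y * sqrt y) - 1 / 1000)"
  have th: "?\<theta> * sqrt l = \<mu>" using s n by (simp add: \<mu>_def \<alpha>_def s_def real_sqrt_divide)
  have abs0: "0 \<le> absmgf \<mu>" unfolding absmgf_def by (intro integral_nonneg_AE) auto
  have e1: "?\<theta>\<^sup>2 * (real l)\<^sup>2 / 4 = real n * ((22 / 25)\<^sup>2 / 4 * \<alpha>\<^sup>2)"
    unfolding \<alpha>(3) s(2)[symmetric] using s(1) by (simp add: power2_eq_square)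
  have e2: "?\<theta> * ?t = real n * (22 / 25 * (P * (1 - y * sqrt y) - 1 / 1000))" using s(1) by simp
  have e3: "real (n - l) = real n * y" using l n by (simp add: y_def of_nat_diff field_simps)
  have pw: "2 ^ l = exp (real n * (\<alpha> * ln 2))"
    by (simp add: powr_realpow[symmetric] powr_def \<alpha>(3) mult_ac)
  have "measure (gauss (pairs {..<n})) {a \<in> space (gauss (pairs {..<n})). ?t \<le> prefix_energy n l a X} \<le> exp (?\<theta>\<^sup>2 * (real l)\<^sup>2 / 4 - ?\<theta> * ?t) * absmgf (?\<theta> * sqrt l) ^ (n - l)"
    by (rule prefix_energy_tail[OF l(1,2)]) (use s in simp)
  also have "\<dots> \<le> exp (?\<theta>\<^sup>2 * (real l)\<^sup>2 / 4 - ?\<theta> * ?t) * exp b ^ (n - l)"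
    unfolding th b_def by (intro mult_left_mono power_mono absmgf_upper \<mu>0 abs0) auto
  also have "\<dots> = exp (?\<theta>\<^sup>2 * (real l)\<^sup>2 / 4 - ?\<theta> * ?t + real (n - l) * b)" by (simp add: exp_of_nat_mult[symmetric] exp_add)
  also have "\<dots> = exp (real n * ((22 / 25)\<^sup>2 / 4 * \<alpha>\<^sup>2 - 22 / 25 * (P * (1 - y * sqrt y) - 1 / 1000) + y * b))"
    unfolding e1 e2 e3 by (simp add: algebra_simps)
  finally have "2 ^ l * measure (gauss (pairs {..<n})) {a \<in> space (gauss (pairs {..<n})). ?t \<le> prefix_energy n l a X}
    \<le> 2 ^ l * exp (real n * ((22 / 25)\<^sup>2 / 4 * \<alpha>\<^sup>2 - 22 / 25 * (P * (1 - y * sqrt y) - 1 / 1000) + y * b))" by simp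
  also have "2 ^ l * exp (real n * ((22 / 25)\<^sup>2 / 4 * \<alpha>\<^sup>2 - 22 / 25 * (P * (1 - y * sqrt y) - 1 / 1000) + y * b))
     = exp (real n * (\<alpha> * ln 2)) * exp (real n * ((22 / 25)\<^sup>2 / 4 * \<alpha>\<^sup>2 - 22 / 25 * (P * (1 - y * sqrt y) - 1 / 1000) + y * b))"
    by (simp only: pw)
  also have "exp (real n * (\<alpha> * ln 2)) * exp (real n * ((22 / 25)\<^sup>2 / 4 * \<alpha>\<^sup>2 - 22 / 25 * (P * (1 - y * sqrt y) - 1 / 1000) + y * b))
     = exp (real n * (\<alpha> * ln 2 + ((22 / 25)\<^sup>2 / 4 * \<alpha>\<^sup>2 - 22 / 25 * (P * (1 - y * sqrt y) - 1 / 1000) + y * b)))"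
    by (simp add: mult_exp_exp distrib_left)
  also have "\<dots> \<le> exp (real n * (4505 / 10000 * ln 2))"
  proof -
    \<comment> \<open>Only the part of \<open>\<alpha>\<close> above 0.4505 is paid with the
      rational bound for \<open>ln 2\<close>; the rest cancels exactly against the right-hand
      side.\<close>
    have "(\<alpha> - 4505 / 10000) * ln 2 \<le> (\<alpha> - 4505 / 10000) * (25 / 36)"
      using ln2_le_25_over_36 \<alpha> by (intro mult_left_mono) auto
    then have "\<alpha> * ln 2 \<le> 4505 / 10000 * ln 2 + (\<alpha> - 4505 / 10000) * (25 / 36)" unfolding left_diff_distrib by linarith
    moreover have "658 / 1000 * (1 - y * (y + 4356 / 10000) / (132 / 100)) \<le> P * (1 - y * sqrt y)"
    proof -
      have "y * sqrt y \<le> y * ((y + 4356 / 10000) / (132 / 100))" using ry(1) y(2) by (intro mult_left_mono) auto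
      then have "658 / 1000 * (1 - y * (y + 4356 / 10000) / (132 / 100)) \<le> 658 / 1000 * (1 - y * sqrt y)"
        unfolding times_divide_eq_right by (intro mult_left_mono diff_left_mono) auto
      also have "\<dots> \<le> P * (1 - y * sqrt y)" using P ry(2,3) y(2,3) by (intro mult_right_mono) (auto intro: mult_le_one)
      finally show ?thesis .
    qed
    moreover have "(\<alpha> - 4505 / 10000) * (25 / 36) - 22 / 25 * (658 / 1000) * (1 - y * (y + 4356 / 10000) / (132 / 100)) + (22 / 25)\<^sup>2 / 4 * \<alpha>\<^sup>2
        + y * b \<le> - 88 / 100000"
      using exponent_polynomial[OF \<mu>] unfolding am y(1)[symmetric] b_def .
    ultimately have "\<alpha> * ln 2 + ((22 / 25)\<^sup>2 / 4 * \<alpha>\<^sup>2 - 22 / 25 * (P * (1 - y * sqrt y) - 1 / 1000) + y * b) \<le> 4505 / 10000 * ln 2"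
      by argo
    then show ?thesis using n by simp
  qed
  also have "\<dots> = 2 powr (4505 / 10000 * real n)" by (simp add: powr_def mult_ac)
  finally show ?thesis unfolding s_def .
qed

section \<open>Reduction to a finite grid of depths\<close>

text \<open>Division by \<open>n + 1\<close> in place of \<open>n\<close> keeps \<open>j < K\<close>
  even for \<open>l = n\<close>, so the grid point stays strictly below \<open>n\<close> and the
  tail there is never empty.\<close>

lemma grid_base:
  fixes n K l :: nat
  assumes K: "0 < K" and l: "l \<le> n" and n: "0 < n"
  defines "j \<equiv> l * K div (n + 1)"
  shows "j < K" "j * n div K \<le> l" "j * n div K < n" "real l \<le> real (j * n div K) + real n / real K + 2"
proof -
  have j1: "j * (n + 1) \<le> l * K" and j2: "l * K < (j + 1) * (n + 1)"
    unfolding j_def using div_times_less_eq_dividend[of "l * K" "n + 1"] dividend_less_div_times[of "n + 1" "l * K"] by (simp_all add: algebra_simps)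
  show jK: "j < K" unfolding j_def using l K by (simp add: div_less_iff_less_mult algebra_simps add_strict_increasing)
  have "j * n \<le> l * K" using j1 by (simp add: algebra_simps)
  then show "j * n div K \<le> l" using K by (metis div_le_mono nonzero_mult_div_cancel_right not_gr_zero)
  have "j * n < n * K" using jK n by simp
  then show "j * n div K < n" using K by (simp add: div_less_iff_less_mult)
  have "j * n < (j * n div K + 1) * K" using dividend_less_div_times[of K "j * n"] K by (simp add: algebra_simps)
  then have "real (j * n) < real ((j * n div K + 1) * K)" by (simp only: of_nat_less_iff)
  then have a: "real j * real n < (real (j * n div K) + 1) * real K" by (simp add: algebra_simps)
  have "real (l * K) < real ((j + 1) * (n + 1))" using j2 by (simp only: of_nat_less_iff)
  then have b: "real l * real K < (real j + 1) * (real n + 1)" by (simp add: algebra_simps)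
  have "real j \<le> real K - 1" using jK by linarith
  then have "real l * real K < real j * real n + real n + real K" using b by (simp add: algebra_simps)
  also have "\<dots> \<le> (real (j * n div K) + 1) * real K + real n + real K" using a by simp
  also have "\<dots> = (real (j * n div K) + real n / real K + 2) * real K" using K by (simp add: algebra_simps)
  finally show "real l \<le> real (j * n div K) + real n / real K + 2" using K by simp
qed

text \<open>With \<open>a\<close> and \<open>b\<close> the square roots, the difference of cubes is
  at most \<open>(a - b) * (a + b)\<^sup>2\<close>; the Lipschitz constant 2 is a crude substitute
  for 3/2.\<close>

lemma sqrt_cube_increment:
  fixes y z :: real
  assumes "0 \<le> y" "y \<le> z" "z \<le> 1"
  shows "z * sqrt z \<le> y * sqrt y + 2 * (z - y)"
proof -
  define a b where "a = sqrt z" and "b = sqrt y"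
  have ab: "0 \<le> b" "b \<le> a" "a \<le> 1" "z = a * a" "y = b * b" using assms by (auto simp: a_def b_def)
  have "a * a * a - b * b * b \<le> (a - b) * ((a + b) * (a + b))"
  proof -
    have "(a - b) * ((a + b) * (a + b)) - (a * a * a - b * b * b) = (a - b) * (a * b)" by (simp add: algebra_simps)
    moreover have "0 \<le> (a - b) * (a * b)" using ab by simp
    ultimately show ?thesis by linarith
  qed
  also have "\<dots> \<le> (a - b) * (2 * (a + b))" using ab by (intro mult_left_mono mult_right_mono) auto
  also have "\<dots> = 2 * (a * a - b * b)" by (simp add: algebra_simps)
  finally show ?thesis using ab unfolding a_def[symmetric] b_def[symmetric] by (simp add: ab(4,5))
qed

text \<open>The monotonicity of the maximum in the set of sites reduces all depths to a fixed finite grid of them.\<close>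

lemma energy_gap:
  fixes P :: real and n K :: nat
  assumes n: "20000 \<le> n" and P: "0 \<le> P" "P \<le> 1" and gP: "\<And>k. 0 < k \<Longrightarrow> ground k \<le> real k * P"
    and gn: "real n * (P - 1 / 5000) \<le> ground n"
    and good: "\<And>j. j < 10000 \<Longrightarrow> \<bar>max_energy 1 {j * n div 10000..<n} a (\<lambda>_. 0) - sqrt (real (n - j * n div 10000)) * ground (n - j * n div 10000)\<bar> < real n * sqrt n / 5000"
    and l: "l \<le> n"
  defines "y \<equiv> 1 - real l / real n"
  shows "real n * sqrt n * (P * (1 - y * sqrt y) - 1 / 1000) \<le> max_energy 1 {..<n} a (\<lambda>_. 0) - max_energy 1 {l..<n} a (\<lambda>_. 0)"
proof -
  have n0: "0 < n" "0 < real n" using n by auto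
  define j where "j = l * 10000 div (n + 1)"
  define b where "b = j * n div 10000"
  have j: "j < 10000" "b \<le> l" "b < n" "real l \<le> real b + real n / 10000 + 2"
    unfolding j_def b_def using grid_base[of 10000 l n] l n by auto
  let ?k = "n - b"
  let ?W = "real n * sqrt n"
  have W: "0 \<le> ?W" by simp
  have "\<bar>max_energy 1 {0..<n} a (\<lambda>_. 0) - sqrt n * ground n\<bar> < ?W / 5000" using good[of 0] by simp
  then have "sqrt n * ground n - ?W / 5000 \<le> max_energy 1 {..<n} a (\<lambda>_. 0)" unfolding lessThan_atLeast0 by linarith
  moreover have "?W * (P - 1 / 5000) \<le> sqrt n * ground n"
    using mult_left_mono[OF gn, of "sqrt n"] by (simp add: mult_ac)
  ultimately have full: "?W * (P - 2 / 5000) \<le> max_energy 1 {..<n} a (\<lambda>_. 0)" by (simp add: algebra_simps)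
  have "max_energy 1 {l..<n} a (\<lambda>_. 0) \<le> max_energy 1 {b..<n} a (\<lambda>_. 0)" using j(2) by (intro max_energy_mono) auto
  also have "\<dots> \<le> sqrt ?k * ground ?k + ?W / 5000" using good[OF j(1)] unfolding b_def[symmetric] by linarith
  also have "sqrt ?k * ground ?k \<le> sqrt ?k * (real ?k * P)" using j(3) by (intro mult_left_mono gP) auto
  also have "sqrt ?k * (real ?k * P) \<le> ?W * (P * (y * sqrt y) + 2 / 5000)"
  proof -
    define z where "z = real ?k / real n"
    have kz: "real ?k = z * real n" "z = 1 - real b / real n" using n0 j(3) by (auto simp: z_def of_nat_diff field_simps)
    have yz: "0 \<le> y" "y \<le> z" "z \<le> 1" using l j n0 by (auto simp: y_def kz(2) divide_right_mono)
    \<comment> \<open>Grid spacing 1/10000 plus the rounding term \<open>2 / n\<close>, which is at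
      most 1/10000 because \<open>20000 \<le> n\<close>.\<close>
    have d: "z - y \<le> 1 / 5000"
    proof -
      have "z - y = (real l - real b) / real n" by (simp add: y_def kz(2) diff_divide_distrib)
      also have "\<dots> \<le> (real n / 10000 + 2) / real n" using j(4) n0 by (intro divide_right_mono) auto
      also have "\<dots> \<le> 1 / 5000" using n n0 by (simp add: field_simps)
      finally show ?thesis .
    qed
    have "sqrt ?k * (real ?k * P) = ?W * (P * (z * sqrt z))" unfolding kz(1) by (simp add: real_sqrt_mult mult_ac)
    also have "\<dots> \<le> ?W * (P * (y * sqrt y) + 2 / 5000)"
    proof (rule mult_left_mono[OF _ W])
      have "P * (z * sqrt z) \<le> P * (y * sqrt y + 2 / 5000)"
        using sqrt_cube_increment[OF yz] d P by (intro mult_left_mono) auto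
      also have "\<dots> \<le> P * (y * sqrt y) + 2 / 5000" using P by (simp add: distrib_left)
      finally show "P * (z * sqrt z) \<le> P * (y * sqrt y) + 2 / 5000" .
    qed
    finally show ?thesis .
  qed
  finally have "max_energy 1 {l..<n} a (\<lambda>_. 0) \<le> ?W * (P * (y * sqrt y) + 2 / 5000) + ?W / 5000" by simp
  \<comment> \<open>In units of \<open>?W / 5000\<close> the losses are 2 for the full maximum
    (limit and fluctuation), 1 for the fluctuation of the tail and 2 for the grid, together the
    1/1000 in the claim.\<close>
  then have "?W * (P - 2 / 5000) - (?W * (P * (y * sqrt y) + 2 / 5000) + ?W / 5000) \<le> max_energy 1 {..<n} a (\<lambda>_. 0) - max_energy 1 {l..<n} a (\<lambda>_. 0)"
    using full by linarith
  then show ?thesis by (simp add: algebra_simps)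
qed

section \<open>Counting prefixes above deterministic thresholds\<close>

definition alive :: "nat \<Rightarrow> (nat \<times> nat \<Rightarrow> real) \<Rightarrow> nat \<Rightarrow> nat set set" where
  "alive n a l = {X \<in> Pow {..<l}. max_energy 1 {..<n} a (\<lambda>_. 0) \<le> prefix_energy n l a X + max_energy 1 {l..<n} a (\<lambda>_. 0)}"

definition nodes :: "nat \<Rightarrow> (nat \<times> nat \<Rightarrow> real) \<Rightarrow> nat" where
  "nodes n a = (\<Sum>l\<le>n. card (alive n a l))"

lemma card_filter_sum: "finite S \<Longrightarrow> real (card {X \<in> S. Q X}) = (\<Sum>X\<in>S. if Q X then 1 else 0)"
  by (simp add: sum.If_cases Int_def)

lemma nodes_measurable: "(\<lambda>a. real (nodes n a)) \<in> borel_measurable (gauss (pairs {..<n}))"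
proof -
  have mm: "(\<lambda>a. max_energy 1 V a (\<lambda>_. 0)) \<in> borel_measurable (gauss (pairs {..<n}))" if "V \<subseteq> {..<n}" for V
    using that pairs_mono[OF that] finite_subset[OF that]
    by (intro max_energy_measurable gauss_comp_measurable borel_measurable_const) auto
  have "(\<lambda>a. real (card (alive n a l))) \<in> borel_measurable (gauss (pairs {..<n}))" if "l \<le> n" for l
    unfolding alive_def card_filter_sum[OF finite_Pow_iff[THEN iffD2, OF finite_lessThan]] using that
    by (intro borel_measurable_sum measurable_If borel_measurable_const borel_measurable_le borel_measurable_add prefix_energy_measurable mm) auto
  then show ?thesis unfolding nodes_def by simp
qed

definition late :: "nat \<Rightarrow> nat set" where
  "late n = {l. l \<le> n \<and> 4505 / 10000 * real n \<le> real l}"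

definition threshold :: "real \<Rightarrow> nat \<Rightarrow> nat \<Rightarrow> real" where
  "threshold P n l = real n * sqrt n * (P * (1 - (1 - real l / real n) * sqrt (1 - real l / real n)) - 1 / 1000)"

text \<open>The thresholds are deterministic, unlike the maxima in \<open>alive\<close>, so the
  expectation splits into probabilities for single prefixes.\<close>

definition exceed :: "real \<Rightarrow> nat \<Rightarrow> (nat \<times> nat \<Rightarrow> real) \<Rightarrow> real" where
  "exceed P n a = (\<Sum>l\<in>late n. real (card {X \<in> Pow {..<l}. threshold P n l \<le> prefix_energy n l a X}))"

lemma nodes_le:
  assumes good: "\<And>l. l \<le> n \<Longrightarrow> threshold P n l \<le> max_energy 1 {..<n} a (\<lambda>_. 0) - max_energy 1 {l..<n} a (\<lambda>_. 0)"
  shows "real (nodes n a) \<le> 2 * 2 powr (4505 / 10000 * real n) + exceed P n a"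
proof -
  \<comment> \<open>The early depths contribute a geometric sum below \<open>2 ^ m\<close>, and
    rounding \<open>m\<close> up costs the factor 2 in the bound.\<close>
  define m where "m = nat \<lceil>4505 / 10000 * real n\<rceil>"
  have fin: "finite (alive n a l)" for l unfolding alive_def by simp
  have "real (nodes n a) = (\<Sum>l\<in>{..n} - late n. real (card (alive n a l))) + (\<Sum>l\<in>late n. real (card (alive n a l)))"
    unfolding nodes_def of_nat_sum by (rule sum.subset_diff) (auto simp: late_def)
  also have "(\<Sum>l\<in>late n. real (card (alive n a l))) \<le> exceed P n a"
    unfolding exceed_def
  proof (rule sum_mono)
    fix l assume "l \<in> late n"
    then have "threshold P n l \<le> max_energy 1 {..<n} a (\<lambda>_. 0) - max_energy 1 {l..<n} a (\<lambda>_. 0)" by (intro good) (simp add: late_def)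
    then have "card (alive n a l) \<le> card {X \<in> Pow {..<l}. threshold P n l \<le> prefix_energy n l a X}"
      unfolding alive_def by (intro card_mono) auto
    then show "real (card (alive n a l)) \<le> real (card {X \<in> Pow {..<l}. threshold P n l \<le> prefix_energy n l a X})" by simp
  qed
  also have "(\<Sum>l\<in>{..n} - late n. real (card (alive n a l))) \<le> (\<Sum>l\<in>{..n} - late n. 2 ^ l)"
  proof (rule sum_mono)
    fix l
    have "card (alive n a l) \<le> card (Pow {..<l})" unfolding alive_def by (intro card_mono) auto
    then have "card (alive n a l) \<le> 2 ^ l" by (simp add: card_Pow)
    then have "real (card (alive n a l)) \<le> real (2 ^ l)" by (simp only: of_nat_le_iff)
    then show "real (card (alive n a l)) \<le> 2 ^ l" by simp
  qed
  also have "\<dots> \<le> (\<Sum>l<m. 2 ^ l)"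
    by (rule sum_mono2) (auto simp: late_def m_def, linarith)
  also have "\<dots> \<le> (2::real) ^ m" by (induction m) auto
  also have "\<dots> = 2 powr real m" by (simp add: powr_realpow)
  also have "\<dots> \<le> 2 powr (1 + 4505 / 10000 * real n)" unfolding m_def by (intro powr_mono) linarith+
  also have "\<dots> = 2 * 2 powr (4505 / 10000 * real n)" by (simp add: powr_add)
  finally show ?thesis by simp
qed

text \<open>Each of the at most \<open>n + 1\<close> late depths contributes at most
  \<open>2 powr (0.4505 * n)\<close> to the expectation, because \<open>prefix_tail\<close> already
  includes the number of prefixes.\<close>

lemma exceed_markov:
  assumes n: "20000 \<le> n" and P: "658 / 1000 \<le> P" and c: "0 < c"
  shows "{a \<in> space (gauss (pairs {..<n})). c \<le> exceed P n a} \<in> sets (gauss (pairs {..<n}))"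
    "measure (gauss (pairs {..<n})) {a \<in> space (gauss (pairs {..<n})). c \<le> exceed P n a} \<le> (real n + 1) * 2 powr (4505 / 10000 * real n) / c"
proof -
  interpret prob_space "gauss (pairs {..<n})" by (rule prob_space_gauss)
  let ?S = "\<lambda>l X. {a \<in> space (gauss (pairs {..<n})). threshold P n l \<le> prefix_energy n l a X}"
  have S: "?S l X \<in> events" if "l \<in> late n" for l X
    using that by (intro borel_measurable_le borel_measurable_const prefix_energy_measurable) (simp add: late_def)
  have eq: "exceed P n a = (\<Sum>l\<in>late n. \<Sum>X\<in>Pow {..<l}. indicator (?S l X) a)" if "a \<in> space (gauss (pairs {..<n}))" for a
    unfolding exceed_def card_filter_sum[OF finite_Pow_iff[THEN iffD2, OF finite_lessThan]] using that
    by (simp add: indicator_def of_bool_def)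
  have int: "integrable (gauss (pairs {..<n})) (\<lambda>a. \<Sum>l\<in>late n. \<Sum>X\<in>Pow {..<l}. indicator (?S l X) a :: real)"
    using S by (intro Bochner_Integration.integrable_sum integrable_real_indicator) (auto simp: emeasure_eq_measure)
  then have iZ: "integrable (gauss (pairs {..<n})) (exceed P n)"
    by (rule Bochner_Integration.integrable_cong[THEN iffD1, rotated 2]) (simp_all add: eq)
  have "(\<integral>a. exceed P n a \<partial>gauss (pairs {..<n})) = (\<integral>a. (\<Sum>l\<in>late n. \<Sum>X\<in>Pow {..<l}. indicator (?S l X) a) \<partial>gauss (pairs {..<n}))"
    by (rule Bochner_Integration.integral_cong[OF refl eq])
  also have "\<dots> = (\<Sum>l\<in>late n. \<Sum>X\<in>Pow {..<l}. prob (?S l X))"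
    using S by (subst Bochner_Integration.integral_sum; intro sum.cong refl Bochner_Integration.integrable_sum integrable_real_indicator)
      (auto simp: emeasure_eq_measure Bochner_Integration.integral_sum)
  also have "\<dots> \<le> (\<Sum>l\<in>late n. 2 powr (4505 / 10000 * real n))"
  proof (rule sum_mono)
    fix l assume l: "l \<in> late n"
    then have "2 \<le> l" "l \<le> n" "4505 / 10000 * real n \<le> real l" using n by (auto simp: late_def)
    from prefix_tail[OF this P]
    have "prob (?S l X) \<le> 2 powr (4505 / 10000 * real n) / 2 ^ l" for X
      unfolding threshold_def by (simp add: le_divide_eq mult.commute)
    then have "(\<Sum>X\<in>Pow {..<l}. prob (?S l X)) \<le> (\<Sum>X\<in>Pow {..<l}. 2 powr (4505 / 10000 * real n) / 2 ^ l)" by (intro sum_mono)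
    also have "\<dots> = 2 powr (4505 / 10000 * real n)" by (simp add: card_Pow)
    finally show "(\<Sum>X\<in>Pow {..<l}. prob (?S l X)) \<le> 2 powr (4505 / 10000 * real n)" .
  qed
  also have "\<dots> = real (card (late n)) * 2 powr (4505 / 10000 * real n)" by simp
  also have "\<dots> \<le> (real n + 1) * 2 powr (4505 / 10000 * real n)"
  proof (rule mult_right_mono)
    have "card (late n) \<le> card {..n}" by (intro card_mono) (auto simp: late_def)
    then show "real (card (late n)) \<le> real n + 1" by simp
  qed simp
  finally have E: "(\<integral>a. exceed P n a \<partial>gauss (pairs {..<n})) \<le> (real n + 1) * 2 powr (4505 / 10000 * real n)" .
  show "{a \<in> space (gauss (pairs {..<n})). c \<le> exceed P n a} \<in> events"
    by (intro borel_measurable_le borel_measurable_const borel_measurable_integrable[OF iZ])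
  have "prob {a \<in> space (gauss (pairs {..<n})). c \<le> exceed P n a} \<le> (\<integral>a. exceed P n a \<partial>gauss (pairs {..<n})) / c"
    by (rule integral_Markov_inequality_measure[OF iZ sets.empty_sets _ c]) (auto simp: exceed_def sum_nonneg)
  also have "\<dots> \<le> (real n + 1) * 2 powr (4505 / 10000 * real n) / c" using E c by (intro divide_right_mono) auto
  finally show "prob {a \<in> space (gauss (pairs {..<n})). c \<le> exceed P n a} \<le> (real n + 1) * 2 powr (4505 / 10000 * real n) / c" .
qed

text \<open>The failure probability is shared equally, 5/1000 each, between the concentration at the
  10000 grid points and Markov's inequality for \<open>exceed\<close>. Both become small only with
  \<open>n\<close>: the former is of order \<open>1 / n\<close>, and the margin from 0.4505 to 0.451
  absorbs the factor \<open>n + 1\<close> in the latter.\<close>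

theorem nodes_tail:
  "\<forall>\<^sub>F n in sequentially. measure (gauss (pairs {..<n})) {a \<in> space (gauss (pairs {..<n})). 2 powr (451 / 1000 * real n) \<le> real (nodes n a)} \<le> 1 / 100"
proof -
  obtain P where lim: "(\<lambda>n. ground n / real n) \<longlonglongrightarrow> P" and gP: "\<And>n. 0 < n \<Longrightarrow> ground n \<le> real n * P" and P: "658 / 1000 \<le> P"
    by (rule ground_limit) blast
  have P1: "P \<le> 1"
  proof (rule LIMSEQ_le_const2[OF lim], intro exI allI impI)
    fix n :: nat assume n: "2 \<le> n"
    have "2 / pi \<le> 1" using pi_gt3 by simp
    then have "sqrt (2 / pi) \<le> 1" using real_sqrt_le_mono by fastforce
    then have "real n * sqrt (2 / pi) \<le> real n * 1" by (intro mult_left_mono) auto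
    then have "ground n \<le> real n" using ground_upper[OF n] by linarith
    then show "ground n / real n \<le> 1" using n by (simp add: divide_le_eq)
  qed
  have "\<forall>\<^sub>F n in sequentially. P - 1 / 5000 < ground n / real n"
    by (rule order_tendstoD(1)[OF lim]) simp
  moreover have "\<forall>\<^sub>F n::nat in sequentially. 10000 * (25 * 10 ^ 6 / real n) \<le> 5 / 1000" by real_asymp
  moreover have "\<forall>\<^sub>F n::nat in sequentially. 2 * (real n + 1) * 2 powr (- (5 / 10000 * real n)) \<le> 5 / 1000" by real_asymp
  ultimately show ?thesis using eventually_ge_at_top[of 20000]
  proof eventually_elim
    case (elim n)
    interpret prob_space "gauss (pairs {..<n})" by (rule prob_space_gauss)
    let ?b = "\<lambda>j. j * n div 10000"
    let ?f = "\<lambda>j a. \<bar>max_energy 1 {?b j..<n} a (\<lambda>_. 0) - sqrt (real (n - ?b j)) * ground (n - ?b j)\<bar>"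
    let ?B = "\<lambda>j. {a \<in> space (gauss (pairs {..<n})). real n * sqrt n / 5000 \<le> ?f j a}"
    let ?c = "2 powr (451 / 1000 * real n) :: real"
    let ?Z = "{a \<in> space (gauss (pairs {..<n})). ?c / 2 \<le> exceed P n a}"
    have n: "20000 \<le> n" "0 < n" "0 < real n" using elim by auto
    have bn: "?b j < n" if "j < 10000" for j
      using that n by (simp add: div_less_iff_less_mult)
    have gn: "real n * (P - 1 / 5000) \<le> ground n"
      using elim(1) n by (simp add: pos_less_divide_eq mult.commute less_imp_le)
    have Bm: "?B j \<in> events" if "j < 10000" for j
    proof -
      have "{?b j..<n} \<subseteq> {..<n}" by auto
      note pairs_mono[OF this]
      then have "(\<lambda>a. max_energy 1 {?b j..<n} a (\<lambda>_. 0)) \<in> borel_measurable (gauss (pairs {..<n}))"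
        by (intro max_energy_measurable gauss_comp_measurable borel_measurable_const) auto
      then show ?thesis
        by (intro borel_measurable_le borel_measurable_const borel_measurable_abs borel_measurable_diff)
    qed
    have Bp: "prob (?B j) \<le> 25 * 10 ^ 6 / real n" if j: "j < 10000" for j
    proof -
      have nb: "?b j + (n - ?b j) = n" using bn[OF j] by simp
      have "prob (?B j) \<le> (real n)\<^sup>2 / (real n * sqrt n / 5000)\<^sup>2"
        using tail_concentration[of "n - ?b j" "?b j" n "real n * sqrt n / 5000"] bn[OF j] n unfolding nb by simp
      also have "\<dots> = 25 * 10 ^ 6 / real n" using n by (simp add: power_divide power_mult_distrib)
      finally show ?thesis .
    qed
    have "0 < ?c / 2" by simp
    note Z = exceed_markov[OF n(1) P this]
    have sub: "{a \<in> space (gauss (pairs {..<n})). ?c \<le> real (nodes n a)} \<subseteq> (\<Union>j<10000. ?B j) \<union> ?Z"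
    proof (rule subsetI, rule ccontr)
      fix a assume a: "a \<in> {a \<in> space (gauss (pairs {..<n})). ?c \<le> real (nodes n a)}" and na: "a \<notin> (\<Union>j<10000. ?B j) \<union> ?Z"
      then have good: "?f j a < real n * sqrt n / 5000" if "j < 10000" for j using that by (auto simp: not_le)
      have zc: "exceed P n a < ?c / 2" using a na by auto
      have "threshold P n l \<le> max_energy 1 {..<n} a (\<lambda>_. 0) - max_energy 1 {l..<n} a (\<lambda>_. 0)" if "l \<le> n" for l
        unfolding threshold_def using P P1 by (intro energy_gap[OF n(1) _ _ gP gn good that]) auto
      then have "real (nodes n a) \<le> 2 * 2 powr (4505 / 10000 * real n) + exceed P n a" by (rule nodes_le)
      moreover have "2 * 2 powr (4505 / 10000 * real n) \<le> ?c / 2"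
      proof -
        have "4 * 2 powr (4505 / 10000 * real n) = 2 powr (2 + 4505 / 10000 * real n)" by (simp add: powr_add)
        also have "\<dots> \<le> ?c" using n by (intro powr_mono) auto
        finally show ?thesis by simp
      qed
      ultimately show False using zc a by auto
    qed
    have Bi: "?B j \<in> events" if "j \<in> {..<10000}" for j by (rule Bm) (use that in simp)
    have BU: "(\<Union>j<10000. ?B j) \<in> events" by (intro sets.finite_UN finite_lessThan Bi)
    have "prob {a \<in> space (gauss (pairs {..<n})). ?c \<le> real (nodes n a)} \<le> prob ((\<Union>j<10000. ?B j) \<union> ?Z)"
      by (rule finite_measure_mono[OF sub sets.Un[OF BU Z(1)]])
    also have "\<dots> \<le> prob (\<Union>j<10000. ?B j) + prob ?Z"
      by (rule measure_Un_le[OF BU Z(1)])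
    also have "prob (\<Union>j<10000. ?B j) \<le> 5 / 1000"
    proof -
      have "prob (\<Union>j<10000. ?B j) \<le> (\<Sum>j<10000. prob (?B j))"
        by (rule measure_UNION_le[OF finite_lessThan Bi])
      also have "\<dots> \<le> real (card {..<10000::nat}) * (25 * 10 ^ 6 / real n)"
        by (rule sum_bounded_above) (use Bp in \<open>simp only: lessThan_iff\<close>)
      also have "\<dots> \<le> 5 / 1000" using elim(2) by (simp only: card_lessThan of_nat_numeral)
      finally show ?thesis .
    qed
    also have "prob ?Z \<le> 5 / 1000"
    proof -
      have "prob ?Z \<le> (real n + 1) * 2 powr (4505 / 10000 * real n) / (?c / 2)" by (rule Z(2))
      also have "\<dots> = 2 * (real n + 1) * (2 powr (4505 / 10000 * real n) / ?c)" by simp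
      also have "2 powr (4505 / 10000 * real n) / ?c = 2 powr (- (5 / 10000 * real n))"
        by (simp add: powr_diff[symmetric])
      finally show ?thesis using elim(3) by linarith
    qed
    finally show ?case by simp
  qed
qed


section \<open>The branch-and-bound tree\<close>

definition spin_list :: "nat \<Rightarrow> nat \<Rightarrow> nat set \<Rightarrow> real list" where
  "spin_list l m X = map (spin X) [l..<m]"

lemma spin_list_nth: "l \<le> i \<Longrightarrow> i < m \<Longrightarrow> spin_list l m X ! (i - l) = spin X i"
  by (simp add: spin_list_def)

lemma spin_list_bij: "bij_betw (spin_list l m) (Pow {l..<m}) (spins (m - l))"
proof (rule bij_betwI')
  fix X Y assume X: "X \<in> Pow {l..<m}" and Y: "Y \<in> Pow {l..<m}"
  show "spin_list l m X = spin_list l m Y \<longleftrightarrow> X = Y"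
  proof
    assume "spin_list l m X = spin_list l m Y"
    then have "spin X i = spin Y i" if "i \<in> {l..<m}" for i using that by (simp add: spin_list_def)
    then have "i \<in> X \<longleftrightarrow> i \<in> Y" if "i \<in> {l..<m}" for i using that by (fastforce simp: spin_def split: if_splits)
    then show "X = Y" using X Y by blast
  qed simp
  show "spin_list l m X \<in> spins (m - l)" by (auto simp: spin_list_def spins_def spin_def)
next
  fix z assume z: "z \<in> spins (m - l)"
  let ?X = "{i \<in> {l..<m}. z ! (i - l) = 1}"
  have "z = spin_list l m ?X"
  proof (rule nth_equalityI)
    show "length z = length (spin_list l m ?X)" using z by (simp add: spins_def spin_list_def)
    fix k assume k: "k < length z"
    have "set z \<subseteq> {-1, 1}" using z by (simp add: spins_def)
    then have "z ! k \<in> {-1, 1}" using nth_mem[OF k] by blast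
    then show "z ! k = spin_list l m ?X ! k" using k z by (auto simp: spin_list_def spin_def spins_def)
  qed
  then show "\<exists>X\<in>Pow {l..<m}. z = spin_list l m X" by blast
qed

lemma pair_sum:
  fixes g :: "nat \<times> nat \<Rightarrow> real"
  shows "(\<Sum>j\<in>{l..<m}. \<Sum>i\<in>{l..<j}. g (i, j)) = (\<Sum>e\<in>pairs {l..<m}. g e)"
proof -
  have "(\<Sum>j\<in>{l..<m}. \<Sum>i\<in>{l..<j}. g (i, j)) = (\<Sum>p\<in>(SIGMA j:{l..<m}. {l..<j}). g (snd p, fst p))"
    by (subst sum.Sigma) (auto simp: split_beta)
  also have "\<dots> = (\<Sum>e\<in>pairs {l..<m}. g e)"
    by (rule sum.reindex_bij_witness[of _ prod.swap prod.swap]) (auto simp: pairs_def)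
  finally show ?thesis .
qed

lemma Min_tail:
  "Min ((\<lambda>z. \<Sum>j\<in>{l..<n}. \<Sum>i\<in>{l..<j}. A (i,j) * z ! (i - l) * z ! (j - l)) ` spins (n - l))
    = - max_energy 1 {l..<n} (\<lambda>e. - A e) (\<lambda>_. 0)"
proof -
  let ?h = "\<lambda>z. \<Sum>j\<in>{l..<n}. \<Sum>i\<in>{l..<j}. A (i,j) * z ! (i - l) * z ! (j - l)"
  have h: "?h (spin_list l n X) = - energy 1 {l..<n} (\<lambda>e. - A e) (\<lambda>_. 0) X" for X
  proof -
    have "?h (spin_list l n X) = (\<Sum>j\<in>{l..<n}. \<Sum>i\<in>{l..<j}. A (i,j) * (spin X (fst (i,j)) * spin X (snd (i,j))))"
      by (intro sum.cong refl) (simp add: spin_list_nth mult.assoc)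
    also have "\<dots> = (\<Sum>e\<in>pairs {l..<n}. A e * (spin X (fst e) * spin X (snd e)))" by (rule pair_sum)
    finally show ?thesis by (simp add: energy_def sum_negf)
  qed
  have "?h ` spins (n - l) = ?h ` spin_list l n ` Pow {l..<n}"
    using bij_betw_imp_surj_on[OF spin_list_bij[of l n]] by simp
  also have "\<dots> = uminus ` energy 1 {l..<n} (\<lambda>e. - A e) (\<lambda>_. 0) ` Pow {l..<n}" by (simp add: image_image h)
  also have "Min \<dots> = - max_energy 1 {l..<n} (\<lambda>e. - A e) (\<lambda>_. 0)"
    unfolding max_energy_def by (rule minus_Max_eq_Min[symmetric]) auto
  finally show ?thesis .
qed

lemma Emin_eq: "SK_Emin A n = - max_energy 1 {..<n} (\<lambda>e. - A e) (\<lambda>_. 0)"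
  using Min_tail[of A 0 n] unfolding SK_Emin_def SK_H_def by (simp add: lessThan_atLeast0)

lemma Bound_eq:
  assumes l: "l \<le> n"
  shows "SK_Bound A n (spin_list 0 l X) = - prefix_energy n l (\<lambda>e. - A e) X - max_energy 1 {l..<n} (\<lambda>e. - A e) (\<lambda>_. 0)"
proof -
  have len: "length (spin_list 0 l X) = l" by (simp add: spin_list_def)
  have nth: "spin_list 0 l X ! i = spin X i" if "i < l" for i using spin_list_nth[of 0 i l X] that by simp
  have 1: "(\<Sum>j<l. \<Sum>i<j. A (i,j) * spin_list 0 l X ! i * spin_list 0 l X ! j) = (\<Sum>e\<in>pairs {..<l}. A e * (spin X (fst e) * spin X (snd e)))"
  proof -
    have "(\<Sum>j<l. \<Sum>i<j. A (i,j) * spin_list 0 l X ! i * spin_list 0 l X ! j) = (\<Sum>j\<in>{0..<l}. \<Sum>i\<in>{0..<j}. A (i,j) * (spin X (fst (i,j)) * spin X (snd (i,j))))"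
      unfolding lessThan_atLeast0 by (intro sum.cong refl) (simp add: nth mult.assoc)
    also have "\<dots> = (\<Sum>e\<in>pairs {0..<l}. A e * (spin X (fst e) * spin X (snd e)))" by (rule pair_sum)
    finally show ?thesis by (simp only: lessThan_atLeast0)
  qed
  have 2: "(\<Sum>j\<in>{l..<n}. \<bar>\<Sum>i<l. A (i,j) * spin_list 0 l X ! i\<bar>) = (\<Sum>j\<in>{l..<n}. \<bar>\<Sum>i<l. A (i,j) * spin X i\<bar>)"
    by (intro sum.cong refl arg_cong[where f=abs]) (simp add: nth)
  show ?thesis
    unfolding SK_Bound_def Let_def len Min_tail 1 2 prefix_energy_def by (simp add: sum_negf)
qed

lemma T_eq: "SK_T A n = nodes n (\<lambda>e. - A e)"
proof -
  let ?N = "\<lambda>l. {x \<in> spins l. SK_Bound A n x \<le> SK_Emin A n}"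
  have "{x. length x \<le> n \<and> set x \<subseteq> {-1, 1} \<and> SK_Bound A n x \<le> SK_Emin A n} = (\<Union>l\<le>n. ?N l)"
    by (auto simp: spins_def)
  moreover have img: "?N l = spin_list 0 l ` alive n (\<lambda>e. - A e) l" and inj: "inj_on (spin_list 0 l) (alive n (\<lambda>e. - A e) l)" if "l \<le> n" for l
  proof -
    have sub: "alive n (\<lambda>e. - A e) l \<subseteq> Pow {0..<l}" by (auto simp: alive_def)
    have bij: "bij_betw (spin_list 0 l) (Pow {0..<l}) (spins l)" using spin_list_bij[of 0 l] by simp
    show "inj_on (spin_list 0 l) (alive n (\<lambda>e. - A e) l)" using inj_on_subset[OF bij_betw_imp_inj_on[OF bij] sub] .
    have "?N l = spin_list 0 l ` {X \<in> Pow {0..<l}. SK_Bound A n (spin_list 0 l X) \<le> SK_Emin A n}"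
      using bij_betw_imp_surj_on[OF bij] by auto
    also have "{X \<in> Pow {0..<l}. SK_Bound A n (spin_list 0 l X) \<le> SK_Emin A n} = alive n (\<lambda>e. - A e) l"
      unfolding alive_def Bound_eq[OF that] Emin_eq by (auto simp: lessThan_atLeast0)
    finally show "?N l = spin_list 0 l ` alive n (\<lambda>e. - A e) l" .
  qed
  moreover have "card (\<Union>l\<le>n. ?N l) = (\<Sum>l\<le>n. card (?N l))"
  proof (rule card_UN_disjoint)
    show "\<forall>l\<in>{..n}. finite (?N l)" using img by (auto simp: alive_def)
    show "\<forall>l\<in>{..n}. \<forall>m\<in>{..n}. l \<noteq> m \<longrightarrow> ?N l \<inter> ?N m = {}" by (auto simp: spins_def)
  qed simp
  ultimately show ?thesis
    unfolding SK_T_def nodes_def by (simp add: card_image)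
qed

lemma nodes_cong:
  assumes "\<And>e. e \<in> pairs {..<n} \<Longrightarrow> a e = b e"
  shows "nodes n a = nodes n b"
proof -
  have m: "max_energy 1 V a (\<lambda>_. 0) = max_energy 1 V b (\<lambda>_. 0)" if "V \<subseteq> {..<n}" for V
    using pairs_mono[OF that] assms by (intro max_energy_cong) auto
  have "alive n a l = alive n b l" if "l \<le> n" for l
  proof -
    have "prefix_energy n l a X = prefix_energy n l b X" for X
      unfolding prefix_energy_def using that assms
      by (intro arg_cong2[where f="(+)"] sum.cong refl arg_cong[where f=abs] arg_cong2[where f="(*)"]) (auto simp: pairs_def)
    moreover have "max_energy 1 {l..<n} a (\<lambda>_. 0) = max_energy 1 {l..<n} b (\<lambda>_. 0)" by (rule m) auto
    ultimately show ?thesis unfolding alive_def using m[of "{..<n}"] by simp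
  qed
  then show ?thesis unfolding nodes_def by simp
qed

text \<open>A reflected coordinate is a linear form with the single coefficient -1, so
  \<open>gauss_linear_forms\<close> applies with variance 1.\<close>

lemma gauss_negation:
  assumes I: "finite I" "I \<noteq> {}"
  shows "(\<lambda>\<omega>. \<lambda>i\<in>I. - \<omega> i) \<in> gauss I \<rightarrow>\<^sub>M gauss I" "distr (gauss I) (gauss I) (\<lambda>\<omega>. \<lambda>i\<in>I. - \<omega> i) = gauss I"
proof -
  have "(\<lambda>\<omega>. \<lambda>i\<in>I. - \<omega> i) \<in> gauss I \<rightarrow>\<^sub>M PiM I (\<lambda>_. borel)"
    by (intro measurable_restrict borel_measurable_uminus gauss_comp_measurable)
  then show "(\<lambda>\<omega>. \<lambda>i\<in>I. - \<omega> i) \<in> gauss I \<rightarrow>\<^sub>M gauss I" by (simp cong: measurable_cong_sets add: sets_gauss)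
  have "distr (gauss I) (PiM I (\<lambda>_. borel)) (\<lambda>\<omega>. \<lambda>i\<in>I. \<Sum>j\<in>{i}. (- 1) * \<omega> j) = PiM I (\<lambda>i. scaled_normal (sqrt (\<Sum>j\<in>{i}. (- 1)\<^sup>2)))"
    by (rule gauss_linear_forms[OF I]) (auto simp: disjoint_family_on_def)
  then have "distr (gauss I) (PiM I (\<lambda>_. borel)) (\<lambda>\<omega>. \<lambda>i\<in>I. - \<omega> i) = gauss I"
    by (simp add: scaled_normal_1 gauss_def)
  then show "distr (gauss I) (gauss I) (\<lambda>\<omega>. \<lambda>i\<in>I. - \<omega> i) = gauss I"
    by (metis distr_cong sets_gauss)
qed

lemma SK_measure_eq: "SK_measure n = gauss (pairs {..<n})"
proof -
  have "SK_pairs n = pairs {..<n}" by (auto simp: SK_pairs_def pairs_def)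
  then show ?thesis by (simp add: SK_measure_def gauss_def)
qed

theorem theorem2:
  shows "\<forall>\<^sub>F n in sequentially.
           {A \<in> space (SK_measure n). real (SK_T A n) \<ge> 2 powr (0.451 * real n)} \<in> sets (SK_measure n)
         \<and> measure (SK_measure n)
             {A \<in> space (SK_measure n). real (SK_T A n) \<ge> 2 powr (0.451 * real n)} \<le> 0.01"
  using nodes_tail eventually_ge_at_top[of 2]
proof eventually_elim
  case (elim n)
  let ?I = "pairs {..<n}"
  \<comment> \<open>The restriction makes the reflected couplings a point of the product space;
    \<open>nodes\<close> reads only these coordinates, so the count is unaffected.\<close>
  let ?r = "\<lambda>A. \<lambda>e\<in>?I. - A e"
  have "(0, 1) \<in> ?I" using elim(2) by (auto simp: pairs_def)
  then have I: "finite ?I" "?I \<noteq> {}" by auto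
  let ?S = "{a \<in> space (gauss ?I). 2 powr (451 / 1000 * real n) \<le> real (nodes n a)}"
  have S: "?S \<in> sets (gauss ?I)" by (intro borel_measurable_le borel_measurable_const nodes_measurable)
  have T: "SK_T A n = nodes n (?r A)" for A
    unfolding T_eq by (rule nodes_cong) simp
  have eq: "{A \<in> space (SK_measure n). real (SK_T A n) \<ge> 2 powr (0.451 * real n)} = ?r -` ?S \<inter> space (gauss ?I)"
    using measurable_space[OF gauss_negation(1)[OF I]] unfolding SK_measure_eq T by auto
  have "measure (gauss ?I) (?r -` ?S \<inter> space (gauss ?I)) = measure (distr (gauss ?I) (gauss ?I) ?r) ?S"
    by (rule measure_distr[OF gauss_negation(1)[OF I] S, symmetric])
  also have "\<dots> \<le> 1 / 100" unfolding gauss_negation(2)[OF I] by (rule elim(1))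
  finally have m: "measure (gauss ?I) (?r -` ?S \<inter> space (gauss ?I)) \<le> 0.01" by (rule order_trans) simp
  show ?case
    unfolding eq unfolding SK_measure_eq by (rule conjI[OF measurable_sets[OF gauss_negation(1)[OF I] S] m])
qed

end
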